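(* Consider the system of $N$ oscillators $\dot x=Ax+Bu$, $|u|\le 1$, with the three-stage feedback control described in the context. Let $T=T(x)$ be the motion time from the initial point $x$ to the equilibrium $0$ under the three-stage control, and let $\tau=\tau(x)$ be the minimum time over all admissible controls needed to steer $x$ to $0$. If the system is non-resonant, then, as $\rho(x)\to+\infty$, $$\rho(x)/T(x)=1+o(1),\qquad \tau(x)/T(x)=1+o(1).$$ In the resonant case, there are strictly positive constants $C_1=C_1(\underline\omega)$, $c_1=c_1(\underline\omega)$, depending only on the eigenfrequencies $\underline\omega=(\omega_1,\dots,\omega_N)$, such that for all $x$ with $\rho(x)\ge 1$ $$C_1(\underline\omega)\ge \rho(x)/T(x)\ge c_1(\underline\omega),\qquad 1\ge \tau(x)/T(x)\ge c_1(\underline\omega).$$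
   Context: Oscillators. Let $\omega_1,\dots,\omega_N>0$ be pairwise distinct. The state is $x=(x_1,y_1,\dots,x_N,y_N)^*\in\mathbb{R}^{2N}$, and $\dot x=Ax+Bu$ means $\dot x_i=y_i$, $\dot y_i=-\omega_i^2x_i+u$, $i=1,\dots,N$; so $A$ is block diagonal with blocks $\begin{pmatrix}0&1\\-\omega_i^2&0\end{pmatrix}$ and $B=(0,1,\dots,0,1)^*$. Admissible controls are measurable with $|u|\le1$. The system is non-resonant if there is no $0\ne m\in\mathbb{Z}^N$ with $\sum_{i=1}^N m_i\omega_i=0$, and resonant otherwise. The functions $H$ and $\rho$. For $p=(\xi_1,\eta_1,\dots,\xi_N,\eta_N)\in\mathbb{R}^{2N}$ put $z_i=(\eta_i^2+\omega_i^{-2}\xi_i^2)^{1/2}$ and $$H(p)=\frac1{(2\pi)^N}\int_{(\mathbb{R}/2\pi\mathbb{Z})^N}\Big|\sum_{i=1}^N z_i\cos\varphi_i\Big|\,d\varphi_1\cdots d\varphi_N .$$ $H$ is a norm; $\rho(x)=\max_{H(p)\le1}\langle x,p\rangle$ is the dual norm, differentiable outside $0$. Basic control: $u(x)=-\mathrm{sign}\langle B,\frac{\partial\rho}{\partial x}(x)\rangle$, where $\mathrm{sign}$ is multivalued with $\mathrm{sign}(0)=[-1,1]$, and the motion is understood as a solution of the differential inclusion $\dot x\in Ax+Bu(x)$. For $U\in(0,1]$ the scaled basic control is $u_U(x)=Uu(x)$. Constant $C(\underline\omega)$: a (sufficiently large) positive constant depending only on the eigenfrequencies such that, for some $c=c(\underline\omega)>0$,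 every motion under the basic control from the level set $\rho=M$ to the level set $\rho=M'$ that stays in $\{\rho\ge C(\underline\omega)\}$ and lasts an integer time $t$ satisfies $t\le c(M-M')$. Terminal control. Let $C$ be the row $(c_1,0,c_2,0,\dots,c_N,0)$ with $c_k=(-1)^{N+1}\omega_k^{2N}\prod_{i\ne k}(\omega_i^2-\omega_k^2)^{-1}$, and let $D$ be the $2N\times 2N$ matrix whose $i$-th column is $\frac{(-1)^{i-1}}{(i-1)!}(A+BC)^{i-1}B$, $i=1,\dots,2N$. Put $\mathfrak{x}=D^{-1}x$; in this variable the system becomes $\dot{\mathfrak x}=\mathfrak A\mathfrak x+\mathfrak B\mathfrak u$, where $\mathfrak u=u-Cx$, $\mathfrak A$ is the $2N\times 2N$ matrix whose only nonzero entries are $\mathfrak A_{i+1,i}=-i$ ($1\le i\le 2N-1$), and $\mathfrak B=(1,0,\dots,0)^*$. Let $\delta(\mathfrak T)=\mathrm{diag}(\mathfrak T^{-1},\mathfrak T^{-2},\dots,\mathfrak T^{-2N})$, $\mathfrak q=(\mathfrak q_{ij})_{i,j=1}^{2N}$ with $\mathfrak q_{ij}=[(i+j)(i+j-1)]^{-1}$, $\mathfrak Q=\mathfrak q^{-1}$, $\mathfrak C=-\frac12\mathfrak B^*\mathfrak Q$, $\kappa^2=(2N(2N+1))^{-1}$. For $\mathfrak x\neq 0$ let $\mathfrak T(\mathfrak x)>0$ be defined by $\langle\mathfrak Q\delta(\mathfrak T)\mathfrak x,\delta(\mathfrak T)\mathfrak x\rangle=\kappa^2$, and $\mathfrak T(0)=0$.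 The terminal control is $u=\mathfrak u(\mathfrak x)+Cx$ with $\mathfrak u(\mathfrak x)=\mathfrak C\delta(\mathfrak T(\mathfrak x))\mathfrak x$. For $\Theta>0$ put $G_\Theta=\{x=D\mathfrak x:\mathfrak T(\mathfrak x)\le\Theta\}$. Three-stage control. Fix (depending only on the eigenfrequencies) first $\Theta>0$ so small that $G_\Theta\subset\{|Cx|\le1/2\}$, and then $U\in(0,1]$ so small that $\{\rho(x)\le UC(\underline\omega)\}\subset G_\Theta$. Outside $G_\Theta$ apply the basic control $u(x)$ until $\rho$ reaches the value $C(\underline\omega)$ (stage 1), then the scaled basic control $u_U(x)$ until the boundary of $G_\Theta$ is reached (stage 2); inside $G_\Theta$ apply the terminal control (stage 3). *)

theory Defs
  imports "HOL-Analysis.Analysis"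
begin

text \<open>
  The finite index type \<open>'n\<close> enumerates the oscillators, so \<open>N = CARD('n)\<close>.  A vector
  \<open>(x\<^sub>1, y\<^sub>1, \<dots>, x\<^sub>N, y\<^sub>N)\<close> of the state space is an element of \<open>(real \<times> real)^'n\<close> with
  \<open>x\<^sub>i = fst (x $ i)\<close> and \<open>y\<^sub>i = snd (x $ i)\<close>; the inner product of this type is the standard one.
\<close>

type_synonym 'n state = "(real \<times> real)^'n"


section \<open>The system\<close>

definition opA :: "('n::finite \<Rightarrow> real) \<Rightarrow> 'n state \<Rightarrow> 'n state" where
  "opA \<omega> x = (\<chi> i. (snd (x $ i), - (\<omega> i)\<^sup>2 * fst (x $ i)))"

definition vecB :: "'n::finite state" where
  "vecB = (\<chi> i. (0, 1))"

definition non_resonant :: "('n::finite \<Rightarrow> real) \<Rightarrow> bool" where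
  "non_resonant \<omega> \<longleftrightarrow> \<not> (\<exists>m :: 'n \<Rightarrow> int. m \<noteq> (\<lambda>_. 0) \<and> (\<Sum>i\<in>UNIV. of_int (m i) * \<omega> i) = 0)"

text \<open>
  Caratheodory solutions of \<open>x' = A x + B u\<close> on an interval \<open>J\<close> with left end point \<open>0\<close>: the
  integral equation with a Lebesgue integrable right-hand side says that \<open>\<gamma>\<close> is (locally)
  absolutely continuous and satisfies the equation almost everywhere.
\<close>

definition controlled_path ::
    "('n::finite \<Rightarrow> real) \<Rightarrow> real set \<Rightarrow> (real \<Rightarrow> real) \<Rightarrow> (real \<Rightarrow> 'n state) \<Rightarrow> bool" where
  "controlled_path \<omega> J u \<gamma> \<longleftrightarrow>
     u \<in> borel_measurable (lebesgue_on J) \<and>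
     (\<forall>t\<in>J. (\<lambda>s. opA \<omega> (\<gamma> s) + u s *\<^sub>R vecB) absolutely_integrable_on {0..t} \<and>
            \<gamma> t = \<gamma> 0 + integral {0..t} (\<lambda>s. opA \<omega> (\<gamma> s) + u s *\<^sub>R vecB))"

definition steerable_in :: "('n::finite \<Rightarrow> real) \<Rightarrow> 'n state \<Rightarrow> real \<Rightarrow> bool" where
  "steerable_in \<omega> x T \<longleftrightarrow> 0 \<le> T \<and>
     (\<exists>u \<gamma>. controlled_path \<omega> {0..T} u \<gamma> \<and> (\<forall>t\<in>{0..T}. \<bar>u t\<bar> \<le> 1) \<and> \<gamma> 0 = x \<and> \<gamma> T = 0)"

definition min_time :: "('n::finite \<Rightarrow> real) \<Rightarrow> 'n state \<Rightarrow> real" where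
  "min_time \<omega> x = Inf {T. steerable_in \<omega> x T}"


section \<open>The norm, its dual, and the basic control\<close>

text \<open>The torus integral is taken over the fundamental cube.\<close>

definition normH :: "('n::finite \<Rightarrow> real) \<Rightarrow> 'n state \<Rightarrow> real" where
  "normH \<omega> p =
     (let z = (\<lambda>i. sqrt ((snd (p $ i))\<^sup>2 + (fst (p $ i))\<^sup>2 / (\<omega> i)\<^sup>2))
      in integral (cbox (0 :: real^'n) (\<chi> i. 2 * pi)) (\<lambda>\<phi>. \<bar>\<Sum>i\<in>UNIV. z i * cos (\<phi> $ i)\<bar>)
           / (2 * pi) ^ CARD('n))"

definition rho :: "('n::finite \<Rightarrow> real) \<Rightarrow> 'n state \<Rightarrow> real" where
  "rho \<omega> x = (SUP p\<in>{p. normH \<omega> p \<le> 1}. x \<bullet> p)"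

definition gradient :: "('a::real_inner \<Rightarrow> real) \<Rightarrow> 'a \<Rightarrow> 'a" where
  "gradient f x = (THE d. GDERIV f x :> d)"

definition multi_sign :: "real \<Rightarrow> real set" where
  "multi_sign s = (if s = 0 then {-1..1} else {sgn s})"

definition basic_control :: "('n::finite \<Rightarrow> real) \<Rightarrow> 'n state \<Rightarrow> real set" where
  "basic_control \<omega> x = uminus ` multi_sign (vecB \<bullet> gradient (rho \<omega>) x)"

definition scaled_basic_control :: "('n::finite \<Rightarrow> real) \<Rightarrow> real \<Rightarrow> 'n state \<Rightarrow> real set" where
  "scaled_basic_control \<omega> U x = (\<lambda>v. U * v) ` basic_control \<omega> x"

definition basic_motion :: "('n::finite \<Rightarrow> real) \<Rightarrow> real \<Rightarrow> (real \<Rightarrow> 'n state) \<Rightarrow> bool" where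
  "basic_motion \<omega> t \<gamma> \<longleftrightarrow>
     (\<exists>u. controlled_path \<omega> {0..t} u \<gamma> \<and>
          (AE s in lebesgue_on {0..t}. u s \<in> basic_control \<omega> (\<gamma> s)))"

text \<open>The defining property of the constant \<open>C(\<omega>)\<close>.\<close>

definition basic_threshold :: "('n::finite \<Rightarrow> real) \<Rightarrow> real \<Rightarrow> bool" where
  "basic_threshold \<omega> K \<longleftrightarrow> K > 0 \<and>
     (\<exists>c>0. \<forall>M M' \<gamma>. \<forall>t::nat.
        basic_motion \<omega> (real t) \<gamma> \<longrightarrow> (\<forall>s\<in>{0..real t}. rho \<omega> (\<gamma> s) \<ge> K) \<longrightarrow>
        rho \<omega> (\<gamma> 0) = M \<longrightarrow> rho \<omega> (\<gamma> (real t)) = M' \<longrightarrow>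
        real t \<le> c * (M - M'))"


section \<open>The terminal control\<close>

text \<open>
  Canonical coordinates live in \<open>real^('n bit0)\<close>, where \<open>CARD('n bit0) = 2 * CARD('n)\<close>;
  \<open>pos\<close> numbers the coordinates by \<open>1, \<dots>, 2N\<close>.
\<close>

definition pos :: "'n::finite bit0 \<Rightarrow> nat" where
  "pos i = nat (Rep_bit0 i) + 1"

definition coeffC :: "('n::finite \<Rightarrow> real) \<Rightarrow> 'n \<Rightarrow> real" where
  "coeffC \<omega> k = (-1) ^ (CARD('n) + 1) * \<omega> k ^ (2 * CARD('n)) *
     inverse (\<Prod>i\<in>UNIV - {k}. (\<omega> i)\<^sup>2 - (\<omega> k)\<^sup>2)"

definition rowC :: "('n::finite \<Rightarrow> real) \<Rightarrow> 'n state \<Rightarrow> real" where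
  "rowC \<omega> x = (\<Sum>k\<in>UNIV. coeffC \<omega> k * fst (x $ k))"

definition opABC :: "('n::finite \<Rightarrow> real) \<Rightarrow> 'n state \<Rightarrow> 'n state" where
  "opABC \<omega> x = opA \<omega> x + rowC \<omega> x *\<^sub>R vecB"

definition colD :: "('n::finite \<Rightarrow> real) \<Rightarrow> nat \<Rightarrow> 'n state" where
  "colD \<omega> i = ((-1) ^ (i - 1) / fact (i - 1)) *\<^sub>R ((opABC \<omega> ^^ (i - 1)) vecB)"

definition opD :: "('n::finite \<Rightarrow> real) \<Rightarrow> real^('n bit0) \<Rightarrow> 'n state" where
  "opD \<omega> v = (\<Sum>i\<in>UNIV. (v $ i) *\<^sub>R colD \<omega> (pos i))"

definition frakB :: "real^('n::finite bit0)" where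
  "frakB = (\<chi> i. if pos i = 1 then 1 else 0)"

definition delta :: "real \<Rightarrow> real^('n::finite bit0)^('n bit0)" where
  "delta T = (\<chi> i j. if i = j then inverse (T ^ pos i) else 0)"

definition frak_q :: "real^('n::finite bit0)^('n bit0)" where
  "frak_q = (\<chi> i j. inverse (real (pos i + pos j) * real (pos i + pos j - 1)))"

definition frakQ :: "real^('n::finite bit0)^('n bit0)" where
  "frakQ = matrix_inv frak_q"

definition frakC :: "real^('n::finite bit0)" where
  "frakC = (- 1 / 2) *\<^sub>R (frakB v* frakQ)"

definition kappa :: "'n::finite itself \<Rightarrow> real" where
  "kappa _ = sqrt (inverse (2 * real CARD('n) * (2 * real CARD('n) + 1)))"

definition frakT :: "real^('n::finite bit0) \<Rightarrow> real" where
  "frakT v =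
     (if v = 0 then 0
      else THE T. T > 0 \<and> (frakQ *v (delta T *v v)) \<bullet> (delta T *v v) = (kappa TYPE('n))\<^sup>2)"

definition frak_u :: "real^('n::finite bit0) \<Rightarrow> real" where
  "frak_u v = frakC \<bullet> (delta (frakT v) *v v)"

definition terminal_control :: "('n::finite \<Rightarrow> real) \<Rightarrow> 'n state \<Rightarrow> real" where
  "terminal_control \<omega> x = frak_u (inv (opD \<omega>) x) + rowC \<omega> x"

definition regionG :: "('n::finite \<Rightarrow> real) \<Rightarrow> real \<Rightarrow> 'n state set" where
  "regionG \<omega> \<Theta> = opD \<omega> ` {v. frakT v \<le> \<Theta>}"


section \<open>The three-stage control\<close>

definition three_stage_parameters ::
    "('n::finite \<Rightarrow> real) \<Rightarrow> real \<Rightarrow> real \<Rightarrow> real \<Rightarrow> bool" where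
  "three_stage_parameters \<omega> K \<Theta> U \<longleftrightarrow>
     basic_threshold \<omega> K \<and>
     \<Theta> > 0 \<and> regionG \<omega> \<Theta> \<subseteq> {x. \<bar>rowC \<omega> x\<bar> \<le> 1 / 2} \<and>
     0 < U \<and> U \<le> 1 \<and> {x. rho \<omega> x \<le> U * K} \<subseteq> regionG \<omega> \<Theta>"

text \<open>
  Switching is irreversible: the stage at time \<open>t\<close> is determined by the sets that the motion has
  already met on \<open>{0..t}\<close>.  A stage whose terminal set contains the initial point is empty.
\<close>

definition three_stage_control ::
    "('n::finite \<Rightarrow> real) \<Rightarrow> real \<Rightarrow> real \<Rightarrow> real \<Rightarrow> (real \<Rightarrow> 'n state) \<Rightarrow> real \<Rightarrow> real set" where
  "three_stage_control \<omega> K \<Theta> U \<gamma> t =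
     (if \<exists>s\<in>{0..t}. \<gamma> s \<in> regionG \<omega> \<Theta> then {terminal_control \<omega> (\<gamma> t)}
      else if \<exists>s\<in>{0..t}. rho \<omega> (\<gamma> s) \<le> K then scaled_basic_control \<omega> U (\<gamma> t)
      else basic_control \<omega> (\<gamma> t))"

definition three_stage_motion ::
    "('n::finite \<Rightarrow> real) \<Rightarrow> real \<Rightarrow> real \<Rightarrow> real \<Rightarrow> 'n state \<Rightarrow> (real \<Rightarrow> 'n state) \<Rightarrow> bool" where
  "three_stage_motion \<omega> K \<Theta> U x \<gamma> \<longleftrightarrow> \<gamma> 0 = x \<and>
     (\<exists>u. controlled_path \<omega> {0..} u \<gamma> \<and>
          (AE t in lebesgue_on {0..}. u t \<in> three_stage_control \<omega> K \<Theta> U \<gamma> t))"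

definition arrival_time :: "(real \<Rightarrow> 'n::finite state) \<Rightarrow> real \<Rightarrow> bool" where
  "arrival_time \<gamma> T \<longleftrightarrow> 0 \<le> T \<and> \<gamma> T = 0 \<and> (\<forall>s\<in>{0..<T}. \<gamma> s \<noteq> 0)"

text \<open>A relation, so that uniqueness of the motion from \<open>x\<close> is not presupposed.\<close>

definition motion_time ::
    "('n::finite \<Rightarrow> real) \<Rightarrow> real \<Rightarrow> real \<Rightarrow> real \<Rightarrow> 'n state \<Rightarrow> real \<Rightarrow> bool" where
  "motion_time \<omega> K \<Theta> U x T \<longleftrightarrow> (\<exists>\<gamma>. three_stage_motion \<omega> K \<Theta> U x \<gamma> \<and> arrival_time \<gamma> T)"

end

theory Submission
  imports Defs "HOL-Complex_Analysis.Great_Picard"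
begin

text \<open>
  In the rotating frame \<open>y = exp (- A t) x\<close> the free motion disappears, and \<open>rho\<close>, being invariant
  under it, decreases along the basic control at the rate \<open>\<bar>p \<bullet> exp (- A t) B\<bar>\<close>, where \<open>p\<close> is the
  gradient of \<open>rho\<close>.  Far from the origin \<open>p\<close> is almost constant on long time intervals, so that
  equidistribution of the non-resonant torus flow makes the mean rate close to \<open>normH \<omega> p = 1\<close>.
  No admissible control does better: \<open>rho x = x \<bullet> p\<close> is at most the integral of
  \<open>\<bar>p \<bullet> exp (- A t) B\<bar>\<close> over the control time.  The terminal control decreases \<open>frakT\<close> at
  unit rate, so the last stages only cost a bounded time.  Without non-resonance the defining
  property of \<open>C(\<omega>)\<close> still gives a positive rate.  Motions exist because Euler schemes
  for an upper semicontinuous interval-valued control have convergent subsequences (Arzela-Ascoli).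
\<close>

text \<open>The gradient of \<open>rho\<close> exists only because the dual norm
  \<open>normH\<close> is strictly convex, and this is where the geometry of the torus enters:
  equality in the triangle inequality makes \<open>p \<bullet> circ_vec \<omega> \<theta>\<close>
  and \<open>q \<bullet> circ_vec \<omega> \<theta>\<close> agree in sign on the whole torus, which
  forces \<open>p\<close> and \<open>q\<close> to be proportional. A second obstacle is that
  controls are merely measurable. Paths are therefore compared with the primitive of the control,
  which is Lipschitz, and the product rule is replaced by a defect with quadratically small
  increments. In the decrease estimate the order of choices matters: the window length
  \<open>L\<close> comes first, uniformly over the unit ball of \<open>normH\<close>, and only then
  the level \<open>R\<close> beyond which the gradient hardly varies during such a window. Finally,
  the property of \<open>C(\<omega>)\<close> speaks of integer durations only, so it always serves
  to refute a motion that lasts up to the next integer.\<close>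

abbreviation torus :: "(real^'n) set" where
  "torus \<equiv> cbox 0 (\<chi> i. 2 * pi)"

section \<open>Integrals of periodic functions over the torus\<close>

lemma integral_cbox_translate:
  fixes f :: "'a::euclidean_space \<Rightarrow> real"
  assumes "continuous_on UNIV f"
  shows "integral (cbox a b) (\<lambda>x. f (x + c)) = integral (cbox (a + c) (b + c)) f"
proof -
  have "(f has_integral integral (cbox (a + c) (b + c)) f) (cbox (a + c) (b + c))"
    using assms by (intro integrable_integral integrable_continuous)
      (auto intro: continuous_on_subset)
  from has_integral_affinity'[OF this, of 1 c] show ?thesis
    by (auto intro!: integral_unique)
qed

text \<open>Cut the cube at height \<open>2 * pi - c\<close> along axis \<open>i\<close>: the shift
  moves the lower slab to the top and, after subtraction of one period, the upper slab to the
  bottom. The two images tile the cube again.\<close>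

lemma torus_integral_shift_axis:
  fixes f :: "real^'n \<Rightarrow> real"
  assumes cont: "continuous_on UNIV f" and per: "\<And>x. f (x + axis i (2 * pi)) = f x"
    and c: "0 \<le> c" "c \<le> 2 * pi"
  shows "integral torus (\<lambda>x. f (x + axis i c)) = integral torus f"
proof -
  let ?k = "axis i (1::real) :: real^'n"
  have k: "?k \<in> Basis" by (simp add: axis_in_Basis_iff)
  have cont': "continuous_on UNIV (\<lambda>x. f (x + d))" for d
    by (intro continuous_on_compose2[OF cont] continuous_intros) auto
  have intf: "f integrable_on torus" "(\<lambda>x. f (x + axis i c)) integrable_on torus"
    using cont cont' by (auto intro!: integrable_continuous intro: continuous_on_subset)
  define lo :: "real \<Rightarrow> real^'n" where "lo d = (\<chi> j. if j = i then d else 0)" for d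
  define hi :: "real \<Rightarrow> real^'n" where "hi d = (\<chi> j. if j = i then d else 2 * pi)" for d
  have sp: "torus \<inter> {x. x \<bullet> ?k \<le> d} = cbox 0 (hi d)"
           "torus \<inter> {x. x \<bullet> ?k \<ge> d} = cbox (lo d) (\<chi> j. 2 * pi)" if "0 \<le> d" "d \<le> 2 * pi" for d
    using that by (auto simp: mem_box_cart inner_axis lo_def hi_def split: if_splits)
      (metis order_trans, metis order_trans)
  have "integral torus (\<lambda>x. f (x + axis i c)) =
      integral (cbox 0 (hi (2 * pi - c))) (\<lambda>x. f (x + axis i c)) +
      integral (cbox (lo (2 * pi - c)) (\<chi> j. 2 * pi)) (\<lambda>x. f (x + axis i c))"
    using integral_split[OF intf(2) k, of "2 * pi - c"] sp[of "2 * pi - c"] c by simp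
  also have "integral (cbox 0 (hi (2 * pi - c))) (\<lambda>x. f (x + axis i c))
      = integral (cbox (lo c) (\<chi> j. 2 * pi)) f"
  proof -
    have "0 + axis i c = lo c" "hi (2 * pi - c) + axis i c = (\<chi> j. 2 * pi)"
      by (auto simp: lo_def hi_def axis_def vec_eq_iff)
    then show ?thesis using integral_cbox_translate[OF cont, of 0 "hi (2 * pi - c)" "axis i c"] by simp
  qed
  also have "integral (cbox (lo (2 * pi - c)) (\<chi> j. 2 * pi)) (\<lambda>x. f (x + axis i c))
      = integral (cbox (lo (2 * pi - c)) (\<chi> j. 2 * pi)) (\<lambda>x. f (x + axis i (c - 2 * pi)))"
  proof (rule integral_cong)
    fix x :: "real^'n"
    have "x + axis i (c - 2 * pi) + axis i (2 * pi) = x + axis i c"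
      by (auto simp: axis_def vec_eq_iff)
    then show "f (x + axis i c) = f (x + axis i (c - 2 * pi))" using per by metis
  qed
  also have "\<dots> = integral (cbox 0 (hi c)) f"
  proof -
    have "lo (2 * pi - c) + axis i (c - 2 * pi) = 0"
      "(\<chi> j. 2 * pi) + axis i (c - 2 * pi) = hi c"
      by (auto simp: lo_def hi_def axis_def vec_eq_iff)
    then show ?thesis
      using integral_cbox_translate[OF cont, of "lo (2 * pi - c)" "\<chi> j. 2 * pi" "axis i (c - 2 * pi)"]
      by simp
  qed
  also have "integral (cbox (lo c) (\<chi> j. 2 * pi)) f + integral (cbox 0 (hi c)) f = integral torus f"
    using integral_split[OF intf(1) k, of c] sp[of c] c by simp
  finally show ?thesis .
qed

text \<open>The coordinates are shifted one at a time, by induction on the set of coordinates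
  already shifted; the partially shifted function is still periodic.\<close>

lemma torus_integral_shift:
  fixes f :: "real^'n \<Rightarrow> real"
  assumes cont: "continuous_on UNIV f" and per: "\<And>x i. f (x + axis i (2 * pi)) = f x"
    and c: "\<And>i. 0 \<le> c $ i" "\<And>i. c $ i \<le> 2 * pi"
  shows "integral torus (\<lambda>x. f (x + c)) = integral torus f"
proof -
  have "integral torus (\<lambda>x. f (x + (\<chi> i. if i \<in> S then c $ i else 0))) = integral torus f"
    if "finite S" for S
    using that
  proof (induction S)
    case empty
    have "(\<chi> i. 0) = (0::real^'n)" by (simp add: vec_eq_iff)
    then show ?case by simp
  next
    case (insert j S)
    let ?d = "\<chi> i. if i \<in> S then c $ i else 0"
    have e: "(\<chi> i. if i \<in> insert j S then c $ i else 0) = axis j (c $ j) + ?d"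
      using insert by (auto simp: vec_eq_iff axis_def)
    have "integral torus (\<lambda>x. f (x + axis j (c $ j) + ?d)) = integral torus (\<lambda>x. f (x + ?d))"
    proof (rule torus_integral_shift_axis[of "\<lambda>x. f (x + ?d)"])
      show "continuous_on UNIV (\<lambda>x. f (x + ?d))"
        by (intro continuous_on_compose2[OF cont] continuous_intros) auto
      show "f (x + axis j (2 * pi) + ?d) = f (x + ?d)" for x
        using per[of "x + ?d" j] by (simp add: algebra_simps)
    qed (use c in auto)
    then show ?case using insert e by (simp add: add.assoc)
  qed
  from this[of UNIV] show ?thesis by simp
qed

text \<open>A shift by \<open>pi / \<bar>m i\<bar>\<close> along an axis with
  \<open>m i \<noteq> 0\<close> is half a period of the wave: it reverses the sign of the integrand
  but preserves the integral.\<close>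

lemma torus_integral_cos_zero:
  fixes m :: "'n::finite \<Rightarrow> int"
  assumes "m \<noteq> (\<lambda>_. 0)"
  shows "integral torus (\<lambda>\<theta>::real^'n. cos ((\<Sum>i\<in>UNIV. of_int (m i) * \<theta> $ i) + \<psi>)) = 0"
proof -
  obtain i where i: "m i \<noteq> 0" using assms by auto
  define c where "c = pi / \<bar>of_int (m i)\<bar>"
  have c: "0 \<le> c" "c \<le> 2 * pi"
  proof -
    have "1 \<le> \<bar>real_of_int (m i)\<bar>" using i by linarith
    then have "c \<le> pi" unfolding c_def by (simp add: divide_le_eq)
    then show "c \<le> 2 * pi" using pi_ge_zero by linarith
  qed (simp add: c_def)
  let ?f = "\<lambda>\<theta>::real^'n. cos ((\<Sum>i\<in>UNIV. of_int (m i) * \<theta> $ i) + \<psi>)"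
  have sh: "(\<Sum>j\<in>UNIV. of_int (m j) * (x + axis i d :: real^'n) $ j) = (\<Sum>j\<in>UNIV. of_int (m j) * x $ j) + of_int (m i) * d" for x and d :: real
  proof -
    have "(\<Sum>j\<in>UNIV. of_int (m j) * (axis i d :: real^'n) $ j) = (\<Sum>j\<in>UNIV. if j = i then of_int (m i) * d else 0)"
      by (rule sum.cong) (auto simp: axis_def)
    then show ?thesis by (simp add: distrib_left sum.distrib)
  qed
  have "integral torus (\<lambda>x. ?f (x + axis i c)) = integral torus ?f"
  proof (rule torus_integral_shift_axis)
    show "continuous_on UNIV ?f" by (intro continuous_intros)
    show "?f (x + axis i (2 * pi)) = ?f x" for x
    proof -
      have "cos ((\<Sum>j\<in>UNIV. of_int (m j) * x $ j) + \<psi> + of_int (m i) * (2 * pi)) = ?f x"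
        by (simp add: cos_add mult.commute[of _ "2 * pi"] cos_int_2pin sin_int_2pin)
      then show ?thesis unfolding sh by (simp add: algebra_simps)
    qed
  qed (use c in auto)
  moreover have "?f (x + axis i c) = - ?f x" for x
  proof -
    have "of_int (m i) * c = pi \<or> of_int (m i) * c = - pi"
      unfolding c_def using i by (auto simp: abs_if)
    then have "cos ((\<Sum>j\<in>UNIV. of_int (m j) * x $ j) + \<psi> + of_int (m i) * c) = - ?f x"
      by (auto simp: cos_add)
    then show ?thesis unfolding sh by (simp add: algebra_simps)
  qed
  ultimately show ?thesis by simp
qed

text \<open>The orbit of the vector \<open>B\<close> under the free motion is \<open>circ_vec \<omega> (\<omega> s)\<close>.\<close>

definition circ_vec :: "('n::finite \<Rightarrow> real) \<Rightarrow> real^'n \<Rightarrow> 'n state" where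
  "circ_vec \<omega> \<theta> = (\<chi> i. (- sin (\<theta> $ i) / \<omega> i, cos (\<theta> $ i)))"

text \<open>These are the radii \<open>z i\<close> in the definition of
  \<open>normH\<close>.\<close>

definition amp :: "('n::finite \<Rightarrow> real) \<Rightarrow> 'n state \<Rightarrow> 'n \<Rightarrow> real" where
  "amp \<omega> p i = sqrt ((snd (p $ i))\<^sup>2 + (fst (p $ i))\<^sup>2 / (\<omega> i)\<^sup>2)"

lemma amp_nonneg: "0 \<le> amp \<omega> p i"
  by (simp add: amp_def)

lemma inner_circ_vec:
  "p \<bullet> circ_vec \<omega> \<theta> = (\<Sum>i\<in>UNIV. snd (p $ i) * cos (\<theta> $ i) - fst (p $ i) / \<omega> i * sin (\<theta> $ i))"
  by (simp add: inner_vec_def circ_vec_def inner_prod_def algebra_simps)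

lemma continuous_on_circ_vec [continuous_intros]:
  fixes g :: "'a::t2_space \<Rightarrow> real^'n::finite"
  assumes "continuous_on S g"
  shows "continuous_on S (\<lambda>x. circ_vec \<omega> (g x))"
  unfolding circ_vec_def divide_inverse using assms
  by (intro continuous_intros continuous_on_sin continuous_on_cos continuous_on_component)

lemma circ_vec_periodic: "circ_vec \<omega> (\<theta> + axis i (2 * pi)) = circ_vec \<omega> \<theta>"
  by (auto simp: circ_vec_def vec_eq_iff axis_def)

lemma norm_circ_vec_le: "norm (circ_vec \<omega> \<theta>) \<le> (\<Sum>i\<in>UNIV. norm (1 / \<omega> i) + 1)"
proof -
  have "norm (circ_vec \<omega> \<theta>) \<le> (\<Sum>i\<in>UNIV. norm (circ_vec \<omega> \<theta> $ i))"
    unfolding norm_vec_def by (rule L2_set_le_sum) auto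
  also have "\<dots> \<le> (\<Sum>i\<in>UNIV. norm (1 / \<omega> i) + 1)"
  proof (rule sum_mono)
    fix i
    have "norm (circ_vec \<omega> \<theta> $ i) \<le> \<bar>sin (\<theta> $ i) / \<omega> i\<bar> + \<bar>cos (\<theta> $ i)\<bar>"
      using sqrt_sum_squares_le_sum_abs[of "norm (- sin (\<theta> $ i) / \<omega> i)" "norm (cos (\<theta> $ i))"]
      unfolding circ_vec_def by (simp add: norm_Pair)
    also have "\<dots> \<le> norm (1 / \<omega> i) + 1"
      by (intro add_mono) (auto simp: abs_divide divide_right_mono)
    finally show "norm (circ_vec \<omega> \<theta> $ i) \<le> norm (1 / \<omega> i) + 1" .
  qed
  finally show ?thesis .
qed

lemma sin_cos_split: "sin x * (sin x * y) + cos x * (cos x * y) = (y :: real)"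
proof -
  have "sin x * (sin x * y) + cos x * (cos x * y) = (cos x * cos x + sin x * sin x) * y"
    by (simp only: distrib_right mult.assoc add.commute)
  also have "\<dots> = y" by (simp only: sin_cos_squared_add3 mult_1)
  finally show ?thesis .
qed

text \<open>Polar coordinates for each oscillator. The range \<open>0\<close> to
  \<open>2 * pi\<close> of the angles is the one for which torus integrals are known to be shift
  invariant.\<close>

lemma phase_exists:
  assumes "\<And>i. \<omega> i > 0"
  obtains \<alpha> :: "real^'n::finite" where "\<And>i. 0 \<le> \<alpha> $ i" "\<And>i. \<alpha> $ i \<le> 2 * pi"
    "\<And>i. fst (p $ i) / \<omega> i = amp \<omega> p i * sin (\<alpha> $ i)" "\<And>i. snd (p $ i) = amp \<omega> p i * cos (\<alpha> $ i)"
proof -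
  have "\<exists>a. 0 \<le> a \<and> a \<le> 2 * pi \<and> fst (p $ i) / \<omega> i = amp \<omega> p i * sin a \<and> snd (p $ i) = amp \<omega> p i * cos a" for i
  proof (cases "amp \<omega> p i = 0")
    case True
    then have "snd (p $ i) = 0" "fst (p $ i) / \<omega> i = 0"
      unfolding amp_def by (simp_all add: power_divide[symmetric] sum_power2_eq_zero_iff del: power_divide)
    with True show ?thesis by (auto intro!: exI[of _ 0])
  next
    case False
    have sq: "(snd (p $ i))\<^sup>2 + (fst (p $ i) / \<omega> i)\<^sup>2 = (amp \<omega> p i)\<^sup>2"
      unfolding amp_def by (simp add: power_divide)
    have "(snd (p $ i) / amp \<omega> p i)\<^sup>2 + (fst (p $ i) / \<omega> i / amp \<omega> p i)\<^sup>2 = 1"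
      unfolding power_divide using False sq
      by (metis add_divide_distrib divide_self_if power_divide zero_eq_power2)
    from sincos_total_2pi[OF this] obtain a where "0 \<le> a" "a < 2 * pi"
      "snd (p $ i) / amp \<omega> p i = cos a" "fst (p $ i) / \<omega> i / amp \<omega> p i = sin a" by blast
    then have "snd (p $ i) = amp \<omega> p i * cos a" "fst (p $ i) / \<omega> i = amp \<omega> p i * sin a"
      using False by (metis nonzero_eq_divide_eq mult.commute)+
    with \<open>0 \<le> a\<close> \<open>a < 2 * pi\<close> show ?thesis by (intro exI[of _ a]) auto
  qed
  then obtain a where "\<And>i. 0 \<le> a i \<and> a i \<le> 2 * pi \<and> fst (p $ i) / \<omega> i = amp \<omega> p i * sin (a i) \<and> snd (p $ i) = amp \<omega> p i * cos (a i)"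
    by metis
  then show ?thesis by (intro that[of "\<chi> i. a i"]) auto
qed

text \<open>The phases of \<open>p\<close> turn the integrand into a translate of the one in the
  definition. The new form is the absolute value of something linear in \<open>p\<close>, from which
  the norm axioms can be read off.\<close>

lemma normH_eq:
  fixes \<omega> :: "'n::finite \<Rightarrow> real"
  assumes "\<And>i. \<omega> i > 0"
  shows "normH \<omega> p = integral torus (\<lambda>\<theta>. \<bar>p \<bullet> circ_vec \<omega> \<theta>\<bar>) / (2 * pi) ^ CARD('n)"
proof -
  obtain \<alpha> :: "real^'n" where a: "\<And>i. 0 \<le> \<alpha> $ i" "\<And>i. \<alpha> $ i \<le> 2 * pi"
    "\<And>i. fst (p $ i) / \<omega> i = amp \<omega> p i * sin (\<alpha> $ i)" "\<And>i. snd (p $ i) = amp \<omega> p i * cos (\<alpha> $ i)"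
    using phase_exists[of \<omega> p, OF assms] by blast
  have e: "p \<bullet> circ_vec \<omega> \<theta> = (\<Sum>i\<in>UNIV. amp \<omega> p i * cos ((\<theta> + \<alpha>) $ i))" for \<theta>
    unfolding inner_circ_vec a by (simp add: cos_add algebra_simps)
  have "integral torus (\<lambda>\<theta>. \<bar>p \<bullet> circ_vec \<omega> \<theta>\<bar>) = integral torus (\<lambda>\<theta>. \<bar>\<Sum>i\<in>UNIV. amp \<omega> p i * cos (\<theta> $ i)\<bar>)"
    unfolding e
  proof (rule torus_integral_shift[of "\<lambda>\<theta>. \<bar>\<Sum>i\<in>UNIV. amp \<omega> p i * cos (\<theta> $ i)\<bar>"])
    show "\<bar>\<Sum>j\<in>UNIV. amp \<omega> p j * cos ((x + axis i (2 * pi)) $ j)\<bar> = \<bar>\<Sum>j\<in>UNIV. amp \<omega> p j * cos (x $ j)\<bar>" for x i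
      by (intro arg_cong[of _ _ abs] sum.cong) (auto simp: axis_def)
    show "continuous_on UNIV (\<lambda>\<theta>::real^'n. \<bar>\<Sum>i\<in>UNIV. amp \<omega> p i * cos (\<theta> $ i)\<bar>)"
      by (intro continuous_intros)
  qed (use a in auto)
  then show ?thesis by (simp add: normH_def Let_def amp_def)
qed

text \<open>The source of the invariance of \<open>rho\<close>: the adjoint of the free flow only
  rotates phases and keeps the amplitudes.\<close>

lemma normH_amp_cong: "amp \<omega> p = amp \<omega> q \<Longrightarrow> normH \<omega> p = normH \<omega> q"
  unfolding normH_def Let_def amp_def[symmetric] by (simp add: fun_eq_iff)

section \<open>\<open>normH\<close> as a strictly convex norm\<close>

locale oscillators =
  fixes \<omega> :: "'n::finite \<Rightarrow> real"
  assumes pos: "\<omega> i > 0"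
begin

lemma circ_integrable [simp]:
  "(\<lambda>\<theta>. \<bar>p \<bullet> circ_vec \<omega> \<theta>\<bar>) integrable_on torus" "(\<lambda>\<theta>. p \<bullet> circ_vec \<omega> \<theta>) integrable_on torus"
  by (intro integrable_continuous continuous_intros)+

lemma normH_triangle: "normH \<omega> (p + q) \<le> normH \<omega> p + normH \<omega> q"
proof -
  have "integral torus (\<lambda>\<theta>. \<bar>(p + q) \<bullet> circ_vec \<omega> \<theta>\<bar>)
     \<le> integral torus (\<lambda>\<theta>. \<bar>p \<bullet> circ_vec \<omega> \<theta>\<bar> + \<bar>q \<bullet> circ_vec \<omega> \<theta>\<bar>)"
    by (rule integral_le) (auto simp: inner_add_left intro!: integrable_add integrable_continuous continuous_intros)
  then show ?thesis unfolding normH_eq[OF pos] add_divide_distrib[symmetric]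
    by (intro divide_right_mono) (auto simp: integral_add)
qed

lemma normH_scaleR: "normH \<omega> (c *\<^sub>R p) = \<bar>c\<bar> * normH \<omega> p"
  unfolding normH_eq[OF pos] by (simp add: abs_mult)

text \<open>On the closed cube a continuous nonnegative function with integral zero vanishes; any
  other point is brought into the cube by removing whole periods coordinate by coordinate.\<close>

lemma torus_vanish:
  fixes f :: "real^'n \<Rightarrow> real"
  assumes cont: "continuous_on UNIV f" and per: "\<And>x i. f (x + axis i (2 * pi)) = f x"
    and nn: "\<And>x. f x \<ge> 0" and z: "integral torus f = 0"
  shows "f x = 0"
proof -
  define c :: "real^'n" where "c = (\<chi> i. x $ i - 2 * pi * of_int \<lfloor>x $ i / (2 * pi)\<rfloor>)"
  have c: "0 \<le> c $ i \<and> c $ i \<le> 2 * pi" for i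
  proof -
    have "of_int \<lfloor>x $ i / (2 * pi)\<rfloor> \<le> x $ i / (2 * pi)" "x $ i / (2 * pi) \<le> of_int \<lfloor>x $ i / (2 * pi)\<rfloor> + 1"
      by linarith+
    from mult_left_mono[OF this(1), of "2 * pi"] mult_left_mono[OF this(2), of "2 * pi"]
    show ?thesis by (simp add: c_def distrib_left)
  qed
  then have "c \<in> torus" by (simp add: mem_box_cart)
  moreover have "f c = 0"
  proof -
    have "f integrable_on torus" using cont by (auto intro!: integrable_continuous intro: continuous_on_subset)
    then have "(f has_integral 0) torus" using z by (metis integrable_integral)
    then show ?thesis using has_integral_0_cbox_imp_0[of 0 "\<chi> i. 2 * pi" f c] cont nn \<open>c \<in> torus\<close>
      by (auto simp: box_ne_empty inner_axis Basis_vec_def intro: continuous_on_subset)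
  qed
  moreover have "f x = f c"
  proof -
    have ax: "axis i (2 * pi * of_int (k + 1)) = axis i (2 * pi * of_int k) + (axis i (2 * pi) :: real^'n)" for i k
      by (auto simp: axis_def vec_eq_iff algebra_simps)
    have int: "f (y + axis i (2 * pi * of_int k)) = f y" for y i k
    proof (induction k rule: int_induct[of _ 0])
      case base
      then show ?case by (simp add: axis_def flip: zero_vec_def)
    next
      case (step1 k)
      then show ?case using per[of "y + axis i (2 * pi * of_int k)" i] by (simp only: ax add.assoc)
    next
      case (step2 k)
      then show ?case using per[of "y + axis i (2 * pi * of_int (k - 1))" i] ax[of i "k - 1"] by (simp add: add.assoc)
    qed
    have "f (c + (\<chi> i. if i \<in> S then 2 * pi * of_int \<lfloor>x $ i / (2 * pi)\<rfloor> else 0)) = f c" if "finite S" for S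
      using that
    proof (induction S)
      case empty
      have "(\<chi> i. 0) = (0::real^'n)" by (simp add: vec_eq_iff)
      then show ?case by simp
    next
      case (insert j S)
      have "(\<chi> i. if i \<in> insert j S then 2 * pi * of_int \<lfloor>x $ i / (2 * pi)\<rfloor> else 0)
        = (\<chi> i. if i \<in> S then 2 * pi * of_int \<lfloor>x $ i / (2 * pi)\<rfloor> else 0) + axis j (2 * pi * of_int \<lfloor>x $ j / (2 * pi)\<rfloor>)"
        using insert by (auto simp: vec_eq_iff axis_def)
      then show ?case using insert int by (simp add: add.assoc[symmetric])
    qed
    from this[of UNIV] show ?thesis by (simp add: c_def plus_vec_def)
  qed
  ultimately show ?thesis by simp
qed

text \<open>At the angle \<open>- \<alpha>\<close> all oscillators are in phase, so
  \<open>p \<bullet> circ_vec\<close> there equals the sum of the amplitudes.\<close>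

lemma normH_eq_0: assumes "normH \<omega> p = 0" shows "p = 0"
proof -
  have "integral torus (\<lambda>\<theta>. \<bar>p \<bullet> circ_vec \<omega> \<theta>\<bar>) = 0" using assms unfolding normH_eq[OF pos] by simp
  then have *: "\<bar>p \<bullet> circ_vec \<omega> \<theta>\<bar> = 0" for \<theta>
    by (intro torus_vanish[of "\<lambda>\<theta>. \<bar>p \<bullet> circ_vec \<omega> \<theta>\<bar>"]) (auto simp: circ_vec_periodic intro!: continuous_intros)
  obtain \<alpha> :: "real^'n" where "\<And>i. 0 \<le> \<alpha> $ i" "\<And>i. \<alpha> $ i \<le> 2 * pi"
    and a: "\<And>i. fst (p $ i) / \<omega> i = amp \<omega> p i * sin (\<alpha> $ i)" "\<And>i. snd (p $ i) = amp \<omega> p i * cos (\<alpha> $ i)"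
    using phase_exists[of \<omega> p, OF pos] by blast
  have "p \<bullet> circ_vec \<omega> (- \<alpha>) = (\<Sum>i\<in>UNIV. amp \<omega> p i)"
    unfolding inner_circ_vec a
  proof (rule sum.cong)
    fix x
    show "amp \<omega> p x * cos (\<alpha> $ x) * cos ((- \<alpha>) $ x) - amp \<omega> p x * sin (\<alpha> $ x) * sin ((- \<alpha>) $ x) = amp \<omega> p x"
      using sin_cos_split[of "\<alpha> $ x" "amp \<omega> p x"] by (simp add: algebra_simps)
  qed simp
  with *[of "- \<alpha>"] have "(\<Sum>i\<in>UNIV. amp \<omega> p i) = 0" by simp
  then have "amp \<omega> p i = 0" for i by (subst (asm) sum_nonneg_eq_0_iff) (auto simp: amp_nonneg)
  then have "fst (p $ i) = 0 \<and> snd (p $ i) = 0" for i using a[of i] pos[of i] by simp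
  then show ?thesis by (auto simp: vec_eq_iff prod_eq_iff)
qed

lemma normH_nonneg: "normH \<omega> p \<ge> 0"
  unfolding normH_eq[OF pos] by (auto intro!: divide_nonneg_nonneg integral_nonneg)

text \<open>Near a zero of \<open>p \<bullet> circ_vec\<close> at which this function changes sign along a coordinate axis,
  the factor \<open>q \<bullet> circ_vec\<close> has to change sign as well, hence vanishes.\<close>

lemma nonneg_product_zero:
  assumes nn: "\<And>\<theta>. (p \<bullet> circ_vec \<omega> \<theta>) * (q \<bullet> circ_vec \<omega> \<theta>) \<ge> 0"
    and z: "p \<bullet> circ_vec \<omega> \<theta> = 0"
    and reg: "snd (p $ i) * sin (\<theta> $ i) + fst (p $ i) / \<omega> i * cos (\<theta> $ i) \<noteq> 0"
  shows "q \<bullet> circ_vec \<omega> \<theta> = 0"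
proof -
  have *: "\<not> q \<bullet> circ_vec \<omega> \<theta> > 0" if z: "p \<bullet> circ_vec \<omega> \<theta> = 0"
    and reg: "snd (p $ i) * sin (\<theta> $ i) + fst (p $ i) / \<omega> i * cos (\<theta> $ i) \<noteq> 0" for \<theta>
  proof
    assume gp: "q \<bullet> circ_vec \<omega> \<theta> > 0"
    let ?f = "\<lambda>s. p \<bullet> circ_vec \<omega> (\<theta> + axis i s)" and ?g = "\<lambda>s. q \<bullet> circ_vec \<omega> (\<theta> + axis i s)"
    have f: "?f s = (\<Sum>j\<in>UNIV. snd (p $ j) * cos (\<theta> $ j + (if j = i then s else 0)) - fst (p $ j) / \<omega> j * sin (\<theta> $ j + (if j = i then s else 0)))"
      for s unfolding inner_circ_vec by (intro sum.cong) (auto simp: axis_def)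
    have split: "(\<Sum>j\<in>UNIV. h j) = h i + (\<Sum>j\<in>UNIV - {i}. h j)" for h :: "'n \<Rightarrow> real"
      by (simp add: sum.remove)
    have f': "?f s = snd (p $ i) * cos (\<theta> $ i + s) - fst (p $ i) / \<omega> i * sin (\<theta> $ i + s) +
      (\<Sum>j\<in>UNIV-{i}. snd (p $ j) * cos (\<theta> $ j) - fst (p $ j) / \<omega> j * sin (\<theta> $ j))" for s
      unfolding f by (subst split) (auto intro!: sum.cong)
    have D: "DERIV ?f 0 :> - (snd (p $ i) * sin (\<theta> $ i) + fst (p $ i) / \<omega> i * cos (\<theta> $ i))"
      unfolding f' by (auto intro!: derivative_eq_intros simp: pos less_imp_neq[OF pos, symmetric])
    have "isCont ?g 0"
    proof -
      have "continuous_on UNIV (\<lambda>s::real. if j = i then s else 0)" for j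
        by (cases "j = i") (auto intro!: continuous_intros)
      then have "continuous_on UNIV ?g" unfolding axis_def
        by (intro continuous_intros continuous_on_vec_lambda) auto
      then show ?thesis by (simp add: continuous_on_eq_continuous_at)
    qed
    moreover have a0: "axis i 0 = (0::real^'n)" by (simp add: axis_def vec_eq_iff)
    ultimately have "\<forall>\<^sub>F s in at 0. ?g s > 0"
      using gp by (intro order_tendstoD) (auto simp: isCont_def)
    then obtain d where d: "d > 0" "\<And>s. s \<noteq> 0 \<Longrightarrow> dist s 0 < d \<Longrightarrow> ?g s > 0"
      by (auto simp: eventually_at)
    \<comment> \<open>Positivity of \<open>?g\<close> near \<open>0\<close> forces \<open>?f\<close>
      to be nonnegative there. As \<open>?f 0 = 0\<close>, this is a local minimum, and the
      derivative excluded by \<open>reg\<close> would have to vanish.\<close>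
    have "?f s \<ge> ?f 0" if "\<bar>0 - s\<bar> < d" for s
    proof (cases "s = 0")
      case False
      then show ?thesis using nn[of "\<theta> + axis i s"] d(2)[of s] that z
        by (simp add: zero_le_mult_iff a0)
    qed simp
    from DERIV_local_min[OF D d(1)] this have "- (snd (p $ i) * sin (\<theta> $ i) + fst (p $ i) / \<omega> i * cos (\<theta> $ i)) = 0"
      by blast
    with reg show False by simp
  qed
  \<comment> \<open>The antipode: adding \<open>pi\<close> to every angle negates all products, so
    excluding positive values there excludes negative values at \<open>\<theta>\<close>.\<close>
  have s: "p' \<bullet> circ_vec \<omega> (t + (\<chi> i. pi)) = - (p' \<bullet> circ_vec \<omega> t)" for p' t
    unfolding inner_circ_vec by (simp add: sum_negf[symmetric])
  have "\<not> q \<bullet> circ_vec \<omega> (\<theta> + (\<chi> i. pi)) > 0"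
  proof (rule *)
    show "p \<bullet> circ_vec \<omega> (\<theta> + (\<chi> i. pi)) = 0" using z s by simp
    show "snd (p $ i) * sin ((\<theta> + (\<chi> i. pi)) $ i) + fst (p $ i) / \<omega> i * cos ((\<theta> + (\<chi> i. pi)) $ i) \<noteq> 0"
    proof -
      have "snd (p $ i) * sin ((\<theta> + (\<chi> i. pi)) $ i) + fst (p $ i) / \<omega> i * cos ((\<theta> + (\<chi> i. pi)) $ i)
        = - (snd (p $ i) * sin (\<theta> $ i) + fst (p $ i) / \<omega> i * cos (\<theta> $ i))" by simp
      then show ?thesis using reg by simp
    qed
  qed
  with *[OF z reg] s[of q \<theta>] show ?thesis by linarith
qed

text \<open>In angles \<open>s\<close> measured from the phases of \<open>p\<close>, the two
  products are \<open>- (\<Sum>k. amp k * sin (s k))\<close> and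
  \<open>\<Sum>k. A k * cos (s k) - B k * sin (s k)\<close>. The second vanishes on zeros of the
  first with \<open>cos (s i) \<noteq> 0\<close>. Suitable zeros give \<open>A = 0\<close> and then
  \<open>B\<close> proportional to the amplitudes, which means that \<open>q\<close> is a multiple
  of \<open>p\<close>.\<close>

lemma nonneg_product_parallel:
  assumes nn: "\<And>\<theta>. (p \<bullet> circ_vec \<omega> \<theta>) * (q \<bullet> circ_vec \<omega> \<theta>) \<ge> 0" and "p \<noteq> 0"
  obtains c where "q = c *\<^sub>R p"
proof -
  obtain \<alpha> :: "real^'n" where "\<And>i. 0 \<le> \<alpha> $ i" "\<And>i. \<alpha> $ i \<le> 2 * pi"
    and a: "\<And>i. fst (p $ i) / \<omega> i = amp \<omega> p i * sin (\<alpha> $ i)" "\<And>i. snd (p $ i) = amp \<omega> p i * cos (\<alpha> $ i)"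
    using phase_exists[of \<omega> p, OF pos] by blast
  define A where "A k = snd (q $ k) * sin (\<alpha> $ k) - fst (q $ k) / \<omega> k * cos (\<alpha> $ k)" for k
  define B where "B k = snd (q $ k) * cos (\<alpha> $ k) + fst (q $ k) / \<omega> k * sin (\<alpha> $ k)" for k
  define \<theta> :: "('n \<Rightarrow> real) \<Rightarrow> real^'n" where "\<theta> s = (\<chi> k. pi / 2 - (\<alpha> $ k - s k))" for s
  have sc: "sin (\<theta> s $ k) = cos (\<alpha> $ k - s k)" "cos (\<theta> s $ k) = sin (\<alpha> $ k - s k)" for s k
    unfolding \<theta>_def by (simp_all add: sin_diff[of "pi/2"] cos_diff[of "pi/2"])
  note one = sin_cos_split
  have q: "q \<bullet> circ_vec \<omega> (\<theta> s) = (\<Sum>k\<in>UNIV. A k * cos (s k) - B k * sin (s k))" for s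
    unfolding inner_circ_vec sc A_def B_def
    by (intro sum.cong) (simp_all add: cos_diff sin_diff algebra_simps)
  have p: "p \<bullet> circ_vec \<omega> (\<theta> s) = (\<Sum>k\<in>UNIV. - amp \<omega> p k * sin (s k))" for s
    unfolding inner_circ_vec sc a
  proof (intro sum.cong refl)
    fix k
    have "amp \<omega> p k * cos (\<alpha> $ k) * sin (\<alpha> $ k - s k) - amp \<omega> p k * sin (\<alpha> $ k) * cos (\<alpha> $ k - s k)
       = amp \<omega> p k * sin ((\<alpha> $ k - s k) - \<alpha> $ k)"
      unfolding sin_diff[of "\<alpha> $ k - s k"] by (simp add: algebra_simps)
    then show "amp \<omega> p k * cos (\<alpha> $ k) * sin (\<alpha> $ k - s k) - amp \<omega> p k * sin (\<alpha> $ k) * cos (\<alpha> $ k - s k)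
      = - amp \<omega> p k * sin (s k)" by simp
  qed
  have reg: "snd (p $ i) * sin (\<theta> s $ i) + fst (p $ i) / \<omega> i * cos (\<theta> s $ i) = amp \<omega> p i * cos (s i)" for s i
  proof -
    have "snd (p $ i) * sin (\<theta> s $ i) + fst (p $ i) / \<omega> i * cos (\<theta> s $ i) = amp \<omega> p i * cos (\<alpha> $ i - (\<alpha> $ i - s i))"
      unfolding sc a cos_diff[of "\<alpha> $ i" "\<alpha> $ i - s i"] by (simp add: algebra_simps)
    then show ?thesis by simp
  qed
  obtain i where i: "amp \<omega> p i \<noteq> 0"
  proof (rule ccontr)
    assume "\<not> thesis"
    then have "amp \<omega> p i = 0" for i using that by blast
    then have "fst (p $ i) = 0 \<and> snd (p $ i) = 0" for i using a[of i] pos[of i] by simp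
    then show False using \<open>p \<noteq> 0\<close> by (auto simp: vec_eq_iff prod_eq_iff)
  qed
  have zero: "(\<Sum>k\<in>UNIV. A k * cos (s k) - B k * sin (s k)) = 0"
    if "(\<Sum>k\<in>UNIV. - amp \<omega> p k * sin (s k)) = 0" "cos (s i) \<noteq> 0" for s
    using nonneg_product_zero[OF nn, of "\<theta> s" i] that i p q reg by simp
  \<comment> \<open>Turning the single angle \<open>s j\<close> from \<open>0\<close> to
    \<open>pi\<close> leaves all sines zero and changes only the sign of the term
    \<open>A j\<close>; the two resulting equations differ by \<open>2 * A j\<close>.\<close>
  have A0: "A j = 0" for j
  proof -
    have split: "(\<Sum>k\<in>UNIV. h k) = h j + (\<Sum>k\<in>UNIV - {j}. h k)" for h :: "'n \<Rightarrow> real"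
      by (simp add: sum.remove)
    have 1: "(\<Sum>k\<in>UNIV. A k) = 0" using zero[of "\<lambda>_. 0"] by simp
    have 2: "(\<Sum>k\<in>UNIV. A k * cos (if k = j then pi else 0)) = 0"
      using zero[of "\<lambda>k. if k = j then pi else 0"] by (simp add: if_distrib[of sin] cong: if_cong)
    have "(\<Sum>k\<in>UNIV - {j}. A k * cos (if k = j then pi else 0)) = (\<Sum>k\<in>UNIV - {j}. A k)"
      by (rule sum.cong) auto
    then show ?thesis using 1 2 by (simp add: split)
  qed
  have B: "B j * amp \<omega> p i = B i * amp \<omega> p j" for j
  proof (cases "j = i")
    case False
    define S where "S = amp \<omega> p i + amp \<omega> p j"
    have S: "S > 0" "amp \<omega> p j < S" "amp \<omega> p j \<ge> 0" "amp \<omega> p i \<ge> 0" "amp \<omega> p i \<le> S"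
      using i amp_nonneg[of \<omega> p i] amp_nonneg[of \<omega> p j] unfolding S_def by linarith+
    \<comment> \<open>The sines are chosen so that the contributions of \<open>i\<close> and
      \<open>j\<close> to the first product cancel. Division by the sum \<open>S\<close> keeps them
      in \<open>[-1, 1]\<close>, and \<open>amp \<omega> p i > 0\<close> keeps
      \<open>sin (s i)\<close> below \<open>1\<close>, hence
      \<open>cos (s i) \<noteq> 0\<close>.\<close>
    define s where "s k = (if k = i then arcsin (amp \<omega> p j / S) else if k = j then - arcsin (amp \<omega> p i / S) else 0)" for k
    have si: "sin (s i) = amp \<omega> p j / S" and sj: "sin (s j) = - (amp \<omega> p i / S)"
    proof -
      have "0 \<le> amp \<omega> p j / S" "amp \<omega> p j / S \<le> 1" "0 \<le> amp \<omega> p i / S" "amp \<omega> p i / S \<le> 1"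
        using S by (simp_all add: divide_le_eq)
      then have "sin (arcsin (amp \<omega> p j / S)) = amp \<omega> p j / S" "sin (arcsin (amp \<omega> p i / S)) = amp \<omega> p i / S"
        by (intro sin_arcsin; linarith)+
      then show "sin (s i) = amp \<omega> p j / S" "sin (s j) = - (amp \<omega> p i / S)"
        using False by (simp_all add: s_def)
    qed
    have ci: "cos (s i) \<noteq> 0"
    proof
      assume "cos (s i) = 0"
      then have "(amp \<omega> p j / S)\<^sup>2 = 1" using sin_cos_squared_add[of "s i"] si by simp
      moreover have "(amp \<omega> p j / S)\<^sup>2 < 1" using S by (simp add: abs_square_less_1)
      ultimately show False by simp
    qed
    have split: "(\<Sum>k\<in>UNIV. h k * sin (s k)) = h i * sin (s i) + h j * sin (s j)" for h :: "'n \<Rightarrow> real"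
    proof -
      have "(\<Sum>k\<in>UNIV. h k * sin (s k)) = (\<Sum>k\<in>{i,j}. h k * sin (s k))"
        by (rule sum.mono_neutral_right) (auto simp: s_def)
      then show ?thesis using False by simp
    qed
    have "(\<Sum>k\<in>UNIV. - amp \<omega> p k * sin (s k)) = 0"
      unfolding split[of "\<lambda>k. - amp \<omega> p k"] si sj by simp
    from zero[OF this ci] have "(\<Sum>k\<in>UNIV. B k * sin (s k)) = 0"
      by (simp add: A0 sum_negf)
    then show ?thesis unfolding split si sj using S(1) by (simp add: field_simps)
  qed simp
  define c where "c = B i / amp \<omega> p i"
  have Bc: "B j = c * amp \<omega> p j" for j using B[of j] i by (simp add: c_def field_simps)
  have "q $ j = c *\<^sub>R (p $ j)" for j
  proof (rule prod_eqI)
    have "A j * sin (\<alpha> $ j) + B j * cos (\<alpha> $ j) =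
        sin (\<alpha> $ j) * (sin (\<alpha> $ j) * snd (q $ j)) + cos (\<alpha> $ j) * (cos (\<alpha> $ j) * snd (q $ j))"
      unfolding A_def B_def by (simp add: left_diff_distrib distrib_right)
    then have "snd (q $ j) = A j * sin (\<alpha> $ j) + B j * cos (\<alpha> $ j)" using one by simp
    then show "snd (q $ j) = snd (c *\<^sub>R (p $ j))" by (simp add: A0 Bc a)
    have "B j * sin (\<alpha> $ j) - A j * cos (\<alpha> $ j) =
        sin (\<alpha> $ j) * (sin (\<alpha> $ j) * (fst (q $ j) / \<omega> j)) + cos (\<alpha> $ j) * (cos (\<alpha> $ j) * (fst (q $ j) / \<omega> j))"
      unfolding A_def B_def by (simp only: left_diff_distrib right_diff_distrib distrib_right distrib_left mult.commute mult.left_commute)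
    then have "fst (q $ j) / \<omega> j = B j * sin (\<alpha> $ j) - A j * cos (\<alpha> $ j)" by (simp only: one)
    also have "\<dots> = c * (fst (p $ j) / \<omega> j)" unfolding A0 Bc a by simp
    finally show "fst (q $ j) = fst (c *\<^sub>R (p $ j))" using pos[of j] by simp
  qed
  then show ?thesis by (intro that[of c]) (simp add: vec_eq_iff)
qed

text \<open>Equality of the integrals makes the pointwise triangle inequality an equality, so the
  two products never have opposite signs. Thus \<open>q = c *\<^sub>R p\<close>, and the three norms
  leave only \<open>c = 1\<close>.\<close>

lemma normH_strict:
  assumes "normH \<omega> p = 1" "normH \<omega> q = 1" "normH \<omega> (p + q) = 2"
  shows "p = q"
proof -
  let ?f = "\<lambda>\<theta>. \<bar>p \<bullet> circ_vec \<omega> \<theta>\<bar> + \<bar>q \<bullet> circ_vec \<omega> \<theta>\<bar> - \<bar>(p + q) \<bullet> circ_vec \<omega> \<theta>\<bar>"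
  have "integral torus ?f = integral torus (\<lambda>\<theta>. \<bar>p \<bullet> circ_vec \<omega> \<theta>\<bar>) + integral torus (\<lambda>\<theta>. \<bar>q \<bullet> circ_vec \<omega> \<theta>\<bar>)
     - integral torus (\<lambda>\<theta>. \<bar>(p + q) \<bullet> circ_vec \<omega> \<theta>\<bar>)"
    by (simp only: integral_diff integral_add integrable_add circ_integrable)
  also have "\<dots> = 0"
    using assms unfolding normH_eq[OF pos] by (simp add: field_simps)
  finally have z: "integral torus ?f = 0" .
  have f0: "?f \<theta> = 0" for \<theta>
  proof (rule torus_vanish[OF _ _ _ z])
    show "continuous_on UNIV ?f" by (intro continuous_intros)
  qed (auto simp: circ_vec_periodic inner_add_left)
  have nn: "(p \<bullet> circ_vec \<omega> \<theta>) * (q \<bullet> circ_vec \<omega> \<theta>) \<ge> 0" for \<theta>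
  proof -
    have "\<bar>a\<bar> + \<bar>b\<bar> - \<bar>a + b\<bar> = 0 \<Longrightarrow> a * b \<ge> 0" for a b :: real
      by (auto simp: zero_le_mult_iff abs_if split: if_splits)
    then show ?thesis using f0[of \<theta>] by (simp add: inner_add_left)
  qed
  have "p \<noteq> 0" using assms(1) normH_scaleR[of 0 p] by auto
  then obtain c where q: "q = c *\<^sub>R p" using nonneg_product_parallel[OF nn] by blast
  have "\<bar>c\<bar> = 1" using assms(1,2) q by (simp add: normH_scaleR)
  moreover have "\<bar>1 + c\<bar> = 2"
    using assms(1,3) normH_scaleR[of "1 + c" p] by (simp add: q scaleR_add_left)
  ultimately have "c = 1" by linarith
  with q show ?thesis by simp
qed

end

section \<open>The dual norm \<open>rho\<close> and its gradient\<close>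

lemma norm_axis_state: "norm (axis i (1, 0) :: 'n::finite state) = 1"
proof -
  have "(\<Sum>j\<in>UNIV. (norm ((axis i (1, 0) :: 'n state) $ j))\<^sup>2) = (\<Sum>j\<in>UNIV. if j = i then 1 else 0)"
    by (rule sum.cong) (auto simp: axis_def norm_Pair)
  then show ?thesis by (simp add: norm_vec_def L2_set_def)
qed

context oscillators
begin

lemma normH_0 [simp]: "normH \<omega> 0 = 0"
  using normH_scaleR[of 0 0] by simp

lemma continuous_on_normH: "continuous_on UNIV (normH \<omega>)"
proof (rule convex_on_continuous)
  show "convex_on UNIV (normH \<omega>)"
  proof (rule convex_onI)
    fix t :: real and x y assume "0 < t" "t < 1"
    then show "normH \<omega> ((1 - t) *\<^sub>R x + t *\<^sub>R y) \<le> (1 - t) * normH \<omega> x + t * normH \<omega> y"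
      using normH_triangle[of "(1 - t) *\<^sub>R x" "t *\<^sub>R y"] by (simp add: normH_scaleR)
  qed simp
qed simp

lemma normH_lower: obtains m where "m > 0" "\<And>p. m * norm p \<le> normH \<omega> p"
proof -
  have "compact (sphere 0 1 :: 'n state set)" by simp
  moreover have "axis undefined (1, 0) \<in> (sphere 0 1 :: 'n state set)"
    by (simp add: norm_axis_state)
  ultimately obtain q where q: "q \<in> sphere 0 1" "\<And>p. p \<in> sphere 0 1 \<Longrightarrow> normH \<omega> q \<le> normH \<omega> p"
    using continuous_attains_inf[of "sphere 0 1" "normH \<omega>"] continuous_on_subset[OF continuous_on_normH]
    by (metis empty_iff top_greatest)
  have "normH \<omega> q > 0"
    using q(1) normH_nonneg[of q] normH_eq_0[of q] by force
  moreover have "normH \<omega> q * norm p \<le> normH \<omega> p" for p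
  proof (cases "p = 0")
    case False
    have "normH \<omega> q \<le> normH \<omega> ((1 / norm p) *\<^sub>R p)" using False by (intro q) simp
    then show ?thesis using False by (simp add: normH_scaleR field_simps)
  qed simp
  ultimately show ?thesis by (rule that)
qed

lemma compact_normH_le: "compact {p. normH \<omega> p \<le> r}"
proof -
  obtain m where m: "m > 0" "\<And>p. m * norm p \<le> normH \<omega> p" using normH_lower by blast
  have "bounded {p. normH \<omega> p \<le> r}"
  proof (rule boundedI)
    fix p assume "p \<in> {p. normH \<omega> p \<le> r}"
    then have "m * norm p \<le> r" using m(2)[of p] by simp
    then show "norm p \<le> r / m" using m(1) by (simp add: field_simps)
  qed
  moreover have "closed {p. normH \<omega> p \<le> r}"
    by (rule closed_Collect_le) (auto intro: continuous_on_normH continuous_intros)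
  ultimately show ?thesis by (simp add: compact_eq_bounded_closed)
qed

lemma rho_attained: obtains p where "normH \<omega> p \<le> 1" "rho \<omega> x = x \<bullet> p" "\<And>q. normH \<omega> q \<le> 1 \<Longrightarrow> x \<bullet> q \<le> rho \<omega> x"
proof -
  have "{p. normH \<omega> p \<le> 1} \<noteq> {}" using normH_0 by (metis (mono_tags) empty_iff mem_Collect_eq zero_le_one)
  then obtain p where p: "normH \<omega> p \<le> 1" "\<And>q. normH \<omega> q \<le> 1 \<Longrightarrow> x \<bullet> q \<le> x \<bullet> p"
    using continuous_attains_sup[OF compact_normH_le[of 1], of "\<lambda>p. x \<bullet> p"] continuous_on_inner[OF continuous_on_const continuous_on_id]
    by (metis (mono_tags, lifting) mem_Collect_eq)
  moreover have "rho \<omega> x = x \<bullet> p"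
    unfolding rho_def by (rule cSup_eq_maximum) (use p in auto)
  ultimately show ?thesis using that by metis
qed

lemma inner_le_rho: "normH \<omega> q \<le> 1 \<Longrightarrow> x \<bullet> q \<le> rho \<omega> x"
  using rho_attained[of x] by metis

lemma rho_nonneg: "0 \<le> rho \<omega> x"
  using inner_le_rho[of 0 x] by simp

lemma rho_0 [simp]: "rho \<omega> 0 = 0"
  using rho_attained[of 0] by (metis inner_zero_left)

lemma rho_triangle: "rho \<omega> (x + y) \<le> rho \<omega> x + rho \<omega> y"
proof -
  obtain p where "normH \<omega> p \<le> 1" "rho \<omega> (x + y) = (x + y) \<bullet> p" using rho_attained[of "x + y"] by metis
  then show ?thesis using inner_le_rho[of p x] inner_le_rho[of p y] by (simp add: inner_add_left)
qed

lemma rho_scaleR: assumes "c \<ge> 0" shows "rho \<omega> (c *\<^sub>R x) = c * rho \<omega> x"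
proof -
  obtain p where p: "normH \<omega> p \<le> 1" "rho \<omega> (c *\<^sub>R x) = c *\<^sub>R x \<bullet> p" using rho_attained[of "c *\<^sub>R x"] by metis
  obtain q where q: "normH \<omega> q \<le> 1" "rho \<omega> x = x \<bullet> q" using rho_attained[of x] by metis
  have "c * (x \<bullet> p) \<le> c * (x \<bullet> q)" using assms inner_le_rho[OF p(1), of x] q by (simp add: mult_left_mono)
  moreover have "c * (x \<bullet> q) \<le> c * (x \<bullet> p)" using inner_le_rho[OF q(1), of "c *\<^sub>R x"] p by simp
  ultimately show ?thesis using p q by simp
qed

lemma rho_minus: "rho \<omega> (- x) = rho \<omega> x"
proof -
  have "rho \<omega> (- x) \<le> rho \<omega> x" for x
  proof -
    obtain p where p: "normH \<omega> p \<le> 1" "rho \<omega> (- x) = (- x) \<bullet> p" using rho_attained[of "- x"] by metis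
    then show ?thesis using inner_le_rho[of "- p" x] normH_scaleR[of "-1" p] by simp
  qed
  from this[of x] this[of "- x"] show ?thesis by simp
qed

lemma rho_pos: assumes "x \<noteq> 0" shows "rho \<omega> x > 0"
proof -
  have h: "normH \<omega> x > 0" using assms normH_nonneg[of x] normH_eq_0[of x] by force
  have "x \<bullet> ((1 / normH \<omega> x) *\<^sub>R x) \<le> rho \<omega> x" using h by (intro inner_le_rho) (simp add: normH_scaleR)
  moreover have "x \<bullet> ((1 / normH \<omega> x) *\<^sub>R x) > 0" using h assms by simp
  ultimately show ?thesis by linarith
qed

lemma rho_le_norm: obtains R where "R > 0" "\<And>x. rho \<omega> x \<le> R * norm x"
   "\<And>p. normH \<omega> p \<le> 1 \<Longrightarrow> norm p \<le> R"
proof -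
  obtain m where m: "m > 0" "\<And>p. m * norm p \<le> normH \<omega> p" using normH_lower by blast
  have n: "norm p \<le> 1 / m" if "normH \<omega> p \<le> 1" for p
    using m(2)[of p] m(1) that by (simp add: field_simps)
  have "rho \<omega> x \<le> 1 / m * norm x" for x
  proof -
    obtain p where p: "normH \<omega> p \<le> 1" "rho \<omega> x = x \<bullet> p" using rho_attained[of x] by metis
    have "x \<bullet> p \<le> norm x * norm p" by (rule norm_cauchy_schwarz)
    also have "\<dots> \<le> norm x * (1 / m)" using n[OF p(1)] by (intro mult_left_mono) auto
    finally show ?thesis using p by (simp add: mult.commute)
  qed
  with n show ?thesis using m(1) by (intro that[of "1 / m"]) auto
qed

lemma rho_diff_le: "\<bar>rho \<omega> x - rho \<omega> y\<bar> \<le> rho \<omega> (x - y)"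
  using rho_triangle[of "x - y" y] rho_triangle[of "y - x" x] rho_minus[of "x - y"] by simp

lemma continuous_on_rho: "continuous_on S (rho \<omega>)"
proof -
  obtain R where R: "R > 0" "\<And>x. rho \<omega> x \<le> R * norm x" using rho_le_norm by metis
  show ?thesis unfolding continuous_on_iff
  proof (intro ballI allI impI)
    fix x and e :: real assume "e > 0"
    have "dist (rho \<omega> y) (rho \<omega> x) < e" if "dist y x < e / R" for y
      using rho_diff_le[of y x] R(2)[of "y - x"] that R(1) by (simp add: dist_norm field_simps)
    then show "\<exists>d>0. \<forall>y\<in>S. dist y x < d \<longrightarrow> dist (rho \<omega> y) (rho \<omega> x) < e"
      using \<open>e > 0\<close> R(1) by (intro exI[of _ "e / R"]) auto
  qed
qed

text \<open>The minimum over the compact unit sphere is positive, and homogeneity extends it.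
  Together with \<open>rho_le_norm\<close> this makes \<open>rho\<close> equivalent to the Euclidean
  norm.\<close>

lemma norm_le_rho: obtains m where "m > 0" "\<And>x. m * norm x \<le> rho \<omega> x"
proof -
  have "compact (sphere 0 1 :: 'n state set)" by simp
  moreover have "axis undefined (1, 0) \<in> (sphere 0 1 :: 'n state set)"
    by (simp add: norm_axis_state)
  ultimately obtain q where q: "q \<in> sphere 0 1" "\<And>p. p \<in> sphere 0 1 \<Longrightarrow> rho \<omega> q \<le> rho \<omega> p"
    using continuous_attains_inf[of "sphere 0 1" "rho \<omega>"] continuous_on_rho
    by (metis empty_iff)
  have "rho \<omega> q > 0" using q(1) by (intro rho_pos) auto
  moreover have "rho \<omega> q * norm p \<le> rho \<omega> p" for p
  proof (cases "p = 0")
    case False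
    have "rho \<omega> q \<le> rho \<omega> ((1 / norm p) *\<^sub>R p)" using False by (intro q) simp
    then show ?thesis using False by (simp add: rho_scaleR field_simps)
  qed simp
  ultimately show ?thesis by (rule that)
qed

lemma maximizer_normH:
  assumes "x \<noteq> 0" "normH \<omega> p \<le> 1" "x \<bullet> p = rho \<omega> x"
  shows "normH \<omega> p = 1"
proof (rule ccontr)
  assume n: "normH \<omega> p \<noteq> 1"
  have "p \<noteq> 0" using assms rho_pos[of x] by auto
  then have h: "normH \<omega> p > 0" using normH_nonneg[of p] normH_eq_0[of p] by force
  have "x \<bullet> ((1 / normH \<omega> p) *\<^sub>R p) \<le> rho \<omega> x" using h by (intro inner_le_rho) (simp add: normH_scaleR)
  then have "rho \<omega> x \<le> rho \<omega> x * normH \<omega> p" using assms h by (simp add: field_simps)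
  moreover have "rho \<omega> x * normH \<omega> p < rho \<omega> x * 1"
    using n assms rho_pos[of x] by (intro mult_strict_left_mono) auto
  ultimately show False by simp
qed

text \<open>The midpoint of two maximizers is again a maximizer and so has norm \<open>1\<close>;
  strict convexity then identifies the two.\<close>

lemma maximizer_unique:
  assumes "x \<noteq> 0" "normH \<omega> p \<le> 1" "x \<bullet> p = rho \<omega> x" "normH \<omega> q \<le> 1" "x \<bullet> q = rho \<omega> x"
  shows "p = q"
proof -
  let ?r = "(1/2) *\<^sub>R (p + q)"
  have "normH \<omega> (p + q) \<le> 2" using normH_triangle[of p q] assms by linarith
  then have "normH \<omega> ?r \<le> 1" by (simp add: normH_scaleR)
  moreover have "x \<bullet> ?r = rho \<omega> x" using assms by (simp add: inner_add_right)
  ultimately have "normH \<omega> ?r = 1" using assms(1) by (intro maximizer_normH)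
  then have "normH \<omega> (p + q) = 2" by (simp add: normH_scaleR)
  then show ?thesis using assms by (intro normH_strict maximizer_normH[of x]) auto
qed

text \<open>A choice of dual vector at every point. Away from \<open>0\<close> there is only one,
  and it turns out to be the gradient of \<open>rho\<close>.\<close>

definition maxim :: "'n state \<Rightarrow> 'n state" where
  "maxim x = (SOME p. normH \<omega> p \<le> 1 \<and> x \<bullet> p = rho \<omega> x)"

lemma maxim: "normH \<omega> (maxim x) \<le> 1" "x \<bullet> maxim x = rho \<omega> x"
proof -
  have "\<exists>p. normH \<omega> p \<le> 1 \<and> x \<bullet> p = rho \<omega> x" using rho_attained[of x] by metis
  from someI_ex[OF this] show "normH \<omega> (maxim x) \<le> 1" "x \<bullet> maxim x = rho \<omega> x"
    unfolding maxim_def by auto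
qed

text \<open>By compactness and uniqueness, competitors at distance at least \<open>e\<close> from
  \<open>maxim x\<close> fall short of \<open>rho \<omega> x\<close> by a fixed
  \<open>\<delta>\<close>, a gap that a small displacement of \<open>x\<close> cannot close.\<close>

lemma isCont_maxim: assumes "x \<noteq> 0" shows "isCont maxim x"
proof -
  obtain R where R: "R > 0" "\<And>p. normH \<omega> p \<le> 1 \<Longrightarrow> norm p \<le> R" using rho_le_norm by metis
  have "\<exists>d>0. \<forall>y. dist y x < d \<longrightarrow> dist (maxim y) (maxim x) < e" if "e > 0" for e
  proof -
    let ?K = "{p. normH \<omega> p \<le> 1} \<inter> {q. dist q (maxim x) \<ge> e}"
    have K: "compact ?K"
      by (intro compact_Int_closed compact_normH_le closed_Collect_le continuous_intros)
    have "\<exists>\<delta>>0. \<forall>q\<in>?K. x \<bullet> q \<le> rho \<omega> x - \<delta>"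
    proof (cases "?K = {}")
      case True
      then show ?thesis by (intro exI[of _ 1]) auto
    next
      case False
      then obtain q where q: "q \<in> ?K" "\<And>p. p \<in> ?K \<Longrightarrow> x \<bullet> p \<le> x \<bullet> q"
        using continuous_attains_sup[OF K False, of "\<lambda>p. x \<bullet> p"] continuous_on_inner[OF continuous_on_const continuous_on_id]
        by metis
      have "x \<bullet> q \<noteq> rho \<omega> x"
        using maximizer_unique[OF assms, of q "maxim x"] maxim[of x] q(1) \<open>e > 0\<close> by auto
      then have "x \<bullet> q < rho \<omega> x" using inner_le_rho[of q x] q(1) by force
      then show ?thesis using q by (intro exI[of _ "rho \<omega> x - x \<bullet> q"]) auto
    qed
    then obtain \<delta> where d: "\<delta> > 0" "\<And>q. q \<in> ?K \<Longrightarrow> x \<bullet> q \<le> rho \<omega> x - \<delta>" by blast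
    \<comment> \<open>Replacing \<open>x\<close> by \<open>y\<close> alters the pairings with
      \<open>maxim x\<close> and with \<open>maxim y\<close> by at most
      \<open>R * norm (y - x)\<close> each, together less than \<open>\<delta>\<close>.\<close>
    have "dist (maxim y) (maxim x) < e" if y: "dist y x < \<delta> / (2 * R)" for y
    proof (rule ccontr)
      assume "\<not> ?thesis"
      then have "maxim y \<in> ?K" using maxim by auto
      then have 1: "x \<bullet> maxim y \<le> rho \<omega> x - \<delta>" by (rule d)
      have 2: "y \<bullet> maxim x \<le> y \<bullet> maxim y" using maxim inner_le_rho by metis
      have n: "\<bar>(y - x) \<bullet> maxim z\<bar> \<le> norm (y - x) * R" for z
        by (rule order_trans[OF Cauchy_Schwarz_ineq2]) (auto intro!: mult_left_mono R maxim)
      have "norm (y - x) * (2 * R) < \<delta>" using y R(1) by (simp add: dist_norm field_simps)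
      then show False using n[of x] n[of y] 1 2 maxim(2)[of x] by (simp add: inner_diff_left)
    qed
    then show ?thesis using d(1) R(1) by (intro exI[of _ "\<delta> / (2 * R)"]) auto
  qed
  then show ?thesis by (simp add: continuous_at_eps_delta)
qed

text \<open>The envelope argument: testing each of \<open>maxim x\<close>, \<open>maxim y\<close> at
  the other point puts the remainder between \<open>0\<close> and
  \<open>(y - x) \<bullet> (maxim y - maxim x)\<close>, which is of higher order since
  \<open>maxim\<close> is continuous.\<close>

lemma rho_GDERIV: assumes "x \<noteq> 0" shows "GDERIV (rho \<omega>) x :> maxim x"
  unfolding gderiv_def
proof (rule has_derivativeI_sandwich[of 1])
  show "bounded_linear (\<lambda>h. h \<bullet> maxim x)" by (rule bounded_linear_inner_left)
  show "((\<lambda>y. norm (maxim y - maxim x)) \<longlongrightarrow> 0) (at x)"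
    using isCont_maxim[OF assms] unfolding isCont_def by (metis LIM_zero tendsto_norm_zero)
  fix y assume "y \<noteq> x"
  have "\<bar>rho \<omega> y - rho \<omega> x - (y - x) \<bullet> maxim x\<bar> \<le> norm (y - x) * norm (maxim y - maxim x)"
  proof -
    have "0 \<le> rho \<omega> y - rho \<omega> x - (y - x) \<bullet> maxim x"
      using inner_le_rho[OF maxim(1), of y x] maxim(2)[of x] by (simp add: inner_diff_left)
    moreover have "rho \<omega> y - rho \<omega> x - (y - x) \<bullet> maxim x \<le> (y - x) \<bullet> (maxim y - maxim x)"
      using inner_le_rho[OF maxim(1), of x y] maxim(2)[of y] by (simp add: inner_diff_left inner_diff_right)
    ultimately show ?thesis using norm_cauchy_schwarz[of "y - x" "maxim y - maxim x"] by linarith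
  qed
  then show "norm (rho \<omega> y - rho \<omega> x - (y - x) \<bullet> maxim x) / norm (y - x) \<le> norm (maxim y - maxim x)"
    using \<open>y \<noteq> x\<close> by (simp add: divide_le_eq mult.commute)
qed simp

lemma gradient_rho: assumes "x \<noteq> 0" shows "gradient (rho \<omega>) x = maxim x"
  unfolding gradient_def
proof (rule the_equality)
  fix d assume "GDERIV (rho \<omega>) x :> d"
  then have "(\<lambda>h. h \<bullet> d) = (\<lambda>h. h \<bullet> maxim x)"
    using rho_GDERIV[OF assms] unfolding gderiv_def by (rule has_derivative_unique)
  then have "(d - maxim x) \<bullet> d = (d - maxim x) \<bullet> maxim x" by metis
  then have "(d - maxim x) \<bullet> (d - maxim x) = 0" by (simp add: inner_diff_right)
  then show "d = maxim x" by simp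
qed (rule rho_GDERIV[OF assms])

lemma gradient_props:
  assumes "x \<noteq> 0"
  shows "normH \<omega> (gradient (rho \<omega>) x) = 1" "x \<bullet> gradient (rho \<omega>) x = rho \<omega> x"
    "GDERIV (rho \<omega>) x :> gradient (rho \<omega>) x"
  using rho_GDERIV[OF assms] maxim[of x] maximizer_normH[OF assms]
  unfolding gradient_rho[OF assms] by auto

lemma gradient_unique:
  assumes "x \<noteq> 0" "normH \<omega> p \<le> 1" "x \<bullet> p = rho \<omega> x" shows "gradient (rho \<omega>) x = p"
  using assms gradient_props[OF assms(1)] by (intro maximizer_unique[of x]) auto

lemma isCont_gradient_rho: assumes "x \<noteq> 0" shows "isCont (gradient (rho \<omega>)) x"
proof -
  have "\<forall>\<^sub>F y in nhds x. y \<noteq> 0" using assms by (rule t1_space_nhds)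
  then have "\<forall>\<^sub>F y in nhds x. gradient (rho \<omega>) y = maxim y"
    by eventually_elim (rule gradient_rho)
  then show ?thesis using isCont_maxim[OF assms] isCont_cong by blast
qed

lemma gradient_scaleR: assumes "x \<noteq> 0" "c > 0" shows "gradient (rho \<omega>) (c *\<^sub>R x) = gradient (rho \<omega>) x"
  using assms gradient_props[OF assms(1)] by (intro gradient_unique) (auto simp: rho_scaleR)

text \<open>Convexity with the gradient taken at \<open>y\<close>. In the decrease estimate
  \<open>y\<close> is the final position, whose gradient then stays fixed under the time
  integral.\<close>

lemma rho_diff_le_gradient:
  assumes "y \<noteq> 0" shows "rho \<omega> y - rho \<omega> x \<le> (y - x) \<bullet> gradient (rho \<omega>) y"
  using inner_le_rho[of "gradient (rho \<omega>) y" x] gradient_props[OF assms] by (simp add: inner_diff_left)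

text \<open>The gradient is homogeneous of degree \<open>0\<close>, so a bounded displacement far
  from the origin amounts to a small one near the unit sphere, where uniform continuity on an
  annulus applies.\<close>

lemma gradient_rho_almost_constant:
  assumes "\<eta> > 0" "D > 0"
  obtains R where "R > 0"
    "\<And>x y. rho \<omega> x \<ge> R \<Longrightarrow> norm (y - x) \<le> D \<Longrightarrow> y \<noteq> 0 \<and> norm (gradient (rho \<omega>) y - gradient (rho \<omega>) x) \<le> \<eta>"
proof -
  let ?P = "gradient (rho \<omega>)"
  let ?A = "{x::'n state. 1/2 \<le> norm x \<and> norm x \<le> 3/2}"
  have A: "compact ?A"
  proof -
    have "?A = cball 0 (3/2) \<inter> {x. 1/2 \<le> norm x}" by auto
    then show ?thesis by (auto intro!: compact_Int_closed closed_Collect_le continuous_intros)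
  qed
  have "continuous_on ?A ?P"
    by (intro continuous_at_imp_continuous_on ballI isCont_gradient_rho) auto
  then have "uniformly_continuous_on ?A ?P" using A by (rule compact_uniformly_continuous)
  then obtain d where d: "d > 0" "\<And>x y. x \<in> ?A \<Longrightarrow> y \<in> ?A \<Longrightarrow> dist y x < d \<Longrightarrow> dist (?P y) (?P x) < \<eta>"
    using uniformly_continuous_onE[OF _ \<open>\<eta> > 0\<close>] by blast
  obtain R0 where R0: "R0 > 0" "\<And>x. rho \<omega> x \<le> R0 * norm x" using rho_le_norm by metis
  \<comment> \<open>After division by \<open>norm x \<ge> K\<close> the displacement is at most
    \<open>1/2\<close>, which keeps both points in the annulus, and at most \<open>d/2\<close>,
    which is within the modulus of continuity.\<close>
  define K where "K = max (2 * D) (2 * D / d)"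
  have K: "K > 0" using assms by (simp add: K_def less_max_iff_disj)
  show ?thesis
  proof (rule that[of "R0 * K"])
    show "R0 * K > 0" using R0 K by simp
    fix x y assume x: "rho \<omega> x \<ge> R0 * K" and xy: "norm (y - x) \<le> D"
    have nx: "norm x \<ge> K" using order_trans[OF x R0(2)[of x]] R0(1) by simp
    then have x0: "x \<noteq> 0" "norm x > 0" using K by auto
    let ?x = "(1 / norm x) *\<^sub>R x" and ?y = "(1 / norm x) *\<^sub>R y"
    have "norm (?y - ?x) = norm (y - x) / norm x"
      by (simp add: scaleR_diff_right[symmetric])
    also have "\<dots> \<le> D / norm x" using xy by (simp add: divide_right_mono)
    finally have e: "norm (?y - ?x) \<le> D / norm x" .
    have "2 * D \<le> norm x" "2 * D / d \<le> norm x" using nx by (auto simp: K_def)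
    then have "D / norm x \<le> 1/2" "D / norm x < d"
      using x0 d(1) assms(2) by (auto simp: field_simps)
    with e have s: "norm (?y - ?x) \<le> 1/2" "norm (?y - ?x) < d" by linarith+
    have nx1: "norm ?x = 1" using x0 by simp
    have "norm ?y \<le> norm ?x + norm (?y - ?x)" "norm ?x \<le> norm ?y + norm (?y - ?x)"
      using norm_triangle_sub[of ?y ?x] norm_triangle_sub[of ?x ?y] by (simp_all only: norm_minus_commute)
    then have "1/2 \<le> norm ?x \<and> norm ?x \<le> 3/2" "1/2 \<le> norm ?y \<and> norm ?y \<le> 3/2"
      using s nx1 by linarith+
    then have A: "?x \<in> ?A" "?y \<in> ?A" by (simp_all only: mem_Collect_eq)
    then have y0: "y \<noteq> 0" by auto
    have "dist (?P ?y) (?P ?x) < \<eta>" using d(2)[OF A] s by (simp add: dist_norm)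
    then show "y \<noteq> 0 \<and> norm (?P y - ?P x) \<le> \<eta>"
      using x0 y0 by (simp add: gradient_scaleR dist_norm)
  qed
qed

end

section \<open>Integration by parts against measurable controls\<close>

lemma has_vector_derivative_vec_lambda:
  fixes f :: "real \<Rightarrow> 'a::euclidean_space ^ 'n::finite"
  assumes "\<And>i. ((\<lambda>x. f x $ i) has_vector_derivative f' $ i) (at a within S)"
  shows "(f has_vector_derivative f') (at a within S)"
proof -
  have "((\<lambda>x. f x \<bullet> b) has_derivative (\<lambda>x. (x *\<^sub>R f') \<bullet> b)) (at a within S)" if bB: "b \<in> Basis" for b
  proof -
    obtain i c where b: "b = axis i c" "c \<in> Basis" using bB unfolding Basis_vec_def by auto
    have "((\<lambda>x. f x $ i) has_derivative (\<lambda>x. x *\<^sub>R (f' $ i))) (at a within S)"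
      using assms[of i] by (simp add: has_vector_derivative_def)
    then have "((\<lambda>x. f x $ i \<bullet> c) has_derivative (\<lambda>x. (x *\<^sub>R (f' $ i)) \<bullet> c)) (at a within S)"
      by (rule has_derivative_inner_left)
    then show ?thesis by (simp add: b inner_axis)
  qed
  then show ?thesis unfolding has_vector_derivative_def has_derivative_componentwise_within[of f] by blast
qed

lemma has_vector_derivative_prodI:
  assumes "((\<lambda>x. fst (f x)) has_vector_derivative fst f') (at a within S)"
    "((\<lambda>x. snd (f x)) has_vector_derivative snd f') (at a within S)"
  shows "(f has_vector_derivative f') (at a within S)"
  using has_vector_derivative_Pair[OF assms] by simp

text \<open>The increments are too small for a nonzero derivative. This allows an identity between
  integrals to be proved without differentiating its terms almost everywhere.\<close>

lemma square_bound_imp_constant: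
  fixes E :: "real \<Rightarrow> 'a::real_normed_vector"
  assumes "\<And>s t. s \<in> {a..b} \<Longrightarrow> t \<in> {a..b} \<Longrightarrow> s \<le> t \<Longrightarrow> norm (E t - E s) \<le> C * (t - s)\<^sup>2"
    and "a \<le> b" "t \<in> {a..b}"
  shows "E t = E a"
proof -
  have n: "norm (E t - E s) \<le> C * (t - s)\<^sup>2" if "s \<in> {a..b}" "t \<in> {a..b}" for s t
    using assms(1)[of s t] assms(1)[of t s] that
    by (cases "s \<le> t") (auto simp: norm_minus_commute power2_commute)
  have "(E has_vector_derivative 0) (at x within {a..b})" if "x \<in> {a..b}" for x
    unfolding has_vector_derivative_def
  proof (rule has_derivativeI_sandwich[of 1])
    show "((\<lambda>y. C * \<bar>y - x\<bar>) \<longlongrightarrow> 0) (at x within {a..b})"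
      by (auto intro!: tendsto_eq_intros)
    fix y assume y: "y \<in> {a..b}" "y \<noteq> x"
    have "norm (E y - E x) \<le> C * (y - x)\<^sup>2" using n that y by blast
    then show "norm (E y - E x - (y - x) *\<^sub>R 0) / norm (y - x) \<le> C * \<bar>y - x\<bar>"
      using y by (simp add: divide_le_eq power2_eq_square mult.assoc flip: abs_mult)
  qed auto
  then obtain c where c: "\<And>x. x \<in> {a..b} \<Longrightarrow> E x = c"
    using has_vector_derivative_zero_constant[of "{a..b}" E] by auto
  show ?thesis using c[of t] c[of a] assms(2,3) by simp
qed

lemma integral_by_parts_bounded:
  fixes b :: "real \<Rightarrow> 'a::euclidean_space"
  assumes u: "u \<in> borel_measurable (lebesgue_on {0..T})" "\<forall>s\<in>{0..T}. \<bar>u s\<bar> \<le> (1::real)"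
    and b: "\<And>s. (b has_vector_derivative b' s) (at s)" "continuous_on UNIV b'" and t: "t \<in> {0..T}"
  defines "v \<equiv> \<lambda>t. integral {0..t} u"
  shows "(\<lambda>s. u s *\<^sub>R b s) integrable_on {0..t}"
    "integral {0..t} (\<lambda>s. u s *\<^sub>R b s) = v t *\<^sub>R b t - integral {0..t} (\<lambda>s. v s *\<^sub>R b' s)"
proof -
  have "0 \<le> T" using t by simp
  have bc: "continuous_on S b" for S
    using b(1) by (meson continuous_at_imp_continuous_on has_vector_derivative_continuous)
  have ui: "u integrable_on {0..T}"
    by (rule measurable_bounded_by_integrable_imp_integrable[OF u(1), of "\<lambda>_. 1"]) (simp_all add: u(2) integrable_continuous_real)
  have uib: "(\<lambda>s. u s *\<^sub>R g s) integrable_on {0..T}" if "continuous_on UNIV g" for g :: "real \<Rightarrow> 'a"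
  proof -
    have "bounded (u ` {0..T})" unfolding bounded_iff using u(2) by (metis imageE real_norm_def)
    moreover have "g absolutely_integrable_on {0..T}"
      using that by (intro absolutely_integrable_continuous_real) (auto intro: continuous_on_subset)
    ultimately have "(\<lambda>s. u s *\<^sub>R g s) absolutely_integrable_on {0..T}"
      using u(1) by (intro absolutely_integrable_bounded_measurable_product[of "(*\<^sub>R)"])
        (auto simp: bilinear_conv_bounded_bilinear bounded_bilinear_scaleR)
    then show ?thesis by (rule set_lebesgue_integral_eq_integral(1))
  qed
  have sub: "h integrable_on {p..q}" if "h integrable_on {0..T}" "0 \<le> p" "q \<le> T" for h :: "real \<Rightarrow> 'b::euclidean_space" and p q
    using integrable_subinterval_real[OF that(1)] that by auto
  show "(\<lambda>s. u s *\<^sub>R b s) integrable_on {0..t}" using sub[OF uib] bc t by auto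
  have vc: "continuous_on {0..T} v" unfolding v_def by (rule indefinite_integral_continuous_1[OF ui])
  have vb: "(\<lambda>s. v s *\<^sub>R b' s) integrable_on {0..T}"
    using vc b(2) by (intro integrable_continuous_real continuous_intros) (auto intro: continuous_on_subset)
  have "compact (b' ` {0..T})" using b(2) by (intro compact_continuous_image) (auto intro: continuous_on_subset)
  then obtain L where L: "\<And>s. s \<in> {0..T} \<Longrightarrow> norm (b' s) \<le> L" "L \<ge> 0"
    using compact_imp_bounded[THEN bounded_pos[THEN iffD1]] by (metis image_eqI less_imp_le)
  have bd: "norm (b t - b s) \<le> L * (t - s)" if "s \<in> {0..T}" "t \<in> {0..T}" "s \<le> t" for s t
  proof -
    have "(b' has_integral (b t - b s)) {s..t}"
      using that b(1) by (intro fundamental_theorem_of_calculus) (auto intro: has_vector_derivative_at_within)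
    then show ?thesis using has_integral_bound_real[OF L(2) finite.emptyI, of b' "b t - b s" s t] L(1) that by auto
  qed
  have vcomb: "v t - v s = integral {s..t} u" if "s \<in> {0..T}" "t \<in> {0..T}" "s \<le> t" for s t
    unfolding v_def using Henstock_Kurzweil_Integration.integral_combine[of 0 s t u] sub[OF ui] that by simp
  have vd: "\<bar>v t - v s\<bar> \<le> t - s" if "s \<in> {0..T}" "t \<in> {0..T}" "s \<le> t" for s t
  proof -
    have "(u has_integral (v t - v s)) {s..t}" using vcomb[OF that] sub[OF ui, of s t] that by (simp add: integrable_integral)
    then show ?thesis using has_integral_bound_real[of 1 "{}" u "v t - v s" s t] u(2) that by auto
  qed
  define E where "E t = v t *\<^sub>R b t - integral {0..t} (\<lambda>s. u s *\<^sub>R b s) - integral {0..t} (\<lambda>s. v s *\<^sub>R b' s)" for t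
  have "E t = E 0"
  proof (rule square_bound_imp_constant[where a=0 and b=T and C="2 * L"])
    fix s t assume st: "s \<in> {0..T}" "t \<in> {0..T}" "s \<le> (t::real)"
    have 1: "integral {0..t} (\<lambda>s. u s *\<^sub>R b s) - integral {0..s} (\<lambda>s. u s *\<^sub>R b s) = integral {s..t} (\<lambda>s. u s *\<^sub>R b s)"
      using Henstock_Kurzweil_Integration.integral_combine[of 0 s t "\<lambda>s. u s *\<^sub>R b s"] sub[OF uib[OF bc]] st by (simp add: algebra_simps)
    have 2: "integral {0..t} (\<lambda>s. v s *\<^sub>R b' s) - integral {0..s} (\<lambda>s. v s *\<^sub>R b' s) = integral {s..t} (\<lambda>s. v s *\<^sub>R b' s)"
      using Henstock_Kurzweil_Integration.integral_combine[of 0 s t "\<lambda>s. v s *\<^sub>R b' s"] sub[OF vb] st by (simp add: algebra_simps)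
    have iu: "(u has_integral (v t - v s)) {s..t}" using vcomb[OF st] sub[OF ui, of s t] st by (simp add: integrable_integral)
    have 3: "((\<lambda>r. u r *\<^sub>R (b t - b r)) has_integral ((v t - v s) *\<^sub>R b t - integral {s..t} (\<lambda>s. u s *\<^sub>R b s))) {s..t}"
    proof -
      have "((\<lambda>r. u r *\<^sub>R b t) has_integral (v t - v s) *\<^sub>R b t) {s..t}" using iu by (rule has_integral_scaleR_left)
      moreover have "((\<lambda>r. u r *\<^sub>R b r) has_integral integral {s..t} (\<lambda>s. u s *\<^sub>R b s)) {s..t}"
        using sub[OF uib[OF bc], of s t] st by (simp add: integrable_integral)
      ultimately show ?thesis unfolding scaleR_diff_right by (rule has_integral_diff)
    qed
    have b'i: "(b' has_integral (b t - b s)) {s..t}"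
      using st b(1) by (intro fundamental_theorem_of_calculus) (auto intro: has_vector_derivative_at_within)
    have 4: "((\<lambda>r. (v s - v r) *\<^sub>R b' r) has_integral (v s *\<^sub>R (b t - b s) - integral {s..t} (\<lambda>s. v s *\<^sub>R b' s))) {s..t}"
      unfolding scaleR_diff_left
      using sub[OF vb, of s t] st by (intro has_integral_diff has_integral_cmul[OF b'i]) (simp add: integrable_integral)
    \<comment> \<open>The two brackets are the integrals of \<open>u r *\<^sub>R (b t - b r)\<close>
      and of \<open>(v s - v r) *\<^sub>R b' r\<close>. Each contains one factor that is itself of
      order \<open>t - s\<close>, hence the constant \<open>2 * L\<close>.\<close>
    have "E t - E s = ((v t - v s) *\<^sub>R b t - integral {s..t} (\<lambda>s. u s *\<^sub>R b s))
        + (v s *\<^sub>R (b t - b s) - integral {s..t} (\<lambda>s. v s *\<^sub>R b' s))"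
      unfolding E_def using 1 2 by (simp add: algebra_simps)
    also have "norm \<dots> \<le> L * (t - s) * (t - s) + (t - s) * L * (t - s)"
    proof (rule norm_triangle_mono)
      have "norm (u r *\<^sub>R (b t - b r)) \<le> L * (t - s)" if "r \<in> {s..t} - {}" for r
      proof -
        have "\<bar>u r\<bar> * norm (b t - b r) \<le> 1 * (L * (t - s))"
        proof (rule mult_mono)
          have "norm (b t - b r) \<le> L * (t - r)" using bd st that by auto
          also have "\<dots> \<le> L * (t - s)" using that L(2) by (intro mult_left_mono) auto
          finally show "norm (b t - b r) \<le> L * (t - s)" .
        qed (use u(2) st that in auto)
        then show ?thesis by simp
      qed
      then show "norm ((v t - v s) *\<^sub>R b t - integral {s..t} (\<lambda>s. u s *\<^sub>R b s)) \<le> L * (t - s) * (t - s)"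
        using has_integral_bound_real[where B="L * (t - s)", OF _ finite.emptyI 3] L(2) st by auto
      have "norm ((v s - v r) *\<^sub>R b' r) \<le> (t - s) * L" if "r \<in> {s..t} - {}" for r
      proof -
        have "\<bar>v r - v s\<bar> \<le> t - s" using vd[of s r] st that by auto
        then have "\<bar>v s - v r\<bar> * norm (b' r) \<le> (t - s) * L" using L(1)[of r] st that by (intro mult_mono) auto
        then show ?thesis by simp
      qed
      then show "norm (v s *\<^sub>R (b t - b s) - integral {s..t} (\<lambda>s. v s *\<^sub>R b' s)) \<le> (t - s) * L * (t - s)"
        using has_integral_bound_real[where B="(t - s) * L", OF _ finite.emptyI 4] L(2) st by auto
    qed
    finally show "norm (E t - E s) \<le> 2 * L * (t - s)\<^sup>2" by (simp add: power2_eq_square algebra_simps)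
  qed (use t in auto)
  then show "integral {0..t} (\<lambda>s. u s *\<^sub>R b s) = v t *\<^sub>R b t - integral {0..t} (\<lambda>s. v s *\<^sub>R b' s)"
    by (simp add: E_def v_def algebra_simps)
qed

subsection \<open>The free flow\<close>

text \<open>The exponential \<open>exp (t A)\<close>, written out block by block.\<close>

definition flow :: "('n::finite \<Rightarrow> real) \<Rightarrow> real \<Rightarrow> 'n state \<Rightarrow> 'n state" where
  "flow \<omega> t x = (\<chi> i. (cos (\<omega> i * t) * fst (x $ i) + sin (\<omega> i * t) / \<omega> i * snd (x $ i),
     - \<omega> i * sin (\<omega> i * t) * fst (x $ i) + cos (\<omega> i * t) * snd (x $ i)))"

text \<open>This is \<open>exp (- t A) B\<close>, the direction in which the control acts in the
  rotating frame. Defining it through the torus makes equidistribution applicable to it.\<close>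

definition free_B :: "('n::finite \<Rightarrow> real) \<Rightarrow> real \<Rightarrow> 'n state" where
  "free_B \<omega> t = circ_vec \<omega> (\<chi> i. \<omega> i * t)"

lemma flow_0 [simp]: "flow \<omega> 0 x = x"
  by (simp add: flow_def vec_eq_iff)

lemma linear_flow: "linear (flow \<omega> t)"
  by (rule linearI) (auto simp: flow_def vec_eq_iff algebra_simps add_divide_distrib)

lemma flow_simps:
  "flow \<omega> t (x + y) = flow \<omega> t x + flow \<omega> t y"
  "flow \<omega> t (x - y) = flow \<omega> t x - flow \<omega> t y"
  "flow \<omega> t (c *\<^sub>R x) = c *\<^sub>R flow \<omega> t x"
  using linear_flow[of \<omega> t] by (simp_all add: linear_add linear_diff linear_scale)

lemma linear_opA: "linear (opA \<omega>)"
  by (rule linearI) (auto simp: opA_def vec_eq_iff algebra_simps)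

lemma bounded_linear_opA: "bounded_linear (opA \<omega>)"
  using linear_opA linear_conv_bounded_linear by blast

lemma opA_simps:
  "opA \<omega> (x + y) = opA \<omega> x + opA \<omega> y"
  "opA \<omega> (x - y) = opA \<omega> x - opA \<omega> y"
  "opA \<omega> (c *\<^sub>R x) = c *\<^sub>R opA \<omega> x"
  using linear_opA[of \<omega>] by (simp_all add: linear_add linear_diff linear_scale)

lemma continuous_on_opA [continuous_intros]:
  "continuous_on S f \<Longrightarrow> continuous_on S (\<lambda>x. opA \<omega> (f x))"
  by (rule bounded_linear.continuous_on[OF bounded_linear_opA])

lemma continuous_on_flow [continuous_intros]:
  fixes f :: "'a::t2_space \<Rightarrow> 'n::finite state" and g :: "'a \<Rightarrow> real"
  assumes "continuous_on S f" "continuous_on S g"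
  shows "continuous_on S (\<lambda>s. flow \<omega> (g s) (f s))"
  unfolding flow_def divide_inverse using assms by (intro continuous_intros)

lemma continuous_on_free_B [continuous_intros]: "continuous_on S (free_B \<omega>)"
  unfolding free_B_def[abs_def] by (intro continuous_intros)

lemma norm_free_B_bound: obtains \<beta> where "\<beta> > 0" "\<And>s. norm (free_B \<omega> s) \<le> \<beta>"
proof
  show "(\<Sum>i\<in>UNIV. norm (1 / \<omega> i) + 1) > 0" by (rule sum_pos) (auto intro: add_nonneg_pos)
qed (unfold free_B_def, rule norm_circ_vec_le)

context oscillators
begin

lemma nz [simp]: "\<omega> i \<noteq> 0" using pos[of i] by simp

lemma flow_flow [simp]: "flow \<omega> s (flow \<omega> t x) = flow \<omega> (s + t) x"
  by (simp add: flow_def vec_eq_iff distrib_left cos_add sin_add) (simp add: field_simps)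

lemma flow_uminus_B: "flow \<omega> (- t) vecB = free_B \<omega> t"
  by (simp add: flow_def free_B_def circ_vec_def vecB_def vec_eq_iff)

lemma flow_minus_vector_derivative:
  assumes w: "(w has_vector_derivative w') (at t within S)"
  shows "((\<lambda>t. flow \<omega> (- t) (w t)) has_vector_derivative flow \<omega> (- t) (w' - opA \<omega> (w t))) (at t within S)"
proof -
  have c: "((\<lambda>t. fst (w t $ i)) has_real_derivative fst (w' $ i)) (at t within S)"
          "((\<lambda>t. snd (w t $ i)) has_real_derivative snd (w' $ i)) (at t within S)" for i
    unfolding has_real_derivative_iff_has_vector_derivative
    by (auto intro!: bounded_linear.has_vector_derivative[OF bounded_linear_fst]
        bounded_linear.has_vector_derivative[OF bounded_linear_snd]
        bounded_linear.has_vector_derivative[OF bounded_linear_vec_nth] w)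
  show ?thesis
    by (intro has_vector_derivative_vec_lambda has_vector_derivative_prodI;
      auto simp: flow_def opA_def has_real_derivative_iff_has_vector_derivative[symmetric] power2_eq_square
      intro!: derivative_eq_intros c simp: field_simps)
qed

text \<open>In the coordinates \<open>\<xi> i / \<omega> i\<close> and \<open>\<eta> i\<close> the
  adjoint flow is a rotation of each oscillator plane, so all amplitudes survive.\<close>

lemma amp_adjoint_flow:
  obtains q where "\<And>x. flow \<omega> t x \<bullet> p = x \<bullet> q" "amp \<omega> q = amp \<omega> p"
proof
  define q :: "'n state" where "q = (\<chi> i. (cos (\<omega> i * t) * fst (p $ i) - \<omega> i * sin (\<omega> i * t) * snd (p $ i),
     sin (\<omega> i * t) / \<omega> i * fst (p $ i) + cos (\<omega> i * t) * snd (p $ i)))"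
  show "flow \<omega> t x \<bullet> p = x \<bullet> q" for x
    unfolding inner_vec_def by (intro sum.cong) (simp_all add: flow_def q_def inner_prod_def algebra_simps)
  show "amp \<omega> q = amp \<omega> p"
  proof
    fix i
    define s c where sc: "s = sin (\<omega> i * t)" "c = cos (\<omega> i * t)"
    have 1: "s\<^sup>2 + c\<^sup>2 = 1" by (simp add: sc)
    have "(snd (q $ i))\<^sup>2 + (fst (q $ i))\<^sup>2 / (\<omega> i)\<^sup>2 = (s\<^sup>2 + c\<^sup>2) * ((snd (p $ i))\<^sup>2 + (fst (p $ i))\<^sup>2 / (\<omega> i)\<^sup>2)"
      unfolding q_def vec_lambda_beta fst_conv snd_conv sc[symmetric] by (simp add: power2_eq_square field_simps)
    then show "amp \<omega> q i = amp \<omega> p i" by (simp add: 1 amp_def)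
  qed
qed

lemma rho_flow [simp]: "rho \<omega> (flow \<omega> t x) = rho \<omega> x"
proof -
  have le: "rho \<omega> (flow \<omega> t x) \<le> rho \<omega> x" for t x
  proof -
    obtain p where p: "normH \<omega> p \<le> 1" "rho \<omega> (flow \<omega> t x) = flow \<omega> t x \<bullet> p" using rho_attained by metis
    obtain q where q: "flow \<omega> t x \<bullet> p = x \<bullet> q" "amp \<omega> q = amp \<omega> p" using amp_adjoint_flow by metis
    show ?thesis using p q inner_le_rho[of q x] normH_amp_cong[of \<omega> q p] by simp
  qed
  show ?thesis using le[of t x] le[of "- t" "flow \<omega> t x"] by simp
qed

lemma flow_eq_0_iff [simp]: "flow \<omega> t x = 0 \<longleftrightarrow> x = 0"
  using rho_flow[of t x] rho_pos[of x] rho_pos[of "flow \<omega> t x"] by (metis less_irrefl rho_0)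

text \<open>The gradient at \<open>flow \<omega> t y\<close>, pulled back by the adjoint flow, has
  the same norm and the same pairing with \<open>y\<close>. By uniqueness it is the gradient at
  \<open>y\<close>, and the switching function can be read in the rotating frame.\<close>

lemma inner_B_gradient_flow:
  assumes "y \<noteq> 0"
  shows "vecB \<bullet> gradient (rho \<omega>) (flow \<omega> t y) = free_B \<omega> t \<bullet> gradient (rho \<omega>) y"
proof -
  let ?P = "gradient (rho \<omega>)"
  obtain q where q: "\<And>x. flow \<omega> t x \<bullet> ?P (flow \<omega> t y) = x \<bullet> q" "amp \<omega> q = amp \<omega> (?P (flow \<omega> t y))"
    using amp_adjoint_flow by metis
  have "?P y = q"
    using assms gradient_props[of "flow \<omega> t y"] q normH_amp_cong[OF q(2)] q(1)[of y]
    by (intro gradient_unique) auto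
  moreover have "flow \<omega> t (free_B \<omega> t) = vecB" unfolding flow_uminus_B[symmetric] by simp
  ultimately show ?thesis using q(1)[of "free_B \<omega> t"] by simp
qed

lemma controlled_path_integral:
  assumes cp: "controlled_path \<omega> {0..T} u \<gamma>" and u1: "\<forall>s\<in>{0..T}. \<bar>u s\<bar> \<le> 1" and T: "0 \<le> T"
  shows "continuous_on {0..T} \<gamma>"
    "t \<in> {0..T} \<Longrightarrow> \<gamma> t = \<gamma> 0 + integral {0..t} (\<lambda>s. opA \<omega> (\<gamma> s)) + integral {0..t} u *\<^sub>R vecB"
proof -
  let ?f = "\<lambda>s. opA \<omega> (\<gamma> s) + u s *\<^sub>R vecB"
  have fi: "?f integrable_on {0..T}"
    using cp T unfolding controlled_path_def by (auto intro: set_lebesgue_integral_eq_integral(1))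
  have eq: "\<gamma> t = \<gamma> 0 + integral {0..t} ?f" if "t \<in> {0..T}" for t
    using cp that unfolding controlled_path_def by blast
  have "continuous_on {0..T} (\<lambda>t. \<gamma> 0 + integral {0..t} ?f)"
    by (intro continuous_intros indefinite_integral_continuous_1 fi)
  then show cont: "continuous_on {0..T} \<gamma>" by (rule continuous_on_eq) (rule eq[symmetric])
  assume t: "t \<in> {0..T}"
  have ui: "u integrable_on {0..T}"
  proof (rule measurable_bounded_by_integrable_imp_integrable)
    show "u \<in> borel_measurable (lebesgue_on {0..T})" using cp by (simp only: controlled_path_def)
    show "(\<lambda>_. 1::real) integrable_on {0..T}" by (simp add: integrable_continuous_real)
  qed (use u1 in auto)
  have ui: "u integrable_on {0..t}" using ui by (rule integrable_subinterval_real) (use t in auto)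
  have "integral {0..t} ?f = integral {0..t} (\<lambda>s. opA \<omega> (\<gamma> s)) + integral {0..t} (\<lambda>s. u s *\<^sub>R vecB)"
  proof (rule integral_add)
    show "(\<lambda>s. opA \<omega> (\<gamma> s)) integrable_on {0..t}"
      using cont t by (intro integrable_continuous_real continuous_intros) (auto intro: continuous_on_subset)
    show "(\<lambda>s. u s *\<^sub>R vecB) integrable_on {0..t}"
      using has_integral_scaleR_left[OF integrable_integral[OF ui]] by (rule has_integral_integrable)
  qed
  also have "integral {0..t} (\<lambda>s. u s *\<^sub>R vecB) = integral {0..t} u *\<^sub>R vecB"
    using integrable_integral[OF ui, THEN has_integral_scaleR_left] by (rule integral_unique)
  finally show "\<gamma> t = \<gamma> 0 + integral {0..t} (\<lambda>s. opA \<omega> (\<gamma> s)) + integral {0..t} u *\<^sub>R vecB"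
    using eq[OF t] by (simp add: add.assoc)
qed

text \<open>The path itself need not be differentiable, but
  \<open>w t = \<gamma> t - v t *\<^sub>R vecB\<close> is, with derivative
  \<open>opA \<omega> (\<gamma> t)\<close>. Transforming \<open>w\<close> to the rotating frame
  leaves an integral of \<open>v\<close>, which integration by parts turns back into one of
  \<open>u\<close>.\<close>

lemma variation_of_constants:
  assumes cp: "controlled_path \<omega> {0..T} u \<gamma>" and u1: "\<forall>s\<in>{0..T}. \<bar>u s\<bar> \<le> 1" and t: "t \<in> {0..T}"
  shows "(\<lambda>s. u s *\<^sub>R free_B \<omega> s) integrable_on {0..t}"
    "flow \<omega> (- t) (\<gamma> t) = \<gamma> 0 + integral {0..t} (\<lambda>s. u s *\<^sub>R free_B \<omega> s)"
proof -
  have T: "0 \<le> T" using t by simp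
  note ci = controlled_path_integral[OF cp u1 T]
  define v where "v t = integral {0..t} u" for t
  have um: "u \<in> borel_measurable (lebesgue_on {0..T})" using cp by (simp add: controlled_path_def)
  define b' where "b' s = - flow \<omega> (- s) (opA \<omega> vecB)" for s
  have b: "(free_B \<omega> has_vector_derivative b' s) (at s)" for s
    using flow_minus_vector_derivative[of "\<lambda>_. vecB" 0 s UNIV]
    by (simp add: flow_uminus_B b'_def has_vector_derivative_const linear_neg[OF linear_flow])
  have b'c: "continuous_on UNIV b'" unfolding b'_def by (intro continuous_intros)
  note parts = integral_by_parts_bounded[OF um u1 b b'c t, folded v_def]
  show "(\<lambda>s. u s *\<^sub>R free_B \<omega> s) integrable_on {0..t}" by (rule parts(1))
  define w where "w t = \<gamma> t - v t *\<^sub>R vecB" for t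
  have "(w has_vector_derivative opA \<omega> (\<gamma> s)) (at s within {0..T})" if "s \<in> {0..T}" for s
  proof -
    have "((\<lambda>t. \<gamma> 0 + integral {0..t} (\<lambda>s. opA \<omega> (\<gamma> s))) has_vector_derivative 0 + opA \<omega> (\<gamma> s)) (at s within {0..T})"
      by (intro has_vector_derivative_add has_vector_derivative_const integral_has_vector_derivative continuous_intros ci(1) that)
    moreover have "\<gamma> 0 + integral {0..t} (\<lambda>s. opA \<omega> (\<gamma> s)) = w t" if "t \<in> {0..T}" for t
      using ci(2)[OF that] by (simp add: w_def v_def)
    ultimately show ?thesis using that
      by (intro has_vector_derivative_transform[of s "{0..T}" w]) simp_all
  qed
  then have "((\<lambda>t. flow \<omega> (- t) (w t)) has_vector_derivative flow \<omega> (- s) (opA \<omega> (\<gamma> s) - opA \<omega> (w s))) (at s within {0..T})"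
    if "s \<in> {0..T}" for s using that by (intro flow_minus_vector_derivative)
  moreover have "flow \<omega> (- s) (opA \<omega> (\<gamma> s) - opA \<omega> (w s)) = - (v s *\<^sub>R b' s)" for s
    by (simp add: w_def opA_simps flow_simps b'_def)
  ultimately have d: "((\<lambda>t. flow \<omega> (- t) (w t)) has_vector_derivative - (v s *\<^sub>R b' s)) (at s within {0..T})"
    if "s \<in> {0..T}" for s using that by simp
  have "((\<lambda>s. - (v s *\<^sub>R b' s)) has_integral (flow \<omega> (- t) (w t) - flow \<omega> (- 0) (w 0))) {0..t}"
    using t by (intro fundamental_theorem_of_calculus) (auto intro!: has_vector_derivative_within_subset[OF d])
  from has_integral_neg[OF this] have "integral {0..t} (\<lambda>s. v s *\<^sub>R b' s) = - (flow \<omega> (- t) (w t) - w 0)"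
    by (auto intro: integral_unique)
  moreover have "w 0 = \<gamma> 0" by (simp add: w_def v_def)
  moreover have "flow \<omega> (- t) (\<gamma> t) = flow \<omega> (- t) (w t) + v t *\<^sub>R free_B \<omega> t"
    by (simp add: w_def flow_simps flow_uminus_B)
  ultimately show "flow \<omega> (- t) (\<gamma> t) = \<gamma> 0 + integral {0..t} (\<lambda>s. u s *\<^sub>R free_B \<omega> s)"
    using parts(2) by simp
qed

end

lemma integral_le_except_negligible:
  fixes f g :: "real \<Rightarrow> real"
  assumes "f integrable_on S" "g integrable_on S" "negligible N" "\<And>x. x \<in> S - N \<Longrightarrow> f x \<le> g x"
  shows "integral S f \<le> integral S g"
proof -
  define f' where "f' x = (if x \<in> N then g x else f x)" for x
  have "f' integrable_on S" "integral S f' = integral S f"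
    using assms(1) integrable_spike[OF assms(1,3), of f'] integral_spike[OF assms(3), of S f f'] by (auto simp: f'_def)
  moreover have "integral S f' \<le> integral S g"
    using assms calculation by (intro integral_le) (auto simp: f'_def)
  ultimately show ?thesis by simp
qed

lemma abs_average_le: "0 < L \<Longrightarrow> \<bar>I\<bar> \<le> c * (L - 0) \<Longrightarrow> I / L = A \<Longrightarrow> \<bar>A\<bar> \<le> (c::real)"
proof -
  assume L: "0 < L" and "\<bar>I\<bar> \<le> c * (L - 0)" and A: "I / L = A"
  then have "\<bar>I\<bar> / L \<le> c" by (simp add: pos_divide_le_eq)
  then show "\<bar>A\<bar> \<le> c" using L unfolding A[symmetric] by (simp add: abs_divide)
qed

section \<open>Equidistribution of the non-resonant line\<close>

text \<open>Real trigonometric polynomials on the torus. The free phase \<open>\<psi>\<close>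
  replaces separate sine terms, so that one product-to-sum formula gives closure under
  multiplication.\<close>

inductive trig_poly :: "(real^'n::finite \<Rightarrow> real) \<Rightarrow> bool" where
  trig_poly_cos: "trig_poly (\<lambda>\<theta>. cos ((\<Sum>i\<in>UNIV. of_int (m i) * \<theta> $ i) + \<psi>))"
| trig_poly_add: "trig_poly f \<Longrightarrow> trig_poly g \<Longrightarrow> trig_poly (\<lambda>\<theta>. f \<theta> + g \<theta>)"
| trig_poly_scale: "trig_poly f \<Longrightarrow> trig_poly (\<lambda>\<theta>. c * f \<theta>)"

lemma trig_poly_const: "trig_poly (\<lambda>\<theta>. c)"
  using trig_poly_scale[OF trig_poly_cos[of "\<lambda>_. 0" 0], of c] by simp

lemma trig_poly_sum: "finite S \<Longrightarrow> (\<And>k. k \<in> S \<Longrightarrow> trig_poly (f k)) \<Longrightarrow> trig_poly (\<lambda>\<theta>. \<Sum>k\<in>S. f k \<theta>)"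
proof (induction S rule: finite_induct)
  case empty
  then show ?case by (simp add: trig_poly_const)
next
  case (insert k S)
  have "trig_poly (\<lambda>\<theta>. f k \<theta> + (\<Sum>k\<in>S. f k \<theta>))" by (rule trig_poly_add) (use insert in auto)
  then show ?case using insert by simp
qed

lemma trig_poly_mult:
  assumes "trig_poly f" "trig_poly g" shows "trig_poly (\<lambda>\<theta>. f \<theta> * g \<theta>)"
  using assms(1)
proof induction
  case (trig_poly_cos m \<psi>)
  show ?case using assms(2)
  proof induction
    case (trig_poly_cos m' \<psi>')
    let ?a = "\<lambda>m \<psi> \<theta>. (\<Sum>i\<in>UNIV. of_int (m i) * \<theta> $ i) + \<psi>"
    have 1: "?a m \<psi> \<theta> + ?a m' \<psi>' \<theta> = ?a (\<lambda>i. m i + m' i) (\<psi> + \<psi>') \<theta>" for \<theta> :: "real^'a"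
      by (simp add: distrib_right sum.distrib)
    have 2: "?a m \<psi> \<theta> - ?a m' \<psi>' \<theta> = ?a (\<lambda>i. m i - m' i) (\<psi> - \<psi>') \<theta>" for \<theta> :: "real^'a"
      by (simp add: left_diff_distrib sum_subtractf)
    have "cos (?a m \<psi> \<theta>) * cos (?a m' \<psi>' \<theta>) =
       1/2 * cos (?a (\<lambda>i. m i - m' i) (\<psi> - \<psi>') \<theta>) + 1/2 * cos (?a (\<lambda>i. m i + m' i) (\<psi> + \<psi>') \<theta>)" for \<theta> :: "real^'a"
      unfolding 1[symmetric] 2[symmetric] cos_times_cos by (simp add: field_simps)
    moreover have "trig_poly (\<lambda>\<theta>. 1/2 * cos (?a (\<lambda>i. m i - m' i) (\<psi> - \<psi>') \<theta>) + 1/2 * cos (?a (\<lambda>i. m i + m' i) (\<psi> + \<psi>') \<theta>))"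
      by (intro trig_poly.intros)
    ultimately show ?case by simp
  next
    case (trig_poly_add f g)
    show ?case unfolding distrib_left by (rule trig_poly.trig_poly_add) (rule trig_poly_add.IH)+
  next
    case (trig_poly_scale f c)
    have "cos ((\<Sum>i\<in>UNIV. of_int (m i) * \<theta> $ i) + \<psi>) * (c * f \<theta>) =
        c * (cos ((\<Sum>i\<in>UNIV. of_int (m i) * \<theta> $ i) + \<psi>) * f \<theta>)" for \<theta>
      by (rule mult.left_commute)
    then show ?case using trig_poly.trig_poly_scale[OF trig_poly_scale.IH, of c] by presburger
  qed
next
  case (trig_poly_add f g)
  show ?case unfolding distrib_right by (rule trig_poly.trig_poly_add) (rule trig_poly_add.IH)+
next
  case (trig_poly_scale f c)
  show ?case unfolding mult.assoc by (rule trig_poly.trig_poly_scale) (rule trig_poly_scale.IH)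
qed

lemma trig_poly_real_polynomial:
  assumes "real_polynomial_function g" "trig_poly F" shows "trig_poly (\<lambda>\<theta>. g (F \<theta> :: real))"
  using assms(1)
proof induction
  case (linear f)
  then have "f x = f 1 * x" for x
    using linear_scale[OF bounded_linear.linear, of f x 1] by (simp add: mult.commute)
  then have "(\<lambda>\<theta>. f (F \<theta>)) = (\<lambda>\<theta>. f 1 * F \<theta>)" by blast
  then show ?case using trig_poly_scale[OF assms(2), of "f 1"] by simp
next
  case (const c)
  show ?case by (rule trig_poly_const)
next
  case (add f g)
  show ?case by (rule trig_poly_add) (rule add.IH)+
next
  case (mult f g)
  show ?case by (rule trig_poly_mult) (rule mult.IH)+
qed

lemma trig_poly_circ_vec:
  fixes p :: "'n::finite state" shows "trig_poly (\<lambda>\<theta>. p \<bullet> circ_vec \<omega> \<theta>)"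
proof -
  have c: "(\<Sum>j\<in>UNIV. of_int (if j = i then 1 else 0) * \<theta> $ j) + \<psi> = \<theta> $ i + \<psi>" for i \<psi> and \<theta> :: "real^'n"
  proof -
    have "(\<Sum>j\<in>UNIV. of_int (if j = i then 1 else 0) * \<theta> $ j) = (\<Sum>j\<in>UNIV. if j = i then \<theta> $ i else 0)"
      by (rule sum.cong) auto
    then show ?thesis by simp
  qed
  have "trig_poly (\<lambda>\<theta>. cos ((\<Sum>j\<in>UNIV. of_int (if j = i then 1 else 0) * \<theta> $ j) + \<psi>))" for i :: 'n and \<psi>
    by (rule trig_poly_cos)
  then have t: "trig_poly (\<lambda>\<theta>. cos (\<theta> $ i + \<psi>))" for i :: 'n and \<psi> unfolding c .
  have e: "p \<bullet> circ_vec \<omega> \<theta> = (\<Sum>i\<in>UNIV. snd (p $ i) * cos (\<theta> $ i + 0) + (- fst (p $ i) / \<omega> i) * cos (\<theta> $ i + (- pi/2)))" for \<theta>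
    unfolding inner_circ_vec by (intro sum.cong) (auto simp: cos_diff)
  show ?thesis unfolding e by (intro trig_poly_sum trig_poly_add trig_poly_scale t) auto
qed

lemma trig_poly_continuous: "trig_poly f \<Longrightarrow> continuous_on S f"
proof (induction rule: trig_poly.induct)
  case (trig_poly_cos m \<psi>)
  show ?case by (intro continuous_intros)
next
  case (trig_poly_add f g)
  show ?case by (rule continuous_on_add) (rule trig_poly_add.IH)+
next
  case (trig_poly_scale f c)
  show ?case by (rule continuous_on_mult_left) (rule trig_poly_scale.IH)
qed

definition line_avg :: "('n::finite \<Rightarrow> real) \<Rightarrow> (real^'n \<Rightarrow> real) \<Rightarrow> real \<Rightarrow> real" where
  "line_avg \<omega> f L = integral {0..L} (\<lambda>s. f (\<chi> i. \<omega> i * s)) / L"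

definition torus_avg :: "(real^'n::finite \<Rightarrow> real) \<Rightarrow> real" where
  "torus_avg f = integral torus f / (2 * pi) ^ CARD('n)"

lemma torus_avg_const: "torus_avg (\<lambda>\<theta>::real^'n::finite. c) = c"
proof -
  have "measure lborel (torus :: (real^'n) set) = (2 * pi) ^ CARD('n)"
    using content_cbox_cart[of "0 :: real^'n" "\<chi> i. 2 * pi"] by (simp add: box_ne_empty inner_axis Basis_vec_def)
  then show ?thesis by (simp add: torus_avg_def)
qed

lemma line_continuous:
  fixes f :: "real^'n::finite \<Rightarrow> real"
  assumes "continuous_on UNIV f" shows "continuous_on S (\<lambda>s. f (\<chi> i. \<omega> i * s))"
proof -
  have "continuous_on S (\<lambda>s. (\<chi> i. \<omega> i * s) :: real^'n)" by (intro continuous_intros)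
  then have "continuous_on S (f \<circ> (\<lambda>s. \<chi> i. \<omega> i * s))"
    using assms continuous_on_compose continuous_on_subset by blast
  then show ?thesis by (simp add: o_def)
qed

lemma line_integrable:
  fixes f :: "real^'n::finite \<Rightarrow> real"
  assumes "continuous_on UNIV f" shows "(\<lambda>s. f (\<chi> i. \<omega> i * s)) integrable_on {a..b}"
  using line_continuous[OF assms] by (rule integrable_continuous_real)

text \<open>Weyl's criterion for a single wave: along the line it oscillates with frequency
  \<open>l = (\<Sum>i. m i * \<omega> i)\<close>, nonzero by non-resonance, so its integral stays
  bounded by \<open>2 / \<bar>l\<bar>\<close> and its mean tends to \<open>0\<close>, the torus
  mean. Constants and linear combinations follow.\<close>

lemma line_avg_trig_poly:
  fixes \<omega> :: "'n::finite \<Rightarrow> real"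
  assumes "non_resonant \<omega>" "trig_poly f"
  shows "(line_avg \<omega> f \<longlongrightarrow> torus_avg f) at_top"
  using assms(2)
proof induction
  case (trig_poly_cos m \<psi>)
  show ?case
  proof (cases "m = (\<lambda>_. 0)")
    case True
    have "line_avg \<omega> (\<lambda>\<theta>. cos \<psi>) L = cos \<psi>" if "L > 0" for L using that by (simp add: line_avg_def)
    then have "\<forall>\<^sub>F L in at_top. line_avg \<omega> (\<lambda>\<theta>. cos \<psi>) L = cos \<psi>"
      by (intro eventually_mono[OF eventually_gt_at_top[of 0]])
    then have "(line_avg \<omega> (\<lambda>\<theta>. cos \<psi>) \<longlongrightarrow> cos \<psi>) at_top" by (rule tendsto_eventually)
    then show ?thesis using True by (simp add: torus_avg_const)
  next
    case False
    define l where "l = (\<Sum>i\<in>UNIV. of_int (m i) * \<omega> i)"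
    have l: "l \<noteq> 0" using False assms(1) unfolding non_resonant_def l_def by blast
    have z: "torus_avg (\<lambda>\<theta>. cos ((\<Sum>i\<in>UNIV. of_int (m i) * \<theta> $ i) + \<psi>)) = 0"
      using torus_integral_cos_zero[OF False] by (simp add: torus_avg_def)
    let ?A = "line_avg \<omega> (\<lambda>\<theta>. cos ((\<Sum>i\<in>UNIV. of_int (m i) * \<theta> $ i) + \<psi>))"
    have A: "\<bar>?A L\<bar> \<le> (2 / \<bar>l\<bar>) / L" if "L > 0" for L
    proof -
      have "((\<lambda>s. cos (l * s + \<psi>)) has_integral (sin (l * L + \<psi>) / l - sin (l * 0 + \<psi>) / l)) {0..L}"
        using that l by (intro fundamental_theorem_of_calculus)
          (auto simp: has_real_derivative_iff_has_vector_derivative[symmetric] intro!: derivative_eq_intros)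
      moreover have "(\<Sum>i\<in>UNIV. of_int (m i) * (\<omega> i * s)) = l * s" for s
        by (simp add: l_def sum_distrib_right mult.assoc)
      ultimately have "?A L = (sin (l * L + \<psi>) - sin \<psi>) / l / L"
        unfolding line_avg_def by (simp add: integral_unique diff_divide_distrib)
      moreover have "\<bar>sin (l * L + \<psi>) - sin \<psi>\<bar> \<le> 2"
        using abs_sin_le_one[of "l * L + \<psi>"] abs_sin_le_one[of \<psi>] by linarith
      ultimately show ?thesis using that by (simp add: abs_mult divide_right_mono)
    qed
    have "((\<lambda>L. (2 / \<bar>l\<bar>) / L) \<longlongrightarrow> 0) at_top"
      by (rule tendsto_divide_0[OF tendsto_const filterlim_at_top_imp_at_infinity[OF filterlim_ident]])
    then have "(?A \<longlongrightarrow> 0) at_top"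
      by (rule Lim_null_comparison[rotated]) (use A in \<open>auto intro!: eventually_mono[OF eventually_gt_at_top[of 0]]\<close>)
    then show ?thesis by (simp add: z)
  qed
next
  case (trig_poly_add f g)
  have c: "continuous_on UNIV f" "continuous_on UNIV g" using trig_poly_add.hyps by (auto intro: trig_poly_continuous)
  have i: "f integrable_on torus" "g integrable_on torus"
    using c by (auto intro!: integrable_continuous intro: continuous_on_subset)
  have "line_avg \<omega> (\<lambda>\<theta>. f \<theta> + g \<theta>) = (\<lambda>L. line_avg \<omega> f L + line_avg \<omega> g L)"
    unfolding line_avg_def integral_add[OF line_integrable[OF c(1)] line_integrable[OF c(2)]] add_divide_distrib ..
  moreover have "torus_avg (\<lambda>\<theta>. f \<theta> + g \<theta>) = torus_avg f + torus_avg g"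
    unfolding torus_avg_def integral_add[OF i] add_divide_distrib ..
  ultimately show ?case using trig_poly_add.IH by (simp add: tendsto_add)
next
  case (trig_poly_scale f c)
  have "line_avg \<omega> (\<lambda>\<theta>. c * f \<theta>) = (\<lambda>L. c * line_avg \<omega> f L)"
    by (rule ext) (simp add: line_avg_def)
  moreover have "torus_avg (\<lambda>\<theta>. c * f \<theta>) = c * torus_avg f"
    unfolding torus_avg_def by simp
  ultimately show ?case using trig_poly_scale.IH by (simp add: tendsto_mult_left)
qed

context oscillators
begin

text \<open>The mean over \<open>[0, L]\<close> of the largest rate at which a control bounded by
  \<open>1\<close> can change the pairing with \<open>p\<close> in the rotating frame.\<close>

definition time_avg :: "real \<Rightarrow> 'n state \<Rightarrow> real" where
  "time_avg L p = integral {0..L} (\<lambda>s. \<bar>free_B \<omega> s \<bullet> p\<bar>) / L"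

lemma free_B_inner_integrable: "(\<lambda>s. \<bar>free_B \<omega> s \<bullet> p\<bar>) integrable_on {a..b}"
proof (rule integrable_continuous_real)
  show "continuous_on {a..b} (\<lambda>s. \<bar>free_B \<omega> s \<bullet> p\<bar>)" by (intro continuous_intros)
qed

text \<open>The absolute value is not a polynomial, but Weierstrass approximation on the range of
  \<open>p \<bullet> circ_vec\<close> replaces it by one, and a polynomial of a trigonometric
  polynomial is again trigonometric. Three errors of \<open>e/4\<close> occur: in the time mean, in
  the torus mean and in the limit.\<close>

lemma time_avg_tendsto:
  assumes "non_resonant \<omega>"
  shows "((\<lambda>L. time_avg L p) \<longlongrightarrow> normH \<omega> p) at_top"
proof (rule tendstoI)
  fix e :: real assume "e > 0"
  let ?F = "\<lambda>\<theta>. p \<bullet> circ_vec \<omega> \<theta>"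
  define R where "R = norm p * (\<Sum>i\<in>UNIV. norm (1 / \<omega> i) + 1)"
  have R: "\<bar>?F \<theta>\<bar> \<le> R" for \<theta>
    using Cauchy_Schwarz_ineq2[of p "circ_vec \<omega> \<theta>"] norm_circ_vec_le[of \<omega> \<theta>]
    unfolding R_def by (meson mult_left_mono norm_ge_zero order_trans)
  obtain g where g: "real_polynomial_function g" "\<And>x. x \<in> {-R..R} \<Longrightarrow> \<bar>\<bar>x\<bar> - g x\<bar> < e/4"
  proof -
    have "continuous_on {-R..R} (\<lambda>x::real. \<bar>x\<bar>)" "e / 4 > 0" using \<open>e > 0\<close> by (auto intro!: continuous_intros)
    from Stone_Weierstrass_real_polynomial_function[OF compact_Icc this] that show ?thesis by metis
  qed
  have tg: "trig_poly (\<lambda>\<theta>. g (?F \<theta>))" using g(1) trig_poly_circ_vec by (rule trig_poly_real_polynomial)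
  have cl: "\<bar>\<bar>?F \<theta>\<bar> - g (?F \<theta>)\<bar> \<le> e/4" for \<theta> using g(2)[of "?F \<theta>"] R[of \<theta>] by (simp add: abs_le_iff less_imp_le)
  have cF: "continuous_on UNIV (\<lambda>\<theta>. \<bar>?F \<theta>\<bar>)" "continuous_on UNIV (\<lambda>\<theta>. g (?F \<theta>))"
    by (auto intro!: continuous_intros trig_poly_continuous[OF tg])
  have ta: "time_avg L p = line_avg \<omega> (\<lambda>\<theta>. \<bar>?F \<theta>\<bar>) L" for L
    by (simp add: time_avg_def line_avg_def free_B_def inner_commute)
  have 1: "\<bar>time_avg L p - line_avg \<omega> (\<lambda>\<theta>. g (?F \<theta>)) L\<bar> \<le> e/4" if "L > 0" for L
  proof -
    have "\<bar>integral {0..L} (\<lambda>s. \<bar>?F (\<chi> i. \<omega> i * s)\<bar> - g (?F (\<chi> i. \<omega> i * s)))\<bar> \<le> e/4 * (L - 0)"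
      using cl that \<open>e > 0\<close> integral_bound[of 0 L "\<lambda>s. \<bar>?F (\<chi> i. \<omega> i * s)\<bar> - g (?F (\<chi> i. \<omega> i * s))" "e/4"]
      continuous_on_diff[OF line_continuous[OF cF(1)] line_continuous[OF cF(2)], of "{0..L}" \<omega> \<omega>]
      by auto
    moreover have "integral {0..L} (\<lambda>s. \<bar>?F (\<chi> i. \<omega> i * s)\<bar> - g (?F (\<chi> i. \<omega> i * s))) / L
        = time_avg L p - line_avg \<omega> (\<lambda>\<theta>. g (?F \<theta>)) L"
      unfolding ta line_avg_def using line_integrable[OF cF(1)] line_integrable[OF cF(2)]
      by (simp add: integral_diff diff_divide_distrib)
    ultimately show ?thesis by (rule abs_average_le[OF that])
  qed
  have 2: "\<bar>normH \<omega> p - torus_avg (\<lambda>\<theta>. g (?F \<theta>))\<bar> \<le> e/4"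
  proof -
    have i: "(\<lambda>\<theta>. \<bar>?F \<theta>\<bar>) integrable_on torus" "(\<lambda>\<theta>. g (?F \<theta>)) integrable_on torus"
      using cF by (auto intro!: integrable_continuous intro: continuous_on_subset)
    have "normH \<omega> p - torus_avg (\<lambda>\<theta>. g (?F \<theta>)) = torus_avg (\<lambda>\<theta>. \<bar>?F \<theta>\<bar> - g (?F \<theta>))"
      unfolding torus_avg_def normH_eq[OF pos] using i by (simp add: integral_diff diff_divide_distrib)
    moreover have "torus_avg (\<lambda>\<theta>. \<bar>?F \<theta>\<bar> - g (?F \<theta>)) \<le> torus_avg (\<lambda>\<theta>::real^'n. e/4)"
      unfolding torus_avg_def
    proof (intro divide_right_mono integral_le)
      show "\<bar>?F \<theta>\<bar> - g (?F \<theta>) \<le> e/4" for \<theta> using cl[of \<theta>] by linarith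
    qed (use integrable_diff[OF i] in \<open>simp_all add: integrable_const\<close>)
    moreover have "torus_avg (\<lambda>\<theta>::real^'n. -(e/4)) \<le> torus_avg (\<lambda>\<theta>. \<bar>?F \<theta>\<bar> - g (?F \<theta>))"
      unfolding torus_avg_def
    proof (intro divide_right_mono integral_le)
      show "-(e/4) \<le> \<bar>?F \<theta>\<bar> - g (?F \<theta>)" for \<theta> using cl[of \<theta>] by linarith
    qed (use integrable_diff[OF i] in \<open>simp_all add: integrable_const\<close>)
    ultimately show ?thesis unfolding torus_avg_const by linarith
  qed
  have "\<forall>\<^sub>F L in at_top. dist (line_avg \<omega> (\<lambda>\<theta>. g (?F \<theta>)) L) (torus_avg (\<lambda>\<theta>. g (?F \<theta>))) < e/4"
    using line_avg_trig_poly[OF assms tg] \<open>e > 0\<close> by (intro tendstoD) auto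
  then show "\<forall>\<^sub>F L in at_top. dist (time_avg L p) (normH \<omega> p) < e"
    using eventually_gt_at_top[of 0]
  proof eventually_elim
    case (elim L)
    then show ?case using 1[of L] 2 \<open>e > 0\<close> unfolding dist_real_def by linarith
  qed
qed

text \<open>A Lipschitz constant in \<open>p\<close> that is independent of \<open>L\<close>; it
  survives the limit and reduces uniformity to finitely many vectors.\<close>

lemma time_avg_bound:
  assumes "\<And>s. norm (free_B \<omega> s) \<le> \<beta>" "L > 0"
  shows "\<bar>time_avg L p - time_avg L q\<bar> \<le> \<beta> * norm (p - q)"
proof -
  have "\<bar>integral {0..L} (\<lambda>s. \<bar>free_B \<omega> s \<bullet> p\<bar> - \<bar>free_B \<omega> s \<bullet> q\<bar>)\<bar> \<le> (\<beta> * norm (p - q)) * (L - 0)"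
  proof -
    have "\<bar>\<bar>free_B \<omega> s \<bullet> p\<bar> - \<bar>free_B \<omega> s \<bullet> q\<bar>\<bar> \<le> \<beta> * norm (p - q)" for s
    proof -
      have "\<bar>\<bar>free_B \<omega> s \<bullet> p\<bar> - \<bar>free_B \<omega> s \<bullet> q\<bar>\<bar> \<le> \<bar>free_B \<omega> s \<bullet> (p - q)\<bar>"
        unfolding inner_diff_right by (rule abs_triangle_ineq3)
      also have "\<dots> \<le> norm (free_B \<omega> s) * norm (p - q)" by (rule Cauchy_Schwarz_ineq2)
      finally show ?thesis using assms(1)[of s] by (meson mult_right_mono norm_ge_zero order_trans)
    qed
    moreover have "continuous_on {0..L} (\<lambda>s. \<bar>free_B \<omega> s \<bullet> p\<bar> - \<bar>free_B \<omega> s \<bullet> q\<bar>)" by (intro continuous_intros)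
    ultimately show ?thesis
      using integral_bound[of 0 L "\<lambda>s. \<bar>free_B \<omega> s \<bullet> p\<bar> - \<bar>free_B \<omega> s \<bullet> q\<bar>"] assms(2) by auto
  qed
  moreover have "integral {0..L} (\<lambda>s. \<bar>free_B \<omega> s \<bullet> p\<bar> - \<bar>free_B \<omega> s \<bullet> q\<bar>) / L = time_avg L p - time_avg L q"
    unfolding time_avg_def by (simp add: integral_diff free_B_inner_integrable diff_divide_distrib)
  ultimately show ?thesis by (rule abs_average_le[OF assms(2)])
qed

text \<open>The unit ball of \<open>normH\<close> is totally bounded, so convergence on a finite net
  suffices. Uniformity is essential, because the window length has to be fixed before the gradient
  met by the motion is known.\<close>

lemma time_avg_uniform:
  assumes "non_resonant \<omega>" "e > 0"
  obtains L0 where "L0 > 0" "\<And>L p. L \<ge> L0 \<Longrightarrow> normH \<omega> p \<le> 1 \<Longrightarrow> \<bar>time_avg L p - normH \<omega> p\<bar> \<le> e"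
proof -
  obtain \<beta> where \<beta>: "\<beta> > 0" "\<And>s. norm (free_B \<omega> s) \<le> \<beta>" using norm_free_B_bound by metis
  have lip: "\<bar>normH \<omega> p - normH \<omega> q\<bar> \<le> \<beta> * norm (p - q)" for p q
  proof (rule tendsto_upperbound)
    show "((\<lambda>L. \<bar>time_avg L p - time_avg L q\<bar>) \<longlongrightarrow> \<bar>normH \<omega> p - normH \<omega> q\<bar>) at_top"
      by (intro tendsto_intros time_avg_tendsto assms(1))
    show "\<forall>\<^sub>F L in at_top. \<bar>time_avg L p - time_avg L q\<bar> \<le> \<beta> * norm (p - q)"
      using eventually_gt_at_top[of 0] by eventually_elim (rule time_avg_bound[OF \<beta>(2)])
  qed simp
  \<comment> \<open>Passing from \<open>p\<close> to the net point costs
    \<open>\<beta> * d = e/3\<close> in the time mean and again in the norm; the last third is the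
    error at the net point.\<close>
  define d where "d = e / (3 * \<beta>)"
  have "d > 0" using assms(2) \<beta>(1) by (simp add: d_def)
  then obtain k where k: "finite k" "{p. normH \<omega> p \<le> 1} \<subseteq> (\<Union>x\<in>k. ball x d)"
    using compact_normH_le[of 1] unfolding compact_eq_totally_bounded by metis
  have "\<forall>\<^sub>F L in at_top. \<forall>q\<in>k. dist (time_avg L q) (normH \<omega> q) < e/3"
    using k(1) assms(2) by (intro eventually_ball_finite ballI tendstoD time_avg_tendsto assms(1)) auto
  then obtain L0 where L0: "\<And>L. L \<ge> L0 \<Longrightarrow> \<forall>q\<in>k. dist (time_avg L q) (normH \<omega> q) < e/3"
    unfolding eventually_at_top_linorder by blast
  show ?thesis
  proof (rule that[of "max L0 1"])
    fix L p assume L: "L \<ge> max L0 1" and p: "normH \<omega> p \<le> 1"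
    then obtain q where q: "q \<in> k" "norm (p - q) < d" using k(2) by (auto simp: dist_norm norm_minus_commute)
    have "\<beta> * norm (p - q) \<le> \<beta> * d" using q(2) \<beta>(1) by (intro mult_left_mono) auto
    also have "\<beta> * d = e/3" using \<beta>(1) by (simp add: d_def)
    finally have "\<bar>time_avg L p - time_avg L q\<bar> \<le> e/3" "\<bar>normH \<omega> p - normH \<omega> q\<bar> \<le> e/3"
      using time_avg_bound[OF \<beta>(2), of L p q] lip[of p q] L by linarith+
    moreover have "\<bar>time_avg L q - normH \<omega> q\<bar> < e/3" using L0[of L] L q(1) by (auto simp: dist_real_def)
    ultimately show "\<bar>time_avg L p - normH \<omega> p\<bar> \<le> e" by linarith
  qed simp
qed

section \<open>Bounds for steering times and for the basic control\<close>

text \<open>The feedback inclusion holds almost everywhere, whereas admissibility bounds the control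
  at every time. Truncation to \<open>[-1, 1]\<close> alters the control on a null set only and
  keeps the path.\<close>

lemma controlled_path_clip:
  assumes cp: "controlled_path \<omega> {0..T} u \<gamma>" and ae: "AE s in lebesgue_on {0..T}. P s (u s)"
    and P: "\<And>s r. P s r \<Longrightarrow> \<bar>r\<bar> \<le> 1"
  obtains u' N where "controlled_path \<omega> {0..T} u' \<gamma>" "\<forall>s\<in>{0..T}. \<bar>u' s\<bar> \<le> 1"
    "negligible N" "\<And>s. s \<in> {0..T} - N \<Longrightarrow> P s (u' s)"
proof -
  have "AE s in lebesgue. s \<in> {0..T} \<longrightarrow> P s (u s)"
    using ae by (subst (asm) AE_restrict_space_iff) auto
  then obtain N where N: "negligible N" "\<And>s. s \<notin> N \<Longrightarrow> s \<in> {0..T} \<longrightarrow> P s (u s)"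
    unfolding eventually_ae_filter negligible_iff_null_sets by auto
  define u' where "u' s = max (-1) (min 1 (u s))" for s
  have eq: "u' s = u s" if "s \<in> {0..T} - N" for s
    using N(2)[of s] P[of s "u s"] that by (auto simp: u'_def abs_le_iff)
  show ?thesis
  proof (rule that[of u' N])
    show "controlled_path \<omega> {0..T} u' \<gamma>"
      unfolding controlled_path_def
    proof (intro conjI ballI)
      show "u' \<in> borel_measurable (lebesgue_on {0..T})"
        using cp unfolding controlled_path_def u'_def[abs_def] by auto
      fix t assume t: "t \<in> {0..T}"
      have old: "(\<lambda>s. opA \<omega> (\<gamma> s) + u s *\<^sub>R vecB) absolutely_integrable_on {0..t}"
        "\<gamma> t = \<gamma> 0 + integral {0..t} (\<lambda>s. opA \<omega> (\<gamma> s) + u s *\<^sub>R vecB)"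
        using cp t unfolding controlled_path_def by blast+
      have e: "opA \<omega> (\<gamma> s) + u' s *\<^sub>R vecB = opA \<omega> (\<gamma> s) + u s *\<^sub>R vecB" if "s \<in> {0..t} - N" for s
        using eq[of s] that t by auto
      show "(\<lambda>s. opA \<omega> (\<gamma> s) + u' s *\<^sub>R vecB) absolutely_integrable_on {0..t}"
        by (rule absolutely_integrable_spike[OF old(1) N(1) e])
      have "integral {0..t} (\<lambda>s. opA \<omega> (\<gamma> s) + u s *\<^sub>R vecB) = integral {0..t} (\<lambda>s. opA \<omega> (\<gamma> s) + u' s *\<^sub>R vecB)"
        by (rule integral_spike[OF N(1) e])
      with old(2) show "\<gamma> t = \<gamma> 0 + integral {0..t} (\<lambda>s. opA \<omega> (\<gamma> s) + u' s *\<^sub>R vecB)"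
        by (rule trans[OF _ arg_cong[of _ _ "(+) (\<gamma> 0)"]])
    qed
  qed (use N eq in \<open>auto simp: u'_def\<close>)
qed

lemma integral_inner_free_B:
  assumes "(\<lambda>s. u s *\<^sub>R free_B \<omega> s) integrable_on {a..b}"
  shows "(\<lambda>s. u s * (free_B \<omega> s \<bullet> p)) integrable_on {a..b}"
    "integral {a..b} (\<lambda>s. u s *\<^sub>R free_B \<omega> s) \<bullet> p = integral {a..b} (\<lambda>s. u s * (free_B \<omega> s \<bullet> p))"
proof -
  have "((\<lambda>s. u s * (free_B \<omega> s \<bullet> p)) has_integral (integral {a..b} (\<lambda>s. u s *\<^sub>R free_B \<omega> s) \<bullet> p)) {a..b}"
    using has_integral_linear[OF integrable_integral[OF assms] bounded_linear_inner_left[of p]]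
    by (simp add: o_def)
  then show "(\<lambda>s. u s * (free_B \<omega> s \<bullet> p)) integrable_on {a..b}"
    "integral {a..b} (\<lambda>s. u s *\<^sub>R free_B \<omega> s) \<bullet> p = integral {a..b} (\<lambda>s. u s * (free_B \<omega> s \<bullet> p))"
    by (auto simp: integrable_on_def integral_unique)
qed

text \<open>Arrival at \<open>0\<close> says that \<open>x\<close> plus the integral of
  \<open>u s *\<^sub>R free_B \<omega> s\<close> is zero. Pairing with a maximizer \<open>p\<close>
  expresses \<open>rho \<omega> x\<close> as an integral of at most
  \<open>\<bar>free_B \<omega> s \<bullet> p\<bar>\<close>.\<close>

lemma steerable_rho_le:
  assumes "steerable_in \<omega> x T" "normH \<omega> p \<le> 1" "x \<bullet> p = rho \<omega> x"
  shows "rho \<omega> x \<le> T * time_avg T p"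
proof -
  obtain u \<gamma> where T: "0 \<le> T" and cp: "controlled_path \<omega> {0..T} u \<gamma>" and u: "\<forall>t\<in>{0..T}. \<bar>u t\<bar> \<le> 1"
    and g: "\<gamma> 0 = x" "\<gamma> T = 0" using assms(1) unfolding steerable_in_def by auto
  from T have "T \<in> {0..T}" by simp
  note v = variation_of_constants[OF cp u this]
  have "x + integral {0..T} (\<lambda>s. u s *\<^sub>R free_B \<omega> s) = 0" using v(2) g by (simp add: linear_0[OF linear_flow])
  then have "x \<bullet> p + integral {0..T} (\<lambda>s. u s *\<^sub>R free_B \<omega> s) \<bullet> p = 0" by (metis inner_add_left inner_zero_left)
  then have "rho \<omega> x = integral {0..T} (\<lambda>s. - (u s * (free_B \<omega> s \<bullet> p)))"
    unfolding integral_inner_free_B(2)[OF v(1)] using assms(3) by simp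
  also have "\<dots> \<le> integral {0..T} (\<lambda>s. \<bar>free_B \<omega> s \<bullet> p\<bar>)"
  proof (rule integral_le)
    show "(\<lambda>s. - (u s * (free_B \<omega> s \<bullet> p))) integrable_on {0..T}"
      using integral_inner_free_B(1)[OF v(1)] by (rule integrable_neg)
    fix s assume "s \<in> {0..T}"
    then have "\<bar>u s\<bar> * \<bar>free_B \<omega> s \<bullet> p\<bar> \<le> 1 * \<bar>free_B \<omega> s \<bullet> p\<bar>" using u by (intro mult_right_mono) auto
    then show "- (u s * (free_B \<omega> s \<bullet> p)) \<le> \<bar>free_B \<omega> s \<bullet> p\<bar>" by (simp add: abs_mult[symmetric])
  qed (rule free_B_inner_integrable)
  finally show ?thesis using T by (cases "T = 0") (auto simp: time_avg_def)
qed

text \<open>A crude bound for arbitrary frequencies. It supplies the constants of the resonant case,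
  and in the non-resonant case it shows first that steering from far away takes long enough for the
  means to settle.\<close>

lemma steerable_rho_le_linear:
  obtains b where "b > 0" "\<And>x T. steerable_in \<omega> x T \<Longrightarrow> rho \<omega> x \<le> b * T"
proof -
  obtain \<beta> where \<beta>: "\<beta> > 0" "\<And>s. norm (free_B \<omega> s) \<le> \<beta>" using norm_free_B_bound by metis
  obtain R where R: "R > 0" "\<And>p. normH \<omega> p \<le> 1 \<Longrightarrow> norm p \<le> R" using rho_le_norm by metis
  show ?thesis
  proof (rule that[of "\<beta> * R"])
    show "\<beta> * R > 0" using \<beta> R by simp
    fix x T assume st: "steerable_in \<omega> x T"
    then have T: "0 \<le> T" by (simp add: steerable_in_def)
    obtain p where p: "normH \<omega> p \<le> 1" "rho \<omega> x = x \<bullet> p" using rho_attained by metis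
    have le: "rho \<omega> x \<le> T * time_avg T p" using st p by (intro steerable_rho_le) auto
    show "rho \<omega> x \<le> \<beta> * R * T"
    proof (cases "T = 0")
      case False
      have "\<bar>time_avg T p - time_avg T 0\<bar> \<le> \<beta> * norm (p - 0)" using False T by (intro time_avg_bound \<beta>) auto
      moreover have "time_avg T 0 = 0" by (simp add: time_avg_def)
      moreover have "\<beta> * norm p \<le> \<beta> * R" using R(2)[OF p(1)] \<beta>(1) by simp
      ultimately have "time_avg T p \<le> \<beta> * R" by simp
      then have "T * time_avg T p \<le> T * (\<beta> * R)" using T by (intro mult_left_mono)
      with le show ?thesis by (simp add: mult.commute)
    qed (use le in simp)
  qed
qed

lemma multi_sign_abs: "r \<in> multi_sign s \<Longrightarrow> \<bar>r\<bar> \<le> 1"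
  by (auto simp: multi_sign_def sgn_if split: if_splits)

lemma multi_sign_mult: "r \<in> multi_sign s \<Longrightarrow> r * s = \<bar>s\<bar>"
  by (auto simp: multi_sign_def sgn_if split: if_splits)

lemma basic_control_abs: "r \<in> basic_control \<omega> x \<Longrightarrow> \<bar>r\<bar> \<le> 1"
  using multi_sign_abs by (auto simp: basic_control_def)

text \<open>During a window of length \<open>L\<close> the rotated path moves by at most
  \<open>L * \<beta>\<close>, so beyond \<open>R\<close> its gradient is nearly constant. The
  control therefore almost realizes the rate
  \<open>- \<bar>free_B \<omega> s \<bullet> q\<bar>\<close> for one fixed \<open>q\<close>, whose
  mean is close to \<open>normH \<omega> q = 1\<close>.\<close>

lemma basic_motion_decrease:
  assumes nr: "non_resonant \<omega>" and "\<epsilon> > 0"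
  obtains L R where "L > 0" "R > 0"
    "\<And>\<gamma>. basic_motion \<omega> L \<gamma> \<Longrightarrow> rho \<omega> (\<gamma> 0) \<ge> R \<Longrightarrow> rho \<omega> (\<gamma> L) \<le> rho \<omega> (\<gamma> 0) - L * (1 - \<epsilon>)"
proof -
  let ?P = "gradient (rho \<omega>)"
  obtain \<beta> where \<beta>: "\<beta> > 0" "\<And>s. norm (free_B \<omega> s) \<le> \<beta>" using norm_free_B_bound by metis
  obtain L where L: "L > 0" "\<And>p. normH \<omega> p \<le> 1 \<Longrightarrow> \<bar>time_avg L p - normH \<omega> p\<bar> \<le> \<epsilon> / 2"
    using time_avg_uniform[OF nr, of "\<epsilon> / 2"] \<open>\<epsilon> > 0\<close> by (metis half_gt_zero order_refl)
  \<comment> \<open>Two gradients in the window differ by at most \<open>2 * \<eta>\<close>.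
    Exchanging them costs \<open>2 * \<beta> * \<eta>\<close> in the product with \<open>u\<close>
    and once more in the absolute value, in all \<open>\<epsilon> / 2\<close>; the other half is the
    error of the time mean.\<close>
  define \<eta> where "\<eta> = \<epsilon> / (8 * \<beta>)"
  have \<eta>: "\<eta> > 0" "8 * \<beta> * \<eta> = \<epsilon>" using \<open>\<epsilon> > 0\<close> \<beta> by (auto simp: \<eta>_def)
  obtain R where R: "R > 0"
    "\<And>x y. rho \<omega> x \<ge> R \<Longrightarrow> norm (y - x) \<le> L * \<beta> \<Longrightarrow> y \<noteq> 0 \<and> norm (?P y - ?P x) \<le> \<eta>"
    using gradient_rho_almost_constant[OF \<eta>(1), of "L * \<beta>"] L \<beta> by (metis mult_pos_pos)
  show ?thesis
  proof (rule that[of L R])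
    fix \<gamma> assume bm: "basic_motion \<omega> L \<gamma>" and x: "rho \<omega> (\<gamma> 0) \<ge> R"
    obtain u0 where u0: "controlled_path \<omega> {0..L} u0 \<gamma>" "AE s in lebesgue_on {0..L}. u0 s \<in> basic_control \<omega> (\<gamma> s)"
      using bm unfolding basic_motion_def by blast
    obtain u N where cp: "controlled_path \<omega> {0..L} u \<gamma>" and u1: "\<forall>s\<in>{0..L}. \<bar>u s\<bar> \<le> 1"
      and N: "negligible N" "\<And>s. s \<in> {0..L} - N \<Longrightarrow> u s \<in> basic_control \<omega> (\<gamma> s)"
    proof (rule controlled_path_clip[where P="\<lambda>s r. r \<in> basic_control \<omega> (\<gamma> s)", OF u0])
      show "\<bar>r\<bar> \<le> 1" if "r \<in> basic_control \<omega> (\<gamma> s)" for s r using that by (rule basic_control_abs)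
    qed (rule that)
    define y where "y s = flow \<omega> (- s) (\<gamma> s)" for s
    have v: "(\<lambda>s. u s *\<^sub>R free_B \<omega> s) integrable_on {0..t}"
      "y t = \<gamma> 0 + integral {0..t} (\<lambda>s. u s *\<^sub>R free_B \<omega> s)" if "t \<in> {0..L}" for t
      using variation_of_constants[OF cp u1 that] by (simp_all add: y_def)
    have ny: "norm (y t - \<gamma> 0) \<le> L * \<beta>" if t: "t \<in> {0..L}" for t
    proof -
      have "norm (u s *\<^sub>R free_B \<omega> s) \<le> \<beta>" if "s \<in> {0..t} - {}" for s
      proof -
        have "\<bar>u s\<bar> * norm (free_B \<omega> s) \<le> 1 * \<beta>" using u1 that t \<beta> by (intro mult_mono) auto
        then show ?thesis by simp
      qed
      then have "norm (integral {0..t} (\<lambda>s. u s *\<^sub>R free_B \<omega> s)) \<le> \<beta> * measure lborel {0..t}"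
        using has_integral_bound_real[OF _ finite.emptyI integrable_integral[OF v(1)[OF t]], of \<beta>] \<beta>(1) by auto
      also have "\<dots> = \<beta> * t" using t by simp
      also have "\<dots> \<le> \<beta> * L" using t \<beta>(1) by (intro mult_left_mono) auto
      finally show ?thesis using v(2)[OF t] by (simp add: mult.commute)
    qed
    have P: "y t \<noteq> 0" "norm (?P (y t) - ?P (\<gamma> 0)) \<le> \<eta>" if "t \<in> {0..L}" for t
      using R(2)[OF x ny[OF that]] by auto
    have LL: "L \<in> {0..L}" using L by simp
    define q where "q = ?P (y L)"
    have q: "normH \<omega> q = 1" using gradient_props(1)[OF P(1)[OF LL]] by (simp add: q_def)
    have pt: "u s * (free_B \<omega> s \<bullet> q) \<le> 4 * \<beta> * \<eta> - \<bar>free_B \<omega> s \<bullet> q\<bar>" if s: "s \<in> {0..L} - N" for s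
    proof -
      have s': "s \<in> {0..L}" using s by simp
      have "flow \<omega> s (y s) = \<gamma> s" by (simp add: y_def)
      then have "vecB \<bullet> ?P (\<gamma> s) = free_B \<omega> s \<bullet> ?P (y s)"
        using inner_B_gradient_flow[OF P(1)[OF s'], of s] by simp
      then have "- u s \<in> multi_sign (free_B \<omega> s \<bullet> ?P (y s))"
        using N(2)[OF s] by (auto simp: basic_control_def)
      then have e: "u s * (free_B \<omega> s \<bullet> ?P (y s)) = - \<bar>free_B \<omega> s \<bullet> ?P (y s)\<bar>"
        using multi_sign_mult by force
      have "norm (q - ?P (y s)) \<le> 2 * \<eta>"
        using P(2)[OF s'] P(2)[OF LL] norm_triangle_ineq4[of "q - ?P (\<gamma> 0)" "?P (y s) - ?P (\<gamma> 0)"]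
        by (simp add: q_def)
      then have "norm (free_B \<omega> s) * norm (q - ?P (y s)) \<le> \<beta> * (2 * \<eta>)" using \<beta> by (intro mult_mono) auto
      then have d: "\<bar>free_B \<omega> s \<bullet> (q - ?P (y s))\<bar> \<le> 2 * \<beta> * \<eta>"
        using Cauchy_Schwarz_ineq2[of "free_B \<omega> s" "q - ?P (y s)"] by linarith
      have "\<bar>u s * (free_B \<omega> s \<bullet> (q - ?P (y s)))\<bar> \<le> 1 * (2 * \<beta> * \<eta>)"
        unfolding abs_mult using u1 s' d by (intro mult_mono) auto
      then have "u s * (free_B \<omega> s \<bullet> q) \<le> u s * (free_B \<omega> s \<bullet> ?P (y s)) + 2 * \<beta> * \<eta>"
        by (simp add: inner_diff_right right_diff_distrib)
      then show ?thesis using e d by (simp add: inner_diff_right)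
    qed
    have "rho \<omega> (\<gamma> L) - rho \<omega> (\<gamma> 0) = rho \<omega> (y L) - rho \<omega> (\<gamma> 0)" by (simp add: y_def)
    also have "\<dots> \<le> (y L - \<gamma> 0) \<bullet> q" using rho_diff_le_gradient[OF P(1)[OF LL]] by (simp add: q_def)
    also have "\<dots> = integral {0..L} (\<lambda>s. u s * (free_B \<omega> s \<bullet> q))"
      using v(2)[OF LL] integral_inner_free_B(2)[OF v(1)[OF LL]] by simp
    also have "\<dots> \<le> integral {0..L} (\<lambda>s. 4 * \<beta> * \<eta> - \<bar>free_B \<omega> s \<bullet> q\<bar>)"
      by (rule integral_le_except_negligible[OF integral_inner_free_B(1)[OF v(1)[OF LL]] _ N(1) pt])
        (auto intro!: integrable_continuous_real continuous_intros)
    also have "\<dots> = L * (\<epsilon> / 2) - L * time_avg L q"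
      using L(1) \<eta>(2) by (simp add: time_avg_def integral_diff free_B_inner_integrable integrable_continuous_real)
    also have "\<dots> \<le> L * (\<epsilon> / 2) - L * (1 - \<epsilon> / 2)"
    proof -
      have "1 - \<epsilon> / 2 \<le> time_avg L q" using L(2)[OF eq_refl[OF q]] q by linarith
      then show ?thesis using L(1) by simp
    qed
    finally show "rho \<omega> (\<gamma> L) \<le> rho \<omega> (\<gamma> 0) - L * (1 - \<epsilon>)" by (simp add: algebra_simps)
  qed (use L R in auto)
qed

end

section \<open>A measurable control between two integral bounds\<close>

text \<open>The set function \<open>emeasure M A + emeasure N A\<close> is itself a measure, so
  uniqueness on an intersection-stable generator extends the equality. It is applied to half-open
  intervals.\<close>

lemma emeasure_add_eq:
  assumes s: "sets M = sets N" "sets D = sets N"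
    and sp: "sets N = sigma_sets UNIV E" "Int_stable E" "space N = UNIV"
    and eq: "\<And>A. A \<in> E \<Longrightarrow> emeasure M A + emeasure N A = emeasure D A"
    and A: "range A \<subseteq> E" "(\<Union>i::nat. A i) = UNIV" "\<And>i. emeasure D (A i) \<noteq> \<infinity>"
    and X: "X \<in> sets N"
  shows "emeasure M X + emeasure N X = emeasure D X"
proof -
  define S where "S = measure_of UNIV (sets N) (\<lambda>A. emeasure M A + emeasure N A)"
  have sa: "sigma_algebra UNIV (sets N)" using sets.sigma_algebra_axioms[of N] sp(3) by simp
  have ms: "measure_space UNIV (sets N) (\<lambda>A. emeasure M A + emeasure N A)"
    unfolding measure_space_def
  proof (intro conjI sa)
    show "positive (sets N) (\<lambda>A. emeasure M A + emeasure N A)" by (simp add: positive_def)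
    show "countably_additive (sets N) (\<lambda>A. emeasure M A + emeasure N A)"
    proof (rule countably_additiveI)
      fix A :: "nat \<Rightarrow> _" assume A: "range A \<subseteq> sets N" "disjoint_family A"
      have "(\<Sum>i. emeasure M (A i) + emeasure N (A i)) = (\<Sum>i. emeasure M (A i)) + (\<Sum>i. emeasure N (A i))"
        by (rule suminf_add[symmetric]) auto
      then show "(\<Sum>i. emeasure M (A i) + emeasure N (A i)) = emeasure M (\<Union>i. A i) + emeasure N (\<Union>i. A i)"
        using A s by (simp add: suminf_emeasure)
    qed
  qed
  have sS: "sets S = sets N" unfolding S_def using sa by (simp add: sets.space_closed sigma_algebra.sigma_sets_eq sigma_algebra.sets_measure_of_eq)
  have eS: "emeasure S Y = emeasure M Y + emeasure N Y" if "Y \<in> sets N" for Y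
    unfolding S_def using ms that sa
    by (intro emeasure_measure_of_sigma) (auto simp: measure_space_def)
  have EN: "E \<subseteq> sets N" using sp(1) by auto
  have EP: "E \<subseteq> Pow UNIV" by simp
  have "S = D"
  proof (rule measure_eqI_generator_eq[OF sp(2) EP _ _ _ A(1) A(2)])
    show "emeasure S X = emeasure D X" if "X \<in> E" for X using that EN eS eq by auto
    show "sets S = sigma_sets UNIV E" using sS sp by simp
    show "sets D = sigma_sets UNIV E" using s sp by simp
    show "emeasure S (A i) \<noteq> \<infinity>" for i using A EN eS eq by (metis range_subsetD subsetD)
  qed
  then show ?thesis using eS[OF X] by simp
qed

lemma has_integral_indicator_Ioc:
  fixes f :: "real \<Rightarrow> real"
  assumes f: "f \<in> borel_measurable borel" "\<And>x. 0 \<le> f x" and ab: "a \<le> b"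
    and I: "(f has_integral I) {a..b}"
  shows "emeasure (density lborel f) {a<..b} = ennreal I"
proof -
  have "((\<lambda>x. if x \<in> {a..b} then f x else 0) has_integral I) UNIV"
    using I by (simp only: has_integral_restrict_UNIV)
  then have "((\<lambda>x. indicator {a<..b} x * f x) has_integral I) UNIV"
    by (rule has_integral_spike[OF negligible_sing[of a], rotated]) (auto simp: indicator_def)
  then have "integral\<^sup>N lborel (\<lambda>x. ennreal (indicator {a<..b} x * f x)) = I"
    using f by (intro nn_integral_has_integral_lborel) auto
  moreover have "emeasure (density lborel f) {a<..b} = integral\<^sup>N lborel (\<lambda>x. ennreal (indicator {a<..b} x * f x))"
    using f by (subst emeasure_density) (auto intro!: nn_integral_cong simp: indicator_def)
  ultimately show ?thesis by simp
qed

lemma emeasure_interval_measure_continuous: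
  assumes "mono F" "continuous_on UNIV F" "a \<le> b"
  shows "emeasure (interval_measure F) {a<..b} = ennreal (F b - F a)"
  using assms by (intro emeasure_interval_measure_Ioc)
    (auto simp: mono_def continuous_on_eq_continuous_at intro: continuous_at_imp_continuous_at_within)

text \<open>A function whose increments lie between the integrals of two bounded functions is the integral
  of a function between the two: the two nonnegative defects are measures that add up to a multiple
  of the Lebesgue measure, and the Radon-Nikodym density of one of them interpolates.\<close>

lemma intermediate_density:
  fixes v lo hi :: "real \<Rightarrow> real"
  assumes T: "0 \<le> T" and m: "lo \<in> borel_measurable borel" "hi \<in> borel_measurable borel"
    and bd: "\<And>t. - R \<le> lo t" "\<And>t. lo t \<le> hi t" "\<And>t. hi t \<le> R"
    and inc: "\<And>s t. 0 \<le> s \<Longrightarrow> s \<le> t \<Longrightarrow> t \<le> T \<Longrightarrow> integral {s..t} lo \<le> v t - v s \<and> v t - v s \<le> integral {s..t} hi"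
  obtains u where "u \<in> borel_measurable borel" "\<And>t. lo t \<le> u t" "\<And>t. u t \<le> hi t"
    "\<And>t. 0 \<le> t \<Longrightarrow> t \<le> T \<Longrightarrow> (u has_integral (v t - v 0)) {0..t}"
proof -
  have bint: "f integrable_on {a..b}" if "f \<in> borel_measurable borel" "\<And>t. \<bar>f t\<bar> \<le> C" for f :: "real \<Rightarrow> real" and a b C
  proof (rule measurable_bounded_by_integrable_imp_integrable)
    show "f \<in> borel_measurable (lebesgue_on {a..b})"
      using that(1) by (simp add: measurable_completion measurable_restrict_space1)
    show "(\<lambda>_. C) integrable_on {a..b}" by (simp add: integrable_continuous_real)
  qed (use that in auto)
  have R: "\<bar>lo t\<bar> \<le> R" "\<bar>hi t\<bar> \<le> R" "\<bar>hi t - lo t\<bar> \<le> 2 * R" for t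
    using bd(1)[of t] bd(2)[of t] bd(3)[of t] by linarith+
  have il: "lo integrable_on {a..b}" and ih: "hi integrable_on {a..b}" and id: "(\<lambda>t. hi t - lo t) integrable_on {a..b}" for a b
    using bint[OF m(1) R(1)] bint[OF m(2) R(2)] integrable_diff by blast+
  \<comment> \<open>Clamping time to \<open>[0, T]\<close> extends the two defects below to
    nondecreasing functions on the whole line, as needed for Stieltjes measures.\<close>
  define cl where "cl t = max 0 (min T t)" for t
  have cl: "0 \<le> cl t" "cl t \<le> T" "s \<le> t \<Longrightarrow> cl s \<le> cl t" for s t using T by (auto simp: cl_def)
  have clc: "continuous_on UNIV cl" unfolding cl_def by (intro continuous_intros)
  \<comment> \<open>\<open>G1\<close> and \<open>G2\<close> measure how far \<open>v\<close> stays
    from its upper and its lower bound; their increments add up to the integral of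
    \<open>hi - lo\<close>.\<close>
  define G1 where "G1 t = integral {0..cl t} hi - (v (cl t) - v 0)" for t
  define G2 where "G2 t = (v (cl t) - v 0) - integral {0..cl t} lo" for t
  have comb: "integral {0..t} f - integral {0..s} f = integral {s..t} f" if "0 \<le> s" "s \<le> t" "\<And>a b. f integrable_on {a..b}" for s t and f :: "real \<Rightarrow> real"
    using Henstock_Kurzweil_Integration.integral_combine[of 0 s t f] that by simp
  have ib: "\<bar>integral {s..t} f\<bar> \<le> R * (t - s)" if "s \<le> t" "\<And>x. \<bar>f x\<bar> \<le> R" "\<And>a b. f integrable_on {a..b}" for s t and f :: "real \<Rightarrow> real"
  proof -
    have "0 \<le> R" using that(2)[of 0] by linarith
    then show ?thesis
      using has_integral_bound_real[of R "{}" f "integral {s..t} f" s t] that by (auto simp: integrable_integral)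
  qed
  have mono1: "mono G1"
  proof (rule monoI)
    fix s t :: real assume "s \<le> t"
    then show "G1 s \<le> G1 t" using inc[of "cl s" "cl t"] cl comb[of "cl s" "cl t" hi] ih unfolding G1_def by force
  qed
  have mono2: "mono G2"
  proof (rule monoI)
    fix s t :: real assume "s \<le> t"
    then show "G2 s \<le> G2 t" using inc[of "cl s" "cl t"] cl comb[of "cl s" "cl t" lo] il unfolding G2_def by force
  qed
  have sum: "G1 t - G1 s + (G2 t - G2 s) = integral {cl s..cl t} (\<lambda>x. hi x - lo x)" if "s \<le> t" for s t
    using comb[of "cl s" "cl t" hi] comb[of "cl s" "cl t" lo] cl that il ih
    unfolding G1_def G2_def by (simp add: integral_diff)
  have d2: "\<bar>G2 t - G2 s\<bar> \<le> 2 * R * \<bar>t - s\<bar>" "\<bar>G1 t - G1 s\<bar> \<le> 2 * R * \<bar>t - s\<bar>" for s t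
  proof -
    have *: "\<bar>G2 t - G2 s\<bar> \<le> 2 * R * (t - s) \<and> \<bar>G1 t - G1 s\<bar> \<le> 2 * R * (t - s)" if "s \<le> t" for s t
    proof -
      have g: "0 \<le> G2 t - G2 s" "0 \<le> G1 t - G1 s" using mono1 mono2 that by (auto simp: mono_def)
      have "0 \<le> R" using R(1)[of 0] by linarith
      have "G1 t - G1 s + (G2 t - G2 s) \<le> 2 * R * (cl t - cl s)"
      proof -
        have "cl s \<le> cl t" using cl(3) that by simp
        then have "\<bar>integral {cl s..cl t} (\<lambda>x. hi x - lo x)\<bar> \<le> 2 * R * (cl t - cl s)"
          using has_integral_bound_real[of "2 * R" "{}" "\<lambda>x. hi x - lo x" "integral {cl s..cl t} (\<lambda>x. hi x - lo x)" "cl s" "cl t"]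
            R(3) id[of "cl s" "cl t"] \<open>0 \<le> R\<close> by (auto simp: integrable_integral)
        then show ?thesis using sum[OF that] by linarith
      qed
      also have "\<dots> \<le> 2 * R * (t - s)"
        using that \<open>0 \<le> R\<close> by (intro mult_left_mono) (auto simp: cl_def)
      finally show ?thesis using g by linarith
    qed
    show "\<bar>G2 t - G2 s\<bar> \<le> 2 * R * \<bar>t - s\<bar>" "\<bar>G1 t - G1 s\<bar> \<le> 2 * R * \<bar>t - s\<bar>"
      using *[of s t] *[of t s] by (cases "s \<le> t"; force simp: abs_minus_commute)+
  qed
  have lipc: "continuous_on UNIV F" if "\<And>s t. \<bar>F t - F s\<bar> \<le> 2 * R * \<bar>t - s\<bar>" for F :: "real \<Rightarrow> real"
  proof -
    have "0 \<le> R" using R(1)[of 0] by linarith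
    then have "(2 * R)-lipschitz_on UNIV F"
      by (intro lipschitz_onI) (use that in \<open>auto simp: dist_real_def\<close>)
    then show ?thesis by (rule lipschitz_on_continuous_on)
  qed
  have cont: "continuous_on UNIV G1" "continuous_on UNIV G2" using lipc d2 by blast+
  define d where "d t = (if t \<in> {0..T} then hi t - lo t else 0)" for t
  have dm: "d \<in> borel_measurable borel" unfolding d_def using m by measurable
  have d0: "0 \<le> d t" for t using bd(2)[of t] by (simp add: d_def)
  have di: "(d has_integral (G1 b - G1 a + (G2 b - G2 a))) {a..b}" if "a \<le> b" for a b
  proof -
    have "((\<lambda>x. hi x - lo x) has_integral (G1 b - G1 a + (G2 b - G2 a))) {cl a..cl b}"
      unfolding sum[OF that] using id by (rule integrable_integral)
    then have "((\<lambda>x. if x \<in> {cl a..cl b} then hi x - lo x else 0) has_integral (G1 b - G1 a + (G2 b - G2 a))) UNIV"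
      by (simp only: has_integral_restrict_UNIV)
    then have "((\<lambda>x. if x \<in> {a..b} then d x else 0) has_integral (G1 b - G1 a + (G2 b - G2 a))) UNIV"
    proof (rule has_integral_spike[of "{0, T}", rotated 2])
      fix x assume "x \<in> UNIV - {0, T}"
      then show "(if x \<in> {a..b} then d x else 0) = (if x \<in> {cl a..cl b} then hi x - lo x else 0)"
        using that T by (auto simp: d_def cl_def)
    qed auto
    then show ?thesis by (simp only: has_integral_restrict_UNIV)
  qed
  let ?D = "density lborel (\<lambda>x. ennreal (d x))"
  let ?E = "range (\<lambda>(a, b). {a<..b::real})"
  have eq: "emeasure (interval_measure G1) {a<..b} + emeasure (interval_measure G2) {a<..b} = emeasure ?D {a<..b}" for a b
  proof (cases "a \<le> b")
    case True
    have "0 \<le> G1 b - G1 a" "0 \<le> G2 b - G2 a" using mono1 mono2 True by (auto simp: mono_def)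
    then show ?thesis
      using emeasure_interval_measure_continuous[OF mono1 cont(1) True] emeasure_interval_measure_continuous[OF mono2 cont(2) True]
        has_integral_indicator_Ioc[OF dm d0 True di[OF True]] by (simp add: ennreal_plus)
  qed simp
  have le: "emeasure (interval_measure G2) X \<le> emeasure ?D X" if "X \<in> sets borel" for X
  proof -
    have "emeasure (interval_measure G1) X + emeasure (interval_measure G2) X = emeasure ?D X"
    proof (rule emeasure_add_eq[where E="?E" and A="\<lambda>i. {- real i <.. real i}"])
      show "sets (interval_measure G2) = sigma_sets UNIV ?E"
        by (simp add: borel_sigma_sets_Ioc)
      show "Int_stable ?E" by (auto simp: Int_stable_def)
      show "(\<Union>i. {- real i<..real i}) = UNIV"
      proof (intro equalityI subsetI UNIV_I)
        fix x :: real
        obtain n where "\<bar>x\<bar> < real n" using reals_Archimedean2 by blast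
        then show "x \<in> (\<Union>i. {- real i<..real i})" by (auto intro!: exI[of _ n])
      qed
      show "emeasure ?D {- real i<..real i} \<noteq> \<infinity>" for i
        using has_integral_indicator_Ioc[OF dm d0 _ di, of "- real i" "real i"] by simp
    qed (use eq that in auto)
    then show ?thesis by (metis le_add2 add.commute le_add1 le_iff_add)
  qed
  have fin: "finite_measure ?D"
  proof
    have "((\<lambda>x. if x \<in> {0..T} then d x else 0) has_integral (G1 T - G1 0 + (G2 T - G2 0))) UNIV"
      using di[OF T] by (simp only: has_integral_restrict_UNIV)
    moreover have "(\<lambda>x. if x \<in> {0..T} then d x else 0) = d" by (auto simp: d_def)
    ultimately have "integral\<^sup>N lborel (\<lambda>x. ennreal (d x)) = ennreal (G1 T - G1 0 + (G2 T - G2 0))"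
      using dm d0 by (intro nn_integral_has_integral_lborel) auto
    then show "emeasure ?D (space ?D) \<noteq> \<infinity>" using dm by (simp add: emeasure_density)
  qed
  interpret D: finite_measure ?D by (rule fin)
  have "absolutely_continuous ?D (interval_measure G2)"
    unfolding absolutely_continuous_def null_sets_def using le by (auto simp: le_zero_eq) (metis le_zero_eq)
  then obtain f where f: "f \<in> borel_measurable ?D" "density ?D f = interval_measure G2"
    using D.Radon_Nikodym[of "interval_measure G2"] by auto
  have fm: "f \<in> borel_measurable borel" using f(1) by simp
  \<comment> \<open>The measure of \<open>G2\<close> is dominated by \<open>?D\<close>, so its
    density cannot exceed \<open>1\<close> on a set of positive measure.\<close>
  have f1: "AE x in ?D. f x \<le> 1"
  proof -
    let ?A = "{x. f x > 1}"
    have A: "?A \<in> sets borel" using fm by measurable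
    have "(\<integral>\<^sup>+ x. f x * indicator ?A x \<partial>?D) \<le> emeasure ?D ?A"
      using le[OF A] f(2) emeasure_density[of f ?D ?A] A fm by simp
    also have "emeasure ?D ?A = (\<integral>\<^sup>+ x. indicator ?A x \<partial>?D)" using A by simp
    finally have i: "(\<integral>\<^sup>+ x. f x * indicator ?A x \<partial>?D) \<le> (\<integral>\<^sup>+ x. indicator ?A x \<partial>?D)" .
    have "(\<integral>\<^sup>+ x. f x * indicator ?A x - indicator ?A x \<partial>?D)
        = (\<integral>\<^sup>+ x. f x * indicator ?A x \<partial>?D) - (\<integral>\<^sup>+ x. indicator ?A x \<partial>?D)"
    proof (rule nn_integral_diff)
      show "(\<integral>\<^sup>+ x. indicator ?A x \<partial>?D) \<noteq> \<infinity>" using A D.emeasure_finite[of ?A] by simp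
      show "AE x in ?D. indicator ?A x \<le> f x * indicator ?A x"
        by (rule AE_I2) (auto simp: indicator_def intro: less_imp_le)
    qed (use A fm in auto)
    also have "\<dots> = 0"
    proof -
      have "(\<integral>\<^sup>+ x. indicator ?A x \<partial>?D) < \<infinity>" using A D.emeasure_finite[of ?A] by (simp add: top.not_eq_extremum[symmetric])
      then show ?thesis using i by (auto simp: diff_eq_0_iff_ennreal intro: le_less_trans)
    qed
    finally have "AE x in ?D. f x * indicator ?A x - indicator ?A x = 0"
      using A fm by (subst (asm) nn_integral_0_iff_AE) auto
    then show ?thesis
    proof eventually_elim
      case (elim x)
      show ?case
      proof (rule ccontr)
        assume "\<not> f x \<le> 1"
        then have "indicator ?A x = (1::ennreal)" by simp
        then show False using elim \<open>\<not> f x \<le> 1\<close> by (simp add: diff_eq_0_iff_ennreal)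
      qed
    qed
  qed
  \<comment> \<open>Capping the density at \<open>1\<close> changes it on a null set only and makes
    the bounds \<open>lo \<le> u \<le> hi\<close> hold at every point.\<close>
  define \<theta> where "\<theta> x = enn2real (min 1 (f x))" for x
  have th: "0 \<le> \<theta> x" "\<theta> x \<le> 1" for x
    unfolding \<theta>_def by (auto simp: enn2real_leI)
  have tm: "\<theta> \<in> borel_measurable borel" unfolding \<theta>_def using fm by measurable
  have dens: "interval_measure G2 = density lborel (\<lambda>x. ennreal (d x * \<theta> x))"
  proof -
    have "AE x in ?D. f x = ennreal (\<theta> x)"
      using f1 by eventually_elim (auto simp: \<theta>_def min_def ennreal_enn2real_if top.not_eq_extremum[symmetric] top_unique)
    then have "interval_measure G2 = density ?D (\<lambda>x. ennreal (\<theta> x))"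
      unfolding f(2)[symmetric] using fm tm by (intro density_cong) auto
    also have "\<dots> = density lborel (\<lambda>x. ennreal (d x * \<theta> x))"
      using dm tm d0 th by (subst density_density_eq) (auto simp: ennreal_mult)
    finally show ?thesis .
  qed
  \<comment> \<open>Its integral is that of \<open>lo\<close> plus the lower defect
    \<open>G2\<close>, which is the increment of \<open>v\<close>.\<close>
  define u where "u x = lo x + \<theta> x * (hi x - lo x)" for x
  show ?thesis
  proof (rule that[of u])
    show "u \<in> borel_measurable borel" unfolding u_def using m tm by measurable
    show "lo t \<le> u t" "u t \<le> hi t" for t
      using th[of t] bd(2)[of t] mult_left_le_one_le[of "hi t - lo t" "\<theta> t"] by (auto simp: u_def)
    fix t assume t: "0 \<le> t" "t \<le> T"
    have "\<bar>d x * \<theta> x\<bar> \<le> 2 * R" for x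
    proof -
      have "\<bar>d x\<bar> * \<bar>\<theta> x\<bar> \<le> (2 * R) * 1"
        using th[of x] R(3)[of x] R(1)[of x] by (intro mult_mono) (auto simp: d_def)
      then show ?thesis by (simp add: abs_mult)
    qed
    then have "(\<lambda>x. d x * \<theta> x) integrable_on {0..t}" using dm tm by (intro bint) auto
    then obtain J where J: "((\<lambda>x. d x * \<theta> x) has_integral J) {0..t}" by (auto simp: integrable_on_def)
    then have J0: "0 \<le> J" using d0 th by (intro has_integral_nonneg[OF J]) simp
    have "ennreal (G2 t - G2 0) = ennreal J"
    proof -
      have "emeasure (density lborel (\<lambda>x. ennreal (d x * \<theta> x))) {0<..t} = ennreal J"
        using J t dm tm d0 th by (intro has_integral_indicator_Ioc) auto
      then show ?thesis using emeasure_interval_measure_continuous[OF mono2 cont(2) t(1)] dens by simp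
    qed
    moreover have "0 \<le> G2 t - G2 0" using mono2 t by (auto simp: mono_def)
    ultimately have "J = G2 t - G2 0" using J0 by simp
    also have "\<dots> = v t - v 0 - integral {0..t} lo" using t T by (simp add: G2_def cl_def)
    finally have "((\<lambda>x. lo x + d x * \<theta> x) has_integral (v t - v 0)) {0..t}"
      using has_integral_add[OF integrable_integral[OF il] J] by simp
    then show "(u has_integral (v t - v 0)) {0..t}"
      by (rule has_integral_eq[rotated]) (use t in \<open>auto simp: u_def d_def\<close>)
  qed
qed

section \<open>Existence of solutions of differential inclusions\<close>

context oscillators
begin

lemma flow_vector_derivative_comp:
  assumes w: "(w has_vector_derivative w') (at t within S)"
  shows "((\<lambda>t. flow \<omega> t (w t)) has_vector_derivative flow \<omega> t w' + opA \<omega> (flow \<omega> t (w t))) (at t within S)"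
proof -
  have c: "((\<lambda>t. fst (w t $ i)) has_real_derivative fst (w' $ i)) (at t within S)"
          "((\<lambda>t. snd (w t $ i)) has_real_derivative snd (w' $ i)) (at t within S)" for i
    unfolding has_real_derivative_iff_has_vector_derivative
    by (auto intro!: bounded_linear.has_vector_derivative[OF bounded_linear_fst]
        bounded_linear.has_vector_derivative[OF bounded_linear_snd]
        bounded_linear.has_vector_derivative[OF bounded_linear_vec_nth] w)
  show ?thesis
    by (intro has_vector_derivative_vec_lambda has_vector_derivative_prodI;
      auto simp: flow_def opA_def has_real_derivative_iff_has_vector_derivative[symmetric] power2_eq_square
      intro!: derivative_eq_intros c simp: field_simps)
qed

text \<open>Variation of constants, integrated by parts: only the integral \<open>v\<close> of the control enters, so the
  response is continuous in \<open>v\<close> under uniform convergence.\<close>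

definition response :: "'n state \<Rightarrow> (real \<Rightarrow> real) \<Rightarrow> real \<Rightarrow> 'n state" where
  "response x v t = flow \<omega> t (x + integral {0..t} (\<lambda>s. v s *\<^sub>R flow \<omega> (- s) (opA \<omega> vecB))) + v t *\<^sub>R vecB"

lemma response_cong: "(\<And>s. 0 \<le> s \<Longrightarrow> s \<le> t \<Longrightarrow> v s = v' s) \<Longrightarrow> 0 \<le> t \<Longrightarrow> response x v t = response x v' t"
  using integral_cong[of "{0..t}" "\<lambda>s. v s *\<^sub>R flow \<omega> (- s) (opA \<omega> vecB)" "\<lambda>s. v' s *\<^sub>R flow \<omega> (- s) (opA \<omega> vecB)"]
  by (simp add: response_def)

lemma response_solves:
  assumes v: "continuous_on {0..T} v" "v 0 = 0"
  shows "continuous_on {0..T} (response x v)"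
    "t \<in> {0..T} \<Longrightarrow> response x v t = x + integral {0..t} (\<lambda>s. opA \<omega> (response x v s)) + v t *\<^sub>R vecB"
proof -
  define k where "k s = v s *\<^sub>R flow \<omega> (- s) (opA \<omega> vecB)" for s
  define w where "w t = flow \<omega> t (x + integral {0..t} k)" for t
  have kc: "continuous_on {0..T} k" unfolding k_def by (intro continuous_intros v)
  have r: "response x v t = w t + v t *\<^sub>R vecB" for t by (simp add: response_def w_def k_def[abs_def])
  have wd: "(w has_vector_derivative opA \<omega> (response x v s)) (at s within {0..T})" if "s \<in> {0..T}" for s
  proof -
    have "((\<lambda>t. x + integral {0..t} k) has_vector_derivative 0 + k s) (at s within {0..T})"
      by (intro has_vector_derivative_add has_vector_derivative_const integral_has_vector_derivative kc that)
    then have "(w has_vector_derivative flow \<omega> s (0 + k s) + opA \<omega> (flow \<omega> s (x + integral {0..s} k))) (at s within {0..T})"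
      unfolding w_def by (rule flow_vector_derivative_comp)
    moreover have "flow \<omega> s (0 + k s) + opA \<omega> (flow \<omega> s (x + integral {0..s} k)) = opA \<omega> (response x v s)"
      unfolding r by (simp add: k_def flow_simps opA_simps w_def)
    ultimately show ?thesis by simp
  qed
  have wc: "continuous_on {0..T} w"
    using wd by (meson continuous_on_eq_continuous_within has_vector_derivative_continuous)
  have "continuous_on {0..T} (\<lambda>t. w t + v t *\<^sub>R vecB)" by (intro continuous_intros wc v)
  then show "continuous_on {0..T} (response x v)" by (simp add: r[abs_def])
  assume t: "t \<in> {0..T}"
  have "((\<lambda>s. opA \<omega> (response x v s)) has_integral (w t - w 0)) {0..t}"
    using t by (intro fundamental_theorem_of_calculus) (auto intro!: has_vector_derivative_within_subset[OF wd])
  then have "integral {0..t} (\<lambda>s. opA \<omega> (response x v s)) = w t - w 0" by (rule integral_unique)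
  moreover have "w 0 = x" by (simp add: w_def)
  ultimately show "response x v t = x + integral {0..t} (\<lambda>s. opA \<omega> (response x v s)) + v t *\<^sub>R vecB"
    by (simp add: r)
qed

text \<open>\<open>rho\<close> is invariant under the flow and equivalent to the Euclidean norm, so
  the bound is uniform in time.\<close>

lemma flow_bounded: obtains c where "c > 0" "\<And>t x. norm (flow \<omega> t x) \<le> c * norm x"
proof -
  obtain m where m: "m > 0" "\<And>x. m * norm x \<le> rho \<omega> x" using norm_le_rho by metis
  obtain R where R: "R > 0" "\<And>x. rho \<omega> x \<le> R * norm x" using rho_le_norm by metis
  have "norm (flow \<omega> t x) \<le> R / m * norm x" for t x
    using order_trans[OF m(2)[of "flow \<omega> t x"]] R(2)[of x] m(1) by (simp add: field_simps)
  then show ?thesis using m R by (intro that[of "R / m"]) auto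
qed

lemma response_lipschitz:
  assumes "0 \<le> T"
  obtains K where "K > 0" "\<And>(v :: real \<Rightarrow> real) v' (e :: real) t. continuous_on {0..T} v \<Longrightarrow> continuous_on {0..T} v' \<Longrightarrow>
    (\<And>s. s \<in> {0..T} \<Longrightarrow> \<bar>v s - v' s\<bar> \<le> e) \<Longrightarrow> t \<in> {0..T} \<Longrightarrow> norm (response x v t - response x v' t) \<le> K * e"
proof -
  obtain c where c: "c > 0" "\<And>t x. norm (flow \<omega> t x) \<le> c * norm x" using flow_bounded by metis
  let ?a = "c * norm (opA \<omega> (vecB :: 'n state))"
  show ?thesis
  proof (rule that[of "c * (?a * T) + norm (vecB :: 'n state) + 1"])
    show "c * (?a * T) + norm (vecB :: 'n state) + 1 > 0" using c assms by (auto intro!: add_nonneg_pos)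
    fix v v' :: "real \<Rightarrow> real" and e t :: real assume v: "continuous_on {0..T} v" "continuous_on {0..T} v'"
      and e: "\<And>s. s \<in> {0..T} \<Longrightarrow> \<bar>v s - v' s\<bar> \<le> e" and t: "t \<in> {0..T}"
    have e0: "0 \<le> e" using e[of 0] assms by force
    let ?k = "\<lambda>v s. v s *\<^sub>R flow \<omega> (- s) (opA \<omega> vecB)"
    have i: "?k v integrable_on {0..t}" if "continuous_on {0..T} v" for v
      using t by (intro integrable_continuous_real continuous_intros continuous_on_subset[OF that]) auto
    have "norm (integral {0..t} (\<lambda>s. ?k v s - ?k v' s)) \<le> (e * ?a) * measure lborel {0..t}"
    proof (rule has_integral_bound_real[OF _ finite.emptyI integrable_integral])
      show "(\<lambda>s. ?k v s - ?k v' s) integrable_on {0..t}" using i v by (intro integrable_diff) auto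
      fix s assume "s \<in> {0..t} - {}"
      then have "\<bar>v s - v' s\<bar> * norm (flow \<omega> (- s) (opA \<omega> vecB)) \<le> e * ?a"
        using e t c e0 by (intro mult_mono) auto
      then show "norm (?k v s - ?k v' s) \<le> e * ?a" by (simp flip: scaleR_diff_left)
    qed (use e0 c in auto)
    also have "\<dots> \<le> (e * ?a) * T" using t e0 c(1) by (intro mult_left_mono) auto
    finally have 1: "norm (integral {0..t} (?k v) - integral {0..t} (?k v')) \<le> e * ?a * T"
      using i v by (simp add: integral_diff)
    have "response x v t - response x v' t = flow \<omega> t (integral {0..t} (?k v) - integral {0..t} (?k v')) + (v t - v' t) *\<^sub>R vecB"
      by (simp add: response_def flow_simps algebra_simps)
    also have "norm \<dots> \<le> c * (e * ?a * T) + e * norm (vecB :: 'n state)"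
    proof (rule norm_triangle_mono)
      show "norm (flow \<omega> t (integral {0..t} (?k v) - integral {0..t} (?k v'))) \<le> c * (e * ?a * T)"
        using order_trans[OF c(2) mult_left_mono[OF 1]] c(1) by simp
      show "norm ((v t - v' t) *\<^sub>R (vecB :: 'n state)) \<le> e * norm (vecB :: 'n state)"
        using e[OF t] by (simp add: mult_right_mono)
    qed
    also have "\<dots> \<le> (c * (?a * T) + norm (vecB :: 'n state) + 1) * e"
      using e0 by (simp add: algebra_simps)
    finally show "norm (response x v t - response x v' t) \<le> (c * (?a * T) + norm (vecB :: 'n state) + 1) * e" .
  qed
qed

lemma controlled_pathI:
  assumes u: "u \<in> borel_measurable borel" "\<And>t. \<bar>u t\<bar> \<le> R" and c: "continuous_on J \<gamma>"
    and J: "J \<in> sets lebesgue" "\<And>t. t \<in> J \<Longrightarrow> {0..t} \<subseteq> J"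
    and eq: "\<And>t. t \<in> J \<Longrightarrow> \<gamma> t = \<gamma> 0 + integral {0..t} (\<lambda>s. opA \<omega> (\<gamma> s)) + integral {0..t} u *\<^sub>R vecB"
  shows "controlled_path \<omega> J u \<gamma>"
  unfolding controlled_path_def
proof (intro conjI ballI)
  have um: "u \<in> borel_measurable (lebesgue_on S)" for S
    using u(1) by (simp add: measurable_completion measurable_restrict_space1)
  then show "u \<in> borel_measurable (lebesgue_on J)" .
  fix t assume t: "t \<in> J"
  have uai: "u absolutely_integrable_on {0..t}"
    by (rule measurable_bounded_by_integrable_imp_absolutely_integrable[OF um, of _ "\<lambda>_. R"])
      (simp_all add: u(2) integrable_continuous_real)
  have ua: "(\<lambda>s. u s *\<^sub>R (vecB :: 'n state)) absolutely_integrable_on {0..t}"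
    using absolutely_integrable_scaleR_right[OF uai] absolutely_integrable_linear[OF uai bounded_linear_scaleR_left[of "vecB :: 'n state"]]
    by (simp add: o_def)
  have Aa: "(\<lambda>s. opA \<omega> (\<gamma> s)) absolutely_integrable_on {0..t}"
    using J(2)[OF t] by (intro absolutely_integrable_continuous_real continuous_intros continuous_on_subset[OF c])
  show "(\<lambda>s. opA \<omega> (\<gamma> s) + u s *\<^sub>R vecB) absolutely_integrable_on {0..t}"
    using Aa ua by (rule set_integral_add(1))
  have "integral {0..t} (\<lambda>s. u s *\<^sub>R (vecB :: 'n state)) = integral {0..t} u *\<^sub>R vecB"
    using integrable_integral[OF set_lebesgue_integral_eq_integral(1)[OF uai], THEN has_integral_scaleR_left]
    by (rule integral_unique)
  then show "\<gamma> t = \<gamma> 0 + integral {0..t} (\<lambda>s. opA \<omega> (\<gamma> s) + u s *\<^sub>R vecB)"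
    using eq[OF t] Aa ua by (subst integral_add) (auto intro: set_lebesgue_integral_eq_integral(1) simp: add.assoc)
qed

text \<open>The functions \<open>f n\<close> need not converge, but their maxima with
  \<open>g\<close> do, pointwise to \<open>g\<close>, so dominated convergence applies to an upper
  bound of the integrals.\<close>

lemma limsup_integral_le:
  fixes f :: "nat \<Rightarrow> real \<Rightarrow> real"
  assumes f: "\<And>n. f n integrable_on {s..t}" "\<And>n x. \<bar>f n x\<bar> \<le> R"
    and g: "g \<in> borel_measurable borel" "\<And>x. \<bar>g x\<bar> \<le> R"
    and ev: "\<And>x e. x \<in> {s..t} \<Longrightarrow> e > 0 \<Longrightarrow> \<forall>\<^sub>F n in sequentially. f n x < g x + e"
    and lim: "(\<lambda>n. integral {s..t} (f n)) \<longlonglongrightarrow> c"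
  shows "c \<le> integral {s..t} g"
proof (rule LIMSEQ_le[OF lim])
  let ?w = "\<lambda>n x. max (f n x) (g x)"
  have gi: "g integrable_on {s..t}"
  proof (rule measurable_bounded_by_integrable_imp_integrable)
    show "g \<in> borel_measurable (lebesgue_on {s..t})"
      using g(1) by (simp add: measurable_completion measurable_restrict_space1)
    show "(\<lambda>_. R) integrable_on {s..t}" by (simp add: integrable_continuous_real)
  qed (use g in auto)
  have Ri: "(\<lambda>_. R) integrable_on {s..t}" by (simp add: integrable_continuous_real)
  have ai: "h absolutely_integrable_on {s..t}" if "h integrable_on {s..t}" "\<And>x. \<bar>h x\<bar> \<le> R" for h :: "real \<Rightarrow> real"
    by (rule absolutely_integrable_integrable_bound[OF _ that(1) Ri]) (use that in simp)
  have wi: "?w n integrable_on {s..t}" for n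
    using absolutely_integrable_max_1[OF ai[OF f(1) f(2)] ai[OF gi g(2)]] by (rule set_lebesgue_integral_eq_integral(1))
  show "\<exists>N. \<forall>n\<ge>N. integral {s..t} (f n) \<le> integral {s..t} (?w n)"
    using f wi by (intro exI allI impI integral_le) auto
  show "(\<lambda>n. integral {s..t} (?w n)) \<longlonglongrightarrow> integral {s..t} g"
  proof (rule dominated_convergence(2)[OF wi Ri])
    show "norm (?w n x) \<le> R" for n x using f(2)[of n x] g(2)[of x] by (auto simp: max_def)
    fix x assume x: "x \<in> {s..t}"
    show "(\<lambda>n. ?w n x) \<longlonglongrightarrow> g x"
    proof (rule tendstoI)
      fix e :: real assume "e > 0"
      show "\<forall>\<^sub>F n in sequentially. dist (?w n x) (g x) < e"
        using ev[OF x \<open>e > 0\<close>] by eventually_elim (use \<open>e > 0\<close> in \<open>auto simp: dist_real_def max_def\<close>)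
    qed
  qed
qed

text \<open>Step \<open>n\<close> of the scheme holds the control on intervals of length
  \<open>1 / Suc n\<close> at the value of \<open>l\<close> taken at the left grid point. The
  controls may oscillate, so only their primitives converge. By semicontinuity the increments of the
  limit lie between the integrals of \<open>l\<close> and \<open>h\<close>, and
  \<open>intermediate_density\<close> recovers a control from it.\<close>

lemma inclusion_solution:
  fixes l h :: "'n state \<Rightarrow> real"
  assumes T: "0 < T" and bd: "\<And>y. - R \<le> l y" "\<And>y. l y \<le> h y" "\<And>y. h y \<le> R"
    and usc: "\<And>a. open {y. h y < a}" "\<And>a. open {y. a < l y}"
  obtains u \<gamma> where "\<gamma> 0 = x" "controlled_path \<omega> {0..T} u \<gamma>" "u \<in> borel_measurable borel"
    "\<And>t. \<bar>u t\<bar> \<le> R" "\<And>t. t \<in> {0..T} \<Longrightarrow> l (\<gamma> t) \<le> u t \<and> u t \<le> h (\<gamma> t)"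
proof -
  have R: "0 \<le> R" using bd(1)[of 0] bd(2)[of 0] bd(3)[of 0] by linarith
  define st where "st a n s = (a (nat \<lfloor>s * real (Suc n)\<rfloor>) :: real)" for a :: "nat \<Rightarrow> real" and n s
  define V where "V a n t = integral {0..t} (st a n)" for a n t
  \<comment> \<open>The recursion is well-founded: the response at grid time \<open>k\<close> sees
    the control only before that time, hence only values \<open>a j\<close> with
    \<open>j < k\<close>. The grid time itself, at which the step index is already \<open>k\<close>,
    is a null set.\<close>
  have "\<exists>a. \<forall>k. a k = l (response x (V a n) (real k / real (Suc n)))" for n
  proof (rule dependent_wellorder_choice)
    fix r f g and k :: nat assume fg: "\<And>j. j < k \<Longrightarrow> f j = (g j :: real)"
    have "V f n s = V g n s" if s: "0 \<le> s" "s \<le> real k / real (Suc n)" for s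
      unfolding V_def
    proof (rule integral_spike[of "{s}"])
      fix z assume z: "z \<in> {0..s} - {s}"
      then have "z < real k / real (Suc n)" using s by auto
      then have "z * real (Suc n) < real k" by (simp add: pos_less_divide_eq)
      then have "nat \<lfloor>z * real (Suc n)\<rfloor> < k" using z by (simp add: nat_less_iff floor_less_iff)
      then show "st g n z = st f n z" using fg by (simp add: st_def)
    qed simp
    then have "response x (V f n) (real k / real (Suc n)) = response x (V g n) (real k / real (Suc n))"
      by (intro response_cong) auto
    then show "(r = l (response x (V f n) (real k / real (Suc n)))) = (r = l (response x (V g n) (real k / real (Suc n))))"
      by simp
  qed simp
  then obtain a where a: "\<And>n k. a n k = l (response x (V (a n) n) (real k / real (Suc n)))" by metis
  define un where "un n = st (a n) n" for n
  define vn where "vn n = V (a n) n" for n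
  have ab: "\<bar>a n k\<bar> \<le> R" for n k
  proof -
    obtain y where "a n k = l y" using a by blast
    then show ?thesis using bd(1)[of y] bd(2)[of y] bd(3)[of y] by linarith
  qed
  have unb: "\<bar>un n s\<bar> \<le> R" for n s unfolding un_def st_def by (rule ab)
  have unm: "un n \<in> borel_measurable borel" for n
  proof -
    have "(\<lambda>s::real. nat \<lfloor>s * real (Suc n)\<rfloor>) \<in> borel \<rightarrow>\<^sub>M count_space UNIV" by measurable
    from measurable_compose[OF this, of "a n" borel] show ?thesis by (simp add: un_def st_def[abs_def])
  qed
  have uni: "un n integrable_on {p..q}" for n p q
  proof (rule measurable_bounded_by_integrable_imp_integrable)
    show "un n \<in> borel_measurable (lebesgue_on {p..q})"
      using unm by (simp add: measurable_completion measurable_restrict_space1)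
    show "(\<lambda>_. R) integrable_on {p..q}" by (simp add: integrable_continuous_real)
  qed (use unb in auto)
  have vn_eq: "vn n t = integral {0..t} (un n)" for n t by (simp add: vn_def V_def un_def)
  have vninc: "vn n t - vn n s = integral {s..t} (un n)" if "0 \<le> s" "s \<le> t" for n s t
    unfolding vn_eq using Henstock_Kurzweil_Integration.integral_combine[of 0 s t "un n"] uni that by simp
  have vnl: "\<bar>vn n t - vn n s\<bar> \<le> R * \<bar>t - s\<bar>" if "0 \<le> s" "0 \<le> t" for n s t
  proof -
    have *: "\<bar>vn n t - vn n s\<bar> \<le> R * (t - s)" if "0 \<le> s" "s \<le> t" for s t
      using has_integral_bound_real[OF R finite.emptyI integrable_integral[OF uni[of n s t]]] unb that
      by (simp add: vninc)
    show ?thesis using *[of s t] *[of t s] that by (cases "s \<le> t") (auto simp: abs_minus_commute)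
  qed
  have vn0: "vn n 0 = 0" for n by (simp add: vn_eq)
  have vnc: "continuous_on {0..T} (vn n)" for n
    unfolding vn_eq[abs_def] by (rule indefinite_integral_continuous_1[OF uni])
  \<comment> \<open>All primitives are \<open>R\<close>-Lipschitz and vanish at \<open>0\<close>,
    hence equicontinuous and bounded.\<close>
  obtain v and r :: "nat \<Rightarrow> nat" where vc: "continuous_on {0..T} v" and r: "strict_mono r"
    and vlim: "\<And>e. 0 < e \<Longrightarrow> \<exists>N. \<forall>n t. n \<ge> N \<and> t \<in> {0..T} \<longrightarrow> norm (vn (r n) t - v t) < e"
  proof (rule Arzela_Ascoli[of "{0..T}" vn "R * T"])
    show "compact {0..T}" by simp
    show "norm (vn n t) \<le> R * T" if "t \<in> {0..T}" for n t
      using vnl[of 0 t n] vn0 that R mult_left_mono[of t T R] by (auto intro: order_trans)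
    fix t e :: real assume t: "t \<in> {0..T}" "0 < e"
    have "norm (vn n t - vn n s) < e" if "s \<in> {0..T}" "norm (t - s) < e / (R + 1)" for n s
    proof -
      have "\<bar>vn n t - vn n s\<bar> \<le> R * \<bar>t - s\<bar>" using that t by (intro vnl) auto
      also have "\<dots> \<le> (R + 1) * \<bar>t - s\<bar>" by (intro mult_right_mono) auto
      also have "\<dots> < e" using that R by (simp add: pos_less_divide_eq mult.commute)
      finally show ?thesis by simp
    qed
    then show "\<exists>d. 0 < d \<and> (\<forall>n y. y \<in> {0..T} \<and> norm (t - y) < d \<longrightarrow> norm (vn n t - vn n y) < e)"
      using t R by (intro exI[of _ "e / (R + 1)"]) auto
  next
    fix g and k :: "nat \<Rightarrow> nat"
    assume "continuous_on {0..T} g" "strict_mono k"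
      "\<And>e. 0 < e \<Longrightarrow> \<exists>N. \<forall>n t. n \<ge> N \<and> t \<in> {0..T} \<longrightarrow> norm (vn (k n) t - g t) < e"
    then show thesis by (intro that[of g k]) simp_all
  qed
  have vptw: "(\<lambda>n. vn (r n) t) \<longlonglongrightarrow> v t" if "t \<in> {0..T}" for t
    unfolding LIMSEQ_def dist_norm using vlim that by meson
  have v0: "v 0 = 0" using vptw[of 0] T vn0 by (simp add: LIMSEQ_const_iff)
  define \<gamma> where "\<gamma> = response x v"
  define yn where "yn n = response x (vn n)" for n
  have a': "a n k = l (yn n (real k / real (Suc n)))" for n k using a[of n k] by (simp add: yn_def vn_def)
  note sol = response_solves[where x=x, OF vc v0, folded \<gamma>_def]
  obtain K where K: "K > 0" "\<And>(v :: real \<Rightarrow> real) v' (e :: real) t. continuous_on {0..T} v \<Longrightarrow> continuous_on {0..T} v' \<Longrightarrow>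
    (\<And>s. s \<in> {0..T} \<Longrightarrow> \<bar>v s - v' s\<bar> \<le> e) \<Longrightarrow> t \<in> {0..T} \<Longrightarrow> norm (response x v t - response x v' t) \<le> K * e"
    using response_lipschitz[OF less_imp_le[OF T], of x] by blast
  have ylim: "\<exists>N. \<forall>n\<ge>N. \<forall>t\<in>{0..T}. dist (yn (r n) t) (\<gamma> t) < e" if e: "e > 0" for e
  proof -
    obtain N where N: "\<And>n t. n \<ge> N \<Longrightarrow> t \<in> {0..T} \<Longrightarrow> norm (vn (r n) t - v t) < e / (2 * K)"
      using vlim[of "e / (2 * K)"] e K(1) by auto
    have "dist (yn (r n) t) (\<gamma> t) < e" if "n \<ge> N" "t \<in> {0..T}" for n t
    proof -
      have "norm (yn (r n) t - \<gamma> t) \<le> K * (e / (2 * K))"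
        unfolding yn_def \<gamma>_def using N that by (intro K(2) vnc vc) (auto intro: less_imp_le)
      then show ?thesis using K(1) e by (simp add: dist_norm)
    qed
    then show ?thesis by blast
  qed
  \<comment> \<open>The controls were evaluated at the last grid point before \<open>t\<close>.
    Uniform convergence of the paths and continuity of the limit bring these evaluation points to
    \<open>\<gamma> t\<close>.\<close>
  have approx: "(\<lambda>n. yn (r n) (real (nat \<lfloor>t * real (Suc (r n))\<rfloor>) / real (Suc (r n)))) \<longlonglongrightarrow> \<gamma> t"
    if t: "t \<in> {0..T}" for t
  proof (rule tendstoI)
    fix e :: real assume e: "e > 0"
    obtain d where d: "d > 0" "\<And>s. s \<in> {0..T} \<Longrightarrow> dist s t < d \<Longrightarrow> dist (\<gamma> s) (\<gamma> t) < e / 2"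
      using sol(1) t e unfolding continuous_on_iff by (metis half_gt_zero)
    obtain N where N: "\<And>n t. n \<ge> N \<Longrightarrow> t \<in> {0..T} \<Longrightarrow> dist (yn (r n) t) (\<gamma> t) < e / 2"
      using ylim[OF half_gt_zero[OF e]] by blast
    obtain N' where N': "1 / real (Suc N') < d" using d(1) nat_approx_posE by metis
    have "dist (yn (r n) (real (nat \<lfloor>t * real (Suc (r n))\<rfloor>) / real (Suc (r n)))) (\<gamma> t) < e"
      if n: "n \<ge> max N N'" for n
    proof -
      let ?c = "real (Suc (r n))"
      let ?s = "real (nat \<lfloor>t * ?c\<rfloor>) / ?c"
      have c: "?c > 0" by simp
      have "0 \<le> t * ?c" using t by simp
      then have f: "real (nat \<lfloor>t * ?c\<rfloor>) \<le> t * ?c" "t * ?c < real (nat \<lfloor>t * ?c\<rfloor>) + 1" by linarith+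
      have "?s \<le> t" using f(1) c by (simp only: pos_divide_le_eq)
      moreover have "t < ?s + 1 / ?c"
        using f(2) c by (simp only: add_divide_distrib[symmetric] pos_less_divide_eq)
      moreover have "1 / ?c \<le> 1 / real (Suc N')"
        using n seq_suble[OF r, of n] by (intro divide_left_mono) auto
      moreover have "0 \<le> ?s" by simp
      ultimately have s: "?s \<in> {0..T}" "dist ?s t < d" using t N' by (auto simp: dist_real_def)
      have "dist (yn (r n) ?s) (\<gamma> ?s) < e / 2" using N n s by auto
      moreover have "dist (\<gamma> ?s) (\<gamma> t) < e / 2" using d(2) s by blast
      ultimately show ?thesis using dist_triangle_half_r dist_commute by (metis dist_triangle_half_l)
    qed
    then show "\<forall>\<^sub>F n in sequentially. dist (yn (r n) (real (nat \<lfloor>t * real (Suc (r n))\<rfloor>) / real (Suc (r n)))) (\<gamma> t) < e"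
      unfolding eventually_sequentially by blast
  qed
  have un_eq: "un n t = l (yn n (real (nat \<lfloor>t * real (Suc n)\<rfloor>) / real (Suc n)))" for n t
    unfolding un_def st_def by (rule a')
  define cl where "cl t = max 0 (min T t)" for t
  have cl: "cl t \<in> {0..T}" for t using T by (auto simp: cl_def)
  have clT: "cl t = t" if "t \<in> {0..T}" for t using that by (auto simp: cl_def)
  have gc: "continuous_on UNIV (\<lambda>t. \<gamma> (cl t))"
  proof (rule continuous_on_compose2[OF sol(1)])
    show "continuous_on UNIV cl" unfolding cl_def by (intro continuous_intros)
  qed (use cl in auto)
  have lm: "(\<lambda>t. l (\<gamma> (cl t))) \<in> borel_measurable borel"
  proof (rule borel_measurableI_greater)
    fix a
    have "open ((\<lambda>t. \<gamma> (cl t)) -` {y. a < l y})" by (rule open_vimage[OF usc(2) gc])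
    then show "{t \<in> space borel. a < l (\<gamma> (cl t))} \<in> sets borel" by (simp add: vimage_def)
  qed
  have hm: "(\<lambda>t. h (\<gamma> (cl t))) \<in> borel_measurable borel"
  proof (rule borel_measurableI_less)
    fix a
    have "open ((\<lambda>t. \<gamma> (cl t)) -` {y. h y < a})" by (rule open_vimage[OF usc(1) gc])
    then show "{t \<in> space borel. h (\<gamma> (cl t)) < a} \<in> sets borel" by (simp add: vimage_def)
  qed
  have lb: "\<bar>l y\<bar> \<le> R" "\<bar>h y\<bar> \<le> R" for y using bd(1)[of y] bd(2)[of y] bd(3)[of y] by linarith+
  have inc: "integral {s..t} (\<lambda>t. l (\<gamma> (cl t))) \<le> v t - v s \<and> v t - v s \<le> integral {s..t} (\<lambda>t. h (\<gamma> (cl t)))"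
    if st: "0 \<le> s" "s \<le> t" "t \<le> T" for s t
  proof
    have "(\<lambda>n. vn (r n) t - vn (r n) s) \<longlonglongrightarrow> v t - v s"
      using st by (intro tendsto_diff vptw) auto
    then have lim: "(\<lambda>n. integral {s..t} (un (r n))) \<longlonglongrightarrow> v t - v s" using vninc st by simp
    show "v t - v s \<le> integral {s..t} (\<lambda>t. h (\<gamma> (cl t)))"
    proof (rule limsup_integral_le[OF uni unb hm lb(2) _ lim])
      fix z e :: real assume z: "z \<in> {s..t}" "e > 0"
      have "\<forall>\<^sub>F n in sequentially. yn (r n) (real (nat \<lfloor>z * real (Suc (r n))\<rfloor>) / real (Suc (r n))) \<in> {y. h y < h (\<gamma> z) + e}"
        using z st by (intro topological_tendstoD[OF approx usc(1)]) auto
      then show "\<forall>\<^sub>F n in sequentially. un (r n) z < h (\<gamma> (cl z)) + e"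
      proof eventually_elim
        case (elim n)
        then show ?case unfolding un_eq using bd(2) clT[of z] z st by (auto intro: le_less_trans)
      qed
    qed
    \<comment> \<open>The lower bound is the upper one for the negated controls, with lower
      semicontinuity of \<open>l\<close> in place of upper semicontinuity of
      \<open>h\<close>.\<close>
    have "- (v t - v s) \<le> integral {s..t} (\<lambda>t. - l (\<gamma> (cl t)))"
    proof (rule limsup_integral_le[where f="\<lambda>n z. - un (r n) z" and R=R])
      show "(\<lambda>z. - un (r n) z) integrable_on {s..t}" for n by (rule integrable_neg[OF uni])
      show "(\<lambda>n. integral {s..t} (\<lambda>z. - un (r n) z)) \<longlonglongrightarrow> - (v t - v s)"
        using tendsto_minus[OF lim] by simp
      fix z e :: real assume z: "z \<in> {s..t}" "e > 0"
      have "\<forall>\<^sub>F n in sequentially. yn (r n) (real (nat \<lfloor>z * real (Suc (r n))\<rfloor>) / real (Suc (r n))) \<in> {y. l (\<gamma> z) - e < l y}"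
        using z st by (intro topological_tendstoD[OF approx usc(2)]) auto
      then show "\<forall>\<^sub>F n in sequentially. - un (r n) z < - l (\<gamma> (cl z)) + e"
      proof eventually_elim
        case (elim n)
        then show ?case unfolding un_eq using clT[of z] z st by auto
      qed
    qed (use unb lm lb in auto)
    then show "integral {s..t} (\<lambda>t. l (\<gamma> (cl t))) \<le> v t - v s" by simp
  qed
  obtain u where u: "u \<in> borel_measurable borel" "\<And>t. l (\<gamma> (cl t)) \<le> u t" "\<And>t. u t \<le> h (\<gamma> (cl t))"
    "\<And>t. 0 \<le> t \<Longrightarrow> t \<le> T \<Longrightarrow> (u has_integral (v t - v 0)) {0..t}"
    by (rule intermediate_density[OF less_imp_le[OF T] lm hm bd(1) bd(2) bd(3) inc]) blast+
  have ub: "\<bar>u t\<bar> \<le> R" for t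
    using u(2)[of t] u(3)[of t] lb[of "\<gamma> (cl t)"] by linarith
  have g0: "\<gamma> 0 = x" using sol(2)[of 0] T v0 by simp
  show ?thesis
  proof (rule that[of \<gamma> u])
    show "controlled_path \<omega> {0..T} u \<gamma>"
    proof (rule controlled_pathI[OF u(1) ub sol(1)])
      fix t assume t: "t \<in> {0..T}"
      have "integral {0..t} u = v t" using u(4)[of t] t v0 by (simp add: integral_unique)
      then show "\<gamma> t = \<gamma> 0 + integral {0..t} (\<lambda>s. opA \<omega> (\<gamma> s)) + integral {0..t} u *\<^sub>R vecB"
        using sol(2)[OF t] g0 by simp
    qed auto
    show "l (\<gamma> t) \<le> u t \<and> u t \<le> h (\<gamma> t)" if "t \<in> {0..T}" for t
      using u(2)[of t] u(3)[of t] clT[OF that] by simp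
  qed (use g0 u(1) ub in auto)
qed

end

subsection \<open>The nilpotent form of the closed-loop system\<close>

text \<open>Interpolation at \<open>CARD('a)\<close> distinct nodes reproduces \<open>p\<close>.
  Every node polynomial \<open>L k\<close> is monic of degree \<open>CARD('a) - 1\<close>, so the
  sum is the top coefficient of the interpolant.\<close>

lemma lagrange_top_coeff:
  fixes \<mu> :: "'a::finite \<Rightarrow> real" and p :: "real poly"
  assumes inj: "inj \<mu>" and deg: "degree p < CARD('a)"
  shows "(\<Sum>k\<in>UNIV. poly p (\<mu> k) / (\<Prod>i\<in>UNIV - {k}. \<mu> k - \<mu> i)) = coeff p (CARD('a) - 1)"
proof -
  define L where "L k = (\<Prod>i\<in>UNIV - {k}. [:- \<mu> i, 1:])" for k
  have Ld: "degree (L k) = CARD('a) - 1" for k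
    unfolding L_def by (subst degree_prod_sum_eq) (auto simp: card_Diff_singleton)
  have Lm: "coeff (L k) (CARD('a) - 1) = 1" for k
    using lead_coeff_prod[of "\<lambda>i. [:- \<mu> i, 1:]" "UNIV - {k}"] Ld[of k] by (simp add: L_def)
  have Lp: "poly (L k) (\<mu> j) = (if j = k then \<Prod>i\<in>UNIV - {k}. \<mu> k - \<mu> i else 0)" for j k
    by (auto simp: L_def poly_prod)
  have nz: "(\<Prod>i\<in>UNIV - {k}. \<mu> k - \<mu> i) \<noteq> 0" for k
    using inj by (auto simp: inj_def)
  define q where "q = (\<Sum>k\<in>UNIV. smult (poly p (\<mu> k) / (\<Prod>i\<in>UNIV - {k}. \<mu> k - \<mu> i)) (L k))"
  have "p = q"
  proof (rule poly_eqI_degree[of "range \<mu>"])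
    have c: "card (range \<mu>) = CARD('a)" using inj by (simp add: card_image)
    show "degree p < card (range \<mu>)" using deg c by simp
    have "degree q \<le> CARD('a) - 1" unfolding q_def
      by (intro degree_sum_le) (auto intro: order_trans[OF degree_smult_le] simp: Ld)
    then show "degree q < card (range \<mu>)" using c deg by linarith
    fix x assume "x \<in> range \<mu>"
    then obtain j where x: "x = \<mu> j" by blast
    have "poly q (\<mu> j) = (\<Sum>k\<in>UNIV. if k = j then poly p (\<mu> j) else 0)"
      unfolding q_def poly_sum using nz by (intro sum.cong) (auto simp: Lp)
    then show "poly p x = poly q x" by (simp add: x)
  qed
  then have "coeff p (CARD('a) - 1) = coeff q (CARD('a) - 1)" by simp
  also have "\<dots> = (\<Sum>k\<in>UNIV. poly p (\<mu> k) / (\<Prod>i\<in>UNIV - {k}. \<mu> k - \<mu> i))"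
    by (simp add: q_def coeff_sum Lm[simplified])
  finally show ?thesis ..
qed

lemma rowC_simps:
  "rowC \<omega> (x + y) = rowC \<omega> x + rowC \<omega> y" "rowC \<omega> (c *\<^sub>R x) = c * rowC \<omega> x"
  unfolding rowC_def by (simp_all add: distrib_left sum.distrib sum_distrib_left mult.left_commute)

lemma linear_opABC: "linear (opABC \<omega>)"
  by (rule linearI) (simp_all add: opABC_def opA_simps rowC_simps scaleR_add_left scaleR_add_right)

lemma linear_opABC_pow: "linear (opABC \<omega> ^^ k)"
proof (induction k)
  case 0
  show ?case by (simp add: linear_iff)
next
  case (Suc k)
  show ?case unfolding funpow.simps by (rule linear_compose[OF Suc linear_opABC])
qed

lemma pos_bij: "bij_betw (pos :: 'n::finite bit0 \<Rightarrow> nat) UNIV {1..2 * CARD('n)}"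
proof -
  have r: "Rep_bit0 i \<in> {0..<2 * int CARD('n)}" for i :: "'n bit0" by (rule Rep_bit0)
  have inj: "inj (pos :: 'n bit0 \<Rightarrow> nat)"
  proof (rule injI)
    fix i j :: "'n bit0" assume "pos i = pos j"
    then have "Rep_bit0 i = Rep_bit0 j" using r[of i] r[of j] by (auto simp: pos_def)
    then show "i = j" by (simp add: Rep_bit0_inject)
  qed
  have "range (pos :: 'n bit0 \<Rightarrow> nat) \<subseteq> {1..2 * CARD('n)}"
  proof
    fix x assume "x \<in> range (pos :: 'n bit0 \<Rightarrow> nat)"
    then obtain i :: "'n bit0" where i: "x = pos i" by blast
    show "x \<in> {1..2 * CARD('n)}" using r[of i] by (auto simp: i pos_def)
  qed
  moreover have "card (range (pos :: 'n bit0 \<Rightarrow> nat)) = card {1..2 * CARD('n)}"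
    using inj by (simp add: card_image)
  ultimately have "range (pos :: 'n bit0 \<Rightarrow> nat) = {1..2 * CARD('n)}" by (intro card_subset_eq) auto
  with inj show ?thesis by (simp add: bij_betw_def)
qed

lemma sum_pos: "(\<Sum>i\<in>UNIV. f (pos (i :: 'n::finite bit0))) = (\<Sum>p=1..2 * CARD('n). f p)"
  by (rule sum.reindex_bij_betw[OF pos_bij])

lemma pos_ge_1 [simp]: "1 \<le> pos i" "0 < pos i" "pos i \<noteq> 0"
  by (simp_all add: pos_def)

lemma pos_le: "pos (i :: 'n::finite bit0) \<le> 2 * CARD('n)"
  using bij_betwE[OF pos_bij] by force

lemma pos_eq_iff [simp]: "pos i = pos j \<longleftrightarrow> i = j"
  using bij_betw_imp_inj_on[OF pos_bij] by (auto simp: inj_def)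

lemma pos_surj:
  assumes "1 \<le> p" "p \<le> 2 * CARD('n)" obtains i :: "'n::finite bit0" where "pos i = p"
  using bij_betw_imp_surj_on[OF pos_bij] assms by (metis atLeastAtMost_iff imageE)

lemma linear_opD: "linear (opD \<omega>)"
  unfolding opD_def[abs_def] by (rule linearI) (simp_all add: algebra_simps sum.distrib scaleR_sum_right)

locale distinct_oscillators = oscillators \<omega> for \<omega> :: "'n::finite \<Rightarrow> real" +
  assumes inj: "inj \<omega>"
begin

text \<open>The square of \<open>opA \<omega>\<close> multiplies the components of oscillator
  \<open>k\<close> by this number.\<close>

definition mu :: "'n \<Rightarrow> real" where "mu k = - (\<omega> k)\<^sup>2"

definition charF :: "real poly" where "charF = (\<Prod>k\<in>UNIV. [:- mu k, 1:])"

lemma mu_inj: "inj mu"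
proof (rule injI)
  fix i j assume "mu i = mu j"
  then have "\<omega> i = \<omega> j" using pos[of i] pos[of j] by (auto simp: mu_def power2_eq_iff)
  then show "i = j" using inj by (auto simp: inj_def)
qed

lemma N_pos: "0 < CARD('n)" by simp

lemma charF_degree: "degree charF = CARD('n)"
  unfolding charF_def by (subst degree_prod_sum_eq) auto

lemma charF_monic: "coeff charF CARD('n) = 1"
  using lead_coeff_prod[of "\<lambda>k. [:- mu k, 1:]" UNIV] charF_degree by (simp add: charF_def)

lemma charF_root: "poly charF (mu k) = 0"
  by (auto simp: charF_def poly_prod)

text \<open>The partial results of Horner's scheme for \<open>charF\<close>, running from
  \<open>1\<close> to \<open>charF\<close> itself. Their values at \<open>mu k\<close> are the
  velocities in the even iterates of \<open>vecB\<close> under the closed loop.\<close>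

definition horner :: "nat \<Rightarrow> real poly" where "horner j = poly_shift (CARD('n) - j) charF"

lemma horner_0: "horner 0 = 1"
proof (rule poly_eqI)
  fix n
  show "coeff (horner 0) n = coeff 1 n"
  proof (cases "n = 0")
    case False
    then have "coeff charF (n + CARD('n)) = 0" using charF_degree by (intro coeff_eq_0) simp
    then show ?thesis using False by (simp add: horner_def coeff_poly_shift)
  qed (simp add: horner_def coeff_poly_shift charF_monic)
qed

lemma horner_Suc: "j < CARD('n) \<Longrightarrow> horner (Suc j) = pCons (coeff charF (CARD('n) - Suc j)) (horner j)"
  by (rule poly_eqI) (auto simp: horner_def coeff_poly_shift coeff_pCons Suc_diff_Suc split: nat.splits)

lemma horner_N: "horner CARD('n) = charF"
  by (simp add: horner_def)

lemma coeffC_eq: "coeffC \<omega> k = - (mu k ^ CARD('n)) / (\<Prod>i\<in>UNIV - {k}. mu k - mu i)"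
proof -
  have "(\<Prod>i\<in>UNIV - {k}. (\<omega> i)\<^sup>2 - (\<omega> k)\<^sup>2) = (\<Prod>i\<in>UNIV - {k}. mu k - mu i)"
    by (simp add: mu_def)
  moreover have "(-1) ^ (CARD('n) + 1) * \<omega> k ^ (2 * CARD('n)) = - (mu k ^ CARD('n))"
    by (simp add: mu_def power_mult power_minus[of "(\<omega> k)\<^sup>2"])
  ultimately show ?thesis unfolding coeffC_def by (simp add: divide_inverse)
qed

text \<open>Write \<open>charF\<close> as a power of the variable times \<open>horner j\<close> plus
  a remainder \<open>r\<close>. At the roots this gives
  \<open>mu k ^ N * horner j = - (mu k ^ j * r)\<close>, so with the values of \<open>coeffC\<close>
  the sum is a Lagrange sum for \<open>q\<close>, whose top coefficient is read off from
  \<open>r\<close>.\<close>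

lemma sum_coeffC_horner:
  assumes j: "j < CARD('n)"
  shows "(\<Sum>k\<in>UNIV. coeffC \<omega> k * poly (horner j) (mu k)) = coeff charF (CARD('n) - Suc j)"
proof -
  define r where "r = poly_cutoff (CARD('n) - j) charF"
  define q where "q = monom 1 j * r"
  have dec: "charF = monom 1 (CARD('n) - j) * horner j + r"
  proof (rule poly_eqI)
    fix n show "coeff charF n = coeff (monom 1 (CARD('n) - j) * horner j + r) n"
      by (simp add: coeff_monom_mult horner_def r_def coeff_poly_shift coeff_poly_cutoff)
  qed
  have "degree q < CARD('n)"
  proof -
    have "degree r \<le> CARD('n) - j - 1"
      by (rule degree_le) (auto simp: r_def coeff_poly_cutoff)
    moreover have "degree q \<le> degree (monom (1::real) j) + degree r" unfolding q_def by (rule degree_mult_le)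
    ultimately show ?thesis using j by (simp add: degree_monom_eq)
  qed
  have e: "coeffC \<omega> k * poly (horner j) (mu k) = poly q (mu k) / (\<Prod>i\<in>UNIV - {k}. mu k - mu i)" for k
  proof -
    have "0 = mu k ^ (CARD('n) - j) * poly (horner j) (mu k) + poly r (mu k)"
      using charF_root[of k] arg_cong[OF dec, of "\<lambda>p. poly p (mu k)"] by (simp add: poly_monom)
    then have "mu k ^ j * (mu k ^ (CARD('n) - j) * poly (horner j) (mu k)) = - (mu k ^ j * poly r (mu k))"
      by (simp add: eq_neg_iff_add_eq_0 distrib_left[symmetric])
    moreover have "mu k ^ j * mu k ^ (CARD('n) - j) = mu k ^ CARD('n)" using j by (simp flip: power_add)
    ultimately have "mu k ^ CARD('n) * poly (horner j) (mu k) = - poly q (mu k)"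
      by (simp add: q_def poly_monom mult.assoc[symmetric])
    then show ?thesis unfolding coeffC_eq by simp
  qed
  have "\<not> CARD('n) - 1 < j" "CARD('n) - Suc j < CARD('n) - j" "CARD('n) - 1 - j = CARD('n) - Suc j"
    using j by linarith+
  then have "coeff q (CARD('n) - 1) = coeff charF (CARD('n) - Suc j)"
    by (simp add: q_def coeff_monom_mult r_def coeff_poly_cutoff)
  then show ?thesis unfolding e lagrange_top_coeff[OF mu_inj \<open>degree q < CARD('n)\<close>] by simp
qed

text \<open>Two applications of the closed loop multiply the velocities by \<open>mu k\<close> and
  add one common feedback value. By the choice of \<open>coeffC\<close> this value is the next
  coefficient of \<open>charF\<close>, so each pair of applications is a Horner step.\<close>

lemma opABC_pow_B:
  "j \<le> CARD('n) \<Longrightarrow> (opABC \<omega> ^^ (2 * j)) vecB = (\<chi> k. (0, poly (horner j) (mu k)))"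
proof (induction j)
  case 0
  then show ?case by (simp add: vecB_def horner_0)
next
  case (Suc j)
  have "(opABC \<omega> ^^ (2 * Suc j)) vecB = opABC \<omega> (opABC \<omega> (\<chi> k. (0, poly (horner j) (mu k))))"
    using Suc by simp
  also have "opABC \<omega> (\<chi> k. (0, poly (horner j) (mu k))) = (\<chi> k. (poly (horner j) (mu k), 0))"
    by (simp add: opABC_def opA_def rowC_def vec_eq_iff)
  also have "opABC \<omega> (\<chi> k. (poly (horner j) (mu k), 0)) = (\<chi> k. (0, poly (horner (Suc j)) (mu k)))"
    using sum_coeffC_horner[of j] Suc.prems
    by (simp add: opABC_def opA_def rowC_def vec_eq_iff vecB_def horner_Suc) (simp add: mu_def)
  finally show ?case .
qed

lemma opABC_nilpotent: "(opABC \<omega> ^^ (2 * CARD('n))) vecB = 0"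
  by (simp add: opABC_pow_B horner_N charF_root vec_eq_iff zero_prod_def)

text \<open>Otherwise \<open>horner (N - 1)\<close> would vanish at all \<open>mu k\<close>. The
  last Horner step would then force the constant coefficient of \<open>charF\<close> to be zero,
  although it is the product of the squared frequencies.\<close>

lemma opABC_pow_ne_0: "(opABC \<omega> ^^ (2 * CARD('n) - 1)) vecB \<noteq> 0"
proof
  assume z: "(opABC \<omega> ^^ (2 * CARD('n) - 1)) vecB = 0"
  have "(opABC \<omega> ^^ (2 * CARD('n) - 1)) vecB = opABC \<omega> (\<chi> k. (0, poly (horner (CARD('n) - 1)) (mu k)))"
  proof -
    have "2 * CARD('n) - 1 = Suc (2 * (CARD('n) - 1))" using N_pos by linarith
    then show ?thesis using opABC_pow_B[of "CARD('n) - 1"] by simp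
  qed
  also have "\<dots> = (\<chi> k. (poly (horner (CARD('n) - 1)) (mu k), 0))"
    by (simp add: opABC_def opA_def rowC_def vec_eq_iff)
  finally have "poly (horner (CARD('n) - 1)) (mu k) = 0" for k using z by (simp add: vec_eq_iff prod_eq_iff)
  moreover have "charF = pCons (coeff charF 0) (horner (CARD('n) - 1))"
    using horner_Suc[of "CARD('n) - 1"] horner_N N_pos by simp
  ultimately have "coeff charF 0 = 0" using charF_root arg_cong[of charF _ "\<lambda>p. poly p (mu undefined)"]
    by (metis add.right_neutral mult_zero_right poly_pCons)
  moreover have "coeff charF 0 = (\<Prod>k\<in>UNIV. - mu k)"
    by (simp add: charF_def poly_0_coeff_0[symmetric] poly_prod)
  ultimately show False by (simp add: mu_def)
qed

lemma colD_Suc: "opABC \<omega> (colD \<omega> p) = - real p *\<^sub>R colD \<omega> (Suc p)" if p1: "1 \<le> p" for p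
proof -
  obtain m where p: "p = Suc m" using p1 by (cases p) auto
  have c: "(-1) ^ m / fact m = - real (Suc m) * ((-1) ^ Suc m / (fact (Suc m) :: real))"
    by (subst fact_Suc) (simp del: of_nat_Suc)
  have "opABC \<omega> (colD \<omega> p) = ((-1) ^ m / fact m) *\<^sub>R (opABC \<omega> ^^ Suc m) vecB"
    by (simp add: p colD_def linear_scale[OF linear_opABC])
  also have "\<dots> = - real p *\<^sub>R colD \<omega> (Suc p)"
    unfolding c by (simp only: p colD_def scaleR_scaleR diff_Suc_1)
  finally show ?thesis .
qed

lemma colD_zero: "2 * CARD('n) < p \<Longrightarrow> colD \<omega> p = 0"
proof -
  assume p: "2 * CARD('n) < p"
  have "(opABC \<omega> ^^ (2 * CARD('n) + m)) vecB = 0" for m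
    by (induction m) (simp_all add: opABC_nilpotent linear_0[OF linear_opABC])
  from this[of "p - 1 - 2 * CARD('n)"] show ?thesis using p by (simp add: colD_def)
qed

text \<open>The columns are nonzero multiples of the iterates of one vector under a map nilpotent on
  it. The power \<open>2 * N - pos i\<close> sends the first column with nonzero coordinate to the
  last nonzero iterate and kills all later columns.\<close>

lemma opD_eq_0: assumes "opD \<omega> v = 0" shows "v = 0"
proof (rule ccontr)
  assume "v \<noteq> 0"
  then obtain i0 where "v $ i0 \<noteq> 0" by (auto simp: vec_eq_iff)
  define i where "i = arg_min_on pos {i. v $ i \<noteq> 0}"
  have i: "v $ i \<noteq> 0" "\<And>j. v $ j \<noteq> 0 \<Longrightarrow> pos i \<le> pos j"
    using arg_min_if_finite(1)[of "{i. v $ i \<noteq> 0}" pos] arg_min_least[of "{i. v $ i \<noteq> 0}" _ pos] \<open>v $ i0 \<noteq> 0\<close>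
    unfolding i_def by auto
  define k where "k = 2 * CARD('n) - pos i"
  let ?M = "opABC \<omega> ^^ k"
  have "?M (opD \<omega> v) = (\<Sum>j\<in>UNIV. v $ j *\<^sub>R ?M (colD \<omega> (pos j)))"
    unfolding opD_def by (simp add: linear_sum[OF linear_opABC_pow] linear_scale[OF linear_opABC_pow])
  also have "\<dots> = (\<Sum>j\<in>UNIV. if j = i then v $ i *\<^sub>R ?M (colD \<omega> (pos i)) else 0)"
  proof (rule sum.cong[OF refl])
    fix j
    show "v $ j *\<^sub>R ?M (colD \<omega> (pos j)) = (if j = i then v $ i *\<^sub>R ?M (colD \<omega> (pos i)) else 0)"
    proof (cases "j = i \<or> v $ j = 0")
      case False
      then have "pos i < pos j" using i(2)[of j] by (metis le_neq_implies_less pos_eq_iff)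
      then have "2 * CARD('n) \<le> k + (pos j - 1)" using pos_le[of i] by (simp add: k_def)
      then obtain m where m: "k + (pos j - 1) = m + 2 * CARD('n)" by (metis add.commute le_Suc_ex)
      have "?M ((opABC \<omega> ^^ (pos j - 1)) vecB) = (opABC \<omega> ^^ (k + (pos j - 1))) vecB"
        by (simp only: funpow_add o_apply)
      also have "\<dots> = (opABC \<omega> ^^ m) ((opABC \<omega> ^^ (2 * CARD('n))) vecB)"
        unfolding m by (simp only: funpow_add o_apply)
      also have "\<dots> = 0" by (simp add: opABC_nilpotent linear_0[OF linear_opABC_pow])
      finally show ?thesis using False by (simp add: colD_def linear_scale[OF linear_opABC_pow])
    qed auto
  qed
  also have "\<dots> = v $ i *\<^sub>R ?M (colD \<omega> (pos i))" by simp
  also have "?M (colD \<omega> (pos i)) = ((-1) ^ (pos i - 1) / fact (pos i - 1)) *\<^sub>R (opABC \<omega> ^^ (2 * CARD('n) - 1)) vecB"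
  proof -
    have "k + (pos i - 1) = 2 * CARD('n) - 1" using pos_le[of i] pos_ge_1(1)[of i] unfolding k_def by linarith
    moreover have "?M ((opABC \<omega> ^^ (pos i - 1)) vecB) = (opABC \<omega> ^^ (k + (pos i - 1))) vecB"
      by (simp only: funpow_add o_apply)
    ultimately have "?M ((opABC \<omega> ^^ (pos i - 1)) vecB) = (opABC \<omega> ^^ (2 * CARD('n) - 1)) vecB" by simp
    then show ?thesis by (simp add: colD_def linear_scale[OF linear_opABC_pow])
  qed
  finally show False using i(1) opABC_pow_ne_0 assms by (simp add: linear_0[OF linear_opABC_pow])
qed

lemma opD_bij: "bij (opD \<omega>)"
proof -
  have inj: "inj (opD \<omega>)" unfolding linear_injective_0[OF linear_opD] using opD_eq_0 by simp
  have "dim (range (opD \<omega>)) = dim (UNIV :: (real^('n bit0)) set)"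
    by (rule dim_image_eq[OF linear_opD]) (use inj in \<open>auto intro: inj_on_subset\<close>)
  also have "\<dots> = DIM('n state)" by simp
  finally have "span (range (opD \<omega>)) = UNIV" using dim_eq_full[of "range (opD \<omega>)"] by simp
  moreover have "subspace (range (opD \<omega>))" by (rule linear_subspace_image[OF linear_opD subspace_UNIV])
  ultimately have "range (opD \<omega>) = UNIV" using span_eq_iff[of "range (opD \<omega>)"] by simp
  with inj show ?thesis by (simp add: bij_def)
qed

lemma inv_opD [simp]: "opD \<omega> (inv (opD \<omega>) x) = x" "inv (opD \<omega>) (opD \<omega> v) = v"
  using opD_bij by (simp_all add: bij_def surj_f_inv_f inv_f_f)

lemma linear_inv_opD: "linear (inv (opD \<omega>))"
proof (rule linearI)
  fix x y c
  have "opD \<omega> (inv (opD \<omega>) x + inv (opD \<omega>) y) = x + y" by (simp add: linear_add[OF linear_opD])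
  then show "inv (opD \<omega>) (x + y) = inv (opD \<omega>) x + inv (opD \<omega>) y" by (metis inv_opD(2))
  have "opD \<omega> (c *\<^sub>R inv (opD \<omega>) x) = c *\<^sub>R x" by (simp add: linear_scale[OF linear_opD])
  then show "inv (opD \<omega>) (c *\<^sub>R x) = c *\<^sub>R inv (opD \<omega>) x" by (metis inv_opD(2))
qed

lemma inv_opD_eq_0 [simp]: "inv (opD \<omega>) x = 0 \<longleftrightarrow> x = 0"
  by (metis inv_opD linear_0 linear_opD)

end

definition frakA :: "real^('n::finite bit0)^('n bit0)" where
  "frakA = (\<chi> i j. if pos i = pos j + 1 then - real (pos j) else 0)"

context distinct_oscillators
begin

text \<open>The factorials in \<open>colD\<close> produce the weights: column \<open>p\<close> goes
  to \<open>- p\<close> times column \<open>p + 1\<close>. Column \<open>2 * N + 1\<close> is zero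
  by nilpotency, matching the empty last column of \<open>frakA\<close>.\<close>

lemma opABC_opD: "opABC \<omega> (opD \<omega> v) = opD \<omega> (frakA *v v)"
proof -
  have "opABC \<omega> (opD \<omega> v) = (\<Sum>j\<in>UNIV. v $ j *\<^sub>R opABC \<omega> (colD \<omega> (pos j)))"
    unfolding opD_def by (simp add: linear_sum[OF linear_opABC] linear_scale[OF linear_opABC])
  also have "\<dots> = (\<Sum>j\<in>UNIV. \<Sum>i\<in>UNIV. (frakA $ i $ j * v $ j) *\<^sub>R colD \<omega> (pos i))"
  proof (rule sum.cong[OF refl])
    fix j :: "'n bit0"
    have "(\<Sum>i\<in>UNIV. (frakA $ i $ j * v $ j) *\<^sub>R colD \<omega> (pos (i :: 'n bit0)))
      = (\<Sum>i\<in>UNIV. if pos (i :: 'n bit0) = pos j + 1 then (- real (pos j) * v $ j) *\<^sub>R colD \<omega> (pos j + 1) else 0)"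
      by (intro sum.cong) (auto simp: frakA_def)
    also have "\<dots> = (\<Sum>p=1..2 * CARD('n). if p = pos j + 1 then (- real (pos j) * v $ j) *\<^sub>R colD \<omega> (pos j + 1) else 0)"
      by (rule sum_pos)
    also have "\<dots> = (- real (pos j) * v $ j) *\<^sub>R colD \<omega> (pos j + 1)"
      using colD_zero[of "pos j + 1"] by (simp add: sum.delta)
    finally show "v $ j *\<^sub>R opABC \<omega> (colD \<omega> (pos j)) = (\<Sum>i\<in>UNIV. (frakA $ i $ j * v $ j) *\<^sub>R colD \<omega> (pos (i :: 'n bit0)))"
      using colD_Suc[OF pos_ge_1(1)[of j]] by (simp add: mult.commute)
  qed
  also have "\<dots> = opD \<omega> (frakA *v v)"
    unfolding opD_def matrix_vector_mult_def by (subst sum.swap) (simp add: scaleR_sum_left)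
  finally show ?thesis .
qed

lemma opD_frakB: "opD \<omega> frakB = vecB"
proof -
  have "opD \<omega> frakB = (\<Sum>i\<in>UNIV. if pos (i :: 'n bit0) = 1 then colD \<omega> 1 else 0)"
    unfolding opD_def frakB_def by (intro sum.cong) auto
  also have "\<dots> = (\<Sum>p=1..2 * CARD('n). if p = 1 then colD \<omega> 1 else 0)" by (rule sum_pos)
  also have "\<dots> = colD \<omega> 1" using N_pos by (simp add: sum.delta)
  finally show ?thesis by (simp add: colD_def)
qed

end

section \<open>Quadratic forms of the terminal control\<close>

lemma matrix_quadratic:
  "y \<bullet> (M *v z) = (\<Sum>i\<in>UNIV. \<Sum>j\<in>UNIV. y $ i * M $ i $ j * z $ j)" for M :: "real^'m^'k::finite"
  by (simp add: inner_vec_def matrix_vector_mult_def sum_distrib_left mult.assoc)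

text \<open>The Hilbert matrix, that is, the Gram matrix of the monomials on
  \<open>[0, 1]\<close>.\<close>

definition hilb :: "real^('n::finite bit0)^('n bit0)" where
  "hilb = (\<chi> i j. inverse (real (pos i + pos j - 1)))"

definition vec_poly :: "real^('n::finite bit0) \<Rightarrow> real poly" where
  "vec_poly y = (\<Sum>i\<in>UNIV. monom (y $ i) (pos i - 1))"

lemma vec_poly_eq_0: assumes "vec_poly y = 0" shows "y = 0"
proof -
  have "y $ j = 0" for j
  proof -
    have "coeff (vec_poly y) (pos j - 1) = (\<Sum>i\<in>UNIV. if i = j then y $ j else 0)"
      unfolding vec_poly_def coeff_sum
    proof (rule sum.cong[OF refl])
      fix i
      have "pos i - 1 = pos j - 1 \<longleftrightarrow> i = j"
        using pos_ge_1(1)[of i] pos_ge_1(1)[of j] pos_eq_iff[of i j] by linarith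
      then show "coeff (monom (y $ i) (pos i - 1)) (pos j - 1) = (if i = j then y $ j else 0)" by auto
    qed
    then show ?thesis using assms by simp
  qed
  then show ?thesis by (simp add: vec_eq_iff)
qed

lemma poly_vec_poly_square:
  "(poly (vec_poly y) s)\<^sup>2 = (\<Sum>i\<in>UNIV. \<Sum>j\<in>UNIV. y $ i * y $ j * s ^ (pos i + pos j - 2))"
proof -
  have p: "poly (vec_poly y) s = (\<Sum>i\<in>UNIV. y $ i * s ^ (pos i - 1))"
    by (simp add: vec_poly_def poly_sum poly_monom)
  have m: "y $ i * s ^ (pos i - 1) * (y $ j * s ^ (pos j - 1)) = y $ i * y $ j * s ^ (pos i + pos j - 2)" for i j
  proof -
    have "s ^ (pos i - 1) * s ^ (pos j - 1) = s ^ (pos i + pos j - 2)"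
      using pos_ge_1(1)[of i] pos_ge_1(1)[of j] unfolding power_add[symmetric]
      by (intro arg_cong[of _ _ "power s"]) linarith
    then show ?thesis by (simp add: algebra_simps)
  qed
  show ?thesis unfolding p power2_eq_square sum_product m ..
qed

lemma has_integral_power_01: "((\<lambda>s. s ^ k) has_integral (inverse (real (Suc k)))) {0..1::real}"
proof -
  have "((\<lambda>s. s ^ k) has_integral (1 ^ Suc k / real (Suc k) - 0 ^ Suc k / real (Suc k))) {0..1::real}"
  proof (rule fundamental_theorem_of_calculus)
    fix x :: real
    have "((\<lambda>s. s ^ Suc k / real (Suc k)) has_real_derivative (real (Suc k) * x ^ (Suc k - Suc 0)) / real (Suc k)) (at x within {0..1})"
      by (intro DERIV_cdivide has_field_derivative_at_within[OF DERIV_pow])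
    then show "((\<lambda>s. s ^ Suc k / real (Suc k)) has_vector_derivative x ^ k) (at x within {0..1})"
      by (simp add: has_real_derivative_iff_has_vector_derivative[symmetric] del: of_nat_Suc power_Suc)
  qed simp
  then show ?thesis by (simp add: inverse_eq_divide)
qed

lemma hilb_integral: "((\<lambda>s. (poly (vec_poly y) s)\<^sup>2) has_integral (y \<bullet> (hilb *v y))) {0..1}"
proof -
  have "((\<lambda>s. \<Sum>i\<in>UNIV. \<Sum>j\<in>UNIV. y $ i * y $ j * s ^ (pos i + pos j - 2)) has_integral
      (\<Sum>i\<in>UNIV. \<Sum>j\<in>UNIV. y $ i * y $ j * inverse (real (Suc (pos i + pos j - 2))))) {0..1}"
    by (intro has_integral_sum finite has_integral_mult_right has_integral_power_01)
  moreover have "Suc (pos i + pos j - 2) = pos i + pos j - 1" for i j :: "'a bit0"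
    using pos_ge_1(1)[of i] pos_ge_1(1)[of j] by linarith
  ultimately show ?thesis
    unfolding poly_vec_poly_square matrix_quadratic hilb_def by (simp add: ac_simps)
qed

text \<open>Since \<open>1/m - 1/(m+1) = 1/(m (m+1))\<close>, the matrix \<open>frak_q\<close> is
  the Gram matrix of the monomials for the weight \<open>1 - s\<close>. Positivity and comparison
  with \<open>hilb\<close> come from this weight.\<close>

lemma frak_q_integral: "((\<lambda>s. (1 - s) * (poly (vec_poly y) s)\<^sup>2) has_integral (y \<bullet> (frak_q *v y))) {0..1}"
proof -
  have "((\<lambda>s. \<Sum>i\<in>UNIV. \<Sum>j\<in>UNIV. y $ i * y $ j * (s ^ (pos i + pos j - 2) - s ^ (pos i + pos j - 1))) has_integral
      (\<Sum>i\<in>UNIV. \<Sum>j\<in>UNIV. y $ i * y $ j * (inverse (real (Suc (pos i + pos j - 2))) - inverse (real (Suc (pos i + pos j - 1)))))) {0..1}"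
    by (intro has_integral_sum finite has_integral_mult_right has_integral_diff has_integral_power_01)
  moreover have "(\<Sum>i\<in>UNIV. \<Sum>j\<in>UNIV. y $ i * y $ j * (s ^ (pos i + pos j - 2) - s ^ (pos i + pos j - 1))) = (1 - s) * (poly (vec_poly y) s)\<^sup>2" for s
  proof -
    have "s ^ (pos i + pos j - 2) - s ^ (pos i + pos j - 1) = (1 - s) * s ^ (pos i + pos j - 2)" for i j :: "'a bit0"
    proof -
      have "pos i + pos j - 1 = Suc (pos i + pos j - 2)" using pos_ge_1(1)[of i] pos_ge_1(1)[of j] by linarith
      then show ?thesis by (simp add: algebra_simps)
    qed
    then show ?thesis unfolding poly_vec_poly_square sum_distrib_left by (simp add: mult.commute mult.left_commute)
  qed
  moreover have "inverse (real (Suc (pos i + pos j - 2))) - inverse (real (Suc (pos i + pos j - 1))) = frak_q $ i $ j" for i j :: "'a bit0"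
  proof -
    define m where "m = pos i + pos j - 1"
    have m: "m \<ge> 1" "Suc (pos i + pos j - 2) = m" "Suc (pos i + pos j - 1) = m + 1" "pos i + pos j = m + 1"
      using pos_ge_1(1)[of i] pos_ge_1(1)[of j] unfolding m_def by linarith+
    have "inverse (real m) - inverse (real (m + 1)) = inverse (real (m + 1) * (real (m + 1) - 1))"
      using m(1) by (simp add: field_simps)
    then show ?thesis using m by (simp add: frak_q_def)
  qed
  ultimately show ?thesis
    unfolding matrix_quadratic by (simp add: mult.commute mult.left_commute)
qed

lemma frak_q_le_hilb: "y \<bullet> (frak_q *v y) \<le> y \<bullet> (hilb *v y)"
proof (rule has_integral_le[OF frak_q_integral hilb_integral])
  fix s :: real assume "s \<in> {0..1}"
  then show "(1 - s) * (poly (vec_poly y) s)\<^sup>2 \<le> (poly (vec_poly y) s)\<^sup>2"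
    by (intro mult_left_le_one_le) auto
qed

text \<open>If the form were zero, the polynomial of \<open>y\<close> would vanish on
  \<open>[0, 1)\<close>, where the weight is positive, and so would have infinitely many
  roots.\<close>

lemma frak_q_pos: assumes "y \<noteq> 0" shows "y \<bullet> (frak_q *v y) > 0"
proof -
  let ?f = "\<lambda>s. (1 - s) * (poly (vec_poly y) s)\<^sup>2"
  have nn: "0 \<le> y \<bullet> (frak_q *v y)" by (rule has_integral_nonneg[OF frak_q_integral]) auto
  moreover have "y \<bullet> (frak_q *v y) \<noteq> 0"
  proof
    assume z: "y \<bullet> (frak_q *v y) = 0"
    have i0: "(?f has_integral 0) (cbox 0 1)" using frak_q_integral[of y] z by simp
    have "?f s = 0" if "s \<in> {0..1}" for s
    proof (rule has_integral_0_cbox_imp_0[OF _ _ i0])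
      show "continuous_on (cbox 0 1) ?f" by (intro continuous_intros)
      show "box 0 (1::real) \<noteq> {}" by simp
    qed (use that in auto)
    then have "poly (vec_poly y) s = 0" if "s \<in> {0..<1}" for s using that by force
    then have "{0..<1} \<subseteq> {s. poly (vec_poly y) s = 0}" by blast
    moreover have "infinite {0..<1::real}" by (simp add: infinite_Ico)
    ultimately have "infinite {s. poly (vec_poly y) s = 0}" by (meson finite_subset)
    then have "vec_poly y = 0" using poly_roots_finite by blast
    then show False using vec_poly_eq_0 assms by blast
  qed
  ultimately show ?thesis by linarith
qed

lemma frakQ: "frak_q ** (frakQ :: real^('n::finite bit0)^('n bit0)) = mat 1" "frakQ ** (frak_q :: real^('n bit0)^('n bit0)) = mat 1"
proof -
  have "frak_q *v y = 0 \<Longrightarrow> y = 0" for y :: "real^('n bit0)" using frak_q_pos[of y] by (metis inner_zero_right less_irrefl)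
  then have "\<exists>B. B ** (frak_q :: real^('n bit0)^('n bit0)) = mat 1" by (simp add: matrix_left_invertible_ker)
  then have "invertible (frak_q :: real^('n bit0)^('n bit0))" by (simp add: invertible_left_inverse)
  then show "frak_q ** (frakQ :: real^('n bit0)^('n bit0)) = mat 1" "frakQ ** (frak_q :: real^('n bit0)^('n bit0)) = mat 1"
    using someI_ex[of "\<lambda>A'. (frak_q :: real^('n bit0)^('n bit0)) ** A' = mat 1 \<and> A' ** frak_q = mat 1"]
    unfolding frakQ_def matrix_inv_def invertible_def by auto
qed

lemma frak_q_frakQ [simp]: "frak_q *v (frakQ *v w) = w" "frakQ *v (frak_q *v w) = w"
  by (simp_all add: matrix_vector_mul_assoc frakQ)

lemma frak_q_sym: "(frak_q *v x) \<bullet> y = x \<bullet> (frak_q *v y)"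
proof -
  have "transpose frak_q = (frak_q :: real^('a bit0)^('a bit0))"
    by (simp add: transpose_def frak_q_def vec_eq_iff add.commute)
  then show ?thesis by (metis dot_lmul_matrix vector_transpose_matrix)
qed

lemma frakQ_sym: "(frakQ *v x) \<bullet> y = x \<bullet> (frakQ *v y)"
  using frak_q_sym[of "frakQ *v x" "frakQ *v y"] by simp

lemma frakQ_pos: assumes "w \<noteq> 0" shows "(frakQ *v w) \<bullet> w > 0"
proof -
  have "frakQ *v w \<noteq> 0" using assms frak_q_frakQ(1)[of w] by (metis matrix_vector_mult_0_right)
  from frak_q_pos[OF this] show ?thesis by simp
qed

text \<open>The generator of the dilations: \<open>T\<close> times the derivative of
  \<open>delta T *v v\<close> in \<open>T\<close> is \<open>- D1 (delta T *v v)\<close>.\<close>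

definition D1 :: "real^('n::finite bit0) \<Rightarrow> real^('n bit0)" where "D1 v = (\<chi> i. real (pos i) * v $ i)"

text \<open>Symmetrization produces the weight \<open>pos i + pos j\<close>, which cancels one of
  the two factors in the denominator of \<open>frak_q\<close>.\<close>

lemma D1_hilb: "2 * (y \<bullet> D1 (frak_q *v y)) = y \<bullet> (hilb *v y)"
proof -
  have e: "real (pos i) * (frak_q $ i $ j) + real (pos j) * frak_q $ j $ i = hilb $ i $ j" for i j :: "'a bit0"
  proof -
    define m where "m = pos i + pos j - 1"
    have m: "m \<ge> 1" "pos i + pos j = m + 1" "pos i + pos j - Suc 0 = m"
      using pos_ge_1(1)[of i] pos_ge_1(1)[of j] unfolding m_def by linarith+
    have "real (pos i) * (frak_q $ i $ j) + real (pos j) * frak_q $ j $ i = real (pos i + pos j) * frak_q $ i $ j"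
      by (simp add: frak_q_def add.commute distrib_right)
    also have "\<dots> = hilb $ i $ j"
    proof -
      have "real (m + 1) * inverse (real (m + 1) * real m) = inverse (real m)"
        unfolding inverse_mult_distrib mult.assoc[symmetric] by (subst right_inverse) auto
      then show ?thesis unfolding frak_q_def hilb_def vec_lambda_beta m(2) add_diff_cancel_right' .
    qed
    finally show ?thesis .
  qed
  have 1: "y \<bullet> D1 (frak_q *v y) = (\<Sum>i\<in>UNIV. \<Sum>j\<in>UNIV. y $ i * y $ j * (real (pos i) * frak_q $ i $ j))"
    by (simp add: inner_vec_def D1_def matrix_vector_mult_def sum_distrib_left algebra_simps)
  also have "\<dots> = (\<Sum>i\<in>UNIV. \<Sum>j\<in>UNIV. y $ i * y $ j * (real (pos j) * frak_q $ j $ i))"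
    by (subst sum.swap) (simp add: mult.commute)
  finally have "2 * (y \<bullet> D1 (frak_q *v y)) = (\<Sum>i\<in>UNIV. \<Sum>j\<in>UNIV. y $ i * y $ j * hilb $ i $ j)"
    using 1 unfolding e[symmetric] by (simp add: distrib_left sum.distrib)
  then show ?thesis unfolding matrix_quadratic by (simp add: mult.commute mult.left_commute)
qed

text \<open>The matrix \<open>frak_q\<close> solves \<open>A q + q A\<^sup>* + D1 q + q D1 = B B\<^sup>*\<close>.\<close>

lemma lyapunov_entry:
  "(frakA ** frak_q) $ i $ j + (frakA ** frak_q) $ j $ i + real (pos i + pos j) * frak_q $ i $ j
     = (if pos i = 1 \<and> pos j = 1 then 1 else (0::real))" for i j :: "'n::finite bit0"
proof -
  have Aq: "(frakA ** frak_q) $ i $ j = - (real (pos i) - 1) / ((real (pos i + pos j) - 1) * (real (pos i + pos j) - 2))" for i j :: "'n bit0"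
  proof (cases "pos i = 1")
    case True
    then have "(frakA ** frak_q) $ i $ j = 0"
      unfolding matrix_matrix_mult_def frakA_def by (auto intro!: sum.neutral)
    then show ?thesis using True by simp
  next
    case False
    then obtain k :: "'n bit0" where k: "pos k = pos i - 1"
      using pos_surj[of "pos i - 1"] pos_le[of i] pos_ge_1(1)[of i] by (metis Suc_leI diff_le_self le_neq_implies_less order_trans zero_less_diff One_nat_def)
    then have k': "pos i = pos k + 1" using False pos_ge_1(1)[of i] by linarith
    have "(frakA ** frak_q) $ i $ j = (\<Sum>l\<in>UNIV. if l = k then - real (pos k) * frak_q $ k $ j else 0)"
      unfolding matrix_matrix_mult_def vec_lambda_beta
      by (rule sum.cong) (use k' in \<open>auto simp: frakA_def\<close>)
    also have "\<dots> = - real (pos k) * frak_q $ k $ j" by simp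
    also have "\<dots> = - (real (pos i) - 1) / ((real (pos i + pos j) - 1) * (real (pos i + pos j) - 2))"
    proof -
      have "real (pos k + pos j - Suc 0) = real (pos k) + real (pos j) - 1"
        using pos_ge_1(1)[of k] by (simp add: of_nat_diff)
      then show ?thesis by (simp add: frak_q_def k' divide_inverse)
    qed
    finally show ?thesis .
  qed
  define m where "m = pos i + pos j"
  have m: "m \<ge> 2" "pos i + pos j = m" "pos j + pos i = m"
    using pos_ge_1(1)[of i] pos_ge_1(1)[of j] by (simp_all add: m_def)
  have s: "(frakA ** frak_q) $ i $ j + (frakA ** frak_q) $ j $ i = - (real m - 2) / ((real m - 1) * (real m - 2))"
    unfolding Aq m add_divide_distrib[symmetric] using m(2) by (simp add: m(2)[symmetric])
  have f: "real (pos i + pos j) * frak_q $ i $ j = 1 / (real m - 1)"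
    unfolding frak_q_def vec_lambda_beta m using m(1) by (simp add: divide_inverse)
  show ?thesis
  \<comment> \<open>For \<open>m = 2\<close> the fraction in \<open>s\<close> is
    \<open>0 / 0\<close>, which is \<open>0\<close>, and \<open>f\<close> contributes
    \<open>1\<close>: the corner entry. In all other cases the two fractions cancel.\<close>
  proof (cases "m = 2")
    case True
    then have "pos i = 1 \<and> pos j = 1" using pos_ge_1(1)[of i] pos_ge_1(1)[of j] by (simp add: m_def)
    then show ?thesis unfolding s f using True by simp
  next
    case False
    then have "\<not> (pos i = 1 \<and> pos j = 1)" by (auto simp: m_def)
    moreover have "real m - 2 \<noteq> 0" "real m - 1 \<noteq> 0" using False m(1) by auto
    ultimately show ?thesis unfolding s f by (simp add: divide_simps)
  qed
qed

lemma sum_frakB: "(\<Sum>i\<in>UNIV. y $ i * (if pos i = 1 then c else 0)) = (y \<bullet> frakB) * (c::real)" for y :: "real^('n::finite bit0)"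
  unfolding inner_vec_def frakB_def sum_distrib_right by (intro sum.cong) auto

lemma lyapunov:
  "2 * (y \<bullet> (frakA *v (frak_q *v y))) + 2 * (y \<bullet> D1 (frak_q *v y)) = (y \<bullet> frakB)\<^sup>2"
proof -
  let ?S = "\<lambda>f. \<Sum>i\<in>UNIV. \<Sum>j\<in>UNIV. y $ i * y $ j * f i j"
  have 1: "y \<bullet> (frakA *v (frak_q *v y)) = ?S (\<lambda>i j. (frakA ** frak_q) $ i $ j)"
    unfolding matrix_vector_mul_assoc matrix_quadratic by (simp add: mult.commute mult.left_commute)
  also have 2: "\<dots> = ?S (\<lambda>i j. (frakA ** frak_q) $ j $ i)"
    by (subst sum.swap) (simp add: mult.commute)
  finally have A: "2 * (y \<bullet> (frakA *v (frak_q *v y))) = ?S (\<lambda>i j. (frakA ** frak_q) $ i $ j) + ?S (\<lambda>i j. (frakA ** frak_q) $ j $ i)"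
    using 1 by simp
  have D: "2 * (y \<bullet> D1 (frak_q *v y)) = ?S (\<lambda>i j. real (pos i + pos j) * frak_q $ i $ j)"
  proof -
    have d: "y \<bullet> D1 (frak_q *v y) = ?S (\<lambda>i j. real (pos i) * frak_q $ i $ j)"
      by (simp add: inner_vec_def D1_def matrix_vector_mult_def sum_distrib_left algebra_simps)
    also have "\<dots> = ?S (\<lambda>i j. real (pos j) * frak_q $ i $ j)"
      by (subst sum.swap) (simp add: mult.commute frak_q_def add.commute)
    finally show ?thesis using d by (simp add: distrib_left distrib_right sum.distrib)
  qed
  have "2 * (y \<bullet> (frakA *v (frak_q *v y))) + 2 * (y \<bullet> D1 (frak_q *v y))
     = ?S (\<lambda>i j. (frakA ** frak_q) $ i $ j + (frakA ** frak_q) $ j $ i + real (pos i + pos j) * frak_q $ i $ j)"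
    unfolding A D by (simp add: distrib_left sum.distrib)
  also have "\<dots> = (\<Sum>i\<in>UNIV. \<Sum>j\<in>UNIV. y $ i * y $ j * (if pos i = 1 \<and> pos j = 1 then 1 else 0))"
    unfolding lyapunov_entry ..
  also have "\<dots> = (\<Sum>i\<in>UNIV. y $ i * (if pos i = 1 then y \<bullet> frakB else 0))"
  proof (rule sum.cong[OF refl])
    fix i
    have "(\<Sum>j\<in>UNIV. y $ i * y $ j * (if pos i = 1 \<and> pos j = 1 then 1 else 0)) = (if pos i = 1 then y $ i else 0) * (\<Sum>j\<in>UNIV. y $ j * (if pos j = 1 then 1 else 0))"
      unfolding sum_distrib_left by (intro sum.cong) auto
    also have "\<dots> = y $ i * (if pos i = 1 then y \<bullet> frakB else 0)" unfolding sum_frakB by simp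
    finally show "(\<Sum>j\<in>UNIV. y $ i * y $ j * (if pos i = 1 \<and> pos j = 1 then 1 else 0)) = y $ i * (if pos i = 1 then y \<bullet> frakB else 0)" .
  qed
  also have "\<dots> = (y \<bullet> frakB)\<^sup>2" unfolding sum_frakB by (simp add: power2_eq_square)
  finally show ?thesis .
qed

text \<open>Taking the trace of the Lyapunov equation multiplied by \<open>frakQ\<close> gives the corner entry of \<open>frakQ\<close>.\<close>

lemma frakQ_corner: "(frakQ *v frakB) \<bullet> (frakB :: real^('n::finite bit0)) = 2 * real CARD('n) * (2 * real CARD('n) + 1)"
proof -
  let ?Q = "frakQ :: real^('n bit0)^('n bit0)" and ?q = "frak_q :: real^('n bit0)^('n bit0)"
    and ?A = "frakA :: real^('n bit0)^('n bit0)"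
  let ?S = "\<lambda>f. \<Sum>i\<in>UNIV. \<Sum>j\<in>UNIV. ?Q $ i $ j * f i j"
  have Qs: "?Q $ i $ j = ?Q $ j $ i" for i j
    using frakQ_sym[of "axis j 1" "axis i 1"]
    by (simp add: matrix_vector_mul_component inner_axis inner_axis' matrix_vector_mult_basis column_def)
  have Qq: "(\<Sum>j\<in>UNIV. ?Q $ i $ j * ?q $ j $ k) = (if i = k then 1 else 0)" for i k
    using frakQ(2)[where 'n='n] by (simp add: vec_eq_iff matrix_matrix_mult_def mat_def)
  have qs: "?q $ i $ j = ?q $ j $ i" for i j by (simp add: frak_q_def add.commute)
  \<comment> \<open>Since \<open>?Q\<close> inverts \<open>?q\<close>, this is the trace of
    \<open>?A\<close>, whose diagonal is zero. The dilation terms likewise each give the trace of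
    \<open>D1\<close>, the sum of \<open>1\<close> to \<open>2 * N\<close>.\<close>
  have tA: "?S (\<lambda>i j. (?A ** ?q) $ i $ j) = 0"
  proof -
    have "?S (\<lambda>i j. (?A ** ?q) $ i $ j) = (\<Sum>i\<in>UNIV. \<Sum>k\<in>UNIV. ?A $ i $ k * (\<Sum>j\<in>UNIV. ?Q $ i $ j * ?q $ j $ k))"
      unfolding matrix_matrix_mult_def vec_lambda_beta sum_distrib_left
      by (rule sum.cong[OF refl], subst sum.swap) (simp add: qs mult.commute mult.left_commute)
    also have "\<dots> = (\<Sum>i\<in>UNIV. \<Sum>k\<in>UNIV. ?A $ i $ k * (if i = k then 1 else 0))" unfolding Qq ..
    also have "\<dots> = 0" by (intro sum.neutral ballI) (auto simp: frakA_def)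
    finally show ?thesis .
  qed
  have tA': "?S (\<lambda>i j. (frakA ** ?q) $ j $ i) = 0"
    using tA by (subst sum.swap) (simp add: Qs)
  have tD1: "?S (\<lambda>i j. real (pos i) * ?q $ i $ j) = (\<Sum>i\<in>UNIV. real (pos (i :: 'n bit0)))"
  proof (rule sum.cong[OF refl])
    fix i :: "'n bit0"
    have "(\<Sum>j\<in>UNIV. ?Q $ i $ j * (real (pos i) * ?q $ i $ j)) = real (pos i) * (\<Sum>j\<in>UNIV. ?Q $ i $ j * ?q $ j $ i)"
      unfolding sum_distrib_left by (intro sum.cong) (auto simp: qs)
    then show "(\<Sum>j\<in>UNIV. ?Q $ i $ j * (real (pos i) * ?q $ i $ j)) = real (pos i)" unfolding Qq by simp
  qed
  have tD2: "?S (\<lambda>i j. real (pos j) * ?q $ i $ j) = (\<Sum>i\<in>UNIV. real (pos (i :: 'n bit0)))"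
    using tD1 by (subst sum.swap) (simp add: Qs qs)
  have gauss: "(\<Sum>i\<in>UNIV. real (pos (i :: 'n bit0))) = real CARD('n) * (2 * real CARD('n) + 1)"
  proof -
    have "(\<Sum>i\<in>UNIV. real (pos (i :: 'n bit0))) = (\<Sum>p=1..2 * CARD('n). real p)" by (rule sum_pos)
    also have "\<dots> = real (2 * CARD('n)) * (real (2 * CARD('n)) + 1) / 2"
    proof -
      have "(\<Sum>p=1..k. real p) = real k * (real k + 1) / 2" for k :: nat
        by (induction k) (auto simp: field_simps)
      then show ?thesis .
    qed
    finally show ?thesis by simp
  qed
  have "?S (\<lambda>i j. if pos i = 1 \<and> pos j = 1 then 1 else 0) = ?S (\<lambda>i j. (frakA ** ?q) $ i $ j) + ?S (\<lambda>i j. (frakA ** ?q) $ j $ i)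
      + (?S (\<lambda>i j. real (pos i) * ?q $ i $ j) + ?S (\<lambda>i j. real (pos j) * ?q $ i $ j))"
    unfolding lyapunov_entry[symmetric] by (simp add: distrib_left distrib_right sum.distrib)
  also have "\<dots> = 2 * real CARD('n) * (2 * real CARD('n) + 1)" unfolding tA tA' tD1 tD2 gauss by simp
  finally have "?S (\<lambda>i j. if pos i = 1 \<and> pos j = 1 then 1 else 0) = 2 * real CARD('n) * (2 * real CARD('n) + 1)" .
  moreover have "frakB \<bullet> (?Q *v frakB) = ?S (\<lambda>i j. if pos i = 1 \<and> pos j = 1 then 1 else 0)"
    unfolding matrix_quadratic by (intro sum.cong) (auto simp: frakB_def)
  ultimately show ?thesis by (simp add: inner_commute)
qed

lemma delta_mult: "(delta T *v v) $ i = v $ i / T ^ pos i"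
proof -
  have "(\<Sum>j\<in>UNIV. (if i = j then inverse (T ^ pos i) else 0) * v $ j) = (\<Sum>j\<in>UNIV. if j = i then v $ i / T ^ pos i else 0)"
    by (intro sum.cong) (auto simp: divide_inverse)
  then show ?thesis by (simp add: delta_def matrix_vector_mult_def)
qed

definition ctrl_form :: "real \<Rightarrow> real^('n::finite bit0) \<Rightarrow> real" where
  "ctrl_form T v = (frakQ *v (delta T *v v)) \<bullet> (delta T *v v)"

lemma kappa_sq: "(kappa TYPE('n::finite))\<^sup>2 = inverse (2 * real CARD('n) * (2 * real CARD('n) + 1))" "(kappa TYPE('n::finite))\<^sup>2 > 0"
  by (simp_all add: kappa_def)

lemma delta_mult_nz: "T > 0 \<Longrightarrow> v \<noteq> 0 \<Longrightarrow> delta T *v v \<noteq> 0"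
  by (auto simp: vec_eq_iff delta_mult)

lemma ctrl_form_pos: "T > 0 \<Longrightarrow> v \<noteq> 0 \<Longrightarrow> ctrl_form T v > 0"
  unfolding ctrl_form_def by (intro frakQ_pos delta_mult_nz)

lemma quadratic_derivative:
  fixes w :: "real \<Rightarrow> real^('n::finite bit0)"
  assumes "(w has_vector_derivative w') (at t within S)"
  shows "((\<lambda>s. (frakQ *v w s) \<bullet> w s) has_real_derivative (2 * ((frakQ *v w t) \<bullet> w'))) (at t within S)"
proof -
  have "((\<lambda>s. frakQ *v w s) has_vector_derivative frakQ *v w') (at t within S)"
    by (rule bounded_linear.has_vector_derivative[OF matrix_vector_mul_bounded_linear assms])
  from bounded_bilinear.has_vector_derivative[OF bounded_bilinear_inner this assms]
  moreover have "(frakQ *v w') \<bullet> w t = (frakQ *v w t) \<bullet> w'" by (metis frakQ_sym inner_commute)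
  ultimately show ?thesis
    unfolding has_real_derivative_iff_has_vector_derivative by simp
qed

lemma delta_derivative:
  fixes v :: "real \<Rightarrow> real^('n::finite bit0)"
  assumes \<tau>: "(\<tau> has_real_derivative \<tau>') (at t within S)" "\<tau> t > 0" and v: "(v has_vector_derivative v') (at t within S)"
  shows "((\<lambda>s. delta (\<tau> s) *v v s) has_vector_derivative delta (\<tau> t) *v v' - (\<tau>' / \<tau> t) *\<^sub>R D1 (delta (\<tau> t) *v v t)) (at t within S)"
proof (rule has_vector_derivative_vec_lambda)
  fix i :: "'n bit0"
  obtain m where m: "pos i = Suc m" by (cases "pos i") auto
  have "((\<lambda>s. v s $ i) has_real_derivative v' $ i) (at t within S)"
    unfolding has_real_derivative_iff_has_vector_derivative
    by (rule bounded_linear.has_vector_derivative[OF bounded_linear_vec_nth v])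
  from DERIV_quotient[OF this DERIV_power[OF \<tau>(1), of "pos i"]]
  have "((\<lambda>s. v s $ i / \<tau> s ^ pos i) has_real_derivative
     (v' $ i * \<tau> t ^ pos i - real (pos i) * (\<tau>' * \<tau> t ^ (pos i - Suc 0)) * v t $ i) / (\<tau> t ^ pos i)\<^sup>2) (at t within S)"
    using \<tau>(2) by (simp add: power2_eq_square)
  moreover have "(v' $ i * \<tau> t ^ pos i - real (pos i) * (\<tau>' * \<tau> t ^ (pos i - Suc 0)) * v t $ i) / (\<tau> t ^ pos i)\<^sup>2
     = v' $ i / \<tau> t ^ pos i - \<tau>' / \<tau> t * (real (pos i) * (v t $ i / \<tau> t ^ pos i))"
    using \<tau>(2) unfolding m by (simp add: field_simps power2_eq_square del: of_nat_Suc)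
  ultimately show "((\<lambda>s. (delta (\<tau> s) *v v s) $ i) has_vector_derivative
      (delta (\<tau> t) *v v' - (\<tau>' / \<tau> t) *\<^sub>R D1 (delta (\<tau> t) *v v t)) $ i) (at t within S)"
    unfolding has_real_derivative_iff_has_vector_derivative[symmetric] delta_mult by (simp add: D1_def delta_mult)
qed

text \<open>The Hilbert form dominates the form of \<open>frak_q\<close>, hence \<open>T * ctrl_form T v\<close> decreases.
  This makes \<open>frakT\<close> depend continuously on its argument, with an explicit estimate.\<close>

lemma ctrl_form_decreasing:
  assumes "0 < a" "a \<le> b"
  shows "b * ctrl_form b v \<le> a * ctrl_form a v"
proof (rule DERIV_nonpos_imp_nonincreasing[OF assms(2)])
  fix T assume T: "a \<le> T" "T \<le> b"
  then have T0: "T > 0" using assms by simp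
  let ?w = "delta T *v v"
  let ?y = "frakQ *v ?w"
  have "((\<lambda>s. delta s *v v) has_vector_derivative delta T *v 0 - (1 / T) *\<^sub>R D1 ?w) (at T)"
    using delta_derivative[of "\<lambda>s. s" 1 T UNIV "\<lambda>_. v" 0] T0 by simp
  from quadratic_derivative[OF this]
  have "((\<lambda>s. ctrl_form s v) has_real_derivative 2 * (?y \<bullet> (- (1 / T) *\<^sub>R D1 ?w))) (at T)"
    by (simp add: ctrl_form_def[abs_def])
  then have "((\<lambda>s. s * ctrl_form s v) has_real_derivative (1 * ctrl_form T v + 2 * (?y \<bullet> (- (1 / T) *\<^sub>R D1 ?w)) * T)) (at T)"
    by (intro DERIV_mult DERIV_ident)
  moreover have "1 * ctrl_form T v + 2 * (?y \<bullet> (- (1 / T) *\<^sub>R D1 ?w)) * T \<le> 0"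
  proof -
    have "1 * ctrl_form T v + 2 * (?y \<bullet> (- (1 / T) *\<^sub>R D1 ?w)) * T = ?y \<bullet> (frak_q *v ?y) - 2 * (?y \<bullet> D1 (frak_q *v ?y))"
      using T0 by (simp add: ctrl_form_def)
    also have "\<dots> \<le> 0" unfolding D1_hilb using frak_q_le_hilb[of ?y] by simp
    finally show ?thesis .
  qed
  ultimately show "\<exists>y. ((\<lambda>s. s * ctrl_form s v) has_real_derivative y) (at T) \<and> y \<le> 0" by blast
qed

lemma continuous_ctrl_form_T: "continuous_on {0<..} (\<lambda>T. ctrl_form T v)"
proof -
  have "continuous_on {0<..} (\<lambda>T. delta T *v v)"
  proof -
    have "delta T *v v = (\<chi> i. v $ i / T ^ pos i)" for T by (simp add: vec_eq_iff delta_mult)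
    then show ?thesis by (auto intro!: continuous_intros)
  qed
  then show ?thesis unfolding ctrl_form_def
    by (intro continuous_on_inner linear_continuous_on_compose[OF _ matrix_vector_mul_linear])
qed

text \<open>Monotonicity of \<open>T * ctrl_form T v\<close> supplies values on both sides of the
  level for the intermediate value theorem, and makes the solution unique, because on the level set
  that product is a multiple of \<open>T\<close>.\<close>

lemma frakT_props:
  fixes v :: "real^('n::finite bit0)"
  assumes "v \<noteq> 0"
  shows "frakT v > 0" "ctrl_form (frakT v) v = (kappa TYPE('n))\<^sup>2"
proof -
  let ?k = "(kappa TYPE('n))\<^sup>2" and ?f = "ctrl_form 1 v"
  have k: "?k > 0" by (rule kappa_sq)
  have f: "?f > 0" using assms by (simp add: ctrl_form_pos)
  \<comment> \<open>Comparison with \<open>T = 1\<close> gives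
    \<open>ctrl_form b v \<le> ?f / b\<close> and \<open>ctrl_form a v \<ge> ?f / a\<close>, so
    these end points enclose the level \<open>?k\<close>.\<close>
  define a b where "a = min 1 (?f / ?k)" and "b = max 1 (?f / ?k)"
  have ab: "0 < a" "a \<le> 1" "1 \<le> b" "a \<le> ?f / ?k" "?f / ?k \<le> b" using k f by (auto simp: a_def b_def)
  have "b * ctrl_form b v \<le> ?f" using ctrl_form_decreasing[of 1 b v] ab by simp
  also have "?f \<le> b * ?k" using ab(5) k by (simp add: field_simps)
  finally have hb: "ctrl_form b v \<le> ?k" using ab by simp
  have "a * ?k \<le> ?f" using ab(4) k by (simp add: field_simps)
  also have "?f \<le> a * ctrl_form a v" using ctrl_form_decreasing[of a 1 v] ab by simp
  finally have ha: "?k \<le> ctrl_form a v" using ab by simp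
  have "continuous_on {a..b} (\<lambda>T. ctrl_form T v)"
    by (rule continuous_on_subset[OF continuous_ctrl_form_T]) (use ab in auto)
  then obtain T where T: "a \<le> T" "T \<le> b" "ctrl_form T v = ?k"
    using IVT2'[of "\<lambda>T. ctrl_form T v" b ?k a] ha hb ab by auto
  have T0: "T > 0" using T ab by simp
  have u: "T' = T" if "T' > 0" "ctrl_form T' v = ?k" for T'
  proof (cases "T' \<le> T")
    case True
    then show ?thesis using ctrl_form_decreasing[of T' T v] that T(3) k by simp
  next
    case False
    then show ?thesis using ctrl_form_decreasing[of T T' v] T0 that T(3) k by simp
  qed
  have "(THE T. T > 0 \<and> ctrl_form T v = ?k) = T" 
    using T0 T(3) by (intro the_equality conjI) (auto intro: u)
  then have "frakT v = T" using assms by (simp add: frakT_def ctrl_form_def)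
  then show "frakT v > 0" "ctrl_form (frakT v) v = ?k" using T0 T(3) by auto
qed

lemma frakT_0 [simp]: "frakT 0 = 0"
  by (simp add: frakT_def)

lemma frakT_nonneg: "0 \<le> frakT v"
  using frakT_props(1)[of v] by (cases "v = 0") auto

text \<open>Monotonicity between \<open>\<tau>\<close> and \<open>frakT v\<close> bounds the error
  in \<open>T\<close> by the error in the form. This takes the role of the implicit function theorem
  for the continuity and the derivative of \<open>frakT\<close>.\<close>

lemma frakT_estimate:
  fixes v :: "real^('n::finite bit0)"
  assumes "v \<noteq> 0" "\<tau> > 0"
  shows "\<bar>frakT v - \<tau>\<bar> \<le> \<tau> / (kappa TYPE('n))\<^sup>2 * \<bar>ctrl_form \<tau> v - (kappa TYPE('n))\<^sup>2\<bar>"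
proof -
  let ?k = "(kappa TYPE('n))\<^sup>2"
  have k: "?k > 0" by (rule kappa_sq)
  note p = frakT_props[OF assms(1)]
  have "\<bar>frakT v - \<tau>\<bar> * ?k \<le> \<tau> * \<bar>ctrl_form \<tau> v - ?k\<bar>"
  proof (cases "\<tau> \<le> frakT v")
    case True
    have "frakT v * ?k \<le> \<tau> * ctrl_form \<tau> v" using ctrl_form_decreasing[OF assms(2) True, of v] p by simp
    then have "(frakT v - \<tau>) * ?k \<le> \<tau> * (ctrl_form \<tau> v - ?k)" by (simp add: algebra_simps)
    also have "\<dots> \<le> \<tau> * \<bar>ctrl_form \<tau> v - ?k\<bar>" using assms(2) by (intro mult_left_mono) auto
    finally show ?thesis using True by simp
  next
    case False
    have "\<tau> * ctrl_form \<tau> v \<le> frakT v * ?k" using ctrl_form_decreasing[of "frakT v" \<tau> v] p False by simp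
    then have "(\<tau> - frakT v) * ?k \<le> \<tau> * (?k - ctrl_form \<tau> v)" by (simp add: algebra_simps)
    also have "\<dots> \<le> \<tau> * \<bar>ctrl_form \<tau> v - ?k\<bar>" using assms(2) by (intro mult_left_mono) auto
    finally show ?thesis using False by simp
  qed
  then show ?thesis using k by (simp add: field_simps)
qed

text \<open>The region is described by one continuous form at the fixed value
  \<open>\<Theta>\<close>; its closedness then includes the origin, where continuity of
  \<open>frakT\<close> is not established.\<close>

lemma frakT_le_iff:
  fixes v :: "real^('n::finite bit0)"
  assumes "\<Theta> > 0"
  shows "frakT v \<le> \<Theta> \<longleftrightarrow> ctrl_form \<Theta> v \<le> (kappa TYPE('n))\<^sup>2"
proof (cases "v = 0")
  case True
  then show ?thesis using assms by (simp add: ctrl_form_def)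
next
  case False
  let ?k = "(kappa TYPE('n))\<^sup>2"
  have k: "?k > 0" by (rule kappa_sq)
  note p = frakT_props[OF False]
  show ?thesis
  proof
    assume le: "frakT v \<le> \<Theta>"
    have "\<Theta> * ctrl_form \<Theta> v \<le> frakT v * ?k" using ctrl_form_decreasing[OF p(1) le, of v] p by simp
    also have "\<dots> \<le> \<Theta> * ?k" using le k by (intro mult_right_mono) auto
    finally show "ctrl_form \<Theta> v \<le> ?k" using assms by simp
  next
    assume le: "ctrl_form \<Theta> v \<le> ?k"
    show "frakT v \<le> \<Theta>"
    proof (rule ccontr)
      assume n: "\<not> frakT v \<le> \<Theta>"
      then have "frakT v * ?k \<le> \<Theta> * ctrl_form \<Theta> v" using ctrl_form_decreasing[OF assms, of "frakT v" v] p by simp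
      also have "\<dots> \<le> \<Theta> * ?k" using le assms by (intro mult_left_mono) auto
      finally show False using k n by simp
    qed
  qed
qed

lemma continuous_ctrl_form_v: "continuous_on UNIV (ctrl_form T)"
  unfolding ctrl_form_def[abs_def]
  by (intro continuous_on_inner linear_continuous_on_compose[OF _ matrix_vector_mul_linear] continuous_on_id)

lemma isCont_frakT:
  fixes v :: "real^('n::finite bit0)"
  assumes "v \<noteq> 0" shows "isCont frakT v"
proof -
  let ?k = "(kappa TYPE('n))\<^sup>2" and ?\<tau> = "frakT v"
  note p = frakT_props[OF assms]
  have "isCont (ctrl_form ?\<tau>) v" using continuous_ctrl_form_v[of ?\<tau>, unfolded continuous_on_eq_continuous_at[OF open_UNIV]] by blast
  then have "((\<lambda>x. ?\<tau> / ?k * \<bar>ctrl_form ?\<tau> x - ?k\<bar>) \<longlongrightarrow> ?\<tau> / ?k * \<bar>ctrl_form ?\<tau> v - ?k\<bar>) (at v)"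
    unfolding isCont_def by (intro tendsto_intros)
  then have l: "((\<lambda>x. ?\<tau> / ?k * \<bar>ctrl_form ?\<tau> x - ?k\<bar>) \<longlongrightarrow> 0) (at v)" by (simp add: p)
  have "\<forall>\<^sub>F x in at v. x \<noteq> 0" using t1_space_nhds[OF assms] by (simp add: eventually_at_filter eventually_mono)
  then have "\<forall>\<^sub>F x in at v. norm (frakT x - ?\<tau>) \<le> ?\<tau> / ?k * \<bar>ctrl_form ?\<tau> x - ?k\<bar>"
    by eventually_elim (use frakT_estimate p in auto)
  from Lim_null_comparison[OF this l] show ?thesis unfolding isCont_def by (simp add: LIM_zero_iff)
qed

lemma isCont_frak_u:
  fixes v :: "real^('n::finite bit0)"
  assumes "v \<noteq> 0" shows "isCont frak_u v"
proof -
  have e: "frak_u = (\<lambda>x. \<Sum>i\<in>UNIV. frakC $ i * (x $ i / frakT x ^ pos (i :: 'n bit0)))"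
    by (rule ext) (simp add: frak_u_def inner_vec_def delta_mult)
  have "isCont (\<lambda>x. \<Sum>i\<in>UNIV. frakC $ i * (x $ i / frakT x ^ pos (i :: 'n bit0))) v"
    using frakT_props(1)[OF assms] by (intro continuous_intros isCont_frakT assms) auto
  then show ?thesis by (simp only: e)
qed

lemma frakC_inner: "frakC \<bullet> w = - (1 / 2) * (frakB \<bullet> (frakQ *v w))"
  by (simp add: frakC_def dot_lmul_matrix)

lemma frak_u_0 [simp]: "frak_u 0 = 0"
  by (simp add: frak_u_def)

text \<open>Cauchy-Schwarz in the form of \<open>frakQ\<close> bounds the square of \<open>b\<close>
  by \<open>kappa\<close> squared times the corner entry of \<open>frakQ\<close>. The value of
  \<open>kappa\<close> makes this product \<open>1\<close>, and the control is
  \<open>- b / 2\<close>.\<close>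

lemma frak_u_le: "\<bar>frak_u (v :: real^('n::finite bit0))\<bar> \<le> 1 / 2"
proof (cases "v = 0")
  case False
  let ?k = "(kappa TYPE('n))\<^sup>2"
  define w where "w = delta (frakT v) *v v"
  have wk: "(frakQ *v w) \<bullet> w = ?k" using frakT_props(2)[OF False] by (simp add: ctrl_form_def w_def)
  define b where "b = (frakB :: real^('n bit0)) \<bullet> (frakQ *v w)"
  define c where "c = (frakQ *v frakB) \<bullet> (frakB :: real^('n bit0))"
  have c: "c * ?k = 1" "c > 0"
  proof -
    have X: "2 * real CARD('n) * (2 * real CARD('n) + 1) > 0" by (simp add: add_pos_pos)
    then show "c > 0" unfolding c_def frakQ_corner .
    show "c * ?k = 1" unfolding c_def frakQ_corner kappa_sq(1) using X by (intro right_inverse) linarith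
  qed
  \<comment> \<open>The factor \<open>b / c\<close> minimizes the form along the direction
    \<open>frakB\<close>.\<close>
  have "0 \<le> (frakQ *v (w - (b / c) *\<^sub>R frakB)) \<bullet> (w - (b / c) *\<^sub>R frakB)"
    using frakQ_pos[of "w - (b / c) *\<^sub>R frakB"] by (cases "w - (b / c) *\<^sub>R frakB = 0") auto
  also have "\<dots> = ?k - 2 * (b / c) * b + (b / c)\<^sup>2 * c"
  proof -
    have "(frakQ *v w) \<bullet> frakB = b" by (simp add: b_def inner_commute)
    moreover have "(frakQ *v frakB) \<bullet> w = b" by (simp add: b_def frakQ_sym)
    ultimately show ?thesis
      by (simp add: matrix_vector_mult_diff_distrib matrix_vector_mult_scaleR inner_diff_left inner_diff_right wk c_def[symmetric] power2_eq_square algebra_simps)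
  qed
  also have "\<dots> = ?k - b\<^sup>2 / c" using c(2) by (simp add: power2_eq_square field_simps)
  finally have "b\<^sup>2 \<le> ?k * c" using c(2) by (simp add: field_simps)
  then have "b\<^sup>2 \<le> 1" using c(1) by (simp add: mult.commute)
  then have "\<bar>b\<bar> \<le> 1" by (simp add: abs_square_le_1)
  moreover have "frak_u v = - (1 / 2) * b" unfolding frak_u_def w_def[symmetric] frakC_inner b_def ..
  ultimately show ?thesis by simp
qed simp

lemma delta_frakA: "T > 0 \<Longrightarrow> delta T *v (frakA *v v) = (1 / T) *\<^sub>R (frakA *v (delta T *v v))"
proof -
  assume T: "T > 0"
  have "(frakA *v v) $ i / T ^ pos i = 1 / T * (frakA *v (delta T *v v)) $ i" for i
    unfolding matrix_vector_mult_def[of frakA] vec_lambda_beta sum_divide_distrib sum_distrib_left delta_mult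
    by (intro sum.cong) (use T in \<open>auto simp: frakA_def\<close>)
  then show ?thesis by (simp add: vec_eq_iff delta_mult)
qed

lemma delta_frakB: "T > 0 \<Longrightarrow> delta T *v frakB = (1 / T) *\<^sub>R frakB"
  by (simp add: vec_eq_iff delta_mult frakB_def)

text \<open>The candidate \<open>\<tau> s = \<tau>0 - (s - t)\<close> solves the level equation to
  first order at \<open>t\<close>: by the Lyapunov equation drift and dilation contribute the square
  of \<open>y \<bullet> frakB\<close>, and the feedback \<open>- (y \<bullet> frakB) / 2\<close>
  cancels it. \<open>frakT_estimate\<close> then shows that \<open>frakT (v s)\<close> differs from
  \<open>\<tau> s\<close> by a higher order term.\<close>

lemma frakT_derivative:
  fixes v :: "real \<Rightarrow> real^('n::finite bit0)"
  assumes v: "(v has_vector_derivative frakA *v v t + frak_u (v t) *\<^sub>R frakB) (at t within S)"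
    and nz: "v t \<noteq> 0" "\<And>s. s \<in> S \<Longrightarrow> v s \<noteq> 0"
  shows "((\<lambda>s. frakT (v s)) has_real_derivative -1) (at t within S)"
proof -
  let ?k = "(kappa TYPE('n))\<^sup>2"
  have k: "?k > 0" by (rule kappa_sq)
  define \<tau>0 where "\<tau>0 = frakT (v t)"
  have \<tau>0: "\<tau>0 > 0" "ctrl_form \<tau>0 (v t) = ?k" using frakT_props[OF nz(1)] by (auto simp: \<tau>0_def)
  define \<tau> where "\<tau> s = \<tau>0 - (s - t)" for s
  have \<tau>t: "\<tau> t = \<tau>0" by (simp add: \<tau>_def)
  define w where "w = delta \<tau>0 *v v t"
  define y where "y = frakQ *v w"
  have wy: "w = frak_q *v y" by (simp add: y_def)
  have \<tau>d: "(\<tau> has_real_derivative -1) (at t within S)"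
    unfolding \<tau>_def by (auto intro!: derivative_eq_intros)
  have "((\<lambda>s. delta (\<tau> s) *v v s) has_vector_derivative delta \<tau>0 *v (frakA *v v t + frak_u (v t) *\<^sub>R frakB) - (- 1 / \<tau>0) *\<^sub>R D1 w) (at t within S)"
    using delta_derivative[OF \<tau>d _ v] \<tau>0(1) by (simp add: \<tau>t w_def)
  from quadratic_derivative[OF this]
  have "((\<lambda>s. ctrl_form (\<tau> s) (v s)) has_real_derivative
     2 * (y \<bullet> (delta \<tau>0 *v (frakA *v v t + frak_u (v t) *\<^sub>R frakB) - (- 1 / \<tau>0) *\<^sub>R D1 w))) (at t within S)"
    by (simp add: ctrl_form_def[abs_def] y_def w_def \<tau>t)
  also have "2 * (y \<bullet> (delta \<tau>0 *v (frakA *v v t + frak_u (v t) *\<^sub>R frakB) - (- 1 / \<tau>0) *\<^sub>R D1 w)) = 0"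
  proof -
    have u: "frak_u (v t) = - (1 / 2) * (y \<bullet> frakB)"
      unfolding frak_u_def \<tau>0_def[symmetric] w_def[symmetric] frakC_inner by (simp add: y_def inner_commute)
    have "delta \<tau>0 *v (frakA *v v t + frak_u (v t) *\<^sub>R frakB) - (- 1 / \<tau>0) *\<^sub>R D1 w
       = (1 / \<tau>0) *\<^sub>R (frakA *v w + frak_u (v t) *\<^sub>R frakB + D1 w)"
      using \<tau>0(1) by (simp add: matrix_vector_right_distrib matrix_vector_mult_scaleR delta_frakA delta_frakB w_def[symmetric] scaleR_add_right)
    then have "2 * (y \<bullet> (delta \<tau>0 *v (frakA *v v t + frak_u (v t) *\<^sub>R frakB) - (- 1 / \<tau>0) *\<^sub>R D1 w))
       = (1 / \<tau>0) * (2 * (y \<bullet> (frakA *v w)) + 2 * (y \<bullet> D1 w) + 2 * (frak_u (v t) * (y \<bullet> frakB)))"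
      by (simp add: inner_add_right algebra_simps)
    also have "2 * (y \<bullet> (frakA *v w)) + 2 * (y \<bullet> D1 w) = (y \<bullet> frakB)\<^sup>2"
      unfolding wy by (rule lyapunov)
    also have "(1 / \<tau>0) * ((y \<bullet> frakB)\<^sup>2 + 2 * (frak_u (v t) * (y \<bullet> frakB))) = 0"
      unfolding u by (simp add: power2_eq_square)
    finally show ?thesis .
  qed
  finally have \<psi>: "((\<lambda>s. ctrl_form (\<tau> s) (v s)) has_real_derivative 0) (at t within S)" .
  have q: "((\<lambda>s. \<bar>ctrl_form (\<tau> s) (v s) - ?k\<bar> / \<bar>s - t\<bar>) \<longlongrightarrow> 0) (at t within S)"
  proof -
    have "((\<lambda>s. (ctrl_form (\<tau> s) (v s) - ctrl_form (\<tau> t) (v t)) / (s - t)) \<longlongrightarrow> 0) (at t within S)"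
      using \<psi> by (simp add: has_field_derivative_iff)
    then have "((\<lambda>s. \<bar>(ctrl_form (\<tau> s) (v s) - ctrl_form (\<tau> t) (v t)) / (s - t)\<bar>) \<longlongrightarrow> 0) (at t within S)"
      by (rule tendsto_rabs_zero)
    then show ?thesis by (simp add: \<tau>t \<tau>0(2))
  qed
  have "((\<lambda>s. (\<bar>\<tau> s\<bar> / ?k) * (\<bar>ctrl_form (\<tau> s) (v s) - ?k\<bar> / \<bar>s - t\<bar>)) \<longlongrightarrow> (\<bar>\<tau> t\<bar> / ?k) * 0) (at t within S)"
  proof (rule tendsto_mult[OF _ q])
    have "continuous (at t within S) \<tau>" unfolding \<tau>_def by (intro continuous_intros)
    then show "((\<lambda>s. \<bar>\<tau> s\<bar> / ?k) \<longlongrightarrow> \<bar>\<tau> t\<bar> / ?k) (at t within S)"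
      unfolding continuous_within using k by (intro tendsto_intros) auto
  qed
  then have H: "((\<lambda>s. (\<bar>\<tau> s\<bar> / ?k) * (\<bar>ctrl_form (\<tau> s) (v s) - ?k\<bar> / \<bar>s - t\<bar>)) \<longlongrightarrow> 0) (at t within S)" by simp
  have "((\<lambda>s. frakT (v s)) has_derivative (*) (-1)) (at t within S)"
  proof (rule has_derivativeI_sandwich[OF \<tau>0(1) _ _ H])
    show "bounded_linear ((*) (- 1 :: real))" by (rule bounded_linear_mult_right)
    fix s assume s: "s \<in> S" "s \<noteq> t" "dist s t < \<tau>0"
    have \<tau>s: "\<tau> s > 0" using s(3) by (auto simp: \<tau>_def dist_real_def)
    have "\<bar>frakT (v s) - \<tau> s\<bar> \<le> \<tau> s / ?k * \<bar>ctrl_form (\<tau> s) (v s) - ?k\<bar>"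
      using frakT_estimate[OF nz(2)[OF s(1)] \<tau>s] .
    moreover have "frakT (v s) - frakT (v t) - (-1) * (s - t) = frakT (v s) - \<tau> s"
      by (simp add: \<tau>_def \<tau>0_def)
    ultimately have "\<bar>frakT (v s) - frakT (v t) - (-1) * (s - t)\<bar> \<le> \<tau> s / ?k * \<bar>ctrl_form (\<tau> s) (v s) - ?k\<bar>" by simp
    then have "\<bar>frakT (v s) - frakT (v t) - (-1) * (s - t)\<bar> / \<bar>s - t\<bar> \<le> (\<tau> s / ?k * \<bar>ctrl_form (\<tau> s) (v s) - ?k\<bar>) / \<bar>s - t\<bar>"
      by (intro divide_right_mono) auto
    then show "norm (frakT (v s) - frakT (v t) - (-1) * (s - t)) / norm (s - t) \<le> (\<bar>\<tau> s\<bar> / ?k) * (\<bar>ctrl_form (\<tau> s) (v s) - ?k\<bar> / \<bar>s - t\<bar>)"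
      using \<tau>s by simp
  qed
  then show ?thesis by (simp add: has_field_derivative_def)
qed

section \<open>Motion under the terminal control\<close>

context distinct_oscillators
begin

lemma bounded_linear_inv_opD: "bounded_linear (inv (opD \<omega>))"
  using linear_inv_opD linear_conv_bounded_linear by blast

lemma bounded_linear_opD: "bounded_linear (opD \<omega>)"
  using linear_opD linear_conv_bounded_linear by blast

text \<open>Away from the origin the feedback is continuous along the path, so in canonical
  coordinates the path is continuously differentiable and \<open>frakT (v s) + s\<close> has
  derivative zero.\<close>

lemma terminal_motion_frakT:
  assumes cp: "controlled_path \<omega> {0..a} u \<gamma>" and a: "0 \<le> a" and c: "continuous_on {0..a} \<gamma>"
    and N: "negligible N" "\<And>s. s \<in> {0..a} - N \<Longrightarrow> u s = terminal_control \<omega> (\<gamma> s)"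
    and nz: "\<And>s. s \<in> {0..a} \<Longrightarrow> \<gamma> s \<noteq> 0" and t: "t \<in> {0..a}"
  shows "frakT (inv (opD \<omega>) (\<gamma> t)) = frakT (inv (opD \<omega>) (\<gamma> 0)) - t"
proof -
  define v where "v s = inv (opD \<omega>) (\<gamma> s)" for s
  have vnz: "v s \<noteq> 0" if "s \<in> {0..a}" for s using nz[OF that] by (simp add: v_def)
  have vc: "continuous_on {0..a} v" unfolding v_def by (rule bounded_linear.continuous_on[OF bounded_linear_inv_opD c])
  have uc: "continuous_on {0..a} (\<lambda>s. frak_u (v s))"
  proof (rule continuous_on_compose2[OF _ vc, of "- {0}"])
    show "continuous_on (- {0}) frak_u"
      by (intro continuous_at_imp_continuous_on ballI isCont_frak_u) auto
  qed (use vnz in auto)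
  let ?g = "\<lambda>s. frakA *v v s + frak_u (v s) *\<^sub>R frakB"
  have gc: "continuous_on {0..a} ?g"
    by (intro continuous_intros uc linear_continuous_on_compose[OF vc matrix_vector_mul_linear])
  have e: "opD \<omega> (?g s) = opA \<omega> (\<gamma> s) + u s *\<^sub>R vecB" if "s \<in> {0..a} - N" for s
  proof -
    have "opD \<omega> (?g s) = opABC \<omega> (\<gamma> s) + frak_u (v s) *\<^sub>R vecB"
      by (simp add: linear_add[OF linear_opD] linear_scale[OF linear_opD] opABC_opD[symmetric] opD_frakB v_def)
    also have "\<dots> = opA \<omega> (\<gamma> s) + u s *\<^sub>R vecB"
      using N(2)[OF that] by (simp add: opABC_def terminal_control_def v_def scaleR_add_left)
    finally show ?thesis .
  qed
  have veq: "v t = v 0 + integral {0..t} ?g" if t: "t \<in> {0..a}" for t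
  proof -
    have gi: "?g integrable_on {0..t}"
      using t by (intro integrable_continuous_real continuous_on_subset[OF gc]) auto
    have "\<gamma> t = \<gamma> 0 + integral {0..t} (\<lambda>s. opA \<omega> (\<gamma> s) + u s *\<^sub>R vecB)"
      using cp t unfolding controlled_path_def by blast
    also have "integral {0..t} (\<lambda>s. opA \<omega> (\<gamma> s) + u s *\<^sub>R vecB) = integral {0..t} (\<lambda>s. opD \<omega> (?g s))"
      by (rule integral_spike[OF N(1)]) (use e t in auto)
    also have "\<dots> = opD \<omega> (integral {0..t} ?g)"
      using integral_linear[OF gi bounded_linear_opD] by (simp add: o_def)
    finally show ?thesis unfolding v_def
      by (simp add: linear_add[OF linear_inv_opD])
  qed
  have vd: "(v has_vector_derivative ?g s) (at s within {0..a})" if s: "s \<in> {0..a}" for s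
  proof -
    have "((\<lambda>t. v 0 + integral {0..t} ?g) has_vector_derivative 0 + ?g s) (at s within {0..a})"
      by (intro has_vector_derivative_add has_vector_derivative_const integral_has_vector_derivative gc s)
    then have "((\<lambda>t. v 0 + integral {0..t} ?g) has_vector_derivative ?g s) (at s within {0..a})" by simp
    from has_vector_derivative_transform[OF s _ this] show ?thesis using veq by blast
  qed
  have "((\<lambda>s. frakT (v s) + s) has_real_derivative (-1 + 1)) (at s within {0..a})" if s: "s \<in> {0..a}" for s
    by (intro DERIV_add DERIV_ident frakT_derivative vd s vnz) auto
  then have "((\<lambda>s. frakT (v s) + s) has_field_derivative 0) (at s within {0..a})" if "s \<in> {0..a}" for s using that by simp
  then obtain c where "\<And>s. s \<in> {0..a} \<Longrightarrow> frakT (v s) + s = c"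
    using has_field_derivative_zero_constant[of "{0..a}" "\<lambda>s. frakT (v s) + s"] by auto
  from this[of t] this[of 0] show ?thesis using t a by (simp add: v_def)
qed

lemma regionG_iff: "x \<in> regionG \<omega> \<Theta> \<longleftrightarrow> frakT (inv (opD \<omega>) x) \<le> \<Theta>"
  unfolding regionG_def by (metis (mono_tags, lifting) imageE image_eqI inv_opD mem_Collect_eq)

lemma zero_in_regionG: "\<Theta> > 0 \<Longrightarrow> 0 \<in> regionG \<omega> \<Theta>"
  by (simp add: regionG_iff linear_0[OF linear_inv_opD])

lemma closed_regionG:
  assumes "\<Theta> > 0" shows "closed (regionG \<omega> \<Theta>)"
proof -
  have "regionG \<omega> \<Theta> = {x. ctrl_form \<Theta> (inv (opD \<omega>) x) \<le> (kappa TYPE('n))\<^sup>2}"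
    by (auto simp: regionG_iff frakT_le_iff[OF assms])
  moreover have "continuous_on UNIV (\<lambda>x. ctrl_form \<Theta> (inv (opD \<omega>) x))"
    by (rule continuous_on_compose2[OF continuous_ctrl_form_v])
      (auto intro: bounded_linear.continuous_on[OF bounded_linear_inv_opD] continuous_on_id)
  ultimately show ?thesis by (auto intro!: closed_Collect_le continuous_intros)
qed

text \<open>One half of the admissible range goes to \<open>frak_u\<close>, the other to the linear
  feedback; this is the purpose of the smallness of \<open>\<Theta>\<close>.\<close>

lemma terminal_control_le:
  assumes "regionG \<omega> \<Theta> \<subseteq> {x. \<bar>rowC \<omega> x\<bar> \<le> 1 / 2}" "x \<in> regionG \<omega> \<Theta>"
  shows "\<bar>terminal_control \<omega> x\<bar> \<le> 1"
proof -
  have "\<bar>rowC \<omega> x\<bar> \<le> 1 / 2" using assms by auto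
  then show ?thesis using frak_u_le[of "inv (opD \<omega>) x"] unfolding terminal_control_def by linarith
qed

lemma continuous_on_rowC: "continuous_on S (rowC \<omega>)"
  unfolding rowC_def[abs_def] by (intro continuous_intros)

lemma isCont_terminal_control:
  assumes "x \<noteq> 0" shows "isCont (terminal_control \<omega>) x"
proof -
  have "isCont (inv (opD \<omega>)) x" by (rule linear_continuous_at[OF bounded_linear_inv_opD])
  moreover have "isCont frak_u (inv (opD \<omega>) x)" using assms by (intro isCont_frak_u) simp
  ultimately have "isCont (\<lambda>x. frak_u (inv (opD \<omega>) x)) x" by (rule isCont_o2)
  moreover have "isCont (rowC \<omega>) x" using continuous_on_rowC[of UNIV] by (simp add: continuous_on_eq_continuous_at)
  ultimately show ?thesis unfolding terminal_control_def[abs_def] by (rule isCont_add)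
qed

lemma terminal_control_0 [simp]: "terminal_control \<omega> 0 = 0"
  by (simp add: terminal_control_def linear_0[OF linear_inv_opD] rowC_def)

end

lemma AE_lebesgue_on_iff_negligible:
  assumes "S \<in> sets lebesgue"
  shows "(AE x in lebesgue_on S. P x) \<longleftrightarrow> (\<exists>N. negligible N \<and> (\<forall>x\<in>S - N. P x))"
proof
  assume "AE x in lebesgue_on S. P x"
  then have "AE x in lebesgue. x \<in> S \<longrightarrow> P x" using assms by (subst (asm) AE_restrict_space_iff) auto
  then obtain N where "negligible N" "\<And>x. x \<notin> N \<Longrightarrow> x \<in> S \<longrightarrow> P x"
    unfolding eventually_ae_filter negligible_iff_null_sets by auto
  then show "\<exists>N. negligible N \<and> (\<forall>x\<in>S - N. P x)" by blast
next
  assume "\<exists>N. negligible N \<and> (\<forall>x\<in>S - N. P x)"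
  then obtain N where N: "negligible N" "\<forall>x\<in>S - N. P x" by blast
  have "AE x in lebesgue. x \<notin> N" using N(1) unfolding negligible_iff_null_sets by (rule AE_not_in)
  then have "AE x in lebesgue. x \<in> S \<longrightarrow> P x" by eventually_elim (use N(2) in blast)
  then show "AE x in lebesgue_on S. P x" using assms by (subst AE_restrict_space_iff) auto
qed

lemma first_hit:
  fixes \<gamma> :: "real \<Rightarrow> 'a::topological_space"
  assumes c: "continuous_on {0..T} \<gamma>" and S: "closed S" and t: "t \<in> {0..T}" "\<gamma> t \<in> S"
  obtains \<tau> where "\<tau> \<in> {0..T}" "\<tau> \<le> t" "\<gamma> \<tau> \<in> S" "\<And>s. 0 \<le> s \<Longrightarrow> s < \<tau> \<Longrightarrow> \<gamma> s \<notin> S"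
proof -
  let ?A = "{0..T} \<inter> \<gamma> -` S"
  have "closed ?A" using c S by (simp add: continuous_on_closed_vimage Int_commute)
  then have "compact ?A" by (auto simp: compact_eq_bounded_closed intro: bounded_Int bounded_closed_interval)
  moreover have "?A \<noteq> {}" using t by auto
  ultimately obtain \<tau> where \<tau>: "\<tau> \<in> ?A" "\<And>s. s \<in> ?A \<Longrightarrow> \<tau> \<le> s" using compact_attains_inf[of ?A] by blast
  have "\<gamma> s \<notin> S" if "0 \<le> s" "s < \<tau>" for s using \<tau>(2)[of s] \<tau>(1) that by force
  with \<tau> t show ?thesis by (intro that[of \<tau>]) auto
qed

lemma integral_shift_real:
  fixes f :: "real \<Rightarrow> 'a::euclidean_space"
  assumes "f integrable_on {s..s+t}"
  shows "(\<lambda>r. f (s + r)) integrable_on {0..t}" "integral {0..t} (\<lambda>r. f (s + r)) = integral {s..s+t} f"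
proof -
  have "(f has_integral integral {s..s+t} f) (cbox s (s + t))"
    using assms by (simp add: integrable_integral)
  from has_integral_affinity'[OF this, of 1 s]
  have "((\<lambda>r. f (s + r)) has_integral integral {s..s+t} f) {0..t}" by (simp add: add.commute)
  then show "(\<lambda>r. f (s + r)) integrable_on {0..t}" "integral {0..t} (\<lambda>r. f (s + r)) = integral {s..s+t} f"
    by (auto simp: integrable_on_def integral_unique)
qed

section \<open>Restricting, shifting, scaling and gluing paths\<close>

lemma controlled_path_subset:
  assumes "controlled_path \<omega> J u \<gamma>" "K \<subseteq> J"
  shows "controlled_path \<omega> K u \<gamma>"
  using assms measurable_restrict_mono[of u lebesgue J borel K] unfolding controlled_path_def by blast

lemma controlled_path_continuous:
  assumes "controlled_path \<omega> {0..T} u \<gamma>" "0 \<le> T"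
  shows "continuous_on {0..T} \<gamma>"
proof -
  let ?f = "\<lambda>s. opA \<omega> (\<gamma> s) + u s *\<^sub>R vecB"
  have "?f integrable_on {0..T}"
    using assms unfolding controlled_path_def by (auto intro: set_lebesgue_integral_eq_integral(1))
  then have "continuous_on {0..T} (\<lambda>t. \<gamma> 0 + integral {0..t} ?f)"
    by (intro continuous_intros indefinite_integral_continuous_1)
  moreover have "\<gamma> t = \<gamma> 0 + integral {0..t} ?f" if "t \<in> {0..T}" for t
    using assms(1) that unfolding controlled_path_def by blast
  ultimately show ?thesis by (rule continuous_on_eq[OF _ sym])
qed

lemma controlled_path_shift:
  fixes \<gamma> :: "real \<Rightarrow> 'n::finite state"
  assumes cp: "controlled_path \<omega> {0..s+t} u \<gamma>" and st: "0 \<le> s" "0 \<le> t"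
  shows "controlled_path \<omega> {0..t} (\<lambda>r. u (s + r)) (\<lambda>r. \<gamma> (s + r))"
proof -
  let ?f = "\<lambda>s. opA \<omega> (\<gamma> s) + u s *\<^sub>R vecB"
  have f: "?f absolutely_integrable_on {0..r}" "\<gamma> r = \<gamma> 0 + integral {0..r} ?f" if "r \<in> {0..s+t}" for r
    using cp that unfolding controlled_path_def by blast+
  have fs: "?f absolutely_integrable_on {s..s+r}" if "r \<in> {0..t}" for r
    by (rule absolutely_integrable_on_subinterval[OF f(1)[of "s + r"]]) (use that st in auto)
  have c: "continuous_on {0..s+t} \<gamma>" using cp st by (intro controlled_path_continuous) auto
  have shift: "(\<lambda>r. g (s + r)) integrable_on {0..r}" if "g integrable_on {s..s+r}" for g :: "real \<Rightarrow> 'b::euclidean_space" and r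
    using integral_shift_real(1)[OF that] .
  \<comment> \<open>Measurability of the shifted control is obtained through integrability:
    \<open>u r *\<^sub>R vecB\<close> is a difference of integrable functions, and any velocity
    component of it is \<open>u\<close>.\<close>
  have "(\<lambda>r. u (s + r)) integrable_on {0..t}"
  proof -
    have "?f integrable_on {s..s+t}" using fs[of t] st set_lebesgue_integral_eq_integral(1) by force
    moreover have "(\<lambda>r. opA \<omega> (\<gamma> r)) integrable_on {s..s+t}"
      using st by (intro integrable_continuous_real continuous_intros continuous_on_subset[OF c]) auto
    ultimately have "(\<lambda>r. ?f r - opA \<omega> (\<gamma> r)) integrable_on {s..s+t}" by (rule integrable_diff)
    then have i: "(\<lambda>r. u r *\<^sub>R (vecB :: 'n state)) integrable_on {s..s+t}" by simp
    have "bounded_linear (\<lambda>x :: 'n state. snd (x $ undefined))"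
      by (intro bounded_linear_compose[OF bounded_linear_snd bounded_linear_vec_nth])
    from integrable_linear[OF i this] have "u integrable_on {s..s+t}" by (simp add: o_def vecB_def)
    then show ?thesis by (rule shift)
  qed
  then have um: "(\<lambda>r. u (s + r)) \<in> borel_measurable (lebesgue_on {0..t})" by (rule integrable_imp_measurable)
  show ?thesis unfolding controlled_path_def
  proof (intro conjI ballI um)
    fix r assume r: "r \<in> {0..t}"
    have fi: "?f integrable_on {s..s+r}" "(\<lambda>x. norm (?f x)) integrable_on {s..s+r}"
      using fs[OF r] unfolding absolutely_integrable_on_def by blast+
    show "(\<lambda>x. opA \<omega> (\<gamma> (s + x)) + u (s + x) *\<^sub>R vecB) absolutely_integrable_on {0..r}"
      unfolding absolutely_integrable_on_def using shift[OF fi(1)] shift[OF fi(2)] by blast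
    have "integral {0..s} ?f + integral {s..s+r} ?f = integral {0..s+r} ?f"
      using r st f(1)[of "s + r"]
      by (intro Henstock_Kurzweil_Integration.integral_combine) (auto intro: set_lebesgue_integral_eq_integral(1))
    then have "\<gamma> (s + r) = \<gamma> s + integral {s..s+r} ?f"
      using f(2)[of "s + r"] f(2)[of s] r st by (auto simp: add.assoc)
    then show "\<gamma> (s + r) = \<gamma> (s + 0) + integral {0..r} (\<lambda>x. opA \<omega> (\<gamma> (s + x)) + u (s + x) *\<^sub>R vecB)"
      using integral_shift_real(2)[OF fi(1)] by simp
  qed
qed

lemma controlled_path_scale:
  fixes \<gamma> :: "real \<Rightarrow> 'n::finite state"
  assumes "controlled_path \<omega> J u \<gamma>"
  shows "controlled_path \<omega> J (\<lambda>t. c * u t) (\<lambda>t. c *\<^sub>R \<gamma> t)"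
proof -
  let ?f = "\<lambda>s. opA \<omega> (\<gamma> s) + u s *\<^sub>R vecB"
  have e: "opA \<omega> (c *\<^sub>R \<gamma> s) + (c * u s) *\<^sub>R vecB = c *\<^sub>R ?f s" for s
    by (simp add: opA_simps scaleR_add_right)
  show ?thesis unfolding controlled_path_def e
  proof (intro conjI ballI)
    have um: "u \<in> borel_measurable (lebesgue_on J)" using assms unfolding controlled_path_def by blast
    show "(\<lambda>t. c * u t) \<in> borel_measurable (lebesgue_on J)"
      using borel_measurable_times[OF borel_measurable_const um] by simp
    fix t assume t: "t \<in> J"
    show "(\<lambda>s. c *\<^sub>R ?f s) absolutely_integrable_on {0..t}"
      using assms t unfolding controlled_path_def by (simp add: absolutely_integrable_on_scaleR_iff)
    have "\<gamma> t = \<gamma> 0 + integral {0..t} ?f" using assms t unfolding controlled_path_def by blast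
    then have "c *\<^sub>R \<gamma> t = c *\<^sub>R (\<gamma> 0 + integral {0..t} ?f)" by (rule arg_cong)
    then show "c *\<^sub>R \<gamma> t = c *\<^sub>R \<gamma> 0 + integral {0..t} (\<lambda>s. c *\<^sub>R ?f s)"
      by (simp only: integral_cmul scaleR_add_right[of c "\<gamma> 0"])
  qed
qed

text \<open>Controls are Borel on the whole line, so that gluing keeps them measurable.\<close>

definition borel_motion :: "('n::finite \<Rightarrow> real) \<Rightarrow> real \<Rightarrow> (real \<Rightarrow> real) \<Rightarrow> (real \<Rightarrow> 'n state) \<Rightarrow> bool" where
  "borel_motion \<omega> T u \<gamma> \<longleftrightarrow> 0 \<le> T \<and> controlled_path \<omega> {0..T} u \<gamma> \<and> u \<in> borel_measurable borel \<and> (\<forall>t. \<bar>u t\<bar> \<le> 2)"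

lemma borel_motion_subset: "borel_motion \<omega> T u \<gamma> \<Longrightarrow> 0 \<le> t \<Longrightarrow> t \<le> T \<Longrightarrow> borel_motion \<omega> t u \<gamma>"
  unfolding borel_motion_def by (auto intro: controlled_path_subset)

lemma borel_motion_continuous: "borel_motion \<omega> T u \<gamma> \<Longrightarrow> continuous_on {0..T} \<gamma>"
  unfolding borel_motion_def by (auto intro: controlled_path_continuous)

lemma borel_motion_zero: "0 \<le> T \<Longrightarrow> borel_motion \<omega> T (\<lambda>_. 0) (\<lambda>_. 0)"
  unfolding borel_motion_def controlled_path_def by (simp add: linear_0[OF linear_opA] absolutely_integrable_on_def)

lemma borel_motion_concat:
  fixes \<gamma>1 :: "real \<Rightarrow> 'n::finite state"
  assumes 1: "borel_motion \<omega> \<tau> u1 \<gamma>1" and 2: "borel_motion \<omega> S u2 \<gamma>2" and g: "\<gamma>2 0 = \<gamma>1 \<tau>"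
  shows "borel_motion \<omega> (\<tau> + S) (\<lambda>t. if t < \<tau> then u1 t else u2 (t - \<tau>)) (\<lambda>t. if t < \<tau> then \<gamma>1 t else \<gamma>2 (t - \<tau>))"
    (is "borel_motion \<omega> _ ?u ?\<gamma>")
proof -
  have TS: "0 \<le> \<tau>" "0 \<le> S" using 1 2 by (auto simp: borel_motion_def)
  have um: "u1 \<in> borel_measurable borel" "u2 \<in> borel_measurable borel" using 1 2 by (auto simp: borel_motion_def)
  have m: "?u \<in> borel_measurable borel" using um by measurable
  let ?f = "\<lambda>s. opA \<omega> (?\<gamma> s) + ?u s *\<^sub>R vecB"
  let ?f1 = "\<lambda>s. opA \<omega> (\<gamma>1 s) + u1 s *\<^sub>R vecB"
  let ?f2 = "\<lambda>s. opA \<omega> (\<gamma>2 s) + u2 s *\<^sub>R vecB"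
  have f1: "?f1 absolutely_integrable_on {0..t}" "\<gamma>1 t = \<gamma>1 0 + integral {0..t} ?f1" if "t \<in> {0..\<tau>}" for t
    using 1 that unfolding borel_motion_def controlled_path_def by blast+
  have f2: "?f2 absolutely_integrable_on {0..t}" "\<gamma>2 t = \<gamma>2 0 + integral {0..t} ?f2" if "t \<in> {0..S}" for t
    using 2 that unfolding borel_motion_def controlled_path_def by blast+
  have F1: "?f absolutely_integrable_on {0..t}" "integral {0..t} ?f = integral {0..t} ?f1" if "t \<in> {0..\<tau>}" for t
  proof -
    show "?f absolutely_integrable_on {0..t}"
      by (rule absolutely_integrable_spike[OF f1(1)[OF that] negligible_sing[of \<tau>]]) (use that in auto)
    show "integral {0..t} ?f = integral {0..t} ?f1"
      by (rule integral_spike[OF negligible_sing[of \<tau>]]) (use that in auto)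
  qed
  have F2: "?f absolutely_integrable_on {\<tau>..\<tau>+t}" "integral {\<tau>..\<tau>+t} ?f = integral {0..t} ?f2" if "t \<in> {0..S}" for t
  proof -
    have i: "?f2 integrable_on {0..t}" "(\<lambda>s. norm (?f2 s)) integrable_on {0..t}"
      using f2(1)[OF that] unfolding absolutely_integrable_on_def by blast+
    have s: "((\<lambda>r. h (r - \<tau>)) has_integral integral {0..t} h) {\<tau>..\<tau>+t}"
      if "h integrable_on {0..t}" for h :: "real \<Rightarrow> 'b::euclidean_space"
    proof -
      have "(h has_integral integral {0..t} h) (cbox 0 t)" using that by (simp add: integrable_integral)
      from has_integral_affinity'[OF this, of 1 "- \<tau>"] show ?thesis by (simp add: add.commute)
    qed
    have e: "?f r = ?f2 (r - \<tau>)" if "r \<in> {\<tau>..\<tau>+t}" for r using that by auto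
    have "(?f has_integral integral {0..t} ?f2) {\<tau>..\<tau>+t}"
      by (rule has_integral_eq[OF _ s[OF i(1)]]) (use e in auto)
    moreover have "((\<lambda>r. norm (?f r)) has_integral integral {0..t} (\<lambda>s. norm (?f2 s))) {\<tau>..\<tau>+t}"
      by (rule has_integral_eq[OF _ s[OF i(2)]]) (use e in auto)
    ultimately show "?f absolutely_integrable_on {\<tau>..\<tau>+t}" "integral {\<tau>..\<tau>+t} ?f = integral {0..t} ?f2"
      unfolding absolutely_integrable_on_def integrable_on_def by (auto simp: integral_unique)
  qed
  have g0: "?\<gamma> 0 = \<gamma>1 0" using g TS by (cases "\<tau> = 0") auto
  have "controlled_path \<omega> {0..\<tau>+S} ?u ?\<gamma>" unfolding controlled_path_def
  proof (intro conjI ballI)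
    show "?u \<in> borel_measurable (lebesgue_on {0..\<tau>+S})"
      using m by (simp add: measurable_completion measurable_restrict_space1)
    fix t assume t: "t \<in> {0..\<tau>+S}"
    show "?f absolutely_integrable_on {0..t}"
    proof (cases "t < \<tau>")
      case True
      then show ?thesis using F1(1)[of t] t by simp
    next
      case False
      have "?f absolutely_integrable_on ({0..\<tau>} \<union> {\<tau>..\<tau>+(t-\<tau>)})"
        using F1(1)[of \<tau>] F2(1)[of "t - \<tau>"] False t TS by (intro set_integrable_Un) auto
      moreover have "{0..\<tau>} \<union> {\<tau>..\<tau>+(t-\<tau>)} = {0..t}" using False TS by auto
      ultimately show ?thesis by metis
    qed
    note ai = this
    show "?\<gamma> t = ?\<gamma> 0 + integral {0..t} ?f"
    proof (cases "t < \<tau>")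
      case True
      then show ?thesis using f1(2)[of t] F1(2)[of t] t g0 by simp
    next
      case False
      have p1: "integral {0..\<tau>} ?f + integral {\<tau>..t} ?f = integral {0..t} ?f"
        using False TS ai by (intro Henstock_Kurzweil_Integration.integral_combine) (auto intro: set_lebesgue_integral_eq_integral(1))
      have p2: "integral {\<tau>..t} ?f = integral {0..t - \<tau>} ?f2" using F2(2)[of "t - \<tau>"] False t by simp
      have p3: "\<gamma>2 (t - \<tau>) = \<gamma>2 0 + integral {0..t - \<tau>} ?f2" by (rule f2(2)) (use False t in auto)
      have p4: "\<gamma>1 \<tau> = \<gamma>1 0 + integral {0..\<tau>} ?f1" by (rule f1(2)) (use TS in auto)
      have p5: "integral {0..\<tau>} ?f = integral {0..\<tau>} ?f1" by (rule F1(2)) (use TS in auto)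
      have "a = d + i" if "a = b0 + i2" "b0 = c" "c = d + i1" "i3 = i1" "i4 = i2" "i3 + i4 = i" for a b0 c d i i1 i2 i3 i4 :: "'n state"
        using that by (simp add: add.assoc)
      from this[OF p3 g p4 p5 p2 p1] have "\<gamma>2 (t - \<tau>) = \<gamma>1 0 + integral {0..t} ?f" .
      then show ?thesis unfolding g0 using False by (simp only: if_False)
    qed
  qed
  then show ?thesis using m 1 2 TS unfolding borel_motion_def by (intro conjI) auto
qed

section \<open>Duration of the three-stage motion\<close>

locale three_stage = distinct_oscillators \<omega> for \<omega> :: "'n::finite \<Rightarrow> real" +
  fixes K \<Theta> U :: real
  assumes parameters: "three_stage_parameters \<omega> K \<Theta> U"
begin

abbreviation G :: "'n state set" where "G \<equiv> regionG \<omega> \<Theta>"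

lemma par: "K > 0" "\<Theta> > 0" "0 < U" "U \<le> 1" "G \<subseteq> {x. \<bar>rowC \<omega> x\<bar> \<le> 1 / 2}" "rho \<omega> x \<le> U * K \<Longrightarrow> x \<in> G"
  using parameters unfolding three_stage_parameters_def basic_threshold_def by auto

text \<open>The threshold property with the final value of \<open>rho\<close> estimated from below
  by \<open>0\<close>. Durations are still integers.\<close>

definition decrease_bound :: "real \<Rightarrow> bool" where
  "decrease_bound c \<longleftrightarrow> c > 0 \<and> (\<forall>\<gamma> t. basic_motion \<omega> (real t) \<gamma> \<longrightarrow>
    (\<forall>s\<in>{0..real t}. rho \<omega> (\<gamma> s) \<ge> K) \<longrightarrow> real t \<le> c * rho \<omega> (\<gamma> 0))"

lemma threshold: "\<exists>c. decrease_bound c"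
proof -
  obtain c where c: "c > 0" "\<forall>M M' \<gamma>. \<forall>t::nat. basic_motion \<omega> (real t) \<gamma> \<longrightarrow> (\<forall>s\<in>{0..real t}. rho \<omega> (\<gamma> s) \<ge> K) \<longrightarrow>
      rho \<omega> (\<gamma> 0) = M \<longrightarrow> rho \<omega> (\<gamma> (real t)) = M' \<longrightarrow> real t \<le> c * (M - M')"
    using parameters unfolding three_stage_parameters_def basic_threshold_def by blast
  have "decrease_bound c" unfolding decrease_bound_def
  proof (intro conjI allI impI c(1))
    fix \<gamma> and t :: nat
    assume "basic_motion \<omega> (real t) \<gamma>" "\<forall>s\<in>{0..real t}. rho \<omega> (\<gamma> s) \<ge> K"
    then have "real t \<le> c * (rho \<omega> (\<gamma> 0) - rho \<omega> (\<gamma> (real t)))" using c(2) by blast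
    also have "\<dots> \<le> c * rho \<omega> (\<gamma> 0)" using c(1) rho_nonneg[of "\<gamma> (real t)"] by simp
    finally show "real t \<le> c * rho \<omega> (\<gamma> 0)" .
  qed
  then show ?thesis ..
qed

lemma decrease_boundD:
  assumes "decrease_bound c" "basic_motion \<omega> (real t) \<gamma>" "\<And>s. 0 \<le> s \<Longrightarrow> s \<le> real t \<Longrightarrow> rho \<omega> (\<gamma> s) \<ge> K"
  shows "real t \<le> c * rho \<omega> (\<gamma> 0)"
  using assms unfolding decrease_bound_def by (meson atLeastAtMost_iff)

definition tsm :: "(real \<Rightarrow> 'n state) \<Rightarrow> (real \<Rightarrow> real) \<Rightarrow> real set \<Rightarrow> bool" where
  "tsm \<gamma> u M \<longleftrightarrow> controlled_path \<omega> {0..} u \<gamma> \<and> negligible M \<and>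
    (\<forall>t. 0 \<le> t \<longrightarrow> t \<notin> M \<longrightarrow> u t \<in> three_stage_control \<omega> K \<Theta> U \<gamma> t)"

lemma three_stage_motion_tsm: "three_stage_motion \<omega> K \<Theta> U x \<gamma> \<longleftrightarrow> \<gamma> 0 = x \<and> (\<exists>u M. tsm \<gamma> u M)"
proof -
  have s: "{0::real..} \<in> sets lebesgue" by simp
  show ?thesis unfolding three_stage_motion_def tsm_def AE_lebesgue_on_iff_negligible[OF s]
    by (auto simp: Ball_def)
qed

lemma tsm_continuous: "tsm \<gamma> u M \<Longrightarrow> continuous_on {0..t} \<gamma>"
proof (cases "0 \<le> t")
  case True
  assume "tsm \<gamma> u M"
  then have "controlled_path \<omega> {0..t} u \<gamma>" unfolding tsm_def by (auto intro: controlled_path_subset)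
  then show ?thesis using True by (rule controlled_path_continuous)
qed simp

lemma tsm_shift:
  assumes "tsm \<gamma> u M" "0 \<le> s" "0 \<le> t"
    and P: "\<And>r. 0 \<le> r \<Longrightarrow> r < t \<Longrightarrow> three_stage_control \<omega> K \<Theta> U \<gamma> (s + r) = F r"
  shows "controlled_path \<omega> {0..t} (\<lambda>r. u (s + r)) (\<lambda>r. \<gamma> (s + r))"
    "\<exists>N. negligible N \<and> (\<forall>r\<in>{0..t} - N. u (s + r) \<in> F r)"
proof -
  have "controlled_path \<omega> {0..s+t} u \<gamma>" using assms(1) unfolding tsm_def by (auto intro: controlled_path_subset)
  then show "controlled_path \<omega> {0..t} (\<lambda>r. u (s + r)) (\<lambda>r. \<gamma> (s + r))" using assms(2,3) by (rule controlled_path_shift)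
  \<comment> \<open>The end point joins the null set because the stage may switch exactly
    there.\<close>
  let ?N = "insert t ((+) (- s) ` M)"
  have M: "negligible M" using assms(1) by (simp add: tsm_def)
  have "negligible ?N" unfolding negligible_insert using M by (rule negligible_translation)
  moreover have "u (s + r) \<in> F r" if r: "r \<in> {0..t} - ?N" for r
  proof -
    have "s + r \<notin> M"
    proof
      assume "s + r \<in> M"
      then have "- s + (s + r) \<in> (+) (- s) ` M" by (rule imageI)
      then show False using r by simp
    qed
    then have "u (s + r) \<in> three_stage_control \<omega> K \<Theta> U \<gamma> (s + r)" using assms(1,2) r unfolding tsm_def by auto
    then show ?thesis using P[of r] r by auto
  qed
  ultimately show "\<exists>N. negligible N \<and> (\<forall>r\<in>{0..t} - N. u (s + r) \<in> F r)" by blast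
qed

lemma tsm_basic:
  assumes m: "tsm \<gamma> u M" and st: "0 \<le> s" "0 \<le> t"
    and no: "\<And>r. 0 \<le> r \<Longrightarrow> r < s + t \<Longrightarrow> \<gamma> r \<notin> G \<and> rho \<omega> (\<gamma> r) > K"
  shows "basic_motion \<omega> t (\<lambda>r. \<gamma> (s + r))"
proof -
  have e: "three_stage_control \<omega> K \<Theta> U \<gamma> (s + r) = basic_control \<omega> (\<gamma> (s + r))" if "0 \<le> r" "r < t" for r
    unfolding three_stage_control_def using no that st by (auto simp: not_le[symmetric])
  have "{0..t} \<in> sets lebesgue" by simp
  from tsm_shift[where F = "\<lambda>r. basic_control \<omega> (\<gamma> (s + r))", OF m st e] AE_lebesgue_on_iff_negligible[OF this]
  show ?thesis unfolding basic_motion_def by blast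
qed

text \<open>The gradient of \<open>rho\<close> is the same on a whole ray, so division of state and
  control by \<open>U\<close> turns a motion under the scaled control into one under the basic
  control.\<close>

lemma tsm_scaled:
  assumes m: "tsm \<gamma> u M" and st: "0 \<le> s" "0 \<le> t"
    and K: "rho \<omega> (\<gamma> s) \<le> K" and no: "\<And>r. 0 \<le> r \<Longrightarrow> r < s + t \<Longrightarrow> \<gamma> r \<notin> G"
  shows "basic_motion \<omega> t (\<lambda>r. (1 / U) *\<^sub>R \<gamma> (s + r))"
proof -
  have e: "three_stage_control \<omega> K \<Theta> U \<gamma> (s + r) = scaled_basic_control \<omega> U (\<gamma> (s + r))" if "0 \<le> r" "r < t" for r
    unfolding three_stage_control_def using no that st K by auto
  have l: "{0..t} \<in> sets lebesgue" by simp
  note sh = tsm_shift[where F = "\<lambda>r. scaled_basic_control \<omega> U (\<gamma> (s + r))", OF m st e]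
  obtain N where N: "negligible N" "\<And>r. r \<in> {0..t} - N \<Longrightarrow> u (s + r) \<in> scaled_basic_control \<omega> U (\<gamma> (s + r))"
    using sh(2) by blast
  have "(1 / U) * u (s + r) \<in> basic_control \<omega> ((1 / U) *\<^sub>R \<gamma> (s + r))" if r: "r \<in> {0..t} - (insert t N)" for r
  proof -
    have "\<gamma> (s + r) \<noteq> 0" using no[of "s + r"] zero_in_regionG[OF par(2)] r st by force
    then have "basic_control \<omega> ((1 / U) *\<^sub>R \<gamma> (s + r)) = basic_control \<omega> (\<gamma> (s + r))"
      using par(3) by (simp add: basic_control_def gradient_scaleR)
    moreover obtain w where "u (s + r) = U * w" "w \<in> basic_control \<omega> (\<gamma> (s + r))"
      using N(2)[of r] r by (auto simp: scaled_basic_control_def)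
    ultimately show ?thesis using par(3) by simp
  qed
  moreover have "negligible (insert t N)" using N(1) by simp
  ultimately have "AE r in lebesgue_on {0..t}. (1 / U) * u (s + r) \<in> basic_control \<omega> ((1 / U) *\<^sub>R \<gamma> (s + r))"
    unfolding AE_lebesgue_on_iff_negligible[OF l] by blast
  moreover have "controlled_path \<omega> {0..t} (\<lambda>r. (1 / U) * u (s + r)) (\<lambda>r. (1 / U) *\<^sub>R \<gamma> (s + r))"
    by (rule controlled_path_scale[OF sh(1)])
  ultimately show ?thesis unfolding basic_motion_def by blast
qed

lemma tsm_frakT:
  assumes m: "tsm \<gamma> u M" and st: "0 \<le> s" "0 \<le> t"
    and G: "\<gamma> s \<in> G" and nz: "\<And>r. s \<le> r \<Longrightarrow> r \<le> s + t \<Longrightarrow> \<gamma> r \<noteq> 0"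
  shows "frakT (inv (opD \<omega>) (\<gamma> (s + t))) = frakT (inv (opD \<omega>) (\<gamma> s)) - t"
proof -
  have e: "three_stage_control \<omega> K \<Theta> U \<gamma> (s + r) = {terminal_control \<omega> (\<gamma> (s + r))}" if "0 \<le> r" "r < t" for r
  proof -
    have "\<exists>q\<in>{0..s + r}. \<gamma> q \<in> G" using G st that by (intro bexI[of _ s]) auto
    then show ?thesis unfolding three_stage_control_def by simp
  qed
  note sh = tsm_shift[where F = "\<lambda>r. {terminal_control \<omega> (\<gamma> (s + r))}", OF m st e]
  obtain N where N: "negligible N" "\<And>r. r \<in> {0..t} - N \<Longrightarrow> u (s + r) = terminal_control \<omega> (\<gamma> (s + r))"
    using sh(2) by blast
  have "frakT (inv (opD \<omega>) (\<gamma> (s + t))) = frakT (inv (opD \<omega>) (\<gamma> (s + 0))) - t"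
    by (rule terminal_motion_frakT[OF sh(1) st(2) controlled_path_continuous[OF sh(1) st(2)] N])
      (use nz st in auto)
  then show ?thesis by simp
qed

text \<open>\<open>frakT\<close> starts at most at \<open>\<Theta>\<close>, falls at unit rate and
  is positive away from the origin, so it cannot avoid zero beyond time
  \<open>\<Theta>\<close>.\<close>

lemma hit_zero:
  assumes m: "tsm \<gamma> u M" and s: "0 \<le> s" and G: "\<gamma> s \<in> G"
  shows "\<exists>r. s \<le> r \<and> r \<le> s + \<Theta> \<and> \<gamma> r = 0"
proof (rule ccontr)
  assume n: "\<not> ?thesis"
  have nz: "\<gamma> r \<noteq> 0" if r: "s \<le> r" "r \<le> s + \<Theta>" for r using n r by blast
  have "frakT (inv (opD \<omega>) (\<gamma> (s + \<Theta>))) = frakT (inv (opD \<omega>) (\<gamma> s)) - \<Theta>"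
    by (rule tsm_frakT[OF m s _ G nz]) (use par(2) in auto)
  moreover have "frakT (inv (opD \<omega>) (\<gamma> s)) \<le> \<Theta>" using G by (simp add: regionG_iff)
  moreover have "frakT (inv (opD \<omega>) (\<gamma> (s + \<Theta>))) > 0"
    using nz[of "s + \<Theta>"] par(2) by (intro frakT_props) simp
  ultimately show False by linarith
qed

text \<open>Switching to the terminal control is irreversible, whereas its bound holds only inside
  \<open>G\<close>. Monotonicity of \<open>frakT\<close> guarantees that the motion is still
  there.\<close>

lemma stays_in_G:
  assumes m: "tsm \<gamma> u M" and s: "0 \<le> s" "s \<le> t" and G: "\<gamma> s \<in> G" and nz: "\<And>r. s \<le> r \<Longrightarrow> r \<le> t \<Longrightarrow> \<gamma> r \<noteq> 0"
  shows "\<gamma> t \<in> G"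
proof -
  have nz': "\<gamma> r \<noteq> 0" if "s \<le> r" "r \<le> s + (t - s)" for r using nz[of r] that by simp
  have "frakT (inv (opD \<omega>) (\<gamma> (s + (t - s)))) = frakT (inv (opD \<omega>) (\<gamma> s)) - (t - s)"
    by (rule tsm_frakT[OF m s(1) _ G nz']) (use s in auto)
  then show ?thesis using G s by (simp add: regionG_iff)
qed

text \<open>The three durations: each \<open>+ 1\<close> rounds up to an integer,
  \<open>K / U\<close> is the initial level of the second stage after division by \<open>U\<close>,
  and \<open>\<Theta>\<close> bounds the last stage.\<close>

definition reach_bound :: "real \<Rightarrow> real \<Rightarrow> real" where
  "reach_bound c R = c * R + 1 + (c * (K / U) + 1) + \<Theta>"

lemma hit_bound:
  assumes c: "decrease_bound c"
    and m: "tsm \<gamma> u M" and s: "0 \<le> s" and R: "rho \<omega> (\<gamma> s) \<le> R"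
  shows "\<exists>r. 0 \<le> r \<and> r \<le> s + reach_bound c R \<and> \<gamma> r = 0"
proof -
  have c0: "c > 0" using c by (simp add: decrease_bound_def)
  have R0: "0 \<le> R" using R rho_nonneg[of "\<gamma> s"] by linarith
  have KU: "0 \<le> c * (K / U)" using c0 par by simp
  have 1: "\<exists>r. 0 \<le> r \<and> r \<le> s + (c * R + 1) \<and> (\<gamma> r \<in> G \<or> rho \<omega> (\<gamma> r) \<le> K)"
  proof (rule ccontr)
    assume n: "\<not> ?thesis"
    \<comment> \<open>The least integer above \<open>c * R\<close>: a basic motion of this duration
      above the level \<open>K\<close> would contradict the threshold property.\<close>
    define k where "k = nat \<lfloor>c * R\<rfloor> + 1"
    have k: "c * R < real k" "real k \<le> c * R + 1" using c0 R0 unfolding k_def by (simp_all, linarith+)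
    have no: "\<gamma> r \<notin> G \<and> rho \<omega> (\<gamma> r) > K" if "0 \<le> r" "r \<le> s + real k" for r
      using n k that by (metis add_left_mono linorder_not_le order_trans)
    have "basic_motion \<omega> (real k) (\<lambda>r. \<gamma> (s + r))" by (rule tsm_basic[OF m s]) (use no in auto)
    from decrease_boundD[OF c this] have "real k \<le> c * rho \<omega> (\<gamma> (s + 0))" using no s by (force intro: less_imp_le)
    also have "\<dots> \<le> c * R" using R c0 by simp
    finally show False using k by simp
  qed
  have 2: "\<exists>r. 0 \<le> r \<and> r \<le> q + (c * (K / U) + 1) \<and> \<gamma> r \<in> G" if q: "0 \<le> q" "rho \<omega> (\<gamma> q) \<le> K" for q
  proof (rule ccontr)
    assume n: "\<not> ?thesis"
    define k where "k = nat \<lfloor>c * (K / U)\<rfloor> + 1"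
    have k: "c * (K / U) < real k" "real k \<le> c * (K / U) + 1" using KU unfolding k_def by linarith+
    have no: "\<gamma> r \<notin> G" if "0 \<le> r" "r \<le> q + real k" for r
      using n k that by (metis add_left_mono order_trans)
    have bm: "basic_motion \<omega> (real k) (\<lambda>r. (1 / U) *\<^sub>R \<gamma> (q + r))" by (rule tsm_scaled[OF m q(1) _ q(2)]) (use no in auto)
    have "real k \<le> c * rho \<omega> ((1 / U) *\<^sub>R \<gamma> (q + 0))"
    proof (rule decrease_boundD[OF c bm])
      fix r assume r: "0 \<le> r" "r \<le> real k"
      \<comment> \<open>As long as \<open>G\<close> is not reached, \<open>rho\<close> exceeds
        \<open>U * K\<close>, so the rescaled path stays above \<open>K\<close> and the threshold
        property applies to the second stage as well.\<close>
      have "\<not> rho \<omega> (\<gamma> (q + r)) \<le> U * K" using no[of "q + r"] par(6)[of "\<gamma> (q + r)"] r q by auto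
      then show "rho \<omega> ((1 / U) *\<^sub>R \<gamma> (q + r)) \<ge> K" using par(3) by (simp add: rho_scaleR field_simps)
    qed
    also have "\<dots> \<le> c * (K / U)"
      using q(2) par(3) c0 by (intro mult_left_mono) (auto simp: rho_scaleR divide_right_mono)
    finally show False using k by simp
  qed
  have 3: "\<exists>r. 0 \<le> r \<and> r \<le> s + (c * R + 1) + (c * (K / U) + 1) \<and> \<gamma> r \<in> G"
  proof -
    obtain r where r: "0 \<le> r" "r \<le> s + (c * R + 1)" "\<gamma> r \<in> G \<or> rho \<omega> (\<gamma> r) \<le> K" using 1 by blast
    show ?thesis
    proof (cases "\<gamma> r \<in> G")
      case True
      then show ?thesis using r KU by (intro exI[of _ r]) auto
    next
      case False
      then obtain q where "0 \<le> q" "q \<le> r + (c * (K / U) + 1)" "\<gamma> q \<in> G" using 2[OF r(1)] r(3) by blast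
      then show ?thesis using r by (intro exI[of _ q]) auto
    qed
  qed
  then obtain r where r: "0 \<le> r" "r \<le> s + (c * R + 1) + (c * (K / U) + 1)" "\<gamma> r \<in> G" by blast
  from hit_zero[OF m r(1,3)] obtain q where "r \<le> q" "q \<le> r + \<Theta>" "\<gamma> q = 0" by blast
  then show ?thesis using r by (intro exI[of _ q]) (auto simp: reach_bound_def)
qed

lemma arrival_exists:
  assumes "tsm \<gamma> u M" shows "\<exists>T. arrival_time \<gamma> T"
proof -
  obtain c where c: "decrease_bound c"
    using threshold by blast
  obtain r where r: "0 \<le> r" "\<gamma> r = 0"
    using hit_bound[OF c assms order_refl[of 0] order_refl] by blast
  have cl: "closed {0 :: 'n state}" by simp
  obtain \<tau> where \<tau>: "\<tau> \<in> {0..r}" "\<gamma> \<tau> \<in> {0}" "\<And>s. 0 \<le> s \<Longrightarrow> s < \<tau> \<Longrightarrow> \<gamma> s \<notin> {0}"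
    by (rule first_hit[OF tsm_continuous[OF assms, of r] cl, of r]) (use r in auto)
  then show ?thesis unfolding arrival_time_def by (intro exI[of _ \<tau>]) auto
qed

lemma arrival_le: "arrival_time \<gamma> T \<Longrightarrow> 0 \<le> r \<Longrightarrow> \<gamma> r = 0 \<Longrightarrow> T \<le> r"
  unfolding arrival_time_def by (meson atLeastLessThan_iff not_le)

text \<open>In each stage the control is bounded by \<open>1\<close> up to arrival, in the last one
  because the motion remains in \<open>G\<close>. Hence the feedback time competes in the minimum
  time problem.\<close>

lemma arrival_steerable:
  assumes m: "tsm \<gamma> u M" and T: "arrival_time \<gamma> T"
  shows "steerable_in \<omega> (\<gamma> 0) T"
proof -
  have T0: "0 \<le> T" "\<gamma> T = 0" "\<And>s. 0 \<le> s \<Longrightarrow> s < T \<Longrightarrow> \<gamma> s \<noteq> 0" using T by (auto simp: arrival_time_def)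
  have cp: "controlled_path \<omega> {0..T} u \<gamma>" using m unfolding tsm_def by (auto intro: controlled_path_subset)
  have bd: "\<bar>u s\<bar> \<le> 1" if s: "s \<in> {0..T} - insert T M" for s
  proof -
    have us: "u s \<in> three_stage_control \<omega> K \<Theta> U \<gamma> s" using m s unfolding tsm_def by auto
    show ?thesis
    proof (cases "\<exists>r\<in>{0..s}. \<gamma> r \<in> G")
      case True
      then obtain r where r: "0 \<le> r" "r \<le> s" "\<gamma> r \<in> G" by auto
      have "\<gamma> s \<in> G" by (rule stays_in_G[OF m r(1,2,3)]) (use T0(3) r s in auto)
      then have "\<bar>terminal_control \<omega> (\<gamma> s)\<bar> \<le> 1" by (rule terminal_control_le[OF par(5)])
      then show ?thesis using us True by (simp add: three_stage_control_def)
    next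
      case False
      show ?thesis
      proof (cases "\<exists>r\<in>{0..s}. rho \<omega> (\<gamma> r) \<le> K")
        case True
        then obtain w where w: "u s = U * w" "w \<in> basic_control \<omega> (\<gamma> s)"
          using us False by (auto simp: three_stage_control_def scaled_basic_control_def)
        have "\<bar>U * w\<bar> \<le> 1 * 1" unfolding abs_mult
          using basic_control_abs[OF w(2)] par(3,4) by (intro mult_mono) auto
        then show ?thesis using w by simp
      next
        case F2: False
        have "u s \<in> basic_control \<omega> (\<gamma> s)" using us unfolding three_stage_control_def if_not_P[OF False] if_not_P[OF F2] .
        then show ?thesis by (rule basic_control_abs)
      qed
    qed
  qed
  have "negligible (insert T M)" using m by (simp add: tsm_def)
  moreover have l: "{0..T} \<in> sets lebesgue" by simp
  ultimately have ae: "AE s in lebesgue_on {0..T}. \<bar>u s\<bar> \<le> 1"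
    unfolding AE_lebesgue_on_iff_negligible[OF l] using bd by blast
  obtain u' where "controlled_path \<omega> {0..T} u' \<gamma>" "\<forall>s\<in>{0..T}. \<bar>u' s\<bar> \<le> 1"
    by (rule controlled_path_clip[where P="\<lambda>s r. \<bar>r\<bar> \<le> 1", OF cp ae])
  then show ?thesis unfolding steerable_in_def using T0 by blast
qed

lemma motion_time_tsm: "motion_time \<omega> K \<Theta> U x T \<longleftrightarrow> (\<exists>\<gamma> u M. tsm \<gamma> u M \<and> \<gamma> 0 = x \<and> arrival_time \<gamma> T)"
  unfolding motion_time_def three_stage_motion_tsm by blast

lemma min_time_bounds:
  assumes "motion_time \<omega> K \<Theta> U x T"
  shows "steerable_in \<omega> x T" "min_time \<omega> x \<le> T"
    "(\<And>S. steerable_in \<omega> x S \<Longrightarrow> b \<le> S) \<Longrightarrow> b \<le> min_time \<omega> x"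
proof -
  show st: "steerable_in \<omega> x T" using assms arrival_steerable unfolding motion_time_tsm by blast
  have "bdd_below {T. steerable_in \<omega> x T}" by (auto simp: bdd_below_def steerable_in_def)
  then show "min_time \<omega> x \<le> T" unfolding min_time_def using st by (intro cInf_lower) auto
  assume "\<And>S. steerable_in \<omega> x S \<Longrightarrow> b \<le> S"
  then show "b \<le> min_time \<omega> x" unfolding min_time_def using st by (intro cInf_greatest) auto
qed

text \<open>The upper bound on \<open>T\<close> comes from the threshold property, the lower bound
  from the limited speed of any admissible control; the latter also bounds the minimum time from
  below.\<close>

lemma general_bounds:
  "\<exists>C\<^sub>1>0. \<exists>c\<^sub>1>0. \<forall>x T. rho \<omega> x \<ge> 1 \<longrightarrow> motion_time \<omega> K \<Theta> U x T \<longrightarrow>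
     C\<^sub>1 \<ge> rho \<omega> x / T \<and> rho \<omega> x / T \<ge> c\<^sub>1 \<and> 1 \<ge> min_time \<omega> x / T \<and> min_time \<omega> x / T \<ge> c\<^sub>1"
proof -
  obtain c where c: "decrease_bound c"
    using threshold by blast
  have c0: "c > 0" using c by (simp add: decrease_bound_def)
  obtain b where b: "b > 0" "\<And>x T. steerable_in \<omega> x T \<Longrightarrow> rho \<omega> x \<le> b * T" using steerable_rho_le_linear by blast
  \<comment> \<open>For \<open>R \<ge> 1\<close> the constant terms of \<open>reach_bound\<close>
    are absorbed into the linear one.\<close>
  define D where "D = reach_bound c 1"
  have "0 \<le> c * (K / U)" using c0 par by simp
  then have rb: "reach_bound c R \<le> D * R" if "R \<ge> 1" for R
  proof -
    have "c * R + (1 + (c * (K / U) + 1) + \<Theta>) * 1 \<le> c * R + (1 + (c * (K / U) + 1) + \<Theta>) * R"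
      using that \<open>0 \<le> c * (K / U)\<close> par(2) by (intro add_left_mono mult_left_mono) auto
    then show ?thesis by (simp add: D_def reach_bound_def algebra_simps)
  qed
  have D: "D > 0" using \<open>0 \<le> c * (K / U)\<close> c0 par(2) by (simp add: D_def reach_bound_def)
  have main: "b \<ge> rho \<omega> x / T \<and> rho \<omega> x / T \<ge> 1 / D \<and> 1 \<ge> min_time \<omega> x / T \<and> min_time \<omega> x / T \<ge> 1 / (D * b)"
    if x: "rho \<omega> x \<ge> 1" and mt: "motion_time \<omega> K \<Theta> U x T" for x T
  proof -
    obtain \<gamma> u M where m: "tsm \<gamma> u M" "\<gamma> 0 = x" "arrival_time \<gamma> T" using mt unfolding motion_time_tsm by blast
    obtain r where r: "0 \<le> r" "r \<le> 0 + reach_bound c (rho \<omega> x)" "\<gamma> r = 0"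
      using hit_bound[OF c m(1) order_refl, of "rho \<omega> x"] m(2) by auto
    have TD: "T \<le> D * rho \<omega> x" using arrival_le[OF m(3) r(1,3)] r(2) rb[OF x] by linarith
    have rT: "rho \<omega> x \<le> b * T" by (rule b(2)[OF min_time_bounds(1)[OF mt]])
    have T: "T > 0" using rT x b(1) by (metis less_le_trans zero_less_mult_pos zero_less_one)
    have mn: "rho \<omega> x / b \<le> min_time \<omega> x"
      by (rule min_time_bounds(3)[OF mt]) (use b in \<open>auto simp: divide_le_eq mult.commute\<close>)
    have "T / (D * b) \<le> rho \<omega> x / b" using TD D b(1) by (simp add: field_simps)
    then have "T / (D * b) \<le> min_time \<omega> x" using mn by linarith
    then have "1 / (D * b) \<le> min_time \<omega> x / T" using T D b(1) by (simp add: field_simps)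
    moreover have "1 / D \<le> rho \<omega> x / T" "rho \<omega> x / T \<le> b" "min_time \<omega> x / T \<le> 1"
      using TD rT T D min_time_bounds(2)[OF mt] by (simp_all add: field_simps)
    ultimately show ?thesis by blast
  qed
  show ?thesis
  proof (intro exI conjI allI impI)
    show "b > 0" by (rule b)
    show "min (1 / D) (1 / (D * b)) > 0" using D b(1) by simp
  qed (use main in \<open>force+\<close>)
qed

text \<open>Consecutive windows of length \<open>L\<close> bring the motion below a fixed level, or
  into \<open>G\<close>, within \<open>rho \<omega> x / (1 - \<epsilon>) + L\<close>; the rest takes
  bounded time, negligible for large \<open>rho\<close>. The second estimate is
  \<open>steerable_rho_le\<close> with the time mean close to its limit.\<close>

lemma asymptotics:
  assumes nr: "non_resonant \<omega>" and \<delta>: "0 < \<delta>" "\<delta> \<le> 1"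
  obtains R0 where "R0 > 0" "\<And>x T. rho \<omega> x \<ge> R0 \<Longrightarrow> motion_time \<omega> K \<Theta> U x T \<Longrightarrow> T \<le> (1 + \<delta>) * rho \<omega> x"
    "\<And>x S. rho \<omega> x \<ge> R0 \<Longrightarrow> steerable_in \<omega> x S \<Longrightarrow> rho \<omega> x \<le> (1 + \<delta>) * S"
proof -
  obtain c where c: "decrease_bound c"
    using threshold by blast
  have c0: "c > 0" using c by (simp add: decrease_bound_def)
  obtain b where b: "b > 0" "\<And>x T. steerable_in \<omega> x T \<Longrightarrow> rho \<omega> x \<le> b * T" using steerable_rho_le_linear by blast
  obtain L0 where L0: "L0 > 0" "\<And>L p. L \<ge> L0 \<Longrightarrow> normH \<omega> p \<le> 1 \<Longrightarrow> \<bar>time_avg L p - normH \<omega> p\<bar> \<le> \<delta>"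
    using time_avg_uniform[OF nr \<delta>(1)] by blast
  \<comment> \<open>Then \<open>1 / (1 - \<epsilon>) \<le> 1 + \<delta> / 2\<close>, and the other
    \<open>\<delta> / 2\<close> is left for the additive constant \<open>C\<close>.\<close>
  define \<epsilon> where "\<epsilon> = \<delta> / 4"
  have \<epsilon>: "\<epsilon> > 0" "\<epsilon> < 1" using \<delta> by (auto simp: \<epsilon>_def)
  have \<epsilon>\<delta>: "1 / (1 - \<epsilon>) \<le> 1 + \<delta> / 2"
  proof -
    have "\<delta> * \<delta> \<le> 1 * \<delta>" using \<delta> by (intro mult_right_mono) auto
    then have "1 \<le> (1 + \<delta> / 2) * (1 - \<epsilon>)" using \<delta> by (simp add: \<epsilon>_def algebra_simps)
    then show ?thesis using \<epsilon> by (simp add: divide_le_eq)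
  qed
  obtain L R where L: "L > 0" and R: "R > 0"
    "\<And>\<gamma>. basic_motion \<omega> L \<gamma> \<Longrightarrow> rho \<omega> (\<gamma> 0) \<ge> R \<Longrightarrow> rho \<omega> (\<gamma> L) \<le> rho \<omega> (\<gamma> 0) - L * (1 - \<epsilon>)"
    using basic_motion_decrease[OF nr \<epsilon>(1)] by metis
  define R' where "R' = max R K"
  define C where "C = L + reach_bound c R'"
  have KU: "0 \<le> c * (K / U)" using c0 par by simp
  have rb0: "\<Theta> \<le> reach_bound c R'" using KU c0 R(1) by (simp add: reach_bound_def R'_def le_max_iff_disj)
  have up: "T \<le> rho \<omega> x / (1 - \<epsilon>) + C" if mt: "motion_time \<omega> K \<Theta> U x T" for x T
  proof -
    obtain \<gamma> u M where m: "tsm \<gamma> u M" "\<gamma> 0 = x" "arrival_time \<gamma> T" using mt unfolding motion_time_tsm by blast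
    define S where "S = rho \<omega> x / (1 - \<epsilon>) + L"
    have "\<exists>s. 0 \<le> s \<and> s \<le> S \<and> (rho \<omega> (\<gamma> s) \<le> R' \<or> \<gamma> s \<in> G)"
    proof (rule ccontr)
      assume n: "\<not> ?thesis"
      then have no: "\<gamma> s \<notin> G \<and> rho \<omega> (\<gamma> s) > K" "rho \<omega> (\<gamma> s) \<ge> R" if "0 \<le> s" "s \<le> S" for s
        using that unfolding R'_def by (fastforce simp: not_le)+
      have dec: "rho \<omega> (\<gamma> (real j * L)) \<le> rho \<omega> x - real j * (L * (1 - \<epsilon>))" if "real j * L \<le> S" for j :: nat
        using that
      proof (induction j)
        case 0
        then show ?case using m(2) by simp
      next
        case (Suc j)
        have jL: "0 \<le> real j * L" "real j * L + L \<le> S" "real (Suc j) * L = real j * L + L"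
          using Suc.prems L by (simp_all add: algebra_simps)
        have "basic_motion \<omega> L (\<lambda>r. \<gamma> (real j * L + r))"
          by (rule tsm_basic[OF m(1) jL(1)]) (use L jL(2) no in auto)
        from R(2)[OF this] have "rho \<omega> (\<gamma> (real j * L + L)) \<le> rho \<omega> (\<gamma> (real j * L)) - L * (1 - \<epsilon>)"
          using no(2)[of "real j * L"] jL L by simp
        moreover have "rho \<omega> (\<gamma> (real j * L)) \<le> rho \<omega> x - real j * (L * (1 - \<epsilon>))"
          using Suc.IH jL L by linarith
        ultimately show ?case unfolding jL(3) by (simp add: algebra_simps)
      qed
      define a where "a = L * (1 - \<epsilon>)"
      have a: "a > 0" using L \<epsilon> by (simp add: a_def)
      \<comment> \<open>After this many windows \<open>rho\<close> would be negative. The extra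
        \<open>L\<close> in \<open>S\<close> makes room for the last one.\<close>
      define j where "j = nat \<lfloor>rho \<omega> x / a\<rfloor> + 1"
      have "0 \<le> rho \<omega> x / a" using a rho_nonneg by simp
      then have j: "rho \<omega> x / a < real j" "real j \<le> rho \<omega> x / a + 1" unfolding j_def by linarith+
      have "real j * L \<le> (rho \<omega> x / a + 1) * L" using j(2) L by (intro mult_right_mono) auto
      also have "\<dots> = S" using L \<epsilon> by (simp add: S_def a_def field_simps)
      finally have "rho \<omega> (\<gamma> (real j * L)) \<le> rho \<omega> x - real j * a" using dec unfolding a_def by blast
      moreover have "rho \<omega> x < real j * a" using j(1) a by (simp add: divide_less_eq)
      ultimately show False using rho_nonneg[of "\<gamma> (real j * L)"] by linarith
    qed
    then obtain s where s: "0 \<le> s" "s \<le> S" "rho \<omega> (\<gamma> s) \<le> R' \<or> \<gamma> s \<in> G" by blast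
    have "\<exists>r. 0 \<le> r \<and> r \<le> s + reach_bound c R' \<and> \<gamma> r = 0"
    proof (cases "\<gamma> s \<in> G")
      case True
      from hit_zero[OF m(1) s(1) this] show ?thesis using s(1) rb0 by (meson add_left_mono order_trans)
    next
      case False
      then show ?thesis using hit_bound[OF c m(1) s(1), of R'] s(3) by metis
    qed
    then obtain r where "0 \<le> r" "r \<le> s + reach_bound c R'" "\<gamma> r = 0" by blast
    then have "T \<le> S + reach_bound c R'" using arrival_le[OF m(3), of r] s(2) by linarith
    then show ?thesis by (simp add: S_def C_def)
  qed
  have C0: "C > 0" using L rb0 par(2) by (simp add: C_def)
  show ?thesis
  \<comment> \<open>The first level makes \<open>C\<close> at most \<open>\<delta> / 2\<close> times
    \<open>rho \<omega> x\<close>; the second forces every steering time to be at least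
    \<open>L0\<close>.\<close>
  proof (rule that[of "max (2 * C / \<delta>) (b * L0)"])
    show "max (2 * C / \<delta>) (b * L0) > 0" using C0 \<delta> b(1) L0(1) by (simp add: less_max_iff_disj)
    fix x assume x: "rho \<omega> x \<ge> max (2 * C / \<delta>) (b * L0)"
    then have x1: "C \<le> \<delta> / 2 * rho \<omega> x" and x2: "b * L0 \<le> rho \<omega> x" using \<delta> by (auto simp: field_simps)
    show "T \<le> (1 + \<delta>) * rho \<omega> x" if "motion_time \<omega> K \<Theta> U x T" for T
    proof -
      have "rho \<omega> x / (1 - \<epsilon>) = (1 / (1 - \<epsilon>)) * rho \<omega> x" by simp
      also have "\<dots> \<le> (1 + \<delta> / 2) * rho \<omega> x" using \<epsilon>\<delta> rho_nonneg by (rule mult_right_mono)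
      finally show ?thesis using up[OF that] x1 by (simp add: algebra_simps)
    qed
    show "rho \<omega> x \<le> (1 + \<delta>) * S" if st: "steerable_in \<omega> x S" for S
    proof -
      have "b * L0 \<le> b * S" using x2 b(2)[OF st] by linarith
      then have SL: "S \<ge> L0" using b(1) by simp
      obtain p where p: "normH \<omega> p \<le> 1" "rho \<omega> x = x \<bullet> p" using rho_attained by metis
      have "rho \<omega> x \<le> S * time_avg S p" using st p by (intro steerable_rho_le) auto
      also have "\<dots> \<le> S * (1 + \<delta>)" using L0(2)[OF SL p(1)] p(1) SL L0(1) by (intro mult_left_mono) linarith+
      finally show ?thesis by (simp add: mult.commute)
    qed
  qed
qed

end

section \<open>Construction of the three-stage motion\<close>

text \<open>Jumping up to the maximal value \<open>R\<close> on a closed set does not destroy upper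
  semicontinuity.\<close>

lemma open_upper_semicontinuous_if:
  fixes f :: "'a::topological_space \<Rightarrow> real"
  assumes S: "open S" "continuous_on S f" and R: "\<And>x. x \<in> S \<Longrightarrow> f x \<le> R"
  shows "open {x. (if x \<in> S then f x else R) < a}"
proof (cases "R < a")
  case True
  then have "{x. (if x \<in> S then f x else R) < a} = UNIV" using R by (fastforce intro: le_less_trans)
  then show ?thesis by simp
next
  case False
  then have "{x. (if x \<in> S then f x else R) < a} = S \<inter> f -` {..<a}" by auto
  moreover have "open (S \<inter> f -` {..<a})" using S by (intro continuous_open_preimage) auto
  ultimately show ?thesis by simp
qed

lemma open_lower_semicontinuous_if:
  fixes f :: "'a::topological_space \<Rightarrow> real"
  assumes S: "open S" "continuous_on S f" and R: "\<And>x. x \<in> S \<Longrightarrow> - R \<le> f x"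
  shows "open {x. a < (if x \<in> S then f x else - R)}"
proof -
  have "open {x. (if x \<in> S then - f x else R) < - a}"
    using S R by (intro open_upper_semicontinuous_if continuous_intros) (auto simp: minus_le_iff)
  moreover have "{x. (if x \<in> S then - f x else R) < - a} = {x. a < (if x \<in> S then f x else - R)}" by auto
  ultimately show ?thesis by simp
qed

context three_stage
begin

text \<open>The multivalued sign is written as an interval between \<open>l\<close> and
  \<open>h\<close>, which are semicontinuous because the switching function is continuous off the
  origin. At the origin, where \<open>rho\<close> has no gradient, the whole interval
  \<open>[-1, 1]\<close> is allowed.\<close>

lemma basic_solution:
  assumes T: "0 < T"
  obtains u \<gamma> where "borel_motion \<omega> T u \<gamma>" "\<gamma> 0 = x" "\<And>t. \<bar>u t\<bar> \<le> 1"
    "\<And>t. 0 \<le> t \<Longrightarrow> t \<le> T \<Longrightarrow> \<gamma> t \<noteq> 0 \<Longrightarrow> u t \<in> basic_control \<omega> (\<gamma> t)"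
proof -
  define \<sigma> where "\<sigma> y = vecB \<bullet> gradient (rho \<omega>) y" for y :: "'n state"
  have c: "continuous_on (- {0}) \<sigma>" unfolding \<sigma>_def
    by (intro continuous_intros continuous_at_imp_continuous_on ballI isCont_gradient_rho) auto
  define S where "S = - {0} \<inter> \<sigma> -` {0<..}"
  define S' where "S' = - {0} \<inter> \<sigma> -` {..<0}"
  have S: "open S" "open S'" unfolding S_def S'_def using c by (auto intro!: continuous_open_preimage)
  define h where "h y = (if y \<in> S then - 1 else 1 :: real)" for y
  define l where "l y = (if y \<in> S' then 1 else - 1 :: real)" for y
  have bd: "- 1 \<le> l y" "l y \<le> h y" "h y \<le> 1" for y by (auto simp: l_def h_def S_def S'_def)
  have usc: "open {y. h y < a}" "open {y. a < l y}" for a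
    unfolding h_def l_def using S
    by (intro open_upper_semicontinuous_if open_lower_semicontinuous_if continuous_on_const; simp)+
  obtain u \<gamma> where s: "\<gamma> 0 = x" "controlled_path \<omega> {0..T} u \<gamma>" "u \<in> borel_measurable borel"
    "\<And>t. \<bar>u t\<bar> \<le> 1" "\<And>t. t \<in> {0..T} \<Longrightarrow> l (\<gamma> t) \<le> u t \<and> u t \<le> h (\<gamma> t)"
    using inclusion_solution[OF T bd usc] by metis
  show ?thesis
  proof (rule that[of u \<gamma>])
    show "\<gamma> 0 = x" "\<bar>u t\<bar> \<le> 1" for t by (rule s(1), rule s(4))
    show "borel_motion \<omega> T u \<gamma>" unfolding borel_motion_def
      using s(2,3) s(4)[THEN order_trans, of 2] T by simp
    fix t assume t: "0 \<le> t" "t \<le> T" "\<gamma> t \<noteq> 0"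
    have lh: "l (\<gamma> t) \<le> u t" "u t \<le> h (\<gamma> t)" using s(5)[of t] t by auto
    have "- u t \<in> multi_sign (\<sigma> (\<gamma> t))"
      using lh s(4)[of t] t(3) unfolding multi_sign_def l_def h_def S_def S'_def
      by (cases "\<sigma> (\<gamma> t)" "0 :: real" rule: linorder_cases) auto
    then have "- (- u t) \<in> uminus ` multi_sign (\<sigma> (\<gamma> t))" by (rule imageI)
    then show "u t \<in> basic_control \<omega> (\<gamma> t)" by (simp add: basic_control_def \<sigma>_def)
  qed
qed

text \<open>A solution is taken over an integer time beyond \<open>c * rho \<omega> x\<close>. If it
  missed \<open>S\<close>, it would be a basic motion above \<open>K\<close> that lasts too long; it
  is stopped at its first hit.\<close>

lemma basic_hit:
  assumes S: "closed S" "{y. rho \<omega> y \<le> K} \<subseteq> S"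
  shows "\<exists>\<tau> u \<gamma>. borel_motion \<omega> \<tau> u \<gamma> \<and> \<gamma> 0 = x \<and> \<gamma> \<tau> \<in> S \<and> (\<forall>t. \<bar>u t\<bar> \<le> 1) \<and>
    (\<forall>t. 0 \<le> t \<longrightarrow> t < \<tau> \<longrightarrow> \<gamma> t \<notin> S \<and> u t \<in> basic_control \<omega> (\<gamma> t))"
proof -
  obtain c where c: "decrease_bound c" using threshold by blast
  define k where "k = nat \<lfloor>c * rho \<omega> x\<rfloor> + 1"
  have k: "c * rho \<omega> x < real k" "0 < real k" unfolding k_def by linarith+
  obtain u \<gamma> where m: "borel_motion \<omega> (real k) u \<gamma>" "\<gamma> 0 = x" "\<And>t. \<bar>u t\<bar> \<le> 1"
    "\<And>t. 0 \<le> t \<Longrightarrow> t \<le> real k \<Longrightarrow> \<gamma> t \<noteq> 0 \<Longrightarrow> u t \<in> basic_control \<omega> (\<gamma> t)"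
    using basic_solution[OF k(2)] by blast
  have z: "0 \<in> S" using S(2) par(1) by auto
  have "\<exists>t. 0 \<le> t \<and> t \<le> real k \<and> \<gamma> t \<in> S"
  proof (rule ccontr)
    assume "\<not> ?thesis"
    then have no: "\<gamma> t \<notin> S" if "0 \<le> t" "t \<le> real k" for t using that by blast
    have l: "{0..real k} \<in> sets lebesgue" by simp
    have "u t \<in> basic_control \<omega> (\<gamma> t)" if t: "t \<in> {0..real k} - {}" for t
      using m(4)[of t] no[of t] t z by (metis Diff_empty atLeastAtMost_iff)
    then have "AE t in lebesgue_on {0..real k}. u t \<in> basic_control \<omega> (\<gamma> t)"
      unfolding AE_lebesgue_on_iff_negligible[OF l] using negligible_empty by blast
    then have "basic_motion \<omega> (real k) \<gamma>" using m(1) unfolding basic_motion_def borel_motion_def by blast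
    then have "real k \<le> c * rho \<omega> (\<gamma> 0)"
      by (rule decrease_boundD[OF c]) (use no S(2) in force)
    then show False using k m(2) by simp
  qed
  then obtain t where t: "t \<in> {0..real k}" "\<gamma> t \<in> S" by auto
  obtain \<tau> where \<tau>: "\<tau> \<in> {0..real k}" "\<gamma> \<tau> \<in> S" "\<And>s. 0 \<le> s \<Longrightarrow> s < \<tau> \<Longrightarrow> \<gamma> s \<notin> S"
    using first_hit[OF borel_motion_continuous[OF m(1)] S(1) t] by metis
  show ?thesis
  proof (intro exI conjI)
    show "borel_motion \<omega> \<tau> u \<gamma>" using borel_motion_subset[OF m(1)] \<tau>(1) by auto
    show "\<forall>t. 0 \<le> t \<longrightarrow> t < \<tau> \<longrightarrow> \<gamma> t \<notin> S \<and> u t \<in> basic_control \<omega> (\<gamma> t)"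
    proof (intro allI impI)
      fix s assume s: "0 \<le> s" "s < \<tau>"
      have "\<gamma> s \<noteq> 0" using \<tau>(3)[OF s] z by metis
      then show "\<gamma> s \<notin> S \<and> u s \<in> basic_control \<omega> (\<gamma> s)" using \<tau>(3)[OF s] m(4)[of s] s \<tau>(1) by auto
    qed
  qed (use m(2,3) \<tau>(2) in auto)
qed

lemma closed_G: "closed G"
  by (rule closed_regionG[OF par(2)])

lemma stage1:
  obtains \<tau> u \<gamma> where "borel_motion \<omega> \<tau> u \<gamma>" "\<gamma> 0 = x" "\<gamma> \<tau> \<in> G \<or> rho \<omega> (\<gamma> \<tau>) \<le> K"
    "\<And>t. 0 \<le> t \<Longrightarrow> t < \<tau> \<Longrightarrow> \<gamma> t \<notin> G \<and> rho \<omega> (\<gamma> t) > K \<and> u t \<in> basic_control \<omega> (\<gamma> t)"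
proof -
  have "closed {y. rho \<omega> y \<le> K}" by (intro closed_Collect_le continuous_on_rho continuous_on_const)
  then have cl: "closed (G \<union> {y. rho \<omega> y \<le> K})" using closed_G by (rule closed_Un[rotated])
  obtain \<tau> u \<gamma> where m: "borel_motion \<omega> \<tau> u \<gamma>" "\<gamma> 0 = x" "\<gamma> \<tau> \<in> G \<union> {y. rho \<omega> y \<le> K}"
    "\<forall>t. 0 \<le> t \<longrightarrow> t < \<tau> \<longrightarrow> \<gamma> t \<notin> G \<union> {y. rho \<omega> y \<le> K} \<and> u t \<in> basic_control \<omega> (\<gamma> t)"
    using basic_hit[OF cl Un_upper2, of x] by blast
  show ?thesis
  proof (rule that[OF m(1,2)])
    show "\<gamma> \<tau> \<in> G \<or> rho \<omega> (\<gamma> \<tau>) \<le> K" using m(3) by blast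
    show "\<gamma> t \<notin> G \<and> rho \<omega> (\<gamma> t) > K \<and> u t \<in> basic_control \<omega> (\<gamma> t)" if "0 \<le> t" "t < \<tau>" for t
      using m(4) that by (simp add: not_le)
  qed
qed

text \<open>The basic problem is solved from \<open>x / U\<close> with the target \<open>G\<close>
  divided by \<open>U\<close>, which contains \<open>{y. rho \<omega> y \<le> K}\<close> by the
  choice of \<open>U\<close>; the solution is then multiplied by \<open>U\<close>.\<close>

lemma stage2:
  obtains \<tau> u \<gamma> where "borel_motion \<omega> \<tau> u \<gamma>" "\<gamma> 0 = x" "\<gamma> \<tau> \<in> G"
    "\<And>t. 0 \<le> t \<Longrightarrow> t < \<tau> \<Longrightarrow> \<gamma> t \<notin> G \<and> u t \<in> scaled_basic_control \<omega> U (\<gamma> t)"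
proof -
  define S where "S = (\<lambda>y. U *\<^sub>R y) -` G"
  have "closed S" unfolding S_def using closed_G by (intro continuous_closed_vimage continuous_intros)
  moreover have "{y. rho \<omega> y \<le> K} \<subseteq> S"
  proof
    fix y assume "y \<in> {y. rho \<omega> y \<le> K}"
    then have "rho \<omega> (U *\<^sub>R y) \<le> U * K" using par(3) by (simp add: rho_scaleR mult_left_mono)
    then show "y \<in> S" using par(6) by (simp add: S_def)
  qed
  ultimately obtain \<tau> u \<gamma> where m: "borel_motion \<omega> \<tau> u \<gamma>" "\<gamma> 0 = (1 / U) *\<^sub>R x" "\<gamma> \<tau> \<in> S" "\<forall>t. \<bar>u t\<bar> \<le> 1"
    "\<forall>t. 0 \<le> t \<longrightarrow> t < \<tau> \<longrightarrow> \<gamma> t \<notin> S \<and> u t \<in> basic_control \<omega> (\<gamma> t)"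
    using basic_hit[of S "(1 / U) *\<^sub>R x"] by blast
  show ?thesis
  proof (rule that[of \<tau> "\<lambda>t. U * u t" "\<lambda>t. U *\<^sub>R \<gamma> t"])
    have "\<bar>U * u t\<bar> \<le> 2" for t
    proof -
      have "\<bar>U * u t\<bar> \<le> 1 * 1" unfolding abs_mult using par(3,4) m(4) by (intro mult_mono) auto
      then show ?thesis by simp
    qed
    moreover have "(\<lambda>t. U * u t) \<in> borel_measurable borel"
      using m(1) unfolding borel_motion_def by (intro borel_measurable_times) auto
    ultimately show "borel_motion \<omega> \<tau> (\<lambda>t. U * u t) (\<lambda>t. U *\<^sub>R \<gamma> t)"
      using m(1) controlled_path_scale unfolding borel_motion_def by blast
    show "U *\<^sub>R \<gamma> 0 = x" using m(2) par(3) by simp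
    show "U *\<^sub>R \<gamma> \<tau> \<in> G" using m(3) by (simp add: S_def)
    fix t assume t: "0 \<le> t" "t < \<tau>"
    have n: "U *\<^sub>R \<gamma> t \<notin> G" using m(5) t by (simp add: S_def)
    then have "\<gamma> t \<noteq> 0" using zero_in_regionG[OF par(2)] by auto
    then have "basic_control \<omega> (U *\<^sub>R \<gamma> t) = basic_control \<omega> (\<gamma> t)"
      using par(3) by (simp add: basic_control_def gradient_scaleR)
    then show "U *\<^sub>R \<gamma> t \<notin> G \<and> U * u t \<in> scaled_basic_control \<omega> U (U *\<^sub>R \<gamma> t)"
      using n m(5) t by (auto simp: scaled_basic_control_def)
  qed
qed

text \<open>The terminal control is clipped at \<open>2\<close> and left free at the origin, where it is discontinuous;
  the solution reaches the origin before either modification matters.\<close>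

lemma stage3:
  assumes x: "x \<in> G"
  obtains \<tau> u \<gamma> where "borel_motion \<omega> \<tau> u \<gamma>" "\<gamma> 0 = x" "\<gamma> \<tau> = 0"
    "\<And>t. 0 \<le> t \<Longrightarrow> t < \<tau> \<Longrightarrow> u t = terminal_control \<omega> (\<gamma> t)"
proof -
  define f where "f y = max (- 2) (min 2 (terminal_control \<omega> y))" for y
  have f: "f y \<le> 2" "- 2 \<le> f y" for y by (auto simp: f_def)
  have c: "continuous_on (- {0}) f" unfolding f_def
    by (intro continuous_intros continuous_at_imp_continuous_on ballI isCont_terminal_control) auto
  define h where "h y = (if y \<in> - {0} then f y else 2)" for y
  define l where "l y = (if y \<in> - {0} then f y else - 2)" for y
  have bd: "- 2 \<le> l y" "l y \<le> h y" "h y \<le> 2" for y using f by (auto simp: l_def h_def)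
  have usc: "open {y. h y < a}" "open {y. a < l y}" for a
    unfolding h_def l_def
    by (rule open_upper_semicontinuous_if open_lower_semicontinuous_if; use c f in force)+
  have T: "0 < \<Theta> + 1" using par(2) by simp
  obtain u \<gamma> where s: "\<gamma> 0 = x" "controlled_path \<omega> {0..\<Theta> + 1} u \<gamma>" "u \<in> borel_measurable borel"
    "\<And>t. \<bar>u t\<bar> \<le> 2" "\<And>t. t \<in> {0..\<Theta> + 1} \<Longrightarrow> l (\<gamma> t) \<le> u t \<and> u t \<le> h (\<gamma> t)"
    using inclusion_solution[OF T bd usc] by metis
  have m: "borel_motion \<omega> (\<Theta> + 1) u \<gamma>" using s T unfolding borel_motion_def by simp
  \<comment> \<open>Outside \<open>S\<close> the terminal control is below
    \<open>1/2 + 3/2 = 2\<close>, so the clipping is inactive. Until \<open>S\<close> is met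
    \<open>frakT\<close> decreases, hence the first hit lies in \<open>G\<close> if it is not the
    origin; there \<open>rowC\<close> is at most \<open>1/2\<close>, which leaves only the
    origin.\<close>
  define S where "S = {0} \<union> {y. 3 / 2 \<le> \<bar>rowC \<omega> y\<bar>}"
  have S: "closed S" unfolding S_def
    by (intro closed_Un closed_Collect_le continuous_intros continuous_on_rowC) auto
  have uS: "u t = terminal_control \<omega> (\<gamma> t)" if t: "0 \<le> t" "t \<le> \<Theta> + 1" "\<gamma> t \<notin> S" for t
  proof -
    have "u t = f (\<gamma> t)" using s(5)[of t] t by (auto simp: l_def h_def S_def)
    moreover have "\<bar>terminal_control \<omega> (\<gamma> t)\<bar> \<le> 2"
      using frak_u_le[of "inv (opD \<omega>) (\<gamma> t)"] t(3) unfolding terminal_control_def S_def by auto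
    ultimately show ?thesis unfolding f_def by linarith
  qed
  have dec: "frakT (inv (opD \<omega>) (\<gamma> a)) = frakT (inv (opD \<omega>) x) - a"
    if a: "0 \<le> a" "a \<le> \<Theta> + 1" "\<gamma> a \<noteq> 0" and n: "\<forall>t. 0 \<le> t \<longrightarrow> t < a \<longrightarrow> \<gamma> t \<notin> S" for a
  proof -
    have ma: "borel_motion \<omega> a u \<gamma>" by (rule borel_motion_subset[OF m a(1,2)])
    have cp: "controlled_path \<omega> {0..a} u \<gamma>" using ma by (simp add: borel_motion_def)
    have N: "negligible {a}" by simp
    have "frakT (inv (opD \<omega>) (\<gamma> a)) = frakT (inv (opD \<omega>) (\<gamma> 0)) - a"
    proof (rule terminal_motion_frakT[OF cp a(1) borel_motion_continuous[OF ma] N])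
      show "u t = terminal_control \<omega> (\<gamma> t)" if "t \<in> {0..a} - {a}" for t
        using that a n by (intro uS) auto
      show "\<gamma> t \<noteq> 0" if "t \<in> {0..a}" for t
        using that a(3) n unfolding S_def by (cases "t = a") auto
    qed (use a in auto)
    then show ?thesis using s(1) by simp
  qed
  have xT: "frakT (inv (opD \<omega>) x) \<le> \<Theta>" using x by (simp add: regionG_iff)
  have "\<exists>t. 0 \<le> t \<and> t \<le> \<Theta> + 1 \<and> \<gamma> t \<in> S"
  proof (rule ccontr)
    assume n: "\<not> ?thesis"
    then have "\<gamma> (\<Theta> + 1) \<notin> S" using T by simp
    then have "\<gamma> (\<Theta> + 1) \<noteq> 0" by (auto simp: S_def)
    then have "frakT (inv (opD \<omega>) (\<gamma> (\<Theta> + 1))) = frakT (inv (opD \<omega>) x) - (\<Theta> + 1)"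
      using n T by (intro dec) auto
    then show False using frakT_nonneg[of "inv (opD \<omega>) (\<gamma> (\<Theta> + 1))"] xT by linarith
  qed
  then obtain t where t: "t \<in> {0..\<Theta> + 1}" "\<gamma> t \<in> S" by auto
  obtain \<tau> where \<tau>: "\<tau> \<in> {0..\<Theta> + 1}" "\<gamma> \<tau> \<in> S" "\<And>s. 0 \<le> s \<Longrightarrow> s < \<tau> \<Longrightarrow> \<gamma> s \<notin> S"
    using first_hit[OF borel_motion_continuous[OF m] S t] by metis
  have "\<gamma> \<tau> = 0"
  proof (rule ccontr)
    assume nz: "\<gamma> \<tau> \<noteq> 0"
    have "frakT (inv (opD \<omega>) (\<gamma> \<tau>)) = frakT (inv (opD \<omega>) x) - \<tau>"
      using \<tau>(1,3) nz by (intro dec) auto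
    then have "\<gamma> \<tau> \<in> G" using xT \<tau>(1) by (simp add: regionG_iff)
    then have "\<bar>rowC \<omega> (\<gamma> \<tau>)\<bar> \<le> 1 / 2" using par(5) by auto
    then show False using \<tau>(2) nz by (simp add: S_def)
  qed
  moreover have "borel_motion \<omega> \<tau> u \<gamma>" using borel_motion_subset[OF m] \<tau>(1) by auto
  moreover have "u t = terminal_control \<omega> (\<gamma> t)" if "0 \<le> t" "t < \<tau>" for t
    using \<tau>(1) \<tau>(3)[OF that] that by (intro uS) auto
  ultimately show ?thesis using s(1) that by blast
qed

lemma three_stage_motion_exists: "\<exists>\<gamma>. three_stage_motion \<omega> K \<Theta> U x \<gamma>"
proof -
  obtain a uA \<gamma>A where A: "borel_motion \<omega> a uA \<gamma>A" "\<gamma>A 0 = x" "\<gamma>A a \<in> G \<or> rho \<omega> (\<gamma>A a) \<le> K"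
    "\<And>t. 0 \<le> t \<Longrightarrow> t < a \<Longrightarrow> \<gamma>A t \<notin> G \<and> rho \<omega> (\<gamma>A t) > K \<and> uA t \<in> basic_control \<omega> (\<gamma>A t)"
    using stage1[of x] by blast
  obtain b uB \<gamma>B where B: "borel_motion \<omega> b uB \<gamma>B" "\<gamma>B 0 = \<gamma>A a" "\<gamma>B b \<in> G"
    "\<And>t. 0 \<le> t \<Longrightarrow> t < b \<Longrightarrow> \<gamma>B t \<notin> G \<and> uB t \<in> scaled_basic_control \<omega> U (\<gamma>B t)"
    using stage2[of "\<gamma>A a"] by blast
  obtain d uC \<gamma>C where C: "borel_motion \<omega> d uC \<gamma>C" "\<gamma>C 0 = \<gamma>B b" "\<gamma>C d = 0"
    "\<And>t. 0 \<le> t \<Longrightarrow> t < d \<Longrightarrow> uC t = terminal_control \<omega> (\<gamma>C t)"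
    using stage3[OF B(3)] by blast
  have abd: "0 \<le> a" "0 \<le> b" "0 \<le> d" using A(1) B(1) C(1) by (auto simp: borel_motion_def)
  \<comment> \<open>After arrival the motion rests at the origin with control \<open>0\<close>, in
    agreement with the terminal control, which is \<open>0\<close> there.\<close>
  define u3 \<gamma>3 where "u3 t = (if t < d then uC t else 0)" and "\<gamma>3 t = (if t < d then \<gamma>C t else 0)" for t
  define u2 \<gamma>2 where "u2 t = (if t < b then uB t else u3 (t - b))" and "\<gamma>2 t = (if t < b then \<gamma>B t else \<gamma>3 (t - b))" for t
  define u \<gamma> where "u t = (if t < a then uA t else u2 (t - a))" and "\<gamma> t = (if t < a then \<gamma>A t else \<gamma>2 (t - a))" for t
  have g3: "\<gamma>3 0 = \<gamma>B b" using C(2,3) abd by (cases "d = 0") (auto simp: \<gamma>3_def)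
  have g2: "\<gamma>2 0 = \<gamma>A a" using B(2) g3 abd by (cases "b = 0") (auto simp: \<gamma>2_def)
  have g: "\<gamma> 0 = x" using A(2) g2 abd by (cases "a = 0") (auto simp: \<gamma>_def)
  have m: "borel_motion \<omega> T u \<gamma>" if T: "0 \<le> T" for T
  proof -
    have "borel_motion \<omega> (d + T) u3 \<gamma>3"
      unfolding u3_def[abs_def] \<gamma>3_def[abs_def]
      using borel_motion_concat[OF C(1) borel_motion_zero[OF T, of \<omega>]] C(3) by simp
    from borel_motion_concat[OF B(1) this g3]
    have "borel_motion \<omega> (b + (d + T)) u2 \<gamma>2" unfolding u2_def[abs_def] \<gamma>2_def[abs_def] .
    from borel_motion_concat[OF A(1) this g2]
    have "borel_motion \<omega> (a + (b + (d + T))) u \<gamma>" unfolding u_def[abs_def] \<gamma>_def[abs_def] .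
    then show ?thesis by (rule borel_motion_subset) (use abd T in auto)
  qed
  have um: "u \<in> borel_measurable borel" using m[of 0] by (simp add: borel_motion_def)
  have cp: "controlled_path \<omega> {0..} u \<gamma>"
    unfolding controlled_path_def
  proof (intro conjI ballI)
    show "u \<in> borel_measurable (lebesgue_on {0..})"
      using um by (simp add: measurable_completion measurable_restrict_space1)
    fix t :: real assume "t \<in> {0..}"
    then have t: "t \<in> {0..t}" "0 \<le> t" by auto
    have "controlled_path \<omega> {0..t} u \<gamma>" using m[OF t(2)] by (simp add: borel_motion_def)
    then show "(\<lambda>s. opA \<omega> (\<gamma> s) + u s *\<^sub>R vecB) absolutely_integrable_on {0..t}"
      "\<gamma> t = \<gamma> 0 + integral {0..t} (\<lambda>s. opA \<omega> (\<gamma> s) + u s *\<^sub>R vecB)"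
      using t(1) unfolding controlled_path_def by blast+
  qed
  have ctrl: "u t \<in> three_stage_control \<omega> K \<Theta> U \<gamma> t" if t: "0 \<le> t" for t
  proof -
    consider "t < a" | "a \<le> t" "t < a + b" | "a + b \<le> t" by linarith
    then show ?thesis
    proof cases
      case 1
      have n: "\<gamma> s \<notin> G \<and> \<not> rho \<omega> (\<gamma> s) \<le> K" if "s \<in> {0..t}" for s
        using A(4)[of s] that 1 by (auto simp: \<gamma>_def)
      then have "three_stage_control \<omega> K \<Theta> U \<gamma> t = basic_control \<omega> (\<gamma> t)"
        unfolding three_stage_control_def by auto
      then show ?thesis using A(4)[OF t 1] 1 by (simp add: u_def \<gamma>_def)
    next
      case 2
      \<comment> \<open>If the first stage had ended in \<open>G\<close>, the second would be empty;
        so within the second stage it ended with \<open>rho\<close> at most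
        \<open>K\<close>.\<close>
      have n: "\<gamma> s \<notin> G" if "s \<in> {0..t}" for s
        using A(4)[of s] B(4)[of "s - a"] that 2 by (auto simp: \<gamma>_def \<gamma>2_def)
      have "\<gamma> a = \<gamma>A a" using g2 by (simp add: \<gamma>_def)
      then have "rho \<omega> (\<gamma> a) \<le> K" using n[of a] A(3) abd 2 by auto
      then have "\<exists>s\<in>{0..t}. rho \<omega> (\<gamma> s) \<le> K" using abd 2 by (intro bexI[of _ a]) auto
      then have "three_stage_control \<omega> K \<Theta> U \<gamma> t = scaled_basic_control \<omega> U (\<gamma> t)"
        unfolding three_stage_control_def using n by auto
      then show ?thesis using B(4)[of "t - a"] 2 by (simp add: u_def \<gamma>_def u2_def \<gamma>2_def)
    next
      case 3
      have "\<gamma> (a + b) = \<gamma>B b" using g3 abd by (simp add: \<gamma>_def \<gamma>2_def)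
      then have "\<exists>s\<in>{0..t}. \<gamma> s \<in> G" using B(3) abd 3 by (intro bexI[of _ "a + b"]) auto
      then have "three_stage_control \<omega> K \<Theta> U \<gamma> t = {terminal_control \<omega> (\<gamma> t)}"
        unfolding three_stage_control_def by simp
      moreover have "u t = u3 (t - a - b)" "\<gamma> t = \<gamma>3 (t - a - b)" using 3 abd by (auto simp: u_def \<gamma>_def u2_def \<gamma>2_def)
      moreover have "u3 (t - a - b) = terminal_control \<omega> (\<gamma>3 (t - a - b))"
        using C(4)[of "t - a - b"] 3 by (auto simp: u3_def \<gamma>3_def)
      ultimately show ?thesis by simp
    qed
  qed
  have "tsm \<gamma> u {}" unfolding tsm_def using cp ctrl by simp
  then show ?thesis using g unfolding three_stage_motion_tsm by blast
qed

text \<open>The filter expresses that \<open>rho \<omega> x\<close> tends to infinity, with no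
  condition on the direction of \<open>x\<close>. The choice \<open>4 * \<delta> \<le> e\<close>
  covers the error \<open>2 * \<delta>\<close> that arises when the two estimates are combined for
  the minimum time.\<close>

lemma limits:
  assumes nr: "non_resonant \<omega>" and T: "\<And>x. motion_time \<omega> K \<Theta> U x (T x)"
  shows "((\<lambda>x. rho \<omega> x / T x) \<longlongrightarrow> 1) (filtercomap (rho \<omega>) at_top)"
    "((\<lambda>x. min_time \<omega> x / T x) \<longlongrightarrow> 1) (filtercomap (rho \<omega>) at_top)"
proof -
  have ev: "\<forall>\<^sub>F x in filtercomap (rho \<omega>) at_top. dist (rho \<omega> x / T x) 1 < e \<and> dist (min_time \<omega> x / T x) 1 < e"
    if e: "e > 0" for e
  proof -
    define \<delta> where "\<delta> = min 1 (e / 4)"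
    have \<delta>: "0 < \<delta>" "\<delta> \<le> 1" "4 * \<delta> \<le> e" using e by (auto simp: \<delta>_def)
    obtain R0 where R0: "R0 > 0" "\<And>x T. rho \<omega> x \<ge> R0 \<Longrightarrow> motion_time \<omega> K \<Theta> U x T \<Longrightarrow> T \<le> (1 + \<delta>) * rho \<omega> x"
      "\<And>x S. rho \<omega> x \<ge> R0 \<Longrightarrow> steerable_in \<omega> x S \<Longrightarrow> rho \<omega> x \<le> (1 + \<delta>) * S"
      using asymptotics[OF nr \<delta>(1,2)] by blast
    have "dist (rho \<omega> x / T x) 1 < e \<and> dist (min_time \<omega> x / T x) 1 < e" if x: "rho \<omega> x \<ge> R0" for x
    proof -
      let ?r = "rho \<omega> x" and ?m = "min_time \<omega> x"
      have 1: "T x \<le> (1 + \<delta>) * ?r" by (rule R0(2)[OF x T])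
      have 2: "?r \<le> (1 + \<delta>) * T x" by (rule R0(3)[OF x min_time_bounds(1)[OF T]])
      have T0: "T x > 0" using 2 x R0(1) \<delta>(1) by (smt (verit) mult_nonneg_nonpos)
      have "?r / (1 + \<delta>) \<le> ?m"
        by (rule min_time_bounds(3)[OF T]) (use R0(3)[OF x] \<delta>(1) in \<open>simp add: divide_le_eq mult.commute\<close>)
      then have 3: "?r \<le> (1 + \<delta>) * ?m" using \<delta>(1) by (simp add: divide_le_eq mult.commute)
      have 4: "?m \<le> T x" by (rule min_time_bounds(2)[OF T])
      have a: "?r / T x \<le> 1 + \<delta>" using 2 T0 by (simp add: divide_le_eq)
      have b: "1 \<le> (1 + \<delta>) * (?r / T x)" using 1 T0 by (simp add: field_simps)
      have d: "?r / T x \<le> (1 + \<delta>) * (?m / T x)" using 3 T0 by (simp add: field_simps)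
      have f: "?m / T x \<le> 1" using 4 T0 by simp
      have "1 - \<delta> \<le> q" if q: "1 \<le> (1 + \<delta>) * q" for q :: real
      proof (cases "q \<le> 1")
        case True
        have "\<delta> * q \<le> \<delta> * 1" using True \<delta>(1) by (intro mult_left_mono) auto
        then show ?thesis using q(1) by (simp add: distrib_right)
      qed (use \<delta>(1) in simp)
      from this[OF b] have ra: "1 - \<delta> \<le> ?r / T x" .
      have "\<delta> * (?m / T x) \<le> \<delta> * 1" using f \<delta>(1) by (intro mult_left_mono) auto
      then have "1 - 2 * \<delta> \<le> ?m / T x" using d ra unfolding distrib_right mult_1 mult_1_right by linarith
      then have "\<bar>?r / T x - 1\<bar> < e" "\<bar>?m / T x - 1\<bar> < e" using a ra f \<delta> by linarith+
      then show ?thesis by (simp add: dist_real_def)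
    qed
    then show ?thesis unfolding eventually_filtercomap using eventually_ge_at_top[of R0] by blast
  qed
  show "((\<lambda>x. rho \<omega> x / T x) \<longlongrightarrow> 1) (filtercomap (rho \<omega>) at_top)"
    "((\<lambda>x. min_time \<omega> x / T x) \<longlongrightarrow> 1) (filtercomap (rho \<omega>) at_top)"
    unfolding tendsto_iff by (intro allI impI, drule ev, erule eventually_mono, simp)+
qed

end

text \<open>Existence of motions and of arrival times are part of the conclusion, so that the
  statements about all values of \<open>motion_time\<close> are not vacuous.\<close>

theorem theorem15:
  fixes \<omega> :: "'n::finite \<Rightarrow> real" and K \<Theta> U :: real
  assumes "\<And>i. \<omega> i > 0" and "inj \<omega>"
    and "three_stage_parameters \<omega> K \<Theta> U"
  shows "(\<forall>x. \<exists>\<gamma>. three_stage_motion \<omega> K \<Theta> U x \<gamma>) \<and>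
    (\<forall>x \<gamma>. three_stage_motion \<omega> K \<Theta> U x \<gamma> \<longrightarrow> (\<exists>T. arrival_time \<gamma> T)) \<and>
    (non_resonant \<omega> \<longrightarrow>
      (\<forall>T. (\<forall>x. motion_time \<omega> K \<Theta> U x (T x)) \<longrightarrow>
        ((\<lambda>x. rho \<omega> x / T x) \<longlongrightarrow> 1) (filtercomap (rho \<omega>) at_top) \<and>
        ((\<lambda>x. min_time \<omega> x / T x) \<longlongrightarrow> 1) (filtercomap (rho \<omega>) at_top))) \<and>
    (\<not> non_resonant \<omega> \<longrightarrow>
      (\<exists>C\<^sub>1>0. \<exists>c\<^sub>1>0. \<forall>x T. rho \<omega> x \<ge> 1 \<longrightarrow> motion_time \<omega> K \<Theta> U x T \<longrightarrow>
        C\<^sub>1 \<ge> rho \<omega> x / T \<and> rho \<omega> x / T \<ge> c\<^sub>1 \<and>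
        1 \<ge> min_time \<omega> x / T \<and> min_time \<omega> x / T \<ge> c\<^sub>1))"
proof -
  interpret three_stage \<omega> K \<Theta> U
    by unfold_locales (use assms in auto)
  show ?thesis
  proof (intro conjI allI impI)
    show "\<exists>\<gamma>. three_stage_motion \<omega> K \<Theta> U x \<gamma>" for x by (rule three_stage_motion_exists)
    show "\<exists>T. arrival_time \<gamma> T" if "three_stage_motion \<omega> K \<Theta> U x \<gamma>" for x \<gamma>
      using that arrival_exists unfolding three_stage_motion_tsm by blast
  qed (use limits general_bounds in blast)+
qed

end
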